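(* Let $k$ be a commutative ring. (1) Let $H$ be a $k$-flat Hopf algebra with bijective antipode, let $T$ be a faithfully flat (right) $H$-Galois object, and regard $T$ as a quantum torsor $(T,\mu,\theta)$ via the torsor structure associated to the Galois object $T$ (defined in the context). Then $H_r(T)\cong H$ and $H_l(T)\cong L(T,H)$ as Hopf algebras. (2) Let $(T,\mu,\theta)$ be a quantum torsor. Then the quantum torsor associated to the $H_r(T)$-Galois object $T$ coincides with $(T,\mu,\theta)$.
   Context: All tensor products are over the commutative base ring $k$; $T$ in a tensor product of maps denotes the identity of $T$. $\nabla$ denotes multiplication, and Sweedler notation $\Delta(h)=h_{(1)}\otimes h_{(2)}$ is used. $S$ denotes the antipode of a Hopf algebra. Galois objects. A right $H$-comodule algebra $T$ is an algebra which is a right $H$-comodule such that the coaction $\rho\colon T\to T\otimes H$, $\rho(x)=x_{(0)}\otimes x_{(1)}$, is an algebra map. It is a (right) $H$-Galois object if $T^{\mathrm{co}H}=\{t\in T\mid \rho(t)=t\otimes 1\}$ equals $k$ and $\beta\colon T\otimes T\to T\otimes H$, $\beta(x\otimes y)=xy_{(0)}\otimes y_{(1)}$, is bijective. It is faithfully flat if $T$ is faithfully flat over $k$. Left Galois objects are defined by switching sides. An $L$-$H$-bi-Galois object is an $L$-$H$-bicomodule algebra which is both a left $L$-Galois object and a right $H$-Galois object. For a right $H$-Galois object put $\gamma(h)=\beta^{-1}(1\otimes h)=h^{[1]}\otimes h^{[2]}\in T\otimes T$ for $h\in H$. Quantum torsors. A quantum torsor $(T,\mu,\theta)$ consists of a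 faithfully flat $k$-algebra $T$, an algebra map $\mu\colon T\to T\otimes T^{\mathrm{op}}\otimes T$, and an algebra automorphism $\theta$ of $T$ such that for all $x\in T$: $(T\otimes\nabla)\mu(x)=x\otimes 1$; $(\nabla\otimes T)\mu(x)=1\otimes x$; $(T\otimes T^{\mathrm{op}}\otimes\mu)\mu=(\mu\otimes T^{\mathrm{op}}\otimes T)\mu$; $(T\otimes T^{\mathrm{op}}\otimes\theta\otimes T^{\mathrm{op}}\otimes T)(\mu\otimes T^{\mathrm{op}}\otimes T)\mu=(T\otimes\mu^{\mathrm{op}}\otimes T)\mu$; $(\theta\otimes\theta\otimes\theta)\mu=\mu\theta$. Here $\mu^{\mathrm{op}}=\tau_{(13)}\mu\colon T^{\mathrm{op}}\to T^{\mathrm{op}}\otimes T\otimes T^{\mathrm{op}}$, with $\tau_{(13)}$ exchanging the first and last tensor factors. Torsor associated to a Galois object. If $T$ is a faithfully flat $H$-Galois object and $H$ has bijective antipode, then $(T,\mu,\theta)$ is a quantum torsor with $\mu(x)=x_{(0)}\otimes x_{(1)}{}^{[1]}\otimes x_{(1)}{}^{[2]}$ and $\theta(x)=x_{(0)}S(x_{(1)})^{[2]}S(x_{(1)})^{[1]}$. This is the torsor associated to $T$. Hopf algebras of a torsor (Grunspan). For a quantum torsor $(T,\mu,\theta)$, $$H_l(T)=\{\xi\in T\otimes T^{\mathrm{op}}\mid (T\otimes T^{\mathrm{op}}\otimes\theta\otimes T^{\mathrm{op}})(\mu\otimes T^{\mathrm{op}})(\xi)=(T\otimes\mu^{\mathrm{op}})(\xi)\},$$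 $$H_r(T)=\{\xi\in T^{\mathrm{op}}\otimes T\mid (T^{\mathrm{op}}\otimes\theta\otimes T^{\mathrm{op}}\otimes T)(T^{\mathrm{op}}\otimes\mu)(\xi)=(\mu^{\mathrm{op}}\otimes T)(\xi)\}.$$ These are subalgebras of $T\otimes T^{\mathrm{op}}$ and $T^{\mathrm{op}}\otimes T$ respectively, and Hopf algebras with comultiplications induced by $\mu\otimes T^{\mathrm{op}}$ and $T^{\mathrm{op}}\otimes\mu$ respectively, and counits induced by the multiplication $\nabla$ of $T$ (which maps them into $k$). The map $\mu$, viewed as $T\to H_l(T)\otimes T$ and as $T\to T\otimes H_r(T)$, makes $T$ an $H_l(T)$-$H_r(T)$-bi-Galois object. In (2), $T$ is regarded as a right $H_r(T)$-Galois object in this way. The Hopf algebra $L(T,H)$. For a faithfully flat $H$-Galois object $T$, $L(T,H)=(T\otimes T)^{\mathrm{co}H}$, the coinvariants for the codiagonal coaction $x\otimes y\mapsto x_{(0)}\otimes y_{(0)}\otimes x_{(1)}y_{(1)}$, as a subalgebra of $T\otimes T^{\mathrm{op}}$, with comultiplication $x\otimes y\mapsto (x_{(0)}\otimes x_{(1)}{}^{[1]})\otimes(x_{(1)}{}^{[2]}\otimes y)$ and counit $x\otimes y\mapsto xy\in k$; it coacts on $T$ from the left by $x\mapsto (x_{(0)}\otimes x_{(1)}{}^{[1]})\otimes x_{(1)}{}^{[2]}\in L(T,H)\otimes T$, and it is the Hopf algebra making $T$ an $L(T,H)$-$H$-bi-Galois object. *)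

theory Defs
  imports "HOL-Algebra.Free_Abelian_Groups" "HOL-Algebra.Module"
begin

section \<open>Modules, algebras and tensor products over a commutative ring\<close>

text \<open>The library locale \<^locale>\<open>algebra\<close> is restricted to commutative algebras.\<close>

locale k_algebra = module + ring M +
  assumes smult_assoc_l:
      "\<lbrakk>a \<in> carrier R; x \<in> carrier M; y \<in> carrier M\<rbrakk> \<Longrightarrow>
        (a \<odot>\<^bsub>M\<^esub> x) \<otimes>\<^bsub>M\<^esub> y = a \<odot>\<^bsub>M\<^esub> (x \<otimes>\<^bsub>M\<^esub> y)"
    and smult_assoc_r:
      "\<lbrakk>a \<in> carrier R; x \<in> carrier M; y \<in> carrier M\<rbrakk> \<Longrightarrow>
        x \<otimes>\<^bsub>M\<^esub> (a \<odot>\<^bsub>M\<^esub> y) = a \<odot>\<^bsub>M\<^esub> (x \<otimes>\<^bsub>M\<^esub> y)"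

definition mod_hom ::
  "('k, 'r) ring_scheme \<Rightarrow> ('k, 'a, 'm) module_scheme \<Rightarrow> ('k, 'b, 'n) module_scheme \<Rightarrow> ('a \<Rightarrow> 'b) set"
  where "mod_hom R M N = {f \<in> carrier M \<rightarrow> carrier N.
     (\<forall>x\<in>carrier M. \<forall>y\<in>carrier M. f (x \<oplus>\<^bsub>M\<^esub> y) = f x \<oplus>\<^bsub>N\<^esub> f y) \<and>
     (\<forall>r\<in>carrier R. \<forall>x\<in>carrier M. f (r \<odot>\<^bsub>M\<^esub> x) = r \<odot>\<^bsub>N\<^esub> f x)}"

definition alg_hom ::
  "('k, 'r) ring_scheme \<Rightarrow> ('k, 'a, 'm) module_scheme \<Rightarrow> ('k, 'b, 'n) module_scheme \<Rightarrow> ('a \<Rightarrow> 'b) set"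
  where "alg_hom R A B = mod_hom R A B \<inter> ring_hom A B"

definition self_module :: "('k, 'r) ring_scheme \<Rightarrow> ('k, 'k) module"
  where "self_module R = \<lparr>carrier = carrier R, monoid.mult = mult R, one = one R,
     zero = zero R, add = add R, smult = mult R\<rparr>"

definition opp :: "('k, 'a, 'm) module_scheme \<Rightarrow> ('k, 'a, 'm) module_scheme"
  where "opp A = A\<lparr>monoid.mult := (\<lambda>x y. y \<otimes>\<^bsub>A\<^esub> x)\<rparr>"

text \<open>\<open>M \<otimes>\<^sub>R N\<close> is the free abelian group on \<open>carrier M \<times> carrier N\<close> modulo the subgroup
  generated by the biadditivity and balancing relations; its elements are cosets.\<close>

type_synonym ('a, 'b) tensor = "('a \<times> 'b \<Rightarrow>\<^sub>0 int) set"

definition tensor_rels ::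
  "('k, 'r) ring_scheme \<Rightarrow> ('k, 'a, 'm) module_scheme \<Rightarrow> ('k, 'b, 'n) module_scheme \<Rightarrow>
    ('a \<times> 'b \<Rightarrow>\<^sub>0 int) set"
  where "tensor_rels R M N =
     {frag_of (x \<oplus>\<^bsub>M\<^esub> y, z) - frag_of (x, z) - frag_of (y, z) | x y z.
        x \<in> carrier M \<and> y \<in> carrier M \<and> z \<in> carrier N} \<union>
     {frag_of (x, y \<oplus>\<^bsub>N\<^esub> z) - frag_of (x, y) - frag_of (x, z) | x y z.
        x \<in> carrier M \<and> y \<in> carrier N \<and> z \<in> carrier N} \<union>
     {frag_of (r \<odot>\<^bsub>M\<^esub> x, y) - frag_of (x, r \<odot>\<^bsub>N\<^esub> y) | r x y.
        r \<in> carrier R \<and> x \<in> carrier M \<and> y \<in> carrier N}"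

definition tensor_null ::
  "('k, 'r) ring_scheme \<Rightarrow> ('k, 'a, 'm) module_scheme \<Rightarrow> ('k, 'b, 'n) module_scheme \<Rightarrow>
    ('a \<times> 'b \<Rightarrow>\<^sub>0 int) set"
  where "tensor_null R M N =
     generate (free_Abelian_group (carrier M \<times> carrier N)) (tensor_rels R M N)"

definition tensor_group ::
  "('k, 'r) ring_scheme \<Rightarrow> ('k, 'a, 'm) module_scheme \<Rightarrow> ('k, 'b, 'n) module_scheme \<Rightarrow>
    ('a, 'b) tensor monoid"
  where "tensor_group R M N =
     free_Abelian_group (carrier M \<times> carrier N) Mod tensor_null R M N"

text \<open>The pure tensor \<open>x \<otimes> y\<close>.\<close>

definition tens ::
  "('k, 'r) ring_scheme \<Rightarrow> ('k, 'a, 'm) module_scheme \<Rightarrow> ('k, 'b, 'n) module_scheme \<Rightarrow>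
    'a \<Rightarrow> 'b \<Rightarrow> ('a, 'b) tensor"
  where "tens R M N x y =
     tensor_null R M N #>\<^bsub>free_Abelian_group (carrier M \<times> carrier N)\<^esub> frag_of (x, y)"

text \<open>The additive map \<open>M \<otimes> N \<rightarrow> G\<close>, \<open>x \<otimes> y \<mapsto> f x y\<close>, induced by a biadditive balanced \<open>f\<close> into an
  abelian group \<open>G\<close> (written multiplicatively): extend \<open>f\<close> to formal sums \<open>c\<close> and take the
  common value on the coset.\<close>

definition group_lift :: "('c, 'm) monoid_scheme \<Rightarrow> ('a \<Rightarrow> 'b \<Rightarrow> 'c) \<Rightarrow> ('a, 'b) tensor \<Rightarrow> 'c"
  where "group_lift G f X = the_elem
     ((\<lambda>c. finprod G (\<lambda>p. f (fst p) (snd p) [^]\<^bsub>G\<^esub> Poly_Mapping.lookup c p) (Poly_Mapping.keys c)) ` X)"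

definition tensor_lift :: "('c, 'm) ring_scheme \<Rightarrow> ('a \<Rightarrow> 'b \<Rightarrow> 'c) \<Rightarrow> ('a, 'b) tensor \<Rightarrow> 'c"
  where "tensor_lift P f = group_lift (add_monoid P) f"

text \<open>The tensor product of modules; for algebras this is the tensor product algebra (for mere
  modules the components \<^const>\<open>mult\<close> and \<^const>\<open>one\<close> carry no information).\<close>

definition tensor ::
  "('k, 'r) ring_scheme \<Rightarrow> ('k, 'a, 'm) module_scheme \<Rightarrow> ('k, 'b, 'n) module_scheme \<Rightarrow>
    ('k, ('a, 'b) tensor) module"
  where "tensor R M N = (let G = tensor_group R M N in
     \<lparr>carrier = carrier G,
      monoid.mult = (\<lambda>X Y. group_lift G (\<lambda>x y. group_lift G
         (\<lambda>x' y'. tens R M N (x \<otimes>\<^bsub>M\<^esub> x') (y \<otimes>\<^bsub>N\<^esub> y')) Y) X),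
      one = tens R M N \<one>\<^bsub>M\<^esub> \<one>\<^bsub>N\<^esub>,
      zero = \<one>\<^bsub>G\<^esub>,
      add = mult G,
      smult = (\<lambda>r. group_lift G (\<lambda>x y. tens R M N (r \<odot>\<^bsub>M\<^esub> x) y))\<rparr>)"

text \<open>\<open>tensor_map R M N f g\<close> is \<open>f \<otimes> g\<close> with values in \<open>M \<otimes> N\<close>.\<close>

definition tensor_map ::
  "('k, 'r) ring_scheme \<Rightarrow> ('k, 'a, 'm) module_scheme \<Rightarrow> ('k, 'b, 'n) module_scheme \<Rightarrow>
    ('c \<Rightarrow> 'a) \<Rightarrow> ('d \<Rightarrow> 'b) \<Rightarrow> ('c, 'd) tensor \<Rightarrow> ('a, 'b) tensor"
  where "tensor_map R M N f g = tensor_lift (tensor R M N) (\<lambda>x y. tens R M N (f x) (g y))"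

text \<open>The canonical maps \<open>(A \<otimes> B) \<otimes> C \<rightarrow> A \<otimes> (B \<otimes> C)\<close>, its inverse,
  \<open>(A \<otimes> (B \<otimes> C)) \<otimes> D \<rightarrow> A \<otimes> (B \<otimes> (C \<otimes> D))\<close>, and
  \<open>\<tau>\<^sub>(\<^sub>1\<^sub>3\<^sub>) : A \<otimes> (B \<otimes> C) \<rightarrow> C \<otimes> (B \<otimes> A)\<close>. Iterated tensor products are nested to the right.\<close>

definition tassoc ::
  "('k, 'r) ring_scheme \<Rightarrow> ('k, 'a, 'm) module_scheme \<Rightarrow> ('k, 'b, 'n) module_scheme \<Rightarrow>
    ('k, 'c, 'p) module_scheme \<Rightarrow> (('a, 'b) tensor, 'c) tensor \<Rightarrow> ('a, ('b, 'c) tensor) tensor"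
  where "tassoc R A B C = (let P = tensor R A (tensor R B C) in
     tensor_lift P (\<lambda>w z. tensor_lift P
       (\<lambda>x y. tens R A (tensor R B C) x (tens R B C y z)) w))"

definition tassoc_inv ::
  "('k, 'r) ring_scheme \<Rightarrow> ('k, 'a, 'm) module_scheme \<Rightarrow> ('k, 'b, 'n) module_scheme \<Rightarrow>
    ('k, 'c, 'p) module_scheme \<Rightarrow> ('a, ('b, 'c) tensor) tensor \<Rightarrow> (('a, 'b) tensor, 'c) tensor"
  where "tassoc_inv R A B C = (let P = tensor R (tensor R A B) C in
     tensor_lift P (\<lambda>x w. tensor_lift P
       (\<lambda>y z. tens R (tensor R A B) C (tens R A B x y) z) w))"

definition tassoc4 ::
  "('k, 'r) ring_scheme \<Rightarrow> ('k, 'a, 'm) module_scheme \<Rightarrow> ('k, 'b, 'n) module_scheme \<Rightarrow>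
    ('k, 'c, 'p) module_scheme \<Rightarrow> ('k, 'd, 'q) module_scheme \<Rightarrow>
    (('a, ('b, 'c) tensor) tensor, 'd) tensor \<Rightarrow> ('a, ('b, ('c, 'd) tensor) tensor) tensor"
  where "tassoc4 R A B C D W =
     tensor_map R A (tensor R B (tensor R C D)) id (tassoc R B C D)
       (tassoc R A (tensor R B C) D W)"

definition tau13 ::
  "('k, 'r) ring_scheme \<Rightarrow> ('k, 'a, 'm) module_scheme \<Rightarrow> ('k, 'b, 'n) module_scheme \<Rightarrow>
    ('k, 'c, 'p) module_scheme \<Rightarrow> ('a, ('b, 'c) tensor) tensor \<Rightarrow> ('c, ('b, 'a) tensor) tensor"
  where "tau13 R A B C = (let P = tensor R C (tensor R B A) in
     tensor_lift P (\<lambda>x w. tensor_lift P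
       (\<lambda>y z. tens R C (tensor R B A) z (tens R B A y x)) w))"

text \<open>The multiplication \<open>\<nabla> : A \<otimes> A \<rightarrow> A\<close> and its opposite \<open>x \<otimes> y \<mapsto> y x\<close>.\<close>

definition nabla :: "('k, 'a, 'm) module_scheme \<Rightarrow> ('a, 'a) tensor \<Rightarrow> 'a"
  where "nabla A = tensor_lift A (\<lambda>x y. x \<otimes>\<^bsub>A\<^esub> y)"

definition nabla_op :: "('k, 'a, 'm) module_scheme \<Rightarrow> ('a, 'a) tensor \<Rightarrow> 'a"
  where "nabla_op A = tensor_lift A (\<lambda>x y. y \<otimes>\<^bsub>A\<^esub> x)"


section \<open>Flatness\<close>

definition exact_seq3 ::
  "('a, 'm) ring_scheme \<Rightarrow> ('b, 'n) ring_scheme \<Rightarrow> ('c, 'p) ring_scheme \<Rightarrow>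
    ('a \<Rightarrow> 'b) \<Rightarrow> ('b \<Rightarrow> 'c) \<Rightarrow> bool"
  where "exact_seq3 A B C f g \<longleftrightarrow> f ` carrier A = {x \<in> carrier B. g x = \<zero>\<^bsub>C\<^esub>}"

text \<open>HOL cannot quantify over types inside a formula, so the test modules \<open>A, B, C\<close> have to live
  on one fixed type. The type \<open>(nat \<Rightarrow> 'k) set\<close> contains an isomorphic copy of every finitely
  generated module (the elements of \<open>R\<^sup>n / N\<close> are subsets of \<open>R\<^sup>n\<close>). As tensor
  products commute with filtered unions and every module is the union of its finitely generated
  submodules, (faithful) flatness with respect to these modules is the same as (faithful)
  flatness with respect to modules on arbitrary types.\<close>

definition flat :: "('k, 'r) ring_scheme \<Rightarrow> ('k, 'a, 'm) module_scheme \<Rightarrow> bool"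
  where "flat R M \<longleftrightarrow> module R M \<and>
    (\<forall>(A :: ('k, (nat \<Rightarrow> 'k) set) module) (B :: ('k, (nat \<Rightarrow> 'k) set) module)
      (C :: ('k, (nat \<Rightarrow> 'k) set) module) f g.
      module R A \<and> module R B \<and> module R C \<and> f \<in> mod_hom R A B \<and> g \<in> mod_hom R B C \<longrightarrow>
      exact_seq3 A B C f g \<longrightarrow>
      exact_seq3 (tensor R A M) (tensor R B M) (tensor R C M)
        (tensor_map R B M f id) (tensor_map R C M g id))"

definition faithfully_flat :: "('k, 'r) ring_scheme \<Rightarrow> ('k, 'a, 'm) module_scheme \<Rightarrow> bool"
  where "faithfully_flat R M \<longleftrightarrow> module R M \<and>
    (\<forall>(A :: ('k, (nat \<Rightarrow> 'k) set) module) (B :: ('k, (nat \<Rightarrow> 'k) set) module)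
      (C :: ('k, (nat \<Rightarrow> 'k) set) module) f g.
      module R A \<and> module R B \<and> module R C \<and> f \<in> mod_hom R A B \<and> g \<in> mod_hom R B C \<longrightarrow>
      (exact_seq3 A B C f g \<longleftrightarrow>
       exact_seq3 (tensor R A M) (tensor R B M) (tensor R C M)
        (tensor_map R B M f id) (tensor_map R C M g id)))"


section \<open>Hopf algebras\<close>

record ('k, 'a) bialg = "('k, 'a) module" +
  comult :: "'a \<Rightarrow> ('a, 'a) tensor"
  counit :: "'a \<Rightarrow> 'k"

definition make_bialg ::
  "('k, 'a, 'm) module_scheme \<Rightarrow> ('a \<Rightarrow> ('a, 'a) tensor) \<Rightarrow> ('a \<Rightarrow> 'k) \<Rightarrow> ('k, 'a) bialg"
  where "make_bialg A \<Delta> \<epsilon> = \<lparr>carrier = carrier A, monoid.mult = mult A, one = one A,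
     zero = zero A, add = add A, smult = module.smult A, comult = \<Delta>, counit = \<epsilon>\<rparr>"

definition coalgebra :: "('k, 'r) ring_scheme \<Rightarrow> ('k, 'a, 'm) bialg_scheme \<Rightarrow> bool"
  where "coalgebra R C \<longleftrightarrow> module R C \<and>
    comult C \<in> mod_hom R C (tensor R C C) \<and>
    counit C \<in> mod_hom R C (self_module R) \<and>
    (\<forall>c\<in>carrier C.
      tassoc R C C C (tensor_map R (tensor R C C) C (comult C) id (comult C c)) =
        tensor_map R C (tensor R C C) id (comult C) (comult C c) \<and>
      tensor_lift C (\<lambda>x y. counit C x \<odot>\<^bsub>C\<^esub> y) (comult C c) = c \<and>
      tensor_lift C (\<lambda>x y. counit C y \<odot>\<^bsub>C\<^esub> x) (comult C c) = c)"

definition bialgebra :: "('k, 'r) ring_scheme \<Rightarrow> ('k, 'a, 'm) bialg_scheme \<Rightarrow> bool"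
  where "bialgebra R H \<longleftrightarrow> k_algebra R H \<and> coalgebra R H \<and>
    comult H \<in> alg_hom R H (tensor R H H) \<and>
    counit H \<in> alg_hom R H (self_module R)"

definition is_antipode ::
  "('k, 'r) ring_scheme \<Rightarrow> ('k, 'a, 'm) bialg_scheme \<Rightarrow> ('a \<Rightarrow> 'a) \<Rightarrow> bool"
  where "is_antipode R H S \<longleftrightarrow> S \<in> mod_hom R H H \<and>
    (\<forall>h\<in>carrier H.
      tensor_lift H (\<lambda>x y. S x \<otimes>\<^bsub>H\<^esub> y) (comult H h) = counit H h \<odot>\<^bsub>H\<^esub> \<one>\<^bsub>H\<^esub> \<and>
      tensor_lift H (\<lambda>x y. x \<otimes>\<^bsub>H\<^esub> S y) (comult H h) = counit H h \<odot>\<^bsub>H\<^esub> \<one>\<^bsub>H\<^esub>)"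

definition hopf_algebra :: "('k, 'r) ring_scheme \<Rightarrow> ('k, 'a, 'm) bialg_scheme \<Rightarrow> bool"
  where "hopf_algebra R H \<longleftrightarrow> bialgebra R H \<and> (\<exists>S. is_antipode R H S)"

text \<open>The antipode is unique on \<open>carrier H\<close>.\<close>

definition antipode ::
  "('k, 'r) ring_scheme \<Rightarrow> ('k, 'a, 'm) bialg_scheme \<Rightarrow> 'a \<Rightarrow> 'a"
  where "antipode R H = (SOME S. is_antipode R H S)"

text \<open>An isomorphism of bialgebras between Hopf algebras automatically preserves antipodes.\<close>

definition hopf_isomorphic ::
  "('k, 'r) ring_scheme \<Rightarrow> ('k, 'a, 'm) bialg_scheme \<Rightarrow> ('k, 'b, 'n) bialg_scheme \<Rightarrow> bool"
  where "hopf_isomorphic R A B \<longleftrightarrow> hopf_algebra R A \<and> hopf_algebra R B \<and>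
    (\<exists>f \<in> alg_hom R A B. bij_betw f (carrier A) (carrier B) \<and>
      (\<forall>a\<in>carrier A. comult B (f a) = tensor_map R B B f f (comult A a) \<and>
        counit B (f a) = counit A a))"


section \<open>Galois objects\<close>

definition right_comodule_algebra ::
  "('k, 'r) ring_scheme \<Rightarrow> ('k, 'h, 'm) bialg_scheme \<Rightarrow> ('k, 't, 'n) module_scheme \<Rightarrow>
    ('t \<Rightarrow> ('t, 'h) tensor) \<Rightarrow> bool"
  where "right_comodule_algebra R H T \<rho> \<longleftrightarrow> k_algebra R T \<and>
    \<rho> \<in> alg_hom R T (tensor R T H) \<and>
    (\<forall>t\<in>carrier T.
      tassoc R T H H (tensor_map R (tensor R T H) H \<rho> id (\<rho> t)) =
        tensor_map R T (tensor R H H) id (comult H) (\<rho> t) \<and>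
      tensor_lift T (\<lambda>x h. counit H h \<odot>\<^bsub>T\<^esub> x) (\<rho> t) = t)"

definition coinvariants ::
  "('k, 'r) ring_scheme \<Rightarrow> ('k, 'h, 'm) bialg_scheme \<Rightarrow> ('k, 't, 'n) module_scheme \<Rightarrow>
    ('t \<Rightarrow> ('t, 'h) tensor) \<Rightarrow> 't set"
  where "coinvariants R H M \<rho> = {t \<in> carrier M. \<rho> t = tens R M H t \<one>\<^bsub>H\<^esub>}"

definition galois_map ::
  "('k, 'r) ring_scheme \<Rightarrow> ('k, 'h, 'm) bialg_scheme \<Rightarrow> ('k, 't, 'n) module_scheme \<Rightarrow>
    ('t \<Rightarrow> ('t, 'h) tensor) \<Rightarrow> ('t, 't) tensor \<Rightarrow> ('t, 'h) tensor"
  where "galois_map R H T \<rho> = tensor_lift (tensor R T H)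
     (\<lambda>x y. tensor_lift (tensor R T H) (\<lambda>y0 y1. tens R T H (x \<otimes>\<^bsub>T\<^esub> y0) y1) (\<rho> y))"

text \<open>\<open>T\<^sup>c\<^sup>o\<^sup>H = k\<close> means that the unit map \<open>k \<rightarrow> T\<close> is a bijection onto the coinvariants.\<close>

definition right_galois_object ::
  "('k, 'r) ring_scheme \<Rightarrow> ('k, 'h, 'm) bialg_scheme \<Rightarrow> ('k, 't, 'n) module_scheme \<Rightarrow>
    ('t \<Rightarrow> ('t, 'h) tensor) \<Rightarrow> bool"
  where "right_galois_object R H T \<rho> \<longleftrightarrow> right_comodule_algebra R H T \<rho> \<and>
    bij_betw (\<lambda>r. r \<odot>\<^bsub>T\<^esub> \<one>\<^bsub>T\<^esub>) (carrier R) (coinvariants R H T \<rho>) \<and>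
    bij_betw (galois_map R H T \<rho>) (carrier (tensor R T T)) (carrier (tensor R T H))"

text \<open>\<open>\<gamma>(h) = \<beta>\<^sup>-\<^sup>1(1 \<otimes> h)\<close>.\<close>

definition galois_gamma ::
  "('k, 'r) ring_scheme \<Rightarrow> ('k, 'h, 'm) bialg_scheme \<Rightarrow> ('k, 't, 'n) module_scheme \<Rightarrow>
    ('t \<Rightarrow> ('t, 'h) tensor) \<Rightarrow> 'h \<Rightarrow> ('t, 't) tensor"
  where "galois_gamma R H T \<rho> h =
     inv_into (carrier (tensor R T T)) (galois_map R H T \<rho>) (tens R T H \<one>\<^bsub>T\<^esub> h)"


section \<open>Quantum torsors\<close>

text \<open>\<open>\<mu>\<^sup>o\<^sup>p = \<tau>\<^sub>(\<^sub>1\<^sub>3\<^sub>) \<mu>\<close>.\<close>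

definition torsor_mu_op ::
  "('k, 'r) ring_scheme \<Rightarrow> ('k, 't, 'n) module_scheme \<Rightarrow>
    ('t \<Rightarrow> ('t, ('t, 't) tensor) tensor) \<Rightarrow> 't \<Rightarrow> ('t, ('t, 't) tensor) tensor"
  where "torsor_mu_op R T \<mu> x = tau13 R (opp T) T (opp T) (\<mu> x)"

definition quantum_torsor ::
  "('k, 'r) ring_scheme \<Rightarrow> ('k, 't, 'n) module_scheme \<Rightarrow>
    ('t \<Rightarrow> ('t, ('t, 't) tensor) tensor) \<Rightarrow> ('t \<Rightarrow> 't) \<Rightarrow> bool"
  where "quantum_torsor R T \<mu> \<theta> \<longleftrightarrow>
    k_algebra R T \<and> faithfully_flat R T \<and>
    \<mu> \<in> alg_hom R T (tensor R T (tensor R (opp T) T)) \<and>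
    \<theta> \<in> alg_hom R T T \<and> bij_betw \<theta> (carrier T) (carrier T) \<and>
    (let T' = opp T;
         P2 = tensor R T' T; P3 = tensor R T P2; P4 = tensor R T' P3;
         \<mu>\<mu> = (\<lambda>x. tassoc4 R T T' T P2 (tensor_map R P3 P2 \<mu> id (\<mu> x)))
     in \<forall>x\<in>carrier T.
       tensor_map R T T id (nabla T) (\<mu> x) = tens R T T x \<one>\<^bsub>T\<^esub> \<and>
       tensor_map R T T (nabla T) id (tassoc_inv R T T' T (\<mu> x)) = tens R T T \<one>\<^bsub>T\<^esub> x \<and>
       tensor_map R T P4 id (tensor_map R T' P3 id \<mu>) (\<mu> x) = \<mu>\<mu> x \<and>
       tensor_map R T P4 id (tensor_map R T' P3 id (tensor_map R T P2 \<theta> id)) (\<mu>\<mu> x) =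
         tensor_map R T P4 id
           (\<lambda>w. tassoc4 R T' T T' T
              (tensor_map R (tensor R T' (tensor R T T')) T (torsor_mu_op R T \<mu>) id w)) (\<mu> x) \<and>
       tensor_map R T P2 \<theta> (tensor_map R T' T \<theta> \<theta>) (\<mu> x) = \<mu> (\<theta> x))"

text \<open>The torsor associated to a Galois object:
  \<open>\<mu>(x) = x\<^sub>0 \<otimes> \<gamma>(x\<^sub>1)\<close> and \<open>\<theta>(x) = x\<^sub>0 S(x\<^sub>1)\<^sup>[\<^sup>2\<^sup>] S(x\<^sub>1)\<^sup>[\<^sup>1\<^sup>]\<close>.\<close>

definition assoc_torsor_mu ::
  "('k, 'r) ring_scheme \<Rightarrow> ('k, 'h, 'm) bialg_scheme \<Rightarrow> ('k, 't, 'n) module_scheme \<Rightarrow>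
    ('t \<Rightarrow> ('t, 'h) tensor) \<Rightarrow> 't \<Rightarrow> ('t, ('t, 't) tensor) tensor"
  where "assoc_torsor_mu R H T \<rho> x =
     tensor_map R T (tensor R (opp T) T) id (galois_gamma R H T \<rho>) (\<rho> x)"

definition assoc_torsor_theta ::
  "('k, 'r) ring_scheme \<Rightarrow> ('k, 'h, 'm) bialg_scheme \<Rightarrow> ('k, 't, 'n) module_scheme \<Rightarrow>
    ('t \<Rightarrow> ('t, 'h) tensor) \<Rightarrow> 't \<Rightarrow> 't"
  where "assoc_torsor_theta R H T \<rho> x = tensor_lift T
     (\<lambda>x0 x1. x0 \<otimes>\<^bsub>T\<^esub> nabla_op T (galois_gamma R H T \<rho> (antipode R H x1))) (\<rho> x)"


section \<open>The Hopf algebras \<open>H\<^sub>l(T)\<close>, \<open>H\<^sub>r(T)\<close> and \<open>L(T,H)\<close>\<close>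

text \<open>Here \<open>A\<close> is \<open>T \<otimes> T\<^sup>o\<^sup>p\<close> or \<open>T\<^sup>o\<^sup>p \<otimes> T\<close> and \<open>C \<subseteq> A\<close>. A map \<open>D\<close> into \<open>A \<otimes> A\<close> is
  corestricted to \<open>C \<otimes> C\<close> along the map \<open>C \<otimes> C \<rightarrow> A \<otimes> A\<close> induced by the inclusion, and \<open>\<nabla>\<close> is
  corestricted to \<open>k\<close> along the unit map of \<open>T\<close>. In the cases of interest both maps are injective,
  by flatness of \<open>C\<close> and faithful flatness of \<open>T\<close>.\<close>

definition induced_comult ::
  "('k, 'r) ring_scheme \<Rightarrow> ('k, 'a) module \<Rightarrow> 'a set \<Rightarrow> ('a \<Rightarrow> ('a, 'a) tensor) \<Rightarrow>
    'a \<Rightarrow> ('a, 'a) tensor"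
  where "induced_comult R A C D \<xi> = (let B = A\<lparr>carrier := C\<rparr> in
     THE \<zeta>. \<zeta> \<in> carrier (tensor R B B) \<and> tensor_map R A A id id \<zeta> = D \<xi>)"

definition induced_counit ::
  "('k, 'r) ring_scheme \<Rightarrow> ('k, 't, 'n) module_scheme \<Rightarrow> ('t, 't) tensor \<Rightarrow> 'k"
  where "induced_counit R T \<xi> = (THE c. c \<in> carrier R \<and> nabla T \<xi> = c \<odot>\<^bsub>T\<^esub> \<one>\<^bsub>T\<^esub>)"

definition Hl_carrier ::
  "('k, 'r) ring_scheme \<Rightarrow> ('k, 't, 'n) module_scheme \<Rightarrow>
    ('t \<Rightarrow> ('t, ('t, 't) tensor) tensor) \<Rightarrow> ('t \<Rightarrow> 't) \<Rightarrow> ('t, 't) tensor set"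
  where "Hl_carrier R T \<mu> \<theta> =
    (let T' = opp T; Q2 = tensor R T T'; Q3 = tensor R T' Q2 in
     {\<xi> \<in> carrier Q2.
       tensor_map R T Q3 id (tensor_map R T' Q2 id (tensor_map R T T' \<theta> id))
         (tassoc4 R T T' T T' (tensor_map R (tensor R T (tensor R T' T)) T' \<mu> id \<xi>)) =
       tensor_map R T Q3 id (torsor_mu_op R T \<mu>) \<xi>})"

definition Hr_carrier ::
  "('k, 'r) ring_scheme \<Rightarrow> ('k, 't, 'n) module_scheme \<Rightarrow>
    ('t \<Rightarrow> ('t, ('t, 't) tensor) tensor) \<Rightarrow> ('t \<Rightarrow> 't) \<Rightarrow> ('t, 't) tensor set"
  where "Hr_carrier R T \<mu> \<theta> =
    (let T' = opp T; P2 = tensor R T' T; P3 = tensor R T P2 in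
     {\<xi> \<in> carrier P2.
       tensor_map R T' P3 id (tensor_map R T P2 \<theta> id) (tensor_map R T' P3 id \<mu> \<xi>) =
       tassoc4 R T' T T' T
         (tensor_map R (tensor R T' (tensor R T T')) T (torsor_mu_op R T \<mu>) id \<xi>)})"

definition Hl ::
  "('k, 'r) ring_scheme \<Rightarrow> ('k, 't, 'n) module_scheme \<Rightarrow>
    ('t \<Rightarrow> ('t, ('t, 't) tensor) tensor) \<Rightarrow> ('t \<Rightarrow> 't) \<Rightarrow> ('k, ('t, 't) tensor) bialg"
  where "Hl R T \<mu> \<theta> =
    (let T' = opp T; Q2 = tensor R T T'; C = Hl_carrier R T \<mu> \<theta> in
     make_bialg (Q2\<lparr>carrier := C\<rparr>)
       (induced_comult R Q2 C
         (\<lambda>\<xi>. tassoc_inv R T T' Q2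
            (tassoc4 R T T' T T' (tensor_map R (tensor R T (tensor R T' T)) T' \<mu> id \<xi>))))
       (induced_counit R T))"

definition Hr ::
  "('k, 'r) ring_scheme \<Rightarrow> ('k, 't, 'n) module_scheme \<Rightarrow>
    ('t \<Rightarrow> ('t, ('t, 't) tensor) tensor) \<Rightarrow> ('t \<Rightarrow> 't) \<Rightarrow> ('k, ('t, 't) tensor) bialg"
  where "Hr R T \<mu> \<theta> =
    (let T' = opp T; P2 = tensor R T' T; C = Hr_carrier R T \<mu> \<theta> in
     make_bialg (P2\<lparr>carrier := C\<rparr>)
       (induced_comult R P2 C
         (\<lambda>\<xi>. tassoc_inv R T' T P2 (tensor_map R T' (tensor R T P2) id \<mu> \<xi>)))
       (induced_counit R T))"

text \<open>\<open>\<mu>\<close> viewed as a map \<open>T \<rightarrow> T \<otimes> H\<^sub>r(T)\<close>.\<close>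

definition Hr_coaction ::
  "('k, 'r) ring_scheme \<Rightarrow> ('k, 't, 'n) module_scheme \<Rightarrow>
    ('t \<Rightarrow> ('t, ('t, 't) tensor) tensor) \<Rightarrow> ('t \<Rightarrow> 't) \<Rightarrow> 't \<Rightarrow> ('t, ('t, 't) tensor) tensor"
  where "Hr_coaction R T \<mu> \<theta> x =
     (THE \<zeta>. \<zeta> \<in> carrier (tensor R T (Hr R T \<mu> \<theta>)) \<and>
        tensor_map R T (tensor R (opp T) T) id id \<zeta> = \<mu> x)"

definition codiagonal_coaction ::
  "('k, 'r) ring_scheme \<Rightarrow> ('k, 'h, 'm) bialg_scheme \<Rightarrow> ('k, 't, 'n) module_scheme \<Rightarrow>
    ('t \<Rightarrow> ('t, 'h) tensor) \<Rightarrow> ('t, 't) tensor \<Rightarrow> (('t, 't) tensor, 'h) tensor"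
  where "codiagonal_coaction R H T \<rho> = (let P = tensor R (tensor R T T) H in
     tensor_lift P (\<lambda>x y.
       tensor_lift P (\<lambda>x0 x1.
         tensor_lift P (\<lambda>y0 y1.
           tens R (tensor R T T) H (tens R T T x0 y0) (x1 \<otimes>\<^bsub>H\<^esub> y1)) (\<rho> y)) (\<rho> x)))"

definition L_hopf ::
  "('k, 'r) ring_scheme \<Rightarrow> ('k, 'h, 'm) bialg_scheme \<Rightarrow> ('k, 't, 'n) module_scheme \<Rightarrow>
    ('t \<Rightarrow> ('t, 'h) tensor) \<Rightarrow> ('k, ('t, 't) tensor) bialg"
  where "L_hopf R H T \<rho> =
    (let T' = opp T; Q2 = tensor R T T'; P = tensor R Q2 Q2;
         C = coinvariants R H (tensor R T T) (codiagonal_coaction R H T \<rho>)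
     in make_bialg (Q2\<lparr>carrier := C\<rparr>)
       (induced_comult R Q2 C
         (tensor_lift P (\<lambda>x y. tensor_lift P (\<lambda>x0 x1. tensor_lift P
            (\<lambda>a b. tens R Q2 Q2 (tens R T T' x0 a) (tens R T T' b y))
            (galois_gamma R H T \<rho> x1)) (\<rho> x))))
       (induced_counit R T))"

end

theory Submission
imports Defs
begin

text \<open>For a Galois object the translation map \<open>\<gamma>\<close> is multiplicative into \<open>T\<^sup>o\<^sup>p \<otimes> T\<close>, and \<open>\<mu>\<close> is
\<open>(T \<otimes> \<gamma>) \<rho>\<close>; hence every \<open>\<gamma>(h)\<close> satisfies the equation defining \<open>H\<^sub>r(T)\<close>, and faithfully flat
descent along \<open>k \<rightarrow> T\<close> shows that nothing else does. Likewise the equation defining \<open>H\<^sub>l(T)\<close> unwinds to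
codiagonal coinvariance. Conversely, for a torsor the equations of \<open>H\<^sub>r(T)\<close> become, after tensoring with \<open>T\<close>, a
split equaliser, so that \<open>\<mu>\<close> takes values in \<open>T \<otimes> H\<^sub>r(T)\<close> and the Galois map has the inverse
\<open>x \<otimes> \<xi> \<mapsto> x \<xi>\<close>; its translation map is the inclusion \<open>H\<^sub>r(T) \<rightarrow> T\<^sup>o\<^sup>p \<otimes> T\<close>.\<close>

text \<open>The obstacle that shapes the proof is injectivity. \<open>induced_comult\<close> and
  \<open>Hr_coaction\<close> are given by \<open>THE\<close>, so
  \<open>C \<otimes> C \<rightarrow> A \<otimes> A\<close> and its relatives must be injective
  before flatness of \<open>C\<close> is available. The substitute is the Galois map itself:
  \<open>a \<otimes> b\<close> goes to the coaction of \<open>b\<close> with its \<open>T\<close>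
  leg multiplied by \<open>a\<close>, and on \<open>C\<close> this is
  \<open>c \<mapsto> c \<otimes> 1\<close>. Hence the inclusion of \<open>C\<close> can be undone up
  to faithfully flat descent, and this property survives tensor products. A second obstacle is that
  \<open>flat\<close> tests only modules on one fixed type. All flatness arguments therefore go
  through finitely generated submodules that are copied onto that type. Both claims share the locale
  \<open>pretorsor_theta\<close>: the Hopf structure of \<open>Hr\<close> is built once from a few
  closure conditions, which are checked separately for a quantum torsor and for a Galois object. For
  the latter one identity connects \<open>\<theta>\<close> with the translation map: h[1] \<otimes>
  \<theta>(h[2]) = S(h)[2] \<otimes> S(h)[1].\<close>

abbreviation (input) "car \<equiv> carrier"
abbreviation (input) "tmp \<equiv> tensor_map"
abbreviation (input) "Hom \<equiv> mod_hom"
abbreviation (input) "tp \<equiv> tensor"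

section \<open>Tensor products of modules\<close>

text \<open>The target group is written multiplicatively because the map is used with values in
  \<open>add_monoid P\<close> as well as directly in \<open>tensor_group\<close>.\<close>

definition balanced ::
"('k, 'r) ring_scheme => ('k, 'a, 'm) module_scheme => ('k, 'b, 'n) module_scheme =>
 ('c, 'g) monoid_scheme => ('a => 'b => 'c) => bool"
where "balanced R M N G f \<longleftrightarrow>
 (ALL x:car M. ALL y:car N. f x y:car G) &
 (ALL x:car M. ALL x':car M. ALL y:car N. f (x \<oplus>\<^bsub>M\<^esub> x') y = f x y \<otimes>\<^bsub>G\<^esub> f x' y) &
 (ALL x:car M. ALL y:car N. ALL y':car N. f x (y \<oplus>\<^bsub>N\<^esub> y') = f x y \<otimes>\<^bsub>G\<^esub> f x y') &
 (ALL r:car R. ALL x:car M. ALL y:car N. f (r \<odot>\<^bsub>M\<^esub> x) y = f x (r \<odot>\<^bsub>N\<^esub> y))"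

text \<open>This is the sum inside \<open>group_lift\<close>, isolated so that it can be studied on
  a single formal sum before passing to cosets.\<close>

definition formal_eval :: "('c, 'g) monoid_scheme => ('a => 'b => 'c) => ('a \<times> 'b \<Rightarrow>\<^sub>0 int) => 'c"
where "formal_eval G f c =
 finprod G (%p. f (fst p) (snd p) [^]\<^bsub>G\<^esub> Poly_Mapping.lookup c p) (Poly_Mapping.keys c)"

text \<open>Pairs outside the support have exponent 0 and contribute the unit. This allows
  \<open>c\<close>, \<open>d\<close> and \<open>c + d\<close> to be summed over one common index
  set.\<close>

lemma (in comm_group) formal_eval_superset:
assumes "!!x y. x:A==>y:B==>f x y:car G"
 and "Poly_Mapping.keys c <= K" "K <= A \<times> B" "finite K"
shows "formal_eval G f c = finprod G (%p. f (fst p) (snd p) [^] Poly_Mapping.lookup c p) K"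
unfolding formal_eval_def using assms
by (intro finprod_mono_neutral_cong_left) (auto simp: in_keys_iff subset_iff)

lemma (in comm_group) formal_eval_hom:
assumes f: "!!x y. x:A==>y:B==>f x y:car G"
shows "formal_eval G f:hom (free_Abelian_group (A \<times> B)) G"
proof (rule homI)
fix c d assume cd: "c:car (free_Abelian_group (A \<times> B))" "d:car (free_Abelian_group (A \<times> B))"
let ?K = "Poly_Mapping.keys c \<union> Poly_Mapping.keys d"
have K: "?K <= A \<times> B" "finite ?K" using cd by auto
have s: "Poly_Mapping.keys (c + d) <= ?K" using keys_add[of c d] by blast
have 1: "formal_eval G f (c + d) = finprod G (%p. f (fst p) (snd p) [^] Poly_Mapping.lookup (c + d) p) ?K"
 by (rule formal_eval_superset[OF f s K]) auto
have 2: "formal_eval G f c = finprod G (%p. f (fst p) (snd p) [^] Poly_Mapping.lookup c p) ?K"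
 by (rule formal_eval_superset[OF f _ K]) auto
have 3: "formal_eval G f d = finprod G (%p. f (fst p) (snd p) [^] Poly_Mapping.lookup d p) ?K"
 by (rule formal_eval_superset[OF f _ K]) auto
have cl: "p:?K==>f (fst p) (snd p):car G" for p using K f by auto
have "formal_eval G f (c + d) = finprod G (%p. f (fst p) (snd p) [^] Poly_Mapping.lookup c p
 \<otimes> f (fst p) (snd p) [^] Poly_Mapping.lookup d p) ?K"
 unfolding 1 using cl by (intro finprod_cong') (auto simp: lookup_add int_pow_mult)
also have "... = formal_eval G f c \<otimes> formal_eval G f d"
 unfolding 2 3 using cl by (intro finprod_multf) auto
finally show "formal_eval G f (c \<otimes>\<^bsub>free_Abelian_group (A \<times> B)\<^esub> d) = formal_eval G f c \<otimes> formal_eval G f d"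
 by simp
next
fix c assume "c:car (free_Abelian_group (A \<times> B))"
then show "formal_eval G f c:car G" unfolding formal_eval_def using f
 by (intro finprod_closed) auto
qed

lemma (in comm_group) formal_eval_frag_of:
"f x y:car G==>formal_eval G f (frag_of (x, y)) = f x y"
unfolding formal_eval_def by simp

lemma keys_diff_subset: "Poly_Mapping.keys a <= S==>Poly_Mapping.keys b <= S==>Poly_Mapping.keys (a - b) <= S"
using keys_diff[of a b] by blast

locale two_modules = M: module R M + N: module R N
for R :: "('k, 'r) ring_scheme" and M :: "('k, 'a, 'm) module_scheme" and N :: "('k, 'b, 'n) module_scheme"
begin

abbreviation "F == free_Abelian_group (car M \<times> car N)"

sublocale F: comm_group F by (rule abelian_free_Abelian_group)

lemma tensor_rels_carrier: "tensor_rels R M N <= car F"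
proof
fix c assume "c:tensor_rels R M N"
then show "c:car F"
 unfolding tensor_rels_def by (elim UnE CollectE exE conjE) (simp_all add: keys_diff_subset)
qed

sublocale null: subgroup "tensor_null R M N" F
unfolding tensor_null_def by (rule F.generate_is_subgroup[OF tensor_rels_carrier])

sublocale TG: comm_group "tensor_group R M N"
unfolding tensor_group_def by (rule F.abelian_FactGroup) (rule null.subgroup_axioms)

lemma normal_null: "tensor_null R M N \<lhd> F"
by (simp add: F.normal_iff_subgroup null.subgroup_axioms)

abbreviation "cl == (%c. tensor_null R M N #>\<^bsub>F\<^esub> c)"

lemma cl_in_carrier: "c:car F==>cl c:car (tensor_group R M N)"
using F.rcosetsI[OF null.subset] by (simp add: tensor_group_def FactGroup_def)

lemma carrier_cases:
assumes "X:car (tensor_group R M N)" obtains c where "c:car F" "X = cl c"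
using assms unfolding tensor_group_def FactGroup_def RCOSETS_def by (elim partial_object.select_convs(1)[THEN equalityD1, THEN subsetD, elim_format] UN_E singletonE)

lemma cl_add: "c:car F==>d:car F==>cl (c + d) = cl c \<otimes>\<^bsub>tensor_group R M N\<^esub> cl d"
using normal.rcos_sum[OF normal_null, of c d] by (simp add: tensor_group_def)

lemma cl_hom: "cl:hom F (tensor_group R M N)"
by (rule homI) (use cl_in_carrier cl_add in auto)

lemma cl_diff: "c:car F==>d:car F ==>
cl (c - d) = cl c \<otimes>\<^bsub>tensor_group R M N\<^esub> inv\<^bsub>tensor_group R M N\<^esub> (cl d)"
proof -
interpret h: group_hom F "tensor_group R M N" cl by unfold_locales (rule cl_hom)
assume c: "c:car F" and d: "d:car F"
have "cl (c \<otimes>\<^bsub>F\<^esub> inv\<^bsub>F\<^esub> d) = cl c \<otimes>\<^bsub>tensor_group R M N\<^esub> inv\<^bsub>tensor_group R M N\<^esub> (cl d)"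
 using c d h.hom_mult h.hom_inv F.inv_closed by metis
then show ?thesis using c d by simp
qed

lemma cl_one: "cl c = \<one>\<^bsub>tensor_group R M N\<^esub>" if "c:tensor_null R M N"
proof -
have "cl c = tensor_null R M N"
 using that F.coset_join2[of c "tensor_null R M N"] null.subgroup_axioms null.subset by blast
then show ?thesis by (simp add: tensor_group_def)
qed

lemma cl_zero_iff: "c:car F==>cl c = \<one>\<^bsub>tensor_group R M N\<^esub> \<longleftrightarrow> c:tensor_null R M N"
using cl_one F.coset_join1[of "tensor_null R M N" c] null.subgroup_axioms null.subset
by (auto simp: tensor_group_def)

lemma rel_in_null: "c:tensor_rels R M N==>c:tensor_null R M N"
unfolding tensor_null_def by (rule generate.incl)

lemma tens_in_group: "x:car M==>y:car N==>tens R M N x y:car (tensor_group R M N)"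
unfolding tens_def by (rule cl_in_carrier) simp

lemma tens_group_add1:
assumes "x:car M" "x':car M" "y:car N"
shows "tens R M N (x \<oplus>\<^bsub>M\<^esub> x') y = tens R M N x y \<otimes>\<^bsub>tensor_group R M N\<^esub> tens R M N x' y"
proof -
let ?a = "frag_of (x \<oplus>\<^bsub>M\<^esub> x', y)" and ?b = "frag_of (x, y)" and ?c = "frag_of (x', y)"
have r: "?a - ?b - ?c:tensor_null R M N"
 by (rule rel_in_null) (use assms in \<open>unfold tensor_rels_def, blast\<close>)
then have rc: "?a - ?b - ?c:car F" using null.subset by blast
have bc: "?b + ?c:car F" using F.m_closed[of ?b ?c] assms by simp
\<comment> \<open>The argument on the left is \<open>?a\<close> itself, split into a relation, whose
  class is trivial, and the expected sum.\<close>
have "cl ((?a - ?b - ?c) + (?b + ?c)) = cl (?b + ?c)"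
 unfolding cl_add[OF rc bc] cl_one[OF r] by (rule TG.l_one[OF cl_in_carrier[OF bc]])
then show ?thesis unfolding tens_def using assms by (simp add: cl_add)
qed

lemma tens_group_add2:
assumes "x:car M" "y:car N" "y':car N"
shows "tens R M N x (y \<oplus>\<^bsub>N\<^esub> y') = tens R M N x y \<otimes>\<^bsub>tensor_group R M N\<^esub> tens R M N x y'"
proof -
let ?a = "frag_of (x, y \<oplus>\<^bsub>N\<^esub> y')" and ?b = "frag_of (x, y)" and ?c = "frag_of (x, y')"
have r: "?a - ?b - ?c:tensor_null R M N"
 by (rule rel_in_null) (use assms in \<open>unfold tensor_rels_def, blast\<close>)
then have rc: "?a - ?b - ?c:car F" using null.subset by blast
have bc: "?b + ?c:car F" using F.m_closed[of ?b ?c] assms by simp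
have "cl ((?a - ?b - ?c) + (?b + ?c)) = cl (?b + ?c)"
 unfolding cl_add[OF rc bc] cl_one[OF r] by (rule TG.l_one[OF cl_in_carrier[OF bc]])
then show ?thesis unfolding tens_def using assms by (simp add: cl_add)
qed

lemma tens_group_smult:
assumes "r:car R" "x:car M" "y:car N"
shows "tens R M N (r \<odot>\<^bsub>M\<^esub> x) y = tens R M N x (r \<odot>\<^bsub>N\<^esub> y)"
proof -
let ?a = "frag_of (r \<odot>\<^bsub>M\<^esub> x, y)" and ?b = "frag_of (x, r \<odot>\<^bsub>N\<^esub> y)"
have r: "?a - ?b:tensor_null R M N"
 by (rule rel_in_null) (use assms in \<open>unfold tensor_rels_def, blast\<close>)
then have rc: "?a - ?b:car F" using null.subset by blast
have bc: "?b:car F" using assms by simp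
have "cl ((?a - ?b) + ?b) = cl ?b"
 unfolding cl_add[OF rc bc] cl_one[OF r] by (rule TG.l_one[OF cl_in_carrier[OF bc]])
then show ?thesis unfolding tens_def by simp
qed

lemma tensor_group_induct [consumes 1, case_names tens diff]:
assumes "X:car (tensor_group R M N)"
 and t: "!!x y. x:car M==>y:car N==>P (tens R M N x y)"
 and d: "!!X Y. X:car (tensor_group R M N)==>Y:car (tensor_group R M N)==>P X==>P Y ==>
  P (X \<otimes>\<^bsub>tensor_group R M N\<^esub> inv\<^bsub>tensor_group R M N\<^esub> Y)"
shows "P X"
proof -
\<comment> \<open>The unit is reached as the difference of a pure tensor with itself;
  \<open>0 \<otimes> 0\<close> is one that always exists.\<close>
have one: "P \<one>\<^bsub>tensor_group R M N\<^esub>"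
 using d[of "tens R M N \<zero>\<^bsub>M\<^esub> \<zero>\<^bsub>N\<^esub>" "tens R M N \<zero>\<^bsub>M\<^esub> \<zero>\<^bsub>N\<^esub>"] t tens_in_group
 by (simp)
obtain c where c: "c:car F" "X = cl c" using assms(1) by (rule carrier_cases)
have "Poly_Mapping.keys c <= car M \<times> car N" using c by simp
then have "P (cl c)"
proof (rule free_Abelian_group_induct[where P = "%c. P (cl c)"])
 show "P (cl 0)" using one cl_one[OF null.one_closed] by simp
 show "P (cl (x - y))" if "Poly_Mapping.keys x <= car M \<times> car N"
 "Poly_Mapping.keys y <= car M \<times> car N" "P (cl x)" "P (cl y)" for x y
 using d[of "cl x" "cl y"] cl_in_carrier that by (simp add: cl_diff)
 show "P (cl (frag_of a))" if "a:car M \<times> car N" for a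
 using t that unfolding tens_def by (cases a) auto
qed
then show ?thesis using c by simp
qed

text \<open>A balanced map kills the defining relations, hence the subgroup that they generate, so
  its value is constant on each coset. This makes the image under \<open>formal_eval\<close> a
  singleton, and \<open>the_elem\<close> returns its element.\<close>

lemma group_lift_cl:
assumes "comm_group G" "balanced R M N G f" "c:car F"
shows "group_lift G f (cl c) = formal_eval G f c"
 and "d:cl c==>formal_eval G f d = formal_eval G f c"
proof -
interpret G: comm_group G by fact
have fc: "x:car M==>y:car N==>f x y:car G" for x y
 using assms(2) by (auto simp: balanced_def)
have E: "formal_eval G f:hom F G" by (rule G.formal_eval_hom[OF fc])
interpret h: group_hom F G "formal_eval G f" by unfold_locales (rule E)
have df: "formal_eval G f (a - b) = formal_eval G f a \<otimes>\<^bsub>G\<^esub> inv\<^bsub>G\<^esub> formal_eval G f b"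
 if "a:car F" "b:car F" for a b
 using that h.hom_mult[of a "inv\<^bsub>F\<^esub> b"] h.hom_inv[of b] F.inv_closed[of b] by simp
note bal = assms(2)[unfolded balanced_def]
have cancel: "a \<otimes>\<^bsub>G\<^esub> b \<otimes>\<^bsub>G\<^esub> inv\<^bsub>G\<^esub> a \<otimes>\<^bsub>G\<^esub> inv\<^bsub>G\<^esub> b = \<one>\<^bsub>G\<^esub>" if "a:car G" "b:car G" for a b
 using that G.m_comm[of a b] by (simp add: G.m_assoc)
have rel: "formal_eval G f c = \<one>\<^bsub>G\<^esub>" if "c:tensor_rels R M N" for c
 using that unfolding tensor_rels_def
proof (elim UnE CollectE exE conjE)
 fix x y z assume a: "c = frag_of (x \<oplus>\<^bsub>M\<^esub> y, z) - frag_of (x, z) - frag_of (y, z)"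
 "x:car M" "y:car M" "z:car N"
 then show ?thesis using bal
 by (simp add: df fc G.formal_eval_frag_of keys_diff_subset cancel)
next
 fix x y z assume a: "c = frag_of (x, y \<oplus>\<^bsub>N\<^esub> z) - frag_of (x, y) - frag_of (x, z)"
 "x:car M" "y:car N" "z:car N"
 then show ?thesis using bal
 by (simp add: df fc G.formal_eval_frag_of keys_diff_subset cancel)
next
 fix r x y assume a: "c = frag_of (r \<odot>\<^bsub>M\<^esub> x, y) - frag_of (x, r \<odot>\<^bsub>N\<^esub> y)"
 "r:car R" "x:car M" "y:car N"
 then show ?thesis using bal
 by (simp add: df fc G.formal_eval_frag_of)
qed
have nul: "formal_eval G f n = \<one>\<^bsub>G\<^esub>" if "n:tensor_null R M N" for n
 using that unfolding tensor_null_def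
proof (induction rule: generate.induct)
 case one then show ?case using h.hom_one by simp
next
 case (incl h) then show ?case by (rule rel)
next
 case (inv c) then show ?case using rel[of c] h.hom_inv[of c] tensor_rels_carrier by (auto simp del: inv_free_Abelian_group)
next
 case (eng a b)
 then have "a:car F" "b:car F" using null.subset unfolding tensor_null_def by (blast, blast)
 then show ?case using eng h.hom_mult[of a b] by (simp del: mult_free_Abelian_group)
qed
show 1: "formal_eval G f d = formal_eval G f c" if d: "d:cl c" for d
proof -
 obtain n where n: "n:tensor_null R M N" "d = n + c"
 using d by (auto simp: r_coset_def)
 then have "formal_eval G f d = formal_eval G f n \<otimes>\<^bsub>G\<^esub> formal_eval G f c"
 using h.hom_mult[OF subsetD[OF null.subset n(1)] assms(3)] by simp
 then show ?thesis using nul[OF n(1)] h.hom_closed[OF assms(3)] by simp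
qed
have "c:cl c" using assms(3) F.rcos_self[of c] null.subgroup_axioms by blast
then show "group_lift G f (cl c) = formal_eval G f c"
 unfolding group_lift_def formal_eval_def[symmetric, abs_def]
proof -
 assume "c:cl c"
 then have "formal_eval G f ` cl c = {formal_eval G f c}" using 1 by blast
 then show "the_elem (formal_eval G f ` cl c) = formal_eval G f c" by simp
qed
qed

lemma group_lift_tens:
assumes "comm_group G" "balanced R M N G f" "x:car M" "y:car N"
shows "group_lift G f (tens R M N x y) = f x y"
proof -
interpret G: comm_group G by fact
show ?thesis unfolding tens_def using assms
 by (subst group_lift_cl) (auto simp: G.formal_eval_frag_of balanced_def)
qed

lemma group_lift_hom:
assumes "comm_group G" "balanced R M N G f"
shows "group_lift G f:hom (tensor_group R M N) G"
proof (rule homI)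
interpret G: comm_group G by fact
have E: "formal_eval G f:hom F G"
 by (rule G.formal_eval_hom) (use assms(2) in \<open>auto simp: balanced_def\<close>)
fix X assume "X:car (tensor_group R M N)"
then obtain c where c: "c:car F" "X = cl c" by (rule carrier_cases)
then show "group_lift G f X:car G" using group_lift_cl[OF assms c(1)] E hom_in_carrier by metis
fix Y assume "Y:car (tensor_group R M N)"
then obtain d where d: "d:car F" "Y = cl d" by (rule carrier_cases)
have cd: "c + d:car F" using c d F.m_closed[of c d] by simp
then show "group_lift G f (X \<otimes>\<^bsub>tensor_group R M N\<^esub> Y) = group_lift G f X \<otimes>\<^bsub>G\<^esub> group_lift G f Y"
 unfolding c(2) d(2) cl_add[OF c(1) d(1), symmetric] group_lift_cl(1)[OF assms cd]
 group_lift_cl(1)[OF assms c(1)] group_lift_cl(1)[OF assms d(1)]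
 using hom_mult[OF E c(1) d(1)] by simp
qed

end

section \<open>Linear and bilinear maps\<close>

lemma modD:
assumes "module R A"
shows "cring R" "abelian_group A" "comm_group (add_monoid A)"
using assms by (auto simp: module_def abelian_group.a_comm_group)

lemma mod_homI:
assumes "!!x. x:car M==>f x:car N"
 and "!!x y. x:car M==>y:car M==>f (x \<oplus>\<^bsub>M\<^esub> y) = f x \<oplus>\<^bsub>N\<^esub> f y"
 and "!!r x. r:car R==>x:car M==>f (r \<odot>\<^bsub>M\<^esub> x) = r \<odot>\<^bsub>N\<^esub> f x"
shows "f:Hom R M N"
using assms by (auto simp: mod_hom_def)

lemma hom_mem: "f:Hom R M N==>x:car M==>f x:car N"
and mod_hom_add: "f:Hom R M N==>x:car M==>y:car M==>f (x \<oplus>\<^bsub>M\<^esub> y) = f x \<oplus>\<^bsub>N\<^esub> f y"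
and hom_smult: "f:Hom R M N==>r:car R==>x:car M==>f (r \<odot>\<^bsub>M\<^esub> x) = r \<odot>\<^bsub>N\<^esub> f x"
by (auto simp: mod_hom_def)

lemma mod_hom_cong: "(!!x. x:car M==>f x = g x)==>module R M==>f:Hom R M N \<longleftrightarrow> g:Hom R M N"
by (auto simp: mod_hom_def Pi_def abelian_group.axioms module_def abelian_monoid.a_closed module.smult_closed)

lemma mod_hom_hom: "f:Hom R M N==>f:hom (add_monoid M) (add_monoid N)"
by (auto simp: mod_hom_def hom_def)

lemma mod_hom_zero_inv:
assumes "module R M" "module R N" "f:Hom R M N"
shows "f \<zero>\<^bsub>M\<^esub> = \<zero>\<^bsub>N\<^esub>" "x:car M==>f (\<ominus>\<^bsub>M\<^esub> x) = \<ominus>\<^bsub>N\<^esub> f x"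
 "x:car M==>y:car M==>f (x \<ominus>\<^bsub>M\<^esub> y) = f x \<ominus>\<^bsub>N\<^esub> f y"
proof -
interpret M: module R M by fact
interpret N: module R N by fact
interpret h: group_hom "add_monoid M" "add_monoid N" f
 using mod_hom_hom[OF assms(3)] by unfold_locales
show "f \<zero>\<^bsub>M\<^esub> = \<zero>\<^bsub>N\<^esub>" using h.hom_one by simp
show 1: "x:car M==>f (\<ominus>\<^bsub>M\<^esub> x) = \<ominus>\<^bsub>N\<^esub> f x" for x using h.hom_inv by (simp add: a_inv_def)
show "x:car M==>y:car M==>f (x \<ominus>\<^bsub>M\<^esub> y) = f x \<ominus>\<^bsub>N\<^esub> f y"
 using 1 by (simp add: a_minus_def mod_hom_add[OF assms(3)])
qed

lemma hom_comp: "g:Hom R B C==>f:Hom R A B==>(%x. g (f x)):Hom R A C"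
by (auto simp: mod_hom_def Pi_def)

lemma mod_hom_eq_zero_inj:
assumes "module R M" "module R N" "f:Hom R M N"
 and "!!x. x:car M==>f x = \<zero>\<^bsub>N\<^esub>==>x = \<zero>\<^bsub>M\<^esub>"
 and "x:car M" "y:car M" "f x = f y"
shows "x = y"
proof -
interpret M: module R M by fact
interpret N: module R N by fact
have "f (x \<ominus>\<^bsub>M\<^esub> y) = \<zero>\<^bsub>N\<^esub>"
 using assms(5-7) hom_mem[OF assms(3)]
 by (simp add: mod_hom_zero_inv(3)[OF assms(1-3)]) (simp add: a_minus_def N.r_neg)
then have "x \<ominus>\<^bsub>M\<^esub> y = \<zero>\<^bsub>M\<^esub>" using assms(4)[of "x \<ominus>\<^bsub>M\<^esub> y"] assms(5,6) by simp
then have "x \<oplus>\<^bsub>M\<^esub> \<ominus>\<^bsub>M\<^esub> y = \<zero>\<^bsub>M\<^esub>" by (simp add: a_minus_def)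
from M.minus_equality[OF this] show ?thesis using assms(5,6) by simp
qed

definition bilin ::
"('k, 'r) ring_scheme => ('k, 'a, 'm) module_scheme => ('k, 'b, 'n) module_scheme =>
 ('k, 'c, 'p) module_scheme => ('a => 'b => 'c) => bool"
where "bilin R A B P f \<longleftrightarrow> (ALL x:car A. (%y. f x y):Hom R B P) &
 (ALL y:car B. (%x. f x y):Hom R A P)"

lemma bilinI:
assumes "!!x. x:car A==>(%y. f x y):Hom R B P"
 "!!y. y:car B==>(%x. f x y):Hom R A P"
shows "bilin R A B P f"
using assms by (auto simp: bilin_def)

lemma bilin_in: "bilin R A B P f==>x:car A==>y:car B==>f x y:car P"
by (auto simp: bilin_def mod_hom_def)

lemma bilin_balanced: "bilin R A B P f==>balanced R A B (add_monoid P) f"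
by (auto simp: bilin_def mod_hom_def balanced_def)

section \<open>The module structure of the tensor product\<close>

lemma tsimps:
"car (tp R M N) = car (tensor_group R M N)"
"zero (tp R M N) = one (tensor_group R M N)"
"add (tp R M N) = mult (tensor_group R M N)"
"one (tp R M N) = tens R M N \<one>\<^bsub>M\<^esub> \<one>\<^bsub>N\<^esub>"
"smult (tp R M N) r = group_lift (tensor_group R M N) (%x y. tens R M N (r \<odot>\<^bsub>M\<^esub> x) y)"
by (simp_all add: tensor_def Let_def)

context two_modules
begin

lemma tens_minus: "x:car M==>y:car N ==>
inv\<^bsub>tensor_group R M N\<^esub> (tens R M N x y) = tens R M N (\<ominus>\<^bsub>M\<^esub> x) y"
proof -
assume x: "x:car M" and y: "y:car N"
have z: "tens R M N \<zero>\<^bsub>M\<^esub> y = \<one>\<^bsub>tensor_group R M N\<^esub>"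
 using tens_group_add1[of "\<zero>\<^bsub>M\<^esub>" "\<zero>\<^bsub>M\<^esub>" y] tens_in_group[of "\<zero>\<^bsub>M\<^esub>" y] y by simp
show ?thesis
 using tens_group_add1[of "\<ominus>\<^bsub>M\<^esub> x" x y] x y tens_in_group z
 by (intro TG.inv_equality) (auto simp: M.M.l_neg)
qed

text \<open>The negative of a pure tensor is again a pure tensor, so differences reduce to sums. The
  property is carried for \<open>X\<close> and its inverse at the same time.\<close>

lemma tensor_group_add_induct [consumes 1, case_names tens add]:
assumes "X:car (tensor_group R M N)"
 and t: "!!x y. x:car M==>y:car N==>P (tens R M N x y)"
 and d: "!!X Y. X:car (tensor_group R M N)==>Y:car (tensor_group R M N)==>P X==>P Y ==>
  P (X \<otimes>\<^bsub>tensor_group R M N\<^esub> Y)"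
shows "P X"
proof -
from assms(1) have "P X & P (inv\<^bsub>tensor_group R M N\<^esub> X)"
proof (induction rule: tensor_group_induct)
 case (tens x y) then show ?case using t by (simp add: tens_minus)
next
 case (diff X Y) then show ?case using d by (simp add: TG.inv_mult)
qed
then show ?thesis by simp
qed

lemma tensor_group_hom_eq:
assumes "f:hom (tensor_group R M N) G" "g:hom (tensor_group R M N) G"
 and "!!x y. x:car M==>y:car N==>f (tens R M N x y) = g (tens R M N x y)"
 and "X:car (tensor_group R M N)"
shows "f X = g X"
using assms(4) by (induction rule: tensor_group_add_induct) (auto simp: assms(1,2,3) hom_mult[OF assms(1)] hom_mult[OF assms(2)])

lemma balanced_smult_tens: "r:car R ==>
balanced R M N (tensor_group R M N) (%x y. tens R M N (r \<odot>\<^bsub>M\<^esub> x) y)"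
unfolding balanced_def
proof (intro conjI ballI)
fix s x y assume "r:car R" "s:car R" "x:car M" "y:car N"
then show "tens R M N (r \<odot>\<^bsub>M\<^esub> (s \<odot>\<^bsub>M\<^esub> x)) y = tens R M N (r \<odot>\<^bsub>M\<^esub> x) (s \<odot>\<^bsub>N\<^esub> y)"
 using tens_group_smult[of s "r \<odot>\<^bsub>M\<^esub> x" y]
 by (simp flip: M.smult_assoc1 add: M.R.m_comm)
qed (simp_all add: tens_in_group M.smult_r_distr tens_group_add1 tens_group_add2)

lemma smult_tens: "r:car R==>x:car M==>y:car N ==>
r \<odot>\<^bsub>tp R M N\<^esub> tens R M N x y = tens R M N (r \<odot>\<^bsub>M\<^esub> x) y"
unfolding tsimps by (rule group_lift_tens[OF TG.comm_group_axioms balanced_smult_tens])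

lemma smult_hom: "r:car R==>smult (tp R M N) r:hom (tensor_group R M N) (tensor_group R M N)"
unfolding tsimps by (rule group_lift_hom[OF TG.comm_group_axioms balanced_smult_tens])

lemma tensor_abelian: "abelian_group (tp R M N)"
proof (rule abelian_groupI, unfold tsimps)
show "EX y:car (tensor_group R M N). y \<otimes>\<^bsub>tensor_group R M N\<^esub> x = \<one>\<^bsub>tensor_group R M N\<^esub>"
 if "x:car (tensor_group R M N)" for x using that TG.l_inv_ex by auto
qed (simp_all add: TG.m_ac)

lemma tensor_module: "module R (tp R M N)"
proof (rule moduleI)
show "cring R" by (rule M.R.is_cring)
show "abelian_group (tp R M N)" by (rule tensor_abelian)
fix r X assume r: "r:car R" and X: "X:car (tp R M N)"
show "r \<odot>\<^bsub>tp R M N\<^esub> X:car (tp R M N)"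
 using hom_in_carrier[OF smult_hom[OF r]] X by (simp add: tsimps)
show "r \<odot>\<^bsub>tp R M N\<^esub> (X \<oplus>\<^bsub>tp R M N\<^esub> Y) = r \<odot>\<^bsub>tp R M N\<^esub> X \<oplus>\<^bsub>tp R M N\<^esub> r \<odot>\<^bsub>tp R M N\<^esub> Y"
 if "Y:car (tp R M N)" for Y
 using hom_mult[OF smult_hom[OF r]] X that by (simp add: tsimps)
have X': "X:car (tensor_group R M N)" using X by (simp add: tsimps)
fix s assume s: "s:car R"
note [simp] = smult_tens hom_in_carrier[OF smult_hom] hom_mult[OF smult_hom]
have *: "(r \<oplus>\<^bsub>R\<^esub> s) \<odot>\<^bsub>tp R M N\<^esub> X = r \<odot>\<^bsub>tp R M N\<^esub> X \<otimes>\<^bsub>tensor_group R M N\<^esub> (s \<odot>\<^bsub>tp R M N\<^esub> X)"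
 using X'
proof (induction rule: tensor_group_add_induct)
 case (tens x y) then show ?case using r s by (simp add: M.smult_l_distr tens_group_add1)
next
 case (add X Y)
 then show ?case using r s by (simp add: TG.m_ac)
qed
then show "(r \<oplus>\<^bsub>R\<^esub> s) \<odot>\<^bsub>tp R M N\<^esub> X = r \<odot>\<^bsub>tp R M N\<^esub> X \<oplus>\<^bsub>tp R M N\<^esub> s \<odot>\<^bsub>tp R M N\<^esub> X"
 by (simp add: tsimps(3))
show "(r \<otimes>\<^bsub>R\<^esub> s) \<odot>\<^bsub>tp R M N\<^esub> X = r \<odot>\<^bsub>tp R M N\<^esub> (s \<odot>\<^bsub>tp R M N\<^esub> X)"
 using X'
proof (induction rule: tensor_group_add_induct)
 case (tens x y) then show ?case using r s by (simp add: M.smult_assoc1)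
next
 case (add X Y)
 then show ?case using r s by simp
qed
next
note [simp] = smult_tens hom_in_carrier[OF smult_hom] hom_mult[OF smult_hom]
fix X assume "X:car (tp R M N)"
then have "X:car (tensor_group R M N)" by (simp add: tsimps)
then show "\<one>\<^bsub>R\<^esub> \<odot>\<^bsub>tp R M N\<^esub> X = X"
 by (induction rule: tensor_group_add_induct) simp_all
qed

end

section \<open>Sweedler calculus\<close>

text \<open>Rules that derive linearity and membership of a Sweedler expression from its syntax.
  Most side conditions below are discharged by trying \<open>assumption\<close> and such rules
  repeatedly.\<close>

named_theorems lin

lemma two_modulesI: "module R A==>module R B==>two_modules R A B"
by (rule two_modules.intro)

lemma mod_tens [lin]: "module R A==>module R B==>module R (tp R A B)"
by (rule two_modules.tensor_module[OF two_modulesI])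

lemma tens_in [lin]:
"x:car A==>y:car B==>module R A==>module R B==>tens R A B x y:car (tp R A B)"
unfolding tsimps by (rule two_modules.tens_in_group[OF two_modulesI])

lemma tensor_induct [consumes 3, case_names tens add]:
assumes "module R A" "module R B" "U:car (tp R A B)"
 and "!!x y. x:car A==>y:car B==>P (tens R A B x y)"
 and "!!X Y. X:car (tp R A B)==>Y:car (tp R A B)==>P X==>P Y ==>
  P (X \<oplus>\<^bsub>tp R A B\<^esub> Y)"
shows "P U"
using assms two_modules.tensor_group_add_induct[OF two_modulesI[OF assms(1,2)], of U P]
unfolding tsimps by blast

text \<open>Pure tensors generate additively. Nearly every identity that is linear in a tensor is
  reduced to pure tensors in this way.\<close>

lemma tens_heq:
assumes "module R A" "module R B" "U:car (tp R A B)"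
 and "f:Hom R (tp R A B) P" "g:Hom R (tp R A B) P"
 and "!!x y. x:car A==>y:car B==>f (tens R A B x y) = g (tens R A B x y)"
shows "f U = g U"
using assms(1,2,3) by (induction rule: tensor_induct)
 (auto simp: assms(6) mod_hom_add[OF assms(4)] mod_hom_add[OF assms(5)])

lemma lin_id [lin]: "(%x. x):Hom R A A"
by (rule mod_homI) auto

lemma lin_tens1 [lin]:
assumes "f:Hom R X A" "b:car B" "module R A" "module R B"
shows "(%x. tens R A B (f x) b):Hom R X (tp R A B)"
proof -
interpret two_modules R A B by (rule two_modulesI; fact)
show ?thesis
 using assms(2) by (intro mod_homI)
 (simp_all add: hom_mem[OF assms(1)] mod_hom_add[OF assms(1)] hom_smult[OF assms(1)]
  smult_tens tens_group_add1 tens_in_group, simp_all add: tsimps tens_in_group hom_mem[OF assms(1)] tens_group_add1)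
qed

lemma lin_tens2 [lin]:
assumes "f:Hom R X B" "a:car A" "module R A" "module R B"
shows "(%x. tens R A B a (f x)):Hom R X (tp R A B)"
proof -
interpret two_modules R A B by (rule two_modulesI; fact)
show ?thesis
 using assms(2) by (intro mod_homI)
 (simp_all add: hom_mem[OF assms(1)] mod_hom_add[OF assms(1)] hom_smult[OF assms(1)]
  smult_tens tens_group_smult, simp_all add: tsimps tens_in_group hom_mem[OF assms(1)] tens_group_add2)
qed

lemma bilin_tens: "module R A==>module R B==>bilin R A B (tp R A B) (tens R A B)"
by (rule bilinI) (rule lin_tens1 lin_tens2 lin_id | assumption)+

lemma tensor_smult2:
assumes "module R A" "module R B" "r:car R" "a:car A" "b:car B"
shows "tens R A B (r \<odot>\<^bsub>A\<^esub> a) b = tens R A B a (r \<odot>\<^bsub>B\<^esub> b)"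
by (rule two_modules.tens_group_smult[OF two_modulesI]) fact+

text \<open>\<open>sw P U f\<close> is \<open>\<Sum> f(U\<^sub>1, U\<^sub>2)\<close>, the sum being taken over one chosen formal sum representing
\<open>U\<close>. It therefore makes sense for any \<open>f\<close>; bilinearity of \<open>f\<close> is only needed to vary \<open>U\<close>.\<close>

definition sw :: "('c, 'm) ring_scheme => ('a, 'b) tensor => ('a => 'b => 'c) => 'c"
where "sw P U f = formal_eval (add_monoid P) f (SOME c. c:U)"

lemma sw_repr:
assumes "module R A" "module R B" "U:car (tp R A B)"
shows "Poly_Mapping.keys (SOME c. c:U) <= car A \<times> car B"
 "U = tensor_null R A B #>\<^bsub>free_Abelian_group (car A \<times> car B)\<^esub> (SOME c. c:U)"
proof -
interpret two_modules R A B by (rule two_modulesI; fact)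
obtain c where c: "c:car F" "U = cl c"
 using assms(3) carrier_cases unfolding tsimps by blast
have "c:cl c" using c(1) F.rcos_self[of c] null.subgroup_axioms by blast
then have s: "(SOME c. c:U):cl c" unfolding c(2) by (rule someI)
have "(SOME c. c:U):car F"
 using s F.r_coset_subset_G[OF null.subset c(1)] by blast
then show "Poly_Mapping.keys (SOME c. c:U) <= car A \<times> car B" by simp
show "U = cl (SOME c. c:U)"
 using F.repr_independence[OF s c(1) null.subgroup_axioms] c(2) by simp
qed

text \<open>The bridge from the given definitions, phrased with \<open>tensor_lift\<close>, to
  Sweedler sums: for bilinear \<open>f\<close> the value does not depend on the representative
  chosen in \<open>sw\<close>.\<close>

lemma tlift_sw:
assumes "module R A" "module R B" "module R P" "U:car (tp R A B)" "bilin R A B P f"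
shows "tensor_lift P f U = sw P U f"
proof -
interpret two_modules R A B by (rule two_modulesI; fact)
note s = sw_repr[OF assms(1,2,4)]
show ?thesis unfolding tensor_lift_def sw_def
 by (subst s(2)) (rule group_lift_cl(1)[OF modD(3)[OF assms(3)] bilin_balanced[OF assms(5)]], use s(1) in simp)
qed

lemma formal_eval_diff:
assumes "module R P" "!!x y. x:A==>y:B==>f x y:car P"
 and "Poly_Mapping.keys c <= A \<times> B" "Poly_Mapping.keys d <= A \<times> B"
shows "formal_eval (add_monoid P) f (c - d) =
 formal_eval (add_monoid P) f c \<ominus>\<^bsub>P\<^esub> formal_eval (add_monoid P) f d"
 and "formal_eval (add_monoid P) f c:car P"
 and "formal_eval (add_monoid P) f 0 = \<zero>\<^bsub>P\<^esub>"
proof -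
interpret P: module R P by fact
 have E: "formal_eval (add_monoid P) f:hom (free_Abelian_group (A \<times> B)) (add_monoid P)"
 by (rule P.add.formal_eval_hom) (use assms(2) in auto)
interpret h: group_hom "free_Abelian_group (A \<times> B)" "add_monoid P" "formal_eval (add_monoid P) f"
 by (intro group_hom.intro group_hom_axioms.intro group_free_Abelian_group E P.a_group)
show "formal_eval (add_monoid P) f (c - d) =
 formal_eval (add_monoid P) f c \<ominus>\<^bsub>P\<^esub> formal_eval (add_monoid P) f d"
 using h.hom_mult[of c "-d"] h.hom_inv[of d] assms(3,4)
 by (simp add: a_minus_def a_inv_def)
show "formal_eval (add_monoid P) f c:car P" using h.hom_closed[of c] assms(3) by simp
show "formal_eval (add_monoid P) f 0 = \<zero>\<^bsub>P\<^esub>" using h.hom_one by simp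
qed

lemma formal_eval_frag:
"module R P==>f x y:car P==>formal_eval (add_monoid P) f (frag_of (x, y)) = f x y"
using comm_group.formal_eval_frag_of[OF modD(3), of R P f x y] by simp

lemma formal_eval_cong:
assumes "Poly_Mapping.keys c <= A \<times> B" "!!x y. x:A==>y:B==>f x y = g x y"
 "module R P" "!!x y. x:A==>y:B==>g x y:car P"
shows "formal_eval (add_monoid P) f c = formal_eval (add_monoid P) g c"
proof -
interpret P: module R P by fact
show ?thesis
 unfolding formal_eval_def using assms(1,2,4)
 by (intro comm_monoid.finprod_cong'[OF P.a_comm_monoid])
 (auto intro!: group.int_pow_closed[OF P.a_group, simplified])
qed

lemma formal_eval_hom_comm:
assumes "Poly_Mapping.keys c <= A \<times> B" "module R P" "module R Q" "h:Hom R P Q"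
 "!!x y. x:A==>y:B==>f x y:car P"
shows "h (formal_eval (add_monoid P) f c) = formal_eval (add_monoid Q) (%x y. h (f x y)) c"
using assms(1)
proof (rule free_Abelian_group_induct)
note hc = hom_mem[OF assms(4) assms(5)]
show "h (formal_eval (add_monoid P) f 0) = formal_eval (add_monoid Q) (%x y. h (f x y)) 0"
 using formal_eval_diff(3)[OF assms(2), of A B f c c] formal_eval_diff(3)[OF assms(3), of A B "%x y. h (f x y)" c c] hc assms(1,5)
 by (simp add: mod_hom_zero_inv[OF assms(2-4)])
show "h (formal_eval (add_monoid P) f (x - y)) = formal_eval (add_monoid Q) (%x y. h (f x y)) (x - y)"
 if xy: "Poly_Mapping.keys x <= A \<times> B" "Poly_Mapping.keys y <= A \<times> B" and
 "h (formal_eval (add_monoid P) f x) = formal_eval (add_monoid Q) (%x y. h (f x y)) x"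
 "h (formal_eval (add_monoid P) f y) = formal_eval (add_monoid Q) (%x y. h (f x y)) y" for x y
proof -
 have "h (formal_eval (add_monoid P) f (x - y)) = h (formal_eval (add_monoid P) f x \<ominus>\<^bsub>P\<^esub> formal_eval (add_monoid P) f y)"
 using formal_eval_diff(1)[OF assms(2,5) xy] by simp
 also have "... = h (formal_eval (add_monoid P) f x) \<ominus>\<^bsub>Q\<^esub> h (formal_eval (add_monoid P) f y)"
 by (rule mod_hom_zero_inv(3)[OF assms(2-4)]) (rule formal_eval_diff(2)[OF assms(2,5)], (rule xy | assumption)+)+
 also have "... = formal_eval (add_monoid Q) (%x y. h (f x y)) (x - y)"
 using formal_eval_diff(1)[OF assms(3) hc xy] that by simp
 finally show ?thesis .
qed
show "h (formal_eval (add_monoid P) f (frag_of a)) = formal_eval (add_monoid Q) (%x y. h (f x y)) (frag_of a)"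
 if a: "a:A \<times> B" for a
 using that by (cases a) (simp add: formal_eval_frag[OF assms(2)] formal_eval_frag[OF assms(3)] hc assms(5))
qed

lemma sw_closed [lin]:
assumes "U:car (tp R A B)" "!!x y. x:car A==>y:car B==>f x y:car P"
 "module R A" "module R B" "module R P"
shows "sw P U f:car P"
unfolding sw_def
by (rule formal_eval_diff(2)[OF assms(5,2)], assumption+, rule sw_repr(1)[OF assms(3,4,1)])
 (rule sw_repr(1)[OF assms(3,4,1)])

lemma sw_cong:
assumes "U = U'" "U:car (tp R A B)" "module R A" "module R B" "module R P"
 "!!x y. x:car A==>y:car B==>f x y = g x y"
 "!!x y. x:car A==>y:car B==>f x y:car P"
shows "sw P U f = sw P U' g"
proof -
have "g x y:car P" if "x:car A" "y:car B" for x y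
 using assms(6,7) that by metis
then show ?thesis
 unfolding sw_def assms(1)[symmetric]
 by (intro formal_eval_cong[OF sw_repr(1)[OF assms(3,4,2)] assms(6,5)]) auto
qed

text \<open>Both sides evaluate the same chosen formal sum, so additivity of \<open>h\<close> alone
  carries it inside.\<close>

lemma sw_hom:
assumes "h:Hom R P Q" "U:car (tp R A B)"
 "!!x y. x:car A==>y:car B==>f x y:car P"
 "module R A" "module R B" "module R P" "module R Q"
shows "h (sw P U f) = sw Q U (%x y. h (f x y))"
unfolding sw_def
by (rule formal_eval_hom_comm[OF sw_repr(1)[OF assms(4,5,2)] assms(6,7,1,3)])

lemma sw_tens:
assumes "bilin R A B P f" "x:car A" "y:car B" "module R A" "module R B" "module R P"
shows "sw P (tens R A B x y) f = f x y"
proof -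
have "tensor_lift P f (tens R A B x y) = f x y"
 unfolding tensor_lift_def
 by (rule two_modules.group_lift_tens[OF two_modulesI modD(3) bilin_balanced]) fact+
then show ?thesis using tlift_sw[OF assms(4-6) tens_in[OF assms(2-5)] assms(1)] by simp
qed

lemma tensor_lift_hom:
assumes "bilin R A B P f" "module R A" "module R B" "module R P"
shows "tensor_lift P f:Hom R (tp R A B) P"
proof -
interpret two_modules R A B by (rule two_modulesI; fact)
interpret P: module R P by fact
interpret T: module R "tp R A B" by (rule tensor_module)
have h: "tensor_lift P f:hom (tensor_group R A B) (add_monoid P)"
 unfolding tensor_lift_def by (rule group_lift_hom[OF modD(3)[OF assms(4)] bilin_balanced[OF assms(1)]])
have t: "tensor_lift P f (tens R A B x y) = f x y" if "x:car A" "y:car B" for x y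
 unfolding tensor_lift_def
 by (rule group_lift_tens[OF modD(3)[OF assms(4)] bilin_balanced[OF assms(1)] that])
note bc = bilin_in[OF assms(1)]
show ?thesis
proof (rule mod_homI)
 show "tensor_lift P f X:car P" if "X:car (tp R A B)" for X
 using hom_in_carrier[OF h, of X] that by (simp add: tsimps)
 show a: "tensor_lift P f (X \<oplus>\<^bsub>tp R A B\<^esub> Y) = tensor_lift P f X \<oplus>\<^bsub>P\<^esub> tensor_lift P f Y"
 if "X:car (tp R A B)" "Y:car (tp R A B)" for X Y
 using hom_mult[OF h, of X Y] that by (simp add: tsimps)
 have c: "tensor_lift P f X:car P" if "X:car (tp R A B)" for X
 using hom_in_carrier[OF h, of X] that by (simp add: tsimps)
 show "tensor_lift P f (r \<odot>\<^bsub>tp R A B\<^esub> X) = r \<odot>\<^bsub>P\<^esub> tensor_lift P f X"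
 if "r:car R" and X: "X:car (tp R A B)" for r X
 using assms(2,3) X
 proof (induction rule: tensor_induct)
 case (tens x y)
 then show ?case using that assms(1)
  by (simp add: smult_tens t) (auto simp: bilin_def mod_hom_def)
 next
 case (add X Y)
 then show ?case using that by (simp add: T.smult_r_distr a P.smult_r_distr c)
 qed
qed
qed

lemma sw_mhom:
assumes "bilin R A B P f" "module R A" "module R B" "module R P"
shows "(%U. sw P U f):Hom R (tp R A B) P"
using tensor_lift_hom[OF assms]
by (subst mod_hom_cong[OF tlift_sw[OF assms(2-4) _ assms(1), symmetric]])
 (auto intro: mod_tens assms)

lemma lin_sw1 [lin]:
assumes "g:Hom R X (tp R A B)" "bilin R A B P f" "module R A" "module R B" "module R P"
shows "(%x. sw P (g x) f):Hom R X P"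
by (rule hom_comp[OF sw_mhom[OF assms(2-5)] assms(1)])

declare bilinI [lin]

lemma sw_self:
assumes "U:car (tp R A B)" "module R A" "module R B"
shows "sw (tp R A B) U (tens R A B) = U"
proof (rule tens_heq[OF assms(2,3,1)])
show "(%U. sw (tp R A B) U (tens R A B)):Hom R (tp R A B) (tp R A B)"
 by (intro sw_mhom bilin_tens mod_tens assms)
show "sw (tp R A B) (tens R A B x y) (tens R A B) = tens R A B x y" if "x:car A" "y:car B" for x y
 by (intro sw_tens bilin_tens mod_tens assms that)
qed (rule lin_id)

lemma sw_add_smult:
assumes "U:car (tp R A B)" "module R A" "module R B" "module R P"
 "!!x y. x:car A==>y:car B==>f x y:car P"
 "!!x y. x:car A==>y:car B==>g x y:car P"
shows "sw P U (%x y. f x y \<oplus>\<^bsub>P\<^esub> g x y) = sw P U f \<oplus>\<^bsub>P\<^esub> sw P U g"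
 and "r:car R==>sw P U (%x y. r \<odot>\<^bsub>P\<^esub> f x y) = r \<odot>\<^bsub>P\<^esub> sw P U f"
proof -
interpret P: module R P by fact
show "sw P U (%x y. r \<odot>\<^bsub>P\<^esub> f x y) = r \<odot>\<^bsub>P\<^esub> sw P U f" if r: "r:car R"
proof (rule sw_hom[symmetric, OF _ assms(1,5,2,3,4,4)])
 show "(\<odot>\<^bsub>P\<^esub>) r:Hom R P P"
 using r by (intro mod_homI) (auto simp: P.smult_r_distr P.R.m_comm simp flip: P.smult_assoc1)
qed
define c where "c = (SOME c. c:U)"
have c: "Poly_Mapping.keys c <= car A \<times> car B"
 unfolding c_def by (rule sw_repr(1)[OF assms(2,3,1)])
let ?e = "%f. formal_eval (add_monoid P) f"
let ?h = "%x y. f x y \<oplus>\<^bsub>P\<^esub> g x y"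
have hc: "!!x y. x:car A==>y:car B==>?h x y:car P" using assms(5,6) by simp
note d = formal_eval_diff[OF assms(4), of "car A" "car B"]
from c have "?e ?h c = ?e f c \<oplus>\<^bsub>P\<^esub> ?e g c"
proof (rule free_Abelian_group_induct)
 show "?e ?h 0 = ?e f 0 \<oplus>\<^bsub>P\<^esub> ?e g 0"
 using d(3)[of f c c] d(3)[of g c c] d(3)[of ?h c c] assms(5,6) hc c by simp
 show "?e ?h (x - y) = ?e f (x - y) \<oplus>\<^bsub>P\<^esub> ?e g (x - y)"
 if xy: "Poly_Mapping.keys x <= car A \<times> car B" "Poly_Mapping.keys y <= car A \<times> car B"
 and eq: "?e ?h x = ?e f x \<oplus>\<^bsub>P\<^esub> ?e g x" "?e ?h y = ?e f y \<oplus>\<^bsub>P\<^esub> ?e g y" for x y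
 proof -
 have cl: "?e f x:car P" "?e g x:car P" "?e f y:car P" "?e g y:car P"
  using d(2)[of f x x] d(2)[of f y y] d(2)[of g x x] d(2)[of g y y] xy assms(5,6) by simp_all
 show ?thesis
  using d(1)[of f x y] d(1)[of g x y] d(1)[of ?h x y] xy assms(5,6) hc cl
  by (simp add: eq a_minus_def P.minus_add P.a_ac)
 qed
 show "?e ?h (frag_of a) = ?e f (frag_of a) \<oplus>\<^bsub>P\<^esub> ?e g (frag_of a)" if "a:car A \<times> car B" for a
 using that by (cases a) (simp add: formal_eval_frag[OF assms(4)] assms(5,6))
qed
then show "sw P U ?h = sw P U f \<oplus>\<^bsub>P\<^esub> sw P U g" unfolding sw_def c_def .
qed

text \<open>The formal sum representing \<open>U\<close> stays fixed while \<open>x\<close> varies,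
  so linearity is inherited term by term.\<close>

lemma lin_sw2 [lin]:
assumes "U:car (tp R A B)"
 and F: "!!a b. a:car A==>b:car B==>(%x. F x a b):Hom R X P"
 and "module R A" "module R B" "module R P" "module R X"
shows "(%x. sw P U (F x)):Hom R X P"
proof -
interpret X: module R X by fact
interpret P: module R P by fact
note m = assms(1,3,4,5)
have cl: "x:car X==>a:car A==>b:car B==>F x a b:car P" for x a b
 using hom_mem[OF F] by blast
show ?thesis
proof (rule mod_homI)
 show "sw P U (F x):car P" if "x:car X" for x
 by (rule sw_closed[OF m(1) cl m(2-4)]) (use that in auto)
 show "sw P U (F (x \<oplus>\<^bsub>X\<^esub> y)) = sw P U (F x) \<oplus>\<^bsub>P\<^esub> sw P U (F y)"
 if xy: "x:car X" "y:car X" for x y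
 proof -
 have "sw P U (F (x \<oplus>\<^bsub>X\<^esub> y)) = sw P U (%a b. F x a b \<oplus>\<^bsub>P\<^esub> F y a b)"
  by (rule sw_cong[OF refl m]) (use xy cl mod_hom_add[OF F] in auto)
 also have "... = sw P U (F x) \<oplus>\<^bsub>P\<^esub> sw P U (F y)"
  by (rule sw_add_smult(1)[OF m]) (use xy cl in auto)
 finally show ?thesis .
 qed
 show "sw P U (F (r \<odot>\<^bsub>X\<^esub> x)) = r \<odot>\<^bsub>P\<^esub> sw P U (F x)"
 if xy: "r:car R" "x:car X" for r x
 proof -
 have "sw P U (F (r \<odot>\<^bsub>X\<^esub> x)) = sw P U (%a b. r \<odot>\<^bsub>P\<^esub> F x a b)"
  by (rule sw_cong[OF refl m]) (use xy cl hom_smult[OF F] in auto)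
 also have "... = r \<odot>\<^bsub>P\<^esub> sw P U (F x)"
  by (rule sw_add_smult(2)[OF m, where g = "F x"]) (use xy cl in auto)
 finally show ?thesis .
 qed
qed
qed

text \<open>Fubini for Sweedler sums: both sides are linear in \<open>U\<close>, and for a pure
  tensor the sum over \<open>U\<close> disappears.\<close>

lemma sw_swap:
assumes "U:car (tp R A B)" "\<eta>:car (tp R C D)"
 "module R A" "module R B" "module R C" "module R D" "module R P"
 "!!a b. a:car A==>b:car B==>bilin R C D P (F a b)"
 "!!c d. c:car C==>d:car D==>bilin R A B P (%a b. F a b c d)"
shows "sw P U (%a b. sw P \<eta> (F a b)) = sw P \<eta> (%c d. sw P U (%a b. F a b c d))"
proof (rule tens_heq[OF assms(3,4,1)])
have F1: "(%x. F x b c d):Hom R A P" if "b:car B" "c:car C" "d:car D" for b c d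
 using assms(9) that by (auto simp: bilin_def)
have F2: "(%x. F a x c d):Hom R B P" if "a:car A" "c:car C" "d:car D" for a c d
 using assms(9) that by (auto simp: bilin_def)
have bil: "bilin R A B P (%a b. sw P \<eta> (F a b))"
 by (rule bilinI) (rule lin_sw2 F1 F2 assms | assumption)+
show "(%U. sw P U (%a b. sw P \<eta> (F a b))):Hom R (tp R A B) P"
 by (rule sw_mhom bil assms)+
show "(%U. sw P \<eta> (%c d. sw P U (%a b. F a b c d))):Hom R (tp R A B) P"
 by (rule lin_sw2[OF assms(2)] sw_mhom assms mod_tens | assumption)+
show "sw P (tens R A B x y) (%a b. sw P \<eta> (F a b)) = sw P \<eta> (%c d. sw P (tens R A B x y) (%a b. F a b c d))"
 if "x:car A" "y:car B" for x y
proof -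
 have "sw P (tens R A B x y) (%a b. sw P \<eta> (F a b)) = sw P \<eta> (F x y)"
 by (rule sw_tens[OF bil that assms(3,4,7)])
 also have "... = sw P \<eta> (%c d. sw P (tens R A B x y) (%a b. F a b c d))"
 using sw_tens[OF assms(9) that assms(3,4,7)] bilin_in[OF assms(8)[OF that]]
 by (intro sw_cong[OF refl assms(2,5,6,7)]) auto
 finally show ?thesis .
qed
qed

section \<open>Maps between tensor products\<close>

lemma tensor_map_sw:
assumes "f:Hom R A M" "g:Hom R B N" "module R A" "module R B" "module R M" "module R N"
 "U:car (tp R A B)"
shows "tmp R M N f g U = sw (tp R M N) U (%x y. tens R M N (f x) (g y))"
unfolding tensor_map_def
by (rule tlift_sw[OF assms(3,4) _ assms(7)])
 (rule lin assms hom_mem[OF assms(1)] hom_mem[OF assms(2)] | assumption)+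

lemma tmap_hom [lin]:
assumes "f:Hom R A M" "g:Hom R B N" "module R A" "module R B" "module R M" "module R N"
shows "tmp R M N f g:Hom R (tp R A B) (tp R M N)"
unfolding tensor_map_def
by (rule tensor_lift_hom[OF _ assms(3,4)])
 (rule lin assms hom_mem[OF assms(1)] hom_mem[OF assms(2)] | assumption)+

lemma tensor_map_closed:
assumes "f:Hom R A M" "g:Hom R B N" "module R A" "module R B" "module R M" "module R N"
 "U:car (tp R A B)"
shows "tmp R M N f g U:car (tp R M N)"
by (rule hom_mem[OF tmap_hom]; fact)

lemma tmap_tens:
assumes "f:Hom R A M" "g:Hom R B N" "module R A" "module R B" "module R M" "module R N"
 "x:car A" "y:car B"
shows "tmp R M N f g (tens R A B x y) = tens R M N (f x) (g y)"
proof -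
have "tmp R M N f g (tens R A B x y) =
 sw (tp R M N) (tens R A B x y) (%x y. tens R M N (f x) (g y))"
 by (rule tensor_map_sw[OF assms(1-6)]) (rule tens_in assms)+
also have "... = tens R M N (f x) (g y)"
 by (rule sw_tens) (rule lin assms hom_mem[OF assms(1)] hom_mem[OF assms(2)] | assumption)+
finally show ?thesis .
qed

lemma tensor_map_comp:
assumes "f:Hom R A M" "g:Hom R B N" "f':Hom R M M'" "g':Hom R N N'"
 "module R A" "module R B" "module R M" "module R N" "module R M'" "module R N'"
 "U:car (tp R A B)"
shows "tmp R M' N' f' g' (tmp R M N f g U) =
 tmp R M' N' (%x. f' (f x)) (%y. g' (g y)) U"
proof (rule tens_heq[OF assms(5,6,11)])
note c = hom_comp[OF assms(3,1)] hom_comp[OF assms(4,2)]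
show "(%U. tmp R M' N' f' g' (tmp R M N f g U)):Hom R (tp R A B) (tp R M' N')"
 by (rule hom_comp[OF tmap_hom[OF assms(3,4)] tmap_hom[OF assms(1,2)]]; fact)
show "tmp R M' N' (%x. f' (f x)) (%y. g' (g y)):Hom R (tp R A B) (tp R M' N')"
 by (rule tmap_hom; fact c assms)
show "tmp R M' N' f' g' (tmp R M N f g (tens R A B x y)) =
 tmp R M' N' (%x. f' (f x)) (%y. g' (g y)) (tens R A B x y)"
 if "x:car A" "y:car B" for x y
 by (simp add: tmap_tens[OF assms(1,2,5-8) that] tmap_tens[OF c assms(5,6,9,10) that]
 tmap_tens[OF assms(3,4,7-10) hom_mem[OF assms(1) that(1)] hom_mem[OF assms(2) that(2)]])
qed

lemma tensor_map_cong:
assumes "f:Hom R A M" "g:Hom R B N" "module R A" "module R B" "module R M" "module R N"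
 "!!x. x:car A==>f' x = f x" "!!x. x:car B==>g' x = g x" "U:car (tp R A B)"
shows "tmp R M N f' g' U = tmp R M N f g U"
proof -
have f': "f':Hom R A M" using mod_hom_cong[of A f' f, OF assms(7,3)] assms(1) by blast
have g': "g':Hom R B N" using mod_hom_cong[of B g' g, OF assms(8,4)] assms(2) by blast
show ?thesis
 unfolding tensor_map_sw[OF f' g' assms(3-6,9)] tensor_map_sw[OF assms(1-6,9)]
 by (rule sw_cong[OF refl assms(9,3,4)])
 (use assms(7,8) hom_mem[OF assms(1)] hom_mem[OF assms(2)] in
  \<open>auto intro!: mod_tens tens_in assms\<close>)
qed

lemma tensor_map_id:
assumes "module R A" "module R B" "U:car (tp R A B)"
 "!!x. x:car A==>f x = x" "!!x. x:car B==>g x = x"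
shows "tmp R A B f g U = U"
proof -
have "tmp R A B f g U = tmp R A B (%x. x) (%x. x) U"
 by (rule tensor_map_cong[OF lin_id lin_id]) (use assms in auto)
also have "... = sw (tp R A B) U (tens R A B)"
 by (rule tensor_map_sw[OF lin_id lin_id]) (use assms in auto)
finally show ?thesis by (simp add: sw_self assms)
qed

section \<open>Submodules and their inclusions\<close>

abbreviation sub :: "('k, 'a, 'm) module_scheme => 'a set => ('k, 'a, 'm) module_scheme"
where "sub A C == A\<lparr>carrier := C\<rparr>"

lemma submod_sub: "submodule C R A==>C <= car A"
using submodule.axioms(1) subgroup.subset by fastforce

text \<open>Elements of \<open>tensor R (sub A C) B\<close> are cosets of a different subgroup than
  those of \<open>tensor R A B\<close>. The map induced by an inclusion is therefore always written
  \<open>tensor_map\<close> with \<open>id\<close> and is not itself an inclusion.\<close>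

lemma incl_hom: "C <= C'==>(%x. x):Hom R (sub A C) (sub A C')"
"C <= car A==>(%x. x):Hom R (sub A C) A"
"C <= C'==>id:Hom R (sub A C) (sub A C')"
"C <= car A==>id:Hom R (sub A C) A"
by (auto simp: mod_hom_def)

lemma id_hom: "id:Hom R A A"
by (auto simp: mod_hom_def)

lemma sub_hom: "f:Hom R A B==>C <= car A==>f ` C <= D==>f:Hom R (sub A C) (sub B D)"
"f:Hom R A B==>C <= car A==>f:Hom R (sub A C) B"
"f:Hom R X B==>(!!x. x:car X==>f x:D)==>f:Hom R X (sub B D)"
by (auto simp: mod_hom_def subset_iff)

lemma submodule_zero: "module R A==>submodule {\<zero>\<^bsub>A\<^esub>} R A"
proof -
assume "module R A"
then interpret A: module R A .
have "\<ominus>\<^bsub>A\<^esub> \<zero>\<^bsub>A\<^esub> = \<zero>\<^bsub>A\<^esub>" using A.minus_equality[of "\<zero>\<^bsub>A\<^esub>" "\<zero>\<^bsub>A\<^esub>"] by simp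
then show ?thesis by (intro A.submoduleI) auto
qed

lemma submodule_in:
assumes "module R A" "submodule C R A"
shows "\<zero>\<^bsub>A\<^esub>:C" "!!x y. x:C==>y:C==>x \<oplus>\<^bsub>A\<^esub> y:C" "!!x. x:C==>\<ominus>\<^bsub>A\<^esub> x:C"
 "!!r x. r:car R==>x:C==>r \<odot>\<^bsub>A\<^esub> x:C" "!!x y. x:C==>y:C==>x \<ominus>\<^bsub>A\<^esub> y:C"
proof -
interpret module R A by fact
show "\<zero>\<^bsub>A\<^esub>:C" using submodule.axioms(1)[OF assms(2)] subgroup.one_closed by fastforce
show 1: "!!x y. x:C==>y:C==>x \<oplus>\<^bsub>A\<^esub> y:C"
and 2: "!!x. x:C==>\<ominus>\<^bsub>A\<^esub> x:C"
and "!!r x. r:car R==>x:C==>r \<odot>\<^bsub>A\<^esub> x:C"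
 using submoduleE[OF assms(2)] by auto
show "!!x y. x:C==>y:C==>x \<ominus>\<^bsub>A\<^esub> y:C" using 1 2 by (simp add: a_minus_def)
qed

lemma sub_module: "submodule C R A==>module R A==>module R (sub A C)"
by (rule submodule.submodule_is_module)

lemma kernel_submodule:
assumes "module R A" "module R B" "f:Hom R A B"
shows "submodule {a:car A. f a = \<zero>\<^bsub>B\<^esub>} R A"
proof -
interpret A: module R A by fact
interpret B: module R B by fact
show ?thesis
 by (rule A.submoduleI)
 (use mod_hom_zero_inv[OF assms] mod_hom_add[OF assms(3)] hom_smult[OF assms(3)] in auto)
qed

lemma preimage_submodule:
assumes "module R A" "module R B" "f:Hom R A B" "submodule N R B"
shows "submodule {a:car A. f a:N} R A"
proof -
interpret A: module R A by fact
interpret B: module R B by fact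
show ?thesis
 by (rule A.submoduleI)
 (use submodule_in[OF assms(2,4)] mod_hom_zero_inv[OF assms(1-3)] mod_hom_add[OF assms(3)] hom_smult[OF assms(3)] in auto)
qed

lemma image_submodule:
assumes "module R A" "module R B" "f:Hom R A B"
shows "submodule (f ` car A) R B"
proof -
interpret A: module R A by fact
interpret B: module R B by fact
show ?thesis
proof (rule B.submoduleI)
 show "f ` car A <= car B" using hom_mem[OF assms(3)] by auto
 show "\<zero>\<^bsub>B\<^esub>:f ` car A" using mod_hom_zero_inv(1)[OF assms] A.zero_closed by (metis imageI)
 show "\<ominus>\<^bsub>B\<^esub> a:f ` car A" if "a:f ` car A" for a
 using that mod_hom_zero_inv(2)[OF assms] by (metis (no_types, lifting) A.a_inv_closed image_iff)
 show "a \<oplus>\<^bsub>B\<^esub> b:f ` car A" if "a:f ` car A" "b:f ` car A" for a b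
 using that mod_hom_add[OF assms(3)] by (metis (no_types, lifting) A.a_closed image_iff)
 show "a \<odot>\<^bsub>B\<^esub> b:f ` car A" if "a:car R" "b:f ` car A" for a b
 using that hom_smult[OF assms(3)] by (metis (no_types, lifting) A.smult_closed image_iff)
qed
qed

lemma sub_submodule:
assumes "submodule C R A" "submodule D R A" "D <= C" "module R A"
shows "submodule D R (sub A C)"
by (rule module.module_incl_imp_submodule[OF sub_module[OF assms(1,4)]])
 (use assms(3) sub_module[OF assms(2,4)] in auto)

lemma sub_submodule2:
assumes "submodule C R A" "submodule D R (sub A C)" "module R A"
shows "submodule D R A"
by (rule module.module_incl_imp_submodule[OF assms(3)])
 (use submod_sub[OF assms(1)] submod_sub[OF assms(2)] sub_module[OF assms(2) sub_module[OF assms(1,3)]] in auto)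

text \<open>The same formal sum can be evaluated inside \<open>sub P N\<close>; the inclusion into
  \<open>P\<close> commutes with the evaluation.\<close>

lemma sw_submodule:
assumes "submodule N R P" "U:car (tp R A B)" "module R A" "module R B" "module R P"
 "!!x y. x:car A==>y:car B==>f x y:N"
shows "sw P U f:N"
proof -
have NP: "N <= car P" by (rule submod_sub[OF assms(1)])
have "(%x. x) (sw (sub P N) U f) = sw P U (%x y. f x y)"
 by (rule sw_hom[OF incl_hom(2)[OF NP] assms(2)]) (use assms sub_module in auto)
moreover have "sw (sub P N) U f:car (sub P N)"
 by (rule sw_closed[OF assms(2)]) (use assms sub_module in auto)
ultimately show ?thesis by simp
qed

section \<open>Flatness over arbitrary test modules\<close>

definition span :: "('k, 'r) ring_scheme => ('k, 'a, 'm) module_scheme => nat => (nat => 'a) => 'a set"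
where "span R A n e = (%r. finsum A (%i. r i \<odot>\<^bsub>A\<^esub> e i) {..<n}) ` {r. ALL i<n. r i:car R}"

lemma span_submodule:
assumes "module R A" "!!i. i < n==>e i:car A"
shows "submodule (span R A n e) R A"
proof -
interpret A: module R A by fact
let ?s = "%r. finsum A (%i. r i \<odot>\<^bsub>A\<^esub> e i) {..<n}"
let ?X = "{r. ALL i<n. r i:car R}"
have add: "?s r \<oplus>\<^bsub>A\<^esub> ?s s = ?s (%i. r i \<oplus>\<^bsub>R\<^esub> s i)" if "r:?X" "s:?X" for r s
proof -
 have "?s (%i. r i \<oplus>\<^bsub>R\<^esub> s i) = finsum A (%i. r i \<odot>\<^bsub>A\<^esub> e i \<oplus>\<^bsub>A\<^esub> s i \<odot>\<^bsub>A\<^esub> e i) {..<n}"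
 using that assms(2) by (intro A.finsum_cong') (auto simp: A.smult_l_distr)
 also have "... = ?s r \<oplus>\<^bsub>A\<^esub> ?s s" using that assms(2) by (intro A.finsum_addf) auto
 finally show ?thesis by simp
qed
have sm: "a \<odot>\<^bsub>A\<^esub> ?s r = ?s (%i. a \<otimes>\<^bsub>R\<^esub> r i)" if "r:?X" "a:car R" for r a
proof -
 have "?s (%i. a \<otimes>\<^bsub>R\<^esub> r i) = finsum A (%i. a \<odot>\<^bsub>A\<^esub> (r i \<odot>\<^bsub>A\<^esub> e i)) {..<n}"
 using that assms(2) by (intro A.finsum_cong') (auto simp: A.smult_assoc1)
 also have "... = a \<odot>\<^bsub>A\<^esub> ?s r" using that assms(2) by (intro A.finsum_smult_ldistr[symmetric]) auto
 finally show ?thesis by simp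
qed
have sub: "span R A n e <= car A"
 using assms(2) by (auto simp: span_def intro!: A.finsum_closed)
have smc: "a \<odot>\<^bsub>A\<^esub> x:span R A n e" if "x:span R A n e" "a:car R" for x a
 using that sm unfolding span_def by fastforce
show ?thesis
proof (rule A.submoduleI[OF sub])
 have "?s (%i. \<zero>\<^bsub>R\<^esub>) = \<zero>\<^bsub>A\<^esub>"
 using assms(2) by (subst A.finsum_cong'[of "{..<n}" "{..<n}" "%_. \<zero>\<^bsub>A\<^esub>"]) auto
 then show "\<zero>\<^bsub>A\<^esub>:span R A n e" unfolding span_def by force
 show "\<ominus>\<^bsub>A\<^esub> a:span R A n e" if "a:span R A n e" for a
 using smc[OF that, of "\<ominus>\<^bsub>R\<^esub> \<one>\<^bsub>R\<^esub>"] that sub by (auto simp: A.smult_l_minus)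
 show "a \<oplus>\<^bsub>A\<^esub> b:span R A n e" if "a:span R A n e" "b:span R A n e" for a b
 using that add unfolding span_def by fastforce
qed (use smc in auto)
qed

lemma span_gen:
assumes "module R A" "!!i. i < n==>e i:car A" "i < n"
shows "e i:span R A n e"
proof -
interpret A: module R A by fact
have "finsum A (%j. (if i = j then \<one>\<^bsub>R\<^esub> else \<zero>\<^bsub>R\<^esub>) \<odot>\<^bsub>A\<^esub> e j) {..<n} =
 finsum A (%j. if i = j then e j else \<zero>\<^bsub>A\<^esub>) {..<n}"
 using assms(2) by (intro A.finsum_cong') auto
also have "... = e i"
 using A.add.finprod_singleton[of i "{..<n}" e] assms(2,3) by (auto simp: finsum_def)
finally show ?thesis
 unfolding span_def by (intro image_eqI[where x = "%j. if i = j then \<one>\<^bsub>R\<^esub> else \<zero>\<^bsub>R\<^esub>"]) auto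
qed

lemma span_least:
assumes "module R A" "submodule N R A" "!!i. i < n==>e i:N"
shows "span R A n e <= N"
proof
interpret A: module R A by fact
note N = submodule_in[OF assms(1,2)] submod_sub[OF assms(2)]
fix x assume "x:span R A n e"
then obtain r where r: "ALL i<n. r i:car R" "x = finsum A (%i. r i \<odot>\<^bsub>A\<^esub> e i) {..<n}"
 by (auto simp: span_def)
have "m <= n==>finsum A (%i. r i \<odot>\<^bsub>A\<^esub> e i) {..<m}:N" for m
proof (induction m)
 case 0 then show ?case using N by simp
next
 case (Suc m)
 have "finsum A (%i. r i \<odot>\<^bsub>A\<^esub> e i) {..<Suc m} =
 r m \<odot>\<^bsub>A\<^esub> e m \<oplus>\<^bsub>A\<^esub> finsum A (%i. r i \<odot>\<^bsub>A\<^esub> e i) {..<m}"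
 using Suc r(1) assms(3) N(6) unfolding lessThan_Suc
 by (intro A.finsum_insert) (auto simp: subset_iff)
 then show ?case using Suc r(1) assms(3) N by simp
qed
then show "x:N" using r(2) by simp
qed

lemma finite_enum:
assumes "finite F" obtains e :: "nat => 'a" and n where "F = e ` {..<n}"
using assms finite_imp_nat_seg_image_inj_on[OF assms] by (metis lessThan_def)

text \<open>A finitely generated module embeds into the type \<open>(nat \<Rightarrow> 'k) set\<close> by sending an element to
the set of its coefficient vectors.\<close>

definition coeffs :: "('k, 'r) ring_scheme => ('k, 'a, 'm) module_scheme => nat => (nat => 'a) => 'a => (nat => 'k) set"
where "coeffs R A n e x = {r. (ALL i<n. r i:car R) & finsum A (%i. r i \<odot>\<^bsub>A\<^esub> e i) {..<n} = x}"

lemma coeffs_inj: "inj_on (coeffs R A n e) (span R A n e)"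
by (rule inj_onI) (auto simp: coeffs_def span_def)

text \<open>Transport of structure along an injection. With \<open>coeffs\<close> as the injection,
  it places a finitely generated module on the type over which \<open>flat\<close> quantifies; the
  products are left undefined since only the module structure is tested.\<close>

definition copy :: "('k, 'a, 'm) module_scheme => ('a => 'b) => ('k, 'b) module"
where "copy A j = \<lparr>carrier = j ` car A, monoid.mult = undefined, one = undefined, zero = j \<zero>\<^bsub>A\<^esub>,
 add = (%x y. j (inv_into (car A) j x \<oplus>\<^bsub>A\<^esub> inv_into (car A) j y)),
 smult = (%r x. j (r \<odot>\<^bsub>A\<^esub> inv_into (car A) j x))\<rparr>"

lemma copy:
assumes "module R A" "inj_on j (car A)"
shows "module R (copy A j)" "j:Hom R A (copy A j)" "inv_into (car A) j:Hom R (copy A j) A"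
 "car (copy A j) = j ` car A" "zero (copy A j) = j \<zero>\<^bsub>A\<^esub>"
proof -
interpret A: module R A by fact
have [simp]: "inv_into (car A) j (j x) = x" if "x:car A" for x
 using that assms(2) by simp
show "module R (copy A j)"
proof (rule moduleI)
 show "abelian_group (copy A j)"
 by (rule abelian_groupI)
  (auto simp: copy_def A.a_ac A.r_neg intro!: bexI[of _ "\<ominus>\<^bsub>A\<^esub> _"])
qed (auto simp: copy_def A.is_cring A.smult_l_distr A.smult_r_distr A.smult_assoc1)
show "j:Hom R A (copy A j)" "inv_into (car A) j:Hom R (copy A j) A"
 by (auto simp: copy_def mod_hom_def)
qed (simp_all add: copy_def)

text \<open>An element of the generated subgroup is built from finitely many relations, and each
  relation mentions finitely many elements of \<open>B\<close>. It remains a consequence of the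
  relations over any submodule containing these.\<close>

lemma tensor_null_support:
assumes "module R B" "module R M" "c:tensor_null R B M"
shows "EX F. finite F & F <= car B &
 (ALL B'. submodule B' R B & F <= B' --> c:tensor_null R (sub B B') M)"
proof -
interpret B: module R B by fact
interpret BM: two_modules R B M by (rule two_modulesI; fact)
have S: "two_modules R (sub B B') M" if "submodule B' R B" for B'
 using that assms by (intro two_modulesI sub_module)
have rel: "EX F. finite F & F <= car B &
 (ALL B'. submodule B' R B & F <= B' --> c:tensor_rels R (sub B B') M)"
 if "c:tensor_rels R B M" for c
 using that[unfolded tensor_rels_def]
proof (elim UnE CollectE exE conjE)
 fix x y z assume a: "c = frag_of (x \<oplus>\<^bsub>B\<^esub> y, z) - frag_of (x, z) - frag_of (y, z)"
 "x:car B" "y:car B" "z:car M"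
 show ?thesis unfolding tensor_rels_def using a by (intro exI[of _ "{x, y}"]) auto
next
 fix x y z assume a: "c = frag_of (x, y \<oplus>\<^bsub>M\<^esub> z) - frag_of (x, y) - frag_of (x, z)"
 "x:car B" "y:car M" "z:car M"
 show ?thesis unfolding tensor_rels_def using a by (intro exI[of _ "{x}"]) auto
next
 fix r x y assume a: "c = frag_of (r \<odot>\<^bsub>B\<^esub> x, y) - frag_of (x, r \<odot>\<^bsub>M\<^esub> y)"
 "r:car R" "x:car B" "y:car M"
 show ?thesis unfolding tensor_rels_def using a by (intro exI[of _ "{x}"]) auto
qed
from assms(3) show ?thesis unfolding tensor_null_def[of R B M]
proof (induction rule: generate.induct)
 case one
 have "\<one>\<^bsub>BM.F\<^esub>:tensor_null R (sub B B') M" if "submodule B' R B" for B'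
 proof -
 interpret C: two_modules R "sub B B'" M by (rule S[OF that])
 show ?thesis using C.null.one_closed by simp
 qed
 then show ?case by (intro exI[of _ "{}"] conjI allI impI finite.emptyI empty_subsetI) (elim conjE)
next
 case (incl h)
 then obtain F where F: "finite F" "F <= car B"
 "!!B'. submodule B' R B==>F <= B'==>h:tensor_rels R (sub B B') M"
 using rel[of h] by blast
 then show ?case using two_modules.rel_in_null[OF S] by (intro exI[of _ F] conjI allI impI) (simp_all)
next
 case (inv h)
 obtain F where F: "finite F" "F <= car B"
 "!!B'. submodule B' R B==>F <= B'==>h:tensor_rels R (sub B B') M"
 using rel[OF inv] by blast
 have "inv\<^bsub>BM.F\<^esub> h:tensor_null R (sub B B') M" if B': "submodule B' R B" "F <= B'" for B'
 proof -
 interpret C: two_modules R "sub B B'" M by (rule S[OF B'(1)])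
 have h: "h:tensor_null R (sub B B') M" by (rule C.rel_in_null[OF F(3)[OF B']])
 \<comment> \<open>Inversion in each of the two free groups is negation only on its own carrier, so
   \<open>h\<close> is located in both before the inverses are identified.\<close>
 have "Poly_Mapping.keys h <= car B \<times> car M"
  using subsetD[OF BM.tensor_rels_carrier inv] by (simp only: carrier_free_Abelian_group_iff)
 moreover have "Poly_Mapping.keys h <= car (sub B B') \<times> car M"
  using subsetD[OF C.null.subset h] by (simp only: carrier_free_Abelian_group_iff)
 ultimately show ?thesis using C.null.m_inv_closed[OF h] by (simp only: inv_free_Abelian_group)
 qed
 then show ?case using F(1,2) by (intro exI[of _ F] conjI allI impI) simp_all
next
 case (eng h1 h2)
 from eng.IH(1) obtain F1 where F1: "finite F1" "F1 <= car B"
 "!!B'. submodule B' R B==>F1 <= B'==>h1:tensor_null R (sub B B') M" by (elim exE conjE) simp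
 from eng.IH(2) obtain F2 where F2: "finite F2" "F2 <= car B"
 "!!B'. submodule B' R B==>F2 <= B'==>h2:tensor_null R (sub B B') M" by (elim exE conjE) simp
 have "h1 \<otimes>\<^bsub>BM.F\<^esub> h2:tensor_null R (sub B B') M" if B': "submodule B' R B" "F1 \<union> F2 <= B'" for B'
 proof -
 interpret C: two_modules R "sub B B'" M by (rule S[OF B'(1)])
 show ?thesis using C.null.m_closed[OF F1(3)[OF B'(1)] F2(3)[OF B'(1)]] B'(2) by simp
 qed
 then show ?case using F1(1,2) F2(1,2) by (intro exI[of _ "F1 \<union> F2"] conjI allI impI) simp_all
qed
qed

lemma tensor_incl_coset:
assumes "module R B" "module R M" "submodule B0 R B" "submodule B' R B" "B0 <= B'"
 and "Poly_Mapping.keys c <= B0 \<times> car M"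
shows "tmp R (sub B B') M id id (tensor_null R (sub B B0) M #>\<^bsub>free_Abelian_group (B0 \<times> car M)\<^esub> c) =
 tensor_null R (sub B B') M #>\<^bsub>free_Abelian_group (B' \<times> car M)\<^esub> c"
proof -
have m0: "module R (sub B B0)" and m1: "module R (sub B B')" using assms sub_module by blast+
interpret C: two_modules R "sub B B0" M by (rule two_modulesI; fact)
interpret D: two_modules R "sub B B'" M by (rule two_modulesI; fact)
note ih = incl_hom(3)[OF assms(5), of R B]
have H: "tmp R (sub B B') M id id:Hom R (tp R (sub B B0) M) (tp R (sub B B') M)"
 by (rule tmap_hom; fact ih id_hom assms m0 m1)
have "tmp R (sub B B') M id id (C.cl c) = D.cl c"
 using assms(6)
proof (rule free_Abelian_group_induct)
 show "tmp R (sub B B') M id id (C.cl 0) = D.cl 0"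
 using C.cl_one[OF C.null.one_closed] D.cl_one[OF D.null.one_closed]
  mod_hom_zero_inv(1)[OF _ _ H] mod_tens[OF m0 assms(2)] mod_tens[OF m1 assms(2)]
 by (simp add: tsimps)
 show "tmp R (sub B B') M id id (C.cl (x - y)) = D.cl (x - y)"
 if "Poly_Mapping.keys x <= B0 \<times> car M" "Poly_Mapping.keys y <= B0 \<times> car M"
  and eq: "tmp R (sub B B') M id id (C.cl x) = D.cl x" "tmp R (sub B B') M id id (C.cl y) = D.cl y" for x y
 proof -
 interpret h: group_hom "tensor_group R (sub B B0) M" "tensor_group R (sub B B') M" "tmp R (sub B B') M id id"
  by unfold_locales (use mod_hom_hom[OF H] in \<open>simp add: hom_def tsimps\<close>)
 have x: "x:car C.F" "y:car C.F" and x': "x:car D.F" "y:car D.F"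
  using that(1,2) assms(5) by auto
 show ?thesis
  unfolding C.cl_diff[OF x] D.cl_diff[OF x'] eq[symmetric]
  using C.cl_in_carrier[OF x(1)] C.cl_in_carrier[OF x(2)] by (simp add: h.hom_mult h.hom_inv)
 qed
 show "tmp R (sub B B') M id id (C.cl (frag_of a)) = D.cl (frag_of a)" if a: "a:B0 \<times> car M" for a
 proof -
 obtain x y where xy: "a = (x, y)" "x:B0" "y:car M" using a by auto
 show ?thesis
  using tmap_tens[OF ih id_hom m0 assms(2) m1 assms(2), of x y] xy by (simp add: tens_def)
 qed
qed
then show ?thesis by simp
qed

text \<open>One half of the fact that tensor products commute with directed unions: an element that
  dies over \<open>B\<close> dies already over submodules that contain some finite set.\<close>

lemma tensor_vanish_support:
assumes "module R B" "module R M" "submodule B0 R B" "\<zeta>:car (tp R (sub B B0) M)"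
 "tmp R B M id id \<zeta> = \<zero>\<^bsub>tp R B M\<^esub>"
shows "EX F. finite F & F <= car B & (ALL B'. submodule B' R B & F <= B' & B0 <= B' -->
 tmp R (sub B B') M id id \<zeta> = \<zero>\<^bsub>tp R (sub B B') M\<^esub>)"
proof -
interpret B: module R B by fact
have m0: "module R (sub B B0)" using assms sub_module by blast
interpret C: two_modules R "sub B B0" M by (rule two_modulesI; fact)
interpret D: two_modules R B M by (rule two_modulesI; fact)
obtain c where c: "c:car C.F" "\<zeta> = C.cl c"
 using assms(4) C.carrier_cases unfolding tsimps by blast
have k: "Poly_Mapping.keys c <= B0 \<times> car M" using c(1) by (simp only: carrier_free_Abelian_group_iff) simp
have kB: "c:car D.F" using k submod_sub[OF assms(3)] by auto
have eqB: "sub B (car B) = B" by simp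
have "D.cl c = tmp R B M id id \<zeta>"
 using tensor_incl_coset[OF assms(1-3) B.carrier_is_submodule submod_sub[OF assms(3)] k] c(2)
 by (simp only: eqB) simp
then have "D.cl c = \<one>\<^bsub>tensor_group R B M\<^esub>" using assms(5) by (simp add: tsimps)
then have "c:tensor_null R B M" using D.cl_zero_iff[OF kB] by simp
from tensor_null_support[OF assms(1,2) this] obtain F where F: "finite F" "F <= car B"
 "!!B'. submodule B' R B==>F <= B'==>c:tensor_null R (sub B B') M" by blast
have "tmp R (sub B B') M id id \<zeta> = \<zero>\<^bsub>tp R (sub B B') M\<^esub>"
 if B': "submodule B' R B" "F <= B'" "B0 <= B'" for B'
proof -
 interpret E: two_modules R "sub B B'" M by (rule two_modulesI) (use B' assms sub_module in auto)
 have "tmp R (sub B B') M id id \<zeta> = E.cl c"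
 using tensor_incl_coset[OF assms(1-3) B'(1,3) k] c(2) by simp
 then show ?thesis using E.cl_one[OF F(3)[OF B'(1,2)]] by (simp add: tsimps)
qed
then show ?thesis using F(1,2) by blast
qed

text \<open>The other half: every tensor comes from a submodule as soon as the submodule contains
  some finite set.\<close>

lemma tensor_support:
assumes "module R A" "module R M" "U:car (tp R A M)"
shows "EX F. finite F & F <= car A & (ALL A'. submodule A' R A & F <= A' -->
 U:tmp R A M id id ` car (tp R (sub A A') M))"
using assms
proof (induction rule: tensor_induct)
case (tens x y)
have "tens R A M x y:tmp R A M id id ` car (tp R (sub A A') M)"
 if A': "submodule A' R A" "x:A'" for A'
proof -
 have m: "module R (sub A A')" using sub_module[OF A'(1) assms(1)] .
 have "tmp R A M id id (tens R (sub A A') M x y) = tens R A M x y"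
 using tmap_tens[OF incl_hom(4)[OF submod_sub[OF A'(1)]] id_hom m assms(2,1,2), of x y] A'(2) tens(2) by simp
 moreover have "tens R (sub A A') M x y:car (tp R (sub A A') M)"
 using A'(2) tens(2) m assms(2) by (intro tens_in) auto
 ultimately show ?thesis by (metis imageI)
qed
then show ?case using tens by (intro exI[of _ "{x}"] conjI allI impI) blast+
next
case (add X Y)
obtain F1 where F1: "finite F1" "F1 <= car A" "!!A'. submodule A' R A==>F1 <= A' ==>
 X:tmp R A M id id ` car (tp R (sub A A') M)" using add(3) by blast
obtain F2 where F2: "finite F2" "F2 <= car A" "!!A'. submodule A' R A==>F2 <= A' ==>
 Y:tmp R A M id id ` car (tp R (sub A A') M)" using add(4) by blast
have "X \<oplus>\<^bsub>tp R A M\<^esub> Y:tmp R A M id id ` car (tp R (sub A A') M)"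
 if A': "submodule A' R A" "F1 \<union> F2 <= A'" for A'
proof -
 have m: "module R (sub A A')" using sub_module[OF A'(1) assms(1)] .
 have "submodule (tmp R A M id id ` car (tp R (sub A A') M)) R (tp R A M)"
 by (rule image_submodule[OF mod_tens[OF m assms(2)] mod_tens[OF assms(1,2)]])
  (rule tmap_hom[OF incl_hom(4)[OF submod_sub[OF A'(1)]] id_hom m assms(2,1,2)])
 then show ?thesis using F1(3)[OF A'(1)] F2(3)[OF A'(1)] A'(2) submodule_in(2)[OF mod_tens[OF assms(1,2)]] by blast
qed
then show ?case using F1(1,2) F2(1,2) by (intro exI[of _ "F1 \<union> F2"] conjI allI impI finite_UnI) blast+
qed

text \<open>Left exactness for modules on arbitrary types. \<open>U\<close> is represented over a
  finitely generated \<open>A0\<close>, and its image already vanishes over a finitely generated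
  \<open>B0\<close> containing \<open>f(A0)\<close>. The restricted map is copied onto the test
  type, exactness is used there, and the result is transported back.\<close>

theorem flat_kernel:
fixes R :: "('k, 'r) ring_scheme" and A :: "('k, 'a, 'm) module_scheme" and B :: "('k, 'b, 'n) module_scheme"
assumes "flat R M" "module R A" "module R B" "f:Hom R A B" "U:car (tp R A M)"
 and "tmp R B M f id U = \<zero>\<^bsub>tp R B M\<^esub>"
shows "U:tmp R A M id id ` car (tp R (sub A {a:car A. f a = \<zero>\<^bsub>B\<^esub>}) M)"
proof -
interpret A: module R A by fact
interpret B: module R B by fact
have mM: "module R M" using assms(1) by (simp add: flat_def)
note fcl = hom_mem[OF assms(4)]
obtain FA where FA: "finite FA" "FA <= car A" "!!A'. submodule A' R A==>FA <= A' ==>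
 U:tmp R A M id id ` car (tp R (sub A A') M)"
 using tensor_support[OF assms(2) mM assms(5)] by blast
obtain e n where e: "FA = e ` {..<n::nat}" using FA(1) finite_enum by metis
have eA: "i < n==>e i:car A" for i using e FA(2) by auto
define A0 where "A0 = span R A n e"
have A0: "submodule A0 R A" unfolding A0_def by (rule span_submodule[OF assms(2) eA])
note A0s = submod_sub[OF A0]
have mA0: "module R (sub A A0)" using sub_module[OF A0 assms(2)] .
have "FA <= A0" unfolding e A0_def using span_gen[OF assms(2) eA] by auto
then obtain U0 where U0: "U0:car (tp R (sub A A0) M)" "U = tmp R A M id id U0"
 using FA(3)[OF A0] by blast
define B1 where "B1 = f ` A0"
have fA0: "f:Hom R (sub A A0) B" by (rule sub_hom(2)[OF assms(4) A0s])
have B1: "submodule B1 R B" unfolding B1_def using image_submodule[OF mA0 assms(3) fA0] by simp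
have mB1: "module R (sub B B1)" using sub_module[OF B1 assms(3)] .
have fAB1: "f:Hom R (sub A A0) (sub B B1)" by (rule sub_hom(1)[OF assms(4) A0s]) (simp add: B1_def)
define \<eta> where "\<eta> = tmp R (sub B B1) M f id U0"
have \<eta>: "\<eta>:car (tp R (sub B B1) M)"
 unfolding \<eta>_def by (rule tensor_map_closed[OF fAB1 id_hom mA0 mM mB1 mM U0(1)])
have "tmp R B M id id \<eta> = tmp R B M (%x. id (f x)) (%x. id (id x)) U0"
 unfolding \<eta>_def
 by (rule tensor_map_comp[OF fAB1 id_hom incl_hom(4)[OF submod_sub[OF B1]] id_hom mA0 mM mB1 mM assms(3) mM U0(1)])
also have "... = tmp R B M f id U"
 unfolding U0(2)
 by (subst tensor_map_comp[OF incl_hom(4)[OF A0s] id_hom assms(4) id_hom mA0 mM assms(2) mM assms(3) mM U0(1)]) (simp add: id_def)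
finally have van: "tmp R B M id id \<eta> = \<zero>\<^bsub>tp R B M\<^esub>" using assms(6) by simp
obtain FB where FB: "finite FB" "FB <= car B" "!!B'. submodule B' R B==>FB <= B'==>B1 <= B' ==>
 tmp R (sub B B') M id id \<eta> = \<zero>\<^bsub>tp R (sub B B') M\<^esub>"
 using tensor_vanish_support[OF assms(3) mM B1 \<eta> van] by (elim exE conjE) simp
\<comment> \<open>The generators of \<open>B0\<close> have two tasks: \<open>FB\<close> forces the
  image of \<open>U0\<close> to vanish, and the images of the generators of \<open>A0\<close> make
  \<open>f\<close> map \<open>A0\<close> into \<open>B0\<close>.\<close>
have "finite (FB \<union> f ` FA)" using FA FB by simp
then obtain g m where g: "FB \<union> f ` FA = g ` {..<m::nat}" using finite_enum by metis
have gB: "i < m==>g i:car B" for i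
proof -
 assume "i < m"
 then have "g i:FB \<union> f ` FA" unfolding g by simp
 then show ?thesis using FA(2) FB(2) fcl by auto
qed
define B0 where "B0 = span R B m g"
have B0: "submodule B0 R B" unfolding B0_def by (rule span_submodule[OF assms(3) gB])
note B0s = submod_sub[OF B0]
have mB0: "module R (sub B B0)" using sub_module[OF B0 assms(3)] .
have gB0: "FB \<union> f ` FA <= B0" unfolding g B0_def using span_gen[OF assms(3) gB] by auto
have "A0 <= {a:car A. f a:B0}"
 unfolding A0_def using gB0 e eA
 by (intro span_least[OF assms(2) preimage_submodule[OF assms(2,3,4) B0]]) auto
then have B1B0: "B1 <= B0" unfolding B1_def by auto
have zero0: "tmp R (sub B B0) M id id \<eta> = \<zero>\<^bsub>tp R (sub B B0) M\<^esub>"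
 using FB(3)[OF B0 _ B1B0] gB0 by simp
have fAB0: "f:Hom R (sub A A0) (sub B B0)"
 by (rule sub_hom(1)[OF assms(4) A0s]) (use B1B0 in \<open>simp add: B1_def\<close>)
have zero: "tmp R (sub B B0) M f id U0 = \<zero>\<^bsub>tp R (sub B B0) M\<^esub>"
 using zero0 unfolding \<eta>_def
 by (subst (asm) tensor_map_comp[OF fAB1 id_hom incl_hom(3)[OF B1B0] id_hom mA0 mM mB1 mM mB0 mM U0(1)]) (simp add: id_def)
obtain jA :: "'a => (nat => 'k) set" where jA: "inj_on jA (car (sub A A0))"
 using coeffs_inj[of R A n e] unfolding A0_def by auto
obtain jB :: "'b => (nat => 'k) set" where jB: "inj_on jB (car (sub B B0))"
 using coeffs_inj[of R B m g] unfolding B0_def by auto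
let ?K = "{a:car A. f a = \<zero>\<^bsub>B\<^esub>}"
\<comment> \<open>This kernel may fail to be finitely generated, but as a subset of
  \<open>A0\<close> it is moved to the test type by the injection already chosen for
  \<open>A0\<close>.\<close>
define K0 where "K0 = ?K \<inter> A0"
have K0: "submodule K0 R (sub A A0)"
proof -
 have "K0 = {a:car (sub A A0). f a = \<zero>\<^bsub>B\<^esub>}" using A0s by (auto simp: K0_def)
 then show ?thesis using kernel_submodule[OF mA0 assms(3) fA0] by simp
qed
have mK0: "module R (sub A K0)" using sub_module[OF K0 mA0] by simp
have K0s: "K0 <= A0" "K0 <= ?K" by (auto simp: K0_def)
let ?A = "copy (sub A A0) jA" and ?B = "copy (sub B B0) jB"
let ?i = "inv_into A0 jA"
note cA = copy[OF mA0 jA] and cB = copy[OF mB0 jB]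
let ?KK = "sub ?A (jA ` K0)"
have subK: "submodule (jA ` K0) R ?A"
 using image_submodule[OF mK0 cA(1), of jA] sub_hom(2)[OF cA(2), of K0] K0s by simp
have mKK: "module R ?KK" by (rule sub_module[OF subK cA(1)])
define ff where "ff = (%x. jB (f (?i x)))"
have iA: "?i:Hom R ?A (sub A A0)" using cA(3) by simp
have ff: "ff:Hom R ?A ?B"
 unfolding ff_def by (rule hom_comp[OF cB(2) hom_comp[OF fAB0 iA]])
have ij: "?i (jA x) = x" if "x:A0" for x using that jA by simp
have z0: "jB \<zero>\<^bsub>B\<^esub> = \<zero>\<^bsub>?B\<^esub>" using cB(5) by simp
have fz: "jB (f x) = \<zero>\<^bsub>?B\<^esub> \<longleftrightarrow> f x = \<zero>\<^bsub>B\<^esub>" if "x:A0" for x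
 using that jB fAB0 z0[symmetric] submodule_in(1)[OF assms(3) B0]
 by (auto simp: mod_hom_def inj_on_def)
have ex: "exact_seq3 ?KK ?A ?B id ff"
 unfolding exact_seq3_def
proof
 show "id ` car ?KK <= {x:car ?A. ff x = \<zero>\<^bsub>?B\<^esub>}"
 using K0s cA(4) by (auto simp: ff_def ij fz z0 subset_iff)
 show "{x:car ?A. ff x = \<zero>\<^bsub>?B\<^esub>} <= id ` car ?KK"
 using A0s cA(4) by (auto simp: ff_def ij fz K0_def)
qed
have "exact_seq3 (tp R ?KK M) (tp R ?A M) (tp R ?B M) (tmp R ?A M id id) (tmp R ?B M ff id)"
 using assms(1) ex mKK cA(1) cB(1) ff incl_hom(4)[OF submod_sub[OF subK]] unfolding flat_def by blast
then have ex2: "tmp R ?A M id id ` car (tp R ?KK M) =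
 {x:car (tp R ?A M). tmp R ?B M ff id x = \<zero>\<^bsub>tp R ?B M\<^esub>}"
 unfolding exact_seq3_def .
define U1 where "U1 = tmp R ?A M jA id U0"
have U1: "U1:car (tp R ?A M)"
 unfolding U1_def by (rule tensor_map_closed[OF cA(2) id_hom mA0 mM cA(1) mM U0(1)])
have "tmp R ?B M ff id U1 = tmp R ?B M (%x. ff (jA x)) (%x. id (id x)) U0"
 unfolding U1_def by (rule tensor_map_comp[OF cA(2) id_hom ff id_hom mA0 mM cA(1) mM cB(1) mM U0(1)])
also have "... = tmp R ?B M (%x. jB (f x)) (%x. id (id x)) U0"
 by (rule tensor_map_cong[OF hom_comp[OF cB(2) fAB0] _ mA0 mM cB(1) mM _ _ U0(1)])
 (auto simp: ff_def ij id_def lin_id)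
also have "... = tmp R ?B M jB id (tmp R (sub B B0) M f id U0)"
 by (rule tensor_map_comp[OF fAB0 id_hom cB(2) id_hom mA0 mM mB0 mM cB(1) mM U0(1), symmetric])
also have "... = \<zero>\<^bsub>tp R ?B M\<^esub>"
 unfolding zero
 by (rule mod_hom_zero_inv(1)[OF mod_tens[OF mB0 mM] mod_tens[OF cB(1) mM] tmap_hom[OF cB(2) id_hom mB0 mM cB(1) mM]])
finally have "U1:tmp R ?A M id id ` car (tp R ?KK M)" using ex2 U1 by simp
then obtain \<kappa> where \<kappa>: "\<kappa>:car (tp R ?KK M)" "U1 = tmp R ?A M id id \<kappa>" by blast
have mK: "module R (sub A ?K)" by (rule sub_module[OF kernel_submodule[OF assms(2,3,4)] assms(2)])
have iK: "?i:Hom R ?KK (sub A ?K)"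
 using sub_hom(2)[OF iA, of "jA ` K0"] K0s cA(4) ij by (auto simp: mod_hom_def subset_iff)
define \<kappa>' where "\<kappa>' = tmp R (sub A ?K) M ?i id \<kappa>"
have \<kappa>': "\<kappa>':car (tp R (sub A ?K) M)"
 unfolding \<kappa>'_def by (rule tensor_map_closed[OF iK id_hom mKK mM mK mM \<kappa>(1)])
have iA': "?i:Hom R ?A A" using iA A0s by (auto simp: mod_hom_def)
have "tmp R A M id id \<kappa>' = tmp R A M (%x. id (?i x)) (%x. id (id x)) \<kappa>"
 unfolding \<kappa>'_def by (rule tensor_map_comp[OF iK id_hom incl_hom(4) id_hom mKK mM mK mM assms(2) mM \<kappa>(1)]) auto
also have "... = tmp R A M ?i id U1"
 unfolding \<kappa>(2)
 by (subst tensor_map_comp[OF incl_hom(4)[OF submod_sub[OF subK]] id_hom iA' id_hom mKK mM cA(1) mM assms(2) mM \<kappa>(1)]) (simp add: id_def)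
also have "... = tmp R A M (%x. ?i (jA x)) (%x. id (id x)) U0"
 unfolding U1_def by (rule tensor_map_comp[OF cA(2) id_hom iA' id_hom mA0 mM cA(1) mM assms(2) mM U0(1)])
also have "... = U"
 unfolding U0(2)
 by (rule tensor_map_cong[OF incl_hom(4)[OF A0s] id_hom mA0 mM assms(2) mM _ _ U0(1)]) (auto simp: ij)
finally show ?thesis using \<kappa>' by (intro image_eqI[where x = \<kappa>']) simp_all
qed

lemma tensor_zero_sub:
assumes "module R A" "module R M" "\<zeta>:car (tp R (sub A {\<zero>\<^bsub>A\<^esub>}) M)"
shows "\<zeta> = \<zero>\<^bsub>tp R (sub A {\<zero>\<^bsub>A\<^esub>}) M\<^esub>"
proof -
let ?Z = "sub A {\<zero>\<^bsub>A\<^esub>}"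
have mZ: "module R ?Z" by (rule sub_module[OF submodule_zero[OF assms(1)] assms(1)])
interpret ZM: module R "tp R ?Z M" by (rule mod_tens[OF mZ assms(2)])
show ?thesis using mZ assms(2,3)
proof (induction rule: tensor_induct)
 case (tens x y)
 then have "x = \<zero>\<^bsub>?Z\<^esub>" by simp
 then show ?case using mod_hom_zero_inv(1)[OF mZ ZM.module_axioms lin_tens1[OF lin_id tens(2) mZ assms(2)]] by simp
qed simp
qed

lemma flat_injective:
assumes "flat R M" "module R A" "module R B" "f:Hom R A B" "U:car (tp R A M)"
 and "tmp R B M f id U = \<zero>\<^bsub>tp R B M\<^esub>"
 and inj: "!!a. a:car A==>f a = \<zero>\<^bsub>B\<^esub>==>a = \<zero>\<^bsub>A\<^esub>"
shows "U = \<zero>\<^bsub>tp R A M\<^esub>"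
proof -
have mM: "module R M" using assms(1) by (simp add: flat_def)
interpret A: module R A by fact
have Z: "{a:car A. f a = \<zero>\<^bsub>B\<^esub>} = {\<zero>\<^bsub>A\<^esub>}" using inj mod_hom_zero_inv(1)[OF assms(2,3,4)] by auto
let ?Z = "sub A {\<zero>\<^bsub>A\<^esub>}"
have mZ: "module R ?Z" by (rule sub_module[OF submodule_zero[OF assms(2)] assms(2)])
obtain \<zeta> where z: "\<zeta>:car (tp R ?Z M)" "U = tmp R A M id id \<zeta>"
 using flat_kernel[OF assms(1-6)] unfolding Z by (elim imageE) simp
show ?thesis unfolding z(2) tensor_zero_sub[OF assms(2) mM z(1)]
 by (rule mod_hom_zero_inv(1)[OF mod_tens[OF mZ mM] mod_tens[OF assms(2) mM] tmap_hom])
 (rule incl_hom(4) id_hom mZ mM assms(2) | simp)+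
qed

lemma faithfully_flat_imp_flat: "faithfully_flat R M==>flat R M"
unfolding flat_def faithfully_flat_def by blast

section \<open>Faithfully flat descent along the unit of \<open>T\<close>\<close>

locale ff_algebra = k_algebra R T for R :: "('k, 'r) ring_scheme" and T :: "('k, 't, 'm) module_scheme" +
assumes ff: "faithfully_flat R T"

lemma (in k_algebra) module_axiom: "module R M" by unfold_locales

lemma (in k_algebra) rmult_hom: "t:car M==>f:Hom R X M==>(%x. f x \<otimes>\<^bsub>M\<^esub> t):Hom R X M"
by (auto simp: mod_hom_def Pi_def l_distr smult_assoc_l)

lemma (in k_algebra) lmult_hom: "t:car M==>f:Hom R X M==>(%x. t \<otimes>\<^bsub>M\<^esub> f x):Hom R X M"
by (auto simp: mod_hom_def Pi_def r_distr smult_assoc_r)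

context ff_algebra
begin

abbreviation times_T (infixl "**" 70) where "x ** y \<equiv> x \<otimes>\<^bsub>T\<^esub> y"
abbreviation "eT \<equiv> \<one>\<^bsub>T\<^esub>"
abbreviation smult_T (infixl "*s" 70) where "r *s x \<equiv> r \<odot>\<^bsub>T\<^esub> x"
abbreviation "cT \<equiv> carrier T"
abbreviation "tn \<equiv> tens R"

text \<open>If \<open>a \<otimes> 1\<close> comes from \<open>C \<otimes> T\<close>, then finitely generated submodules \<open>C\<^sub>0 \<subseteq> C\<close> and \<open>A\<^sub>0 \<ni> a\<close> can be
chosen such that \<open>C\<^sub>0 \<otimes> T \<rightarrow> A\<^sub>0 \<otimes> T\<close> is onto; faithful flatness applied to
\<open>C\<^sub>0 \<rightarrow> A\<^sub>0 \<rightarrow> 0\<close> then yields \<open>a \<in> C\<^sub>0\<close>.\<close>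

lemma descent_submodule:
fixes A :: "('k, 'a, 'n) module_scheme"
assumes "module R A" "submodule C R A" "a:car A"
 and "tn A T a eT:tmp R A T id id ` car (tp R (sub A C) T)"
shows "a:C"
proof -
interpret A: module R A by fact
have mT: "module R T" by (rule module_axiom)
have fl: "flat R T" by (rule faithfully_flat_imp_flat[OF ff])
note Cs = submod_sub[OF assms(2)]
have mC: "module R (sub A C)" by (rule sub_module[OF assms(2,1)])
obtain \<zeta> where \<zeta>: "\<zeta>:car (tp R (sub A C) T)" "tens R A T a eT = tmp R A T id id \<zeta>"
 using assms(4) by (elim imageE) simp
obtain F where F: "finite F" "F <= C" "!!A'. submodule A' R (sub A C)==>F <= A' ==>
 \<zeta>:tmp R (sub A C) T id id ` car (tp R (sub (sub A C) A') T)"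
 using tensor_support[OF mC mT \<zeta>(1)] by (elim exE conjE) simp
obtain e n where e: "F = e ` {..<n::nat}" using F(1) finite_enum by metis
have eC: "i < n==>e i:C" for i using e F(2) by auto
define C0 where "C0 = span R A n e"
have C0: "submodule C0 R A" unfolding C0_def by (rule span_submodule[OF assms(1)]) (use eC Cs in auto)
have C0C: "C0 <= C" unfolding C0_def by (rule span_least[OF assms(1,2) eC])
have FC0: "F <= C0" unfolding e C0_def using span_gen[OF assms(1), of n e] eC Cs by auto
have mC0: "module R (sub A C0)" by (rule sub_module[OF C0 assms(1)])
obtain \<zeta>0 where \<zeta>0: "\<zeta>0:car (tp R (sub A C0) T)" "\<zeta> = tmp R (sub A C) T id id \<zeta>0"
 using F(3)[OF sub_submodule[OF assms(2) C0 C0C assms(1)] FC0] by (elim imageE) simp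
\<comment> \<open>The generators of \<open>C0\<close> followed by \<open>a\<close> at index
  \<open>n\<close>, so that \<open>A0\<close> is \<open>C0\<close> enlarged by the single element
  \<open>a\<close>.\<close>
define g where "g = (%i. if i < n then e i else a)"
have gA: "i < Suc n==>g i:car A" for i using eC Cs assms(3) by (auto simp: g_def)
define A0 where "A0 = span R A (Suc n) g"
have A0: "submodule A0 R A" unfolding A0_def by (rule span_submodule[OF assms(1) gA])
note A0s = submod_sub[OF A0]
have aA0: "a:A0" using span_gen[OF assms(1), of "Suc n" g n] gA by (simp add: A0_def g_def)
have eA0: "e i:A0" if "i < n" for i
 using span_gen[OF assms(1), of "Suc n" g i] gA that by (simp add: A0_def g_def)
have C0A0: "C0 <= A0" unfolding C0_def by (rule span_least[OF assms(1) A0 eA0])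
have mA0: "module R (sub A A0)" by (rule sub_module[OF A0 assms(1)])
let ?TC = "tp R (sub A C0) T" and ?TA = "tp R (sub A A0) T"
let ?inc = "tmp R (sub A A0) T id id"
have inc: "?inc:Hom R ?TC ?TA"
 by (rule tmap_hom[OF incl_hom(3)[OF C0A0] id_hom mC0 mT mA0 mT])
have mTC: "module R ?TC" and mTA: "module R ?TA" by (rule mod_tens[OF mC0 mT] mod_tens[OF mA0 mT])+
let ?incA = "tmp R A T id id"
have incA: "?incA:Hom R ?TA (tp R A T)"
 by (rule tmap_hom[OF incl_hom(4)[OF A0s] id_hom mA0 mT assms(1) mT])
have one: "eT:cT" by simp
have a1: "tn (sub A A0) T a eT:car ?TA" by (rule tens_in[OF _ one mA0 mT]) (simp add: aA0)
have "?incA (tn (sub A A0) T a eT) = tn A T a eT"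
 using tmap_tens[OF incl_hom(4)[OF A0s] id_hom mA0 mT assms(1) mT, of a "eT"] aA0 by simp
also have "... = ?incA (?inc \<zeta>0)"
 unfolding \<zeta>(2) \<zeta>0(2)
 by (subst tensor_map_comp[OF incl_hom(3)[OF C0C] id_hom incl_hom(4)[OF Cs] id_hom mC0 mT mC mT assms(1) mT \<zeta>0(1)],
  subst tensor_map_comp[OF incl_hom(3)[OF C0A0] id_hom incl_hom(4)[OF A0s] id_hom mC0 mT mA0 mT assms(1) mT \<zeta>0(1)]) simp
\<comment> \<open>The equation is so far known only in \<open>A \<otimes> T\<close>. Flatness of
  \<open>T\<close> makes \<open>A0 \<otimes> T \<rightarrow> A \<otimes> T\<close> injective and
  brings it down to \<open>A0 \<otimes> T\<close>.\<close>
finally have eq: "tn (sub A A0) T a eT = ?inc \<zeta>0"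
proof (rule mod_hom_eq_zero_inj[OF mTA mod_tens[OF assms(1) mT] incA _ a1 hom_mem[OF inc \<zeta>0(1)], rotated])
 show "x = \<zero>\<^bsub>?TA\<^esub>" if "x:car ?TA" "?incA x = \<zero>\<^bsub>tp R A T\<^esub>" for x
 by (rule flat_injective[OF fl mA0 assms(1) incl_hom(4)[OF A0s] that]) simp
qed
define N where "N = ?inc ` car ?TC"
have N: "submodule N R ?TA" unfolding N_def by (rule image_submodule[OF mTC mTA inc])
\<comment> \<open>To pass from \<open>a \<otimes> 1\<close> to all tensors it is enough that
  \<open>S\<close> is a submodule containing the generators of \<open>A0\<close>. For
  \<open>a\<close> this holds because right multiplication by \<open>t\<close> carries
  \<open>a \<otimes> 1\<close> to \<open>a \<otimes> t\<close> and commutes with the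
  inclusion.\<close>
define S where "S = {x:A0. ALL t:cT. tens R (sub A A0) T x t:N}"
have aS: "a:S" unfolding S_def
proof (intro CollectI conjI ballI aA0)
 fix t assume t: "t:cT"
 have mt: "(%x. x ** t):Hom R T T" by (rule rmult_hom[OF t lin_id])
 have "tn (sub A A0) T a t = tmp R (sub A A0) T id (%x. x ** t) (tn (sub A A0) T a eT)"
 using tmap_tens[OF id_hom mt mA0 mT mA0 mT, of a "eT"] t aA0 by simp
 also have "... = ?inc (tmp R (sub A C0) T id (%x. x ** t) \<zeta>0)"
 unfolding eq
 by (subst tensor_map_comp[OF incl_hom(3)[OF C0A0] id_hom id_hom mt mC0 mT mA0 mT mA0 mT \<zeta>0(1)],
  subst tensor_map_comp[OF id_hom mt incl_hom(3)[OF C0A0] id_hom mC0 mT mC0 mT mA0 mT \<zeta>0(1)]) simp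
 finally show "tn (sub A A0) T a t:N"
 unfolding N_def using tensor_map_closed[OF id_hom mt mC0 mT mC0 mT \<zeta>0(1)] by (rule image_eqI)
qed
have cS: "C0 <= S"
proof
 fix x assume x: "x:C0"
 have "tn (sub A A0) T x t:N" if t: "t:cT" for t
 unfolding N_def
 using tmap_tens[OF incl_hom(3)[OF C0A0] id_hom mC0 mT mA0 mT, of x t] t x tens_in[OF _ t mC0 mT, of x]
 by (intro image_eqI[where x = "tens R (sub A C0) T x t"]) simp_all
 then show "x:S" using x C0A0 by (auto simp: S_def)
qed
have S: "submodule S R A"
proof -
 have p: "submodule {x:car (sub A A0). tn (sub A A0) T x t:N} R (sub A A0)" if "t:cT" for t
 by (rule preimage_submodule[OF mA0 mTA lin_tens1[OF lin_id that mA0 mT] N])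
 have "submodule S R (sub A A0)"
 unfolding S_def
 by (rule module.submoduleI[OF mA0])
  (use submodule_in[OF mA0 p] submod_sub[OF p] submodule_in[OF assms(1) A0]
   submodule_in[OF mA0 module.carrier_is_submodule[OF mA0]] in \<open>auto\<close>)
 then show ?thesis by (rule sub_submodule2[OF A0 _ assms(1)])
qed
have SA0: "A0 <= S"
 unfolding A0_def by (rule span_least[OF assms(1) S]) (use aS cS FC0 e in \<open>auto simp: g_def\<close>)
have surj: "x:N" if "x:car ?TA" for x
 using mA0 mT that
proof (induction rule: tensor_induct)
 case (tens x y) then show ?case using SA0 by (auto simp: S_def)
next
 case (add X Y) then show ?case using submodule_in(2)[OF mTA N] by simp
qed
obtain j :: "'a => (nat => 'k) set" where j: "inj_on j (car (sub A A0))"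
 using coeffs_inj[of R A "Suc n" g] unfolding A0_def by auto
let ?A = "copy (sub A A0) j"
note cA = copy[OF mA0 j]
let ?i = "inv_into A0 j"
have ij: "?i (j x) = x" if "x:A0" for x using that j by simp
have iA: "?i:Hom R ?A (sub A A0)" using cA(3) by simp
have subC: "submodule (j ` C0) R ?A"
 using image_submodule[OF mC0 cA(1), of j] sub_hom(2)[OF cA(2), of C0] C0A0 by simp
have subZ: "submodule {\<zero>\<^bsub>?A\<^esub>} R ?A" by (rule submodule_zero[OF cA(1)])
\<comment> \<open>Surjectivity of \<open>C0 \<rightarrow> A0\<close> is expressed as exactness of a
  sequence ending in the zero module, which is realised as a submodule of the copy.\<close>
let ?C = "sub ?A (j ` C0)" and ?Z = "sub ?A {\<zero>\<^bsub>?A\<^esub>}"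
have mCC: "module R ?C" and mZ: "module R ?Z" by (rule sub_module[OF subC cA(1)] sub_module[OF subZ cA(1)])+
have zh: "(%_. \<zero>\<^bsub>?A\<^esub>):Hom R ?A ?Z"
proof -
 interpret A': module R ?A by (rule cA(1))
 show ?thesis by (auto simp: mod_hom_def)
qed
have jC: "j:Hom R (sub A C0) ?C"
 using sub_hom(1)[OF cA(2), of C0 "j ` C0"] C0A0 by simp
have "exact_seq3 (tp R ?C T) (tp R ?A T) (tp R ?Z T) (tmp R ?A T id id) (tmp R ?Z T (%_. \<zero>\<^bsub>?A\<^esub>) id)"
 unfolding exact_seq3_def
proof
 have "tmp R ?Z T (%_. \<zero>\<^bsub>?A\<^esub>) id x = \<zero>\<^bsub>tp R ?Z T\<^esub>" if "x:car (tp R ?A T)" for x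
 using tensor_zero_sub[OF cA(1) mT] tensor_map_closed[OF zh id_hom cA(1) mT mZ mT that] by simp
 then show "tmp R ?A T id id ` car (tp R ?C T) <= {x:car (tp R ?A T). tmp R ?Z T (%_. \<zero>\<^bsub>?A\<^esub>) id x = \<zero>\<^bsub>tp R ?Z T\<^esub>}"
 using tensor_map_closed[OF incl_hom(4)[OF submod_sub[OF subC]] id_hom mCC mT cA(1) mT] by auto
 show "{x:car (tp R ?A T). tmp R ?Z T (%_. \<zero>\<^bsub>?A\<^esub>) id x = \<zero>\<^bsub>tp R ?Z T\<^esub>} <= tmp R ?A T id id ` car (tp R ?C T)"
 proof
 fix x assume "x:{x:car (tp R ?A T). tmp R ?Z T (%_. \<zero>\<^bsub>?A\<^esub>) id x = \<zero>\<^bsub>tp R ?Z T\<^esub>}"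
 then have x: "x:car (tp R ?A T)" by simp
 have "tmp R (sub A A0) T ?i id x:N"
  by (rule surj[OF tensor_map_closed[OF iA id_hom cA(1) mT mA0 mT x]])
 then obtain y where y: "y:car ?TC" "tmp R (sub A A0) T ?i id x = ?inc y"
  unfolding N_def by (elim imageE) simp
 have "x = tmp R ?A T (%x. j (?i x)) (%x. id (id x)) x"
  using cA(4) ij by (intro tensor_map_id[OF cA(1) mT x, symmetric]) auto
 also have "... = tmp R ?A T j id (tmp R (sub A A0) T ?i id x)"
  by (rule tensor_map_comp[OF iA id_hom cA(2) id_hom cA(1) mT mA0 mT cA(1) mT x, symmetric])
 also have "... = tmp R ?A T id id (tmp R ?C T j id y)"
  unfolding y(2)
  by (subst tensor_map_comp[OF incl_hom(3)[OF C0A0] id_hom cA(2) id_hom mC0 mT mA0 mT cA(1) mT y(1)],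
   subst tensor_map_comp[OF jC id_hom incl_hom(4)[OF submod_sub[OF subC]] id_hom mC0 mT mCC mT cA(1) mT y(1)]) simp
 finally show "x:tmp R ?A T id id ` car (tp R ?C T)"
  using tensor_map_closed[OF jC id_hom mC0 mT mCC mT y(1)] by (rule image_eqI)
 qed
qed
then have "exact_seq3 ?C ?A ?Z id (%_. \<zero>\<^bsub>?A\<^esub>)"
 using ff mCC cA(1) mZ zh incl_hom(4)[OF submod_sub[OF subC]] unfolding faithfully_flat_def by blast
then have "j ` C0 = j ` A0" using cA(4) by (simp add: exact_seq3_def)
then have "C0 = A0" using inj_on_image_eq_iff[OF j, of C0 A0] C0A0 by simp
then show ?thesis using C0C aA0 by auto
qed

lemma descent_zero:
assumes "module R A" "a:car A" "tn A T a eT = \<zero>\<^bsub>tp R A T\<^esub>"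
shows "a = \<zero>\<^bsub>A\<^esub>"
proof -
have mZ: "module R (sub A {\<zero>\<^bsub>A\<^esub>})" by (rule sub_module[OF submodule_zero[OF assms(1)] assms(1)])
note mT = module_axiom
interpret A: module R A by fact
have zA: "{\<zero>\<^bsub>A\<^esub>} <= car A" by simp
interpret ZT: module R "tp R (sub A {\<zero>\<^bsub>A\<^esub>}) T" by (rule mod_tens[OF mZ mT])
have "a:{\<zero>\<^bsub>A\<^esub>}"
proof (rule descent_submodule[OF assms(1) submodule_zero[OF assms(1)] assms(2)])
 have "tmp R A T id id \<zero>\<^bsub>tp R (sub A {\<zero>\<^bsub>A\<^esub>}) T\<^esub> = \<zero>\<^bsub>tp R A T\<^esub>"
 by (rule mod_hom_zero_inv(1)[OF ZT.module_axioms mod_tens[OF assms(1) mT] tmap_hom[OF incl_hom(4)[OF zA] id_hom mZ mT assms(1) mT]])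
 then show "tn A T a eT:tmp R A T id id ` car (tp R (sub A {\<zero>\<^bsub>A\<^esub>}) T)"
 unfolding assms(3) by (intro image_eqI[where x = "\<zero>\<^bsub>tp R (sub A {\<zero>\<^bsub>A\<^esub>}) T\<^esub>"]) simp_all
qed
then show ?thesis by simp
qed

lemma descent_eq:
assumes "module R A" "a:car A" "b:car A" "tn A T a eT = tn A T b eT"
shows "a = b"
by (rule mod_hom_eq_zero_inj[OF assms(1) mod_tens[OF assms(1) module_axiom]
  lin_tens1[OF lin_id one_closed assms(1) module_axiom] _ assms(2,3,4)])
 (rule descent_zero[OF assms(1)])

text \<open>If \<open>c \<mapsto> c \<otimes> 1\<close> factors through \<open>\<iota> : C \<rightarrow> P\<close>, then \<open>\<iota>\<close> is injective; this property passes to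
tensor products and replaces flatness arguments for \<open>C\<close>.\<close>

definition split_after :: "('k, 'a, 'n) module_scheme => ('k, 'b, 'p) module_scheme => ('a => 'b) => bool"
where "split_after C P \<iota> \<longleftrightarrow> \<iota>:Hom R C P &
 (EX \<kappa>:Hom R P (tp R C T). ALL c:car C. \<kappa> (\<iota> c) = tn C T c eT)"

lemma split_inj:
assumes "module R C" "split_after C P \<iota>" "x:car C" "y:car C" "\<iota> x = \<iota> y"
shows "x = y"
proof -
obtain \<kappa> where "ALL c:car C. \<kappa> (\<iota> c) = tens R C T c eT"
 using assms(2) unfolding split_after_def by (elim conjE bexE)
from bspec[OF this assms(3)] bspec[OF this assms(4)] show ?thesis
 using descent_eq[OF assms(1,3,4)] assms(5) by simp
qed

lemma split_id: "module R C==>split_after C C id"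
unfolding split_after_def
by (intro conjI id_hom bexI[of _ "%c. tn C T c eT"] lin_tens1[OF lin_id] one_closed module_axiom) auto

text \<open>The two given maps produce an element of
  \<open>(C \<otimes> T) \<otimes> (C' \<otimes> T)\<close>, and multiplying the two
  \<open>T\<close> legs lands in \<open>(C \<otimes> C') \<otimes> T\<close>. On elements coming
  from \<open>C \<otimes> C'\<close> both legs are 1, and so is their product.\<close>

lemma split_tensor:
assumes m: "module R C" "module R P" "module R C'" "module R P'"
 and "split_after C P \<iota>" "split_after C' P' \<iota>'"
shows "split_after (tp R C C') (tp R P P') (tmp R P P' \<iota> \<iota>')"
proof -
note mT = module_axiom
obtain \<kappa> where \<iota>: "\<iota>:Hom R C P" and \<kappa>: "\<kappa>:Hom R P (tp R C T)"
 "!!c. c:car C==>\<kappa> (\<iota> c) = tn C T c eT"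
 using assms(5) unfolding split_after_def by (elim conjE bexE) simp
obtain \<kappa>' where \<iota>': "\<iota>':Hom R C' P'" and \<kappa>': "\<kappa>':Hom R P' (tp R C' T)"
 "!!c. c:car C'==>\<kappa>' (\<iota>' c) = tn C' T c eT"
 using assms(6) unfolding split_after_def by (elim conjE bexE) simp
let ?CC = "tp R C C'" and ?Q = "tp R (tp R C C') T"
define F where "F = (%p q. sw ?Q (\<kappa> p) (%c t. sw ?Q (\<kappa>' q) (%c' t'. tens R ?CC T (tens R C C' c c') (t ** t'))))"
define \<Psi> where "\<Psi> = (%w. sw ?Q w F)"
note l = lin hom_comp[OF \<kappa>(1)] hom_mem[OF \<kappa>(1)] hom_comp[OF \<kappa>'(1)] hom_mem[OF \<kappa>'(1)]
 hom_mem[OF \<iota>] hom_mem[OF \<iota>'] m mT one_closed rmult_hom lmult_hom m_closed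
have bil: "bilin R P P' ?Q F"
 unfolding F_def by (rule l | assumption)+
have \<Psi>: "\<Psi>:Hom R (tp R P P') ?Q"
 unfolding \<Psi>_def by (rule sw_mhom[OF bil]) (rule l | assumption)+
have in1: "(%z. tn ?CC T z eT):Hom R ?CC ?Q" by (rule l | assumption)+
have key: "\<Psi> (tmp R P P' \<iota> \<iota>' z) = tn ?CC T z eT" if "z:car ?CC" for z
proof (rule tens_heq[OF m(1,3) that hom_comp[OF \<Psi> tmap_hom[OF \<iota> \<iota>' m(1,3,2,4)]] in1])
 fix c a assume c: "c:car C" and a: "a:car C'"
 have "\<Psi> (tmp R P P' \<iota> \<iota>' (tn C C' c a)) = \<Psi> (tn P P' (\<iota> c) (\<iota>' a))"
 using tmap_tens[OF \<iota> \<iota>' m(1,3,2,4) c a] by simp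
 also have "... = F (\<iota> c) (\<iota>' a)"
 unfolding \<Psi>_def by (rule sw_tens[OF bil]) (rule l c a | assumption)+
 also have "... = sw ?Q (tn C T c eT) (%c t. sw ?Q (tn C' T a eT)
  (%c' t'. tn ?CC T (tn C C' c c') (t ** t')))"
 unfolding F_def \<kappa>(2)[OF c] \<kappa>'(2)[OF a] ..
 also have "... = sw ?Q (tn C' T a eT) (%c' t'. tn ?CC T (tn C C' c c') (eT ** t'))"
 by (rule sw_tens) (rule l c a | assumption)+
 also have "... = tn ?CC T (tn C C' c a) (eT ** eT)"
 by (rule sw_tens) (rule l c a | assumption)+
 finally show "\<Psi> (tmp R P P' \<iota> \<iota>' (tn C C' c a)) = tn ?CC T (tn C C' c a) eT" by simp
qed
show ?thesis
 unfolding split_after_def using \<Psi> key tmap_hom[OF \<iota> \<iota>' m(1,3,2,4)] by blast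
qed

end

section \<open>Algebras\<close>

lemma k_algebraI:
assumes "module R A" "bilin R A A A (%x y. x \<otimes>\<^bsub>A\<^esub> y)" "\<one>\<^bsub>A\<^esub>:car A"
 and "!!x y z. x:car A==>y:car A==>z:car A ==>
 x \<otimes>\<^bsub>A\<^esub> y \<otimes>\<^bsub>A\<^esub> z = x \<otimes>\<^bsub>A\<^esub> (y \<otimes>\<^bsub>A\<^esub> z)"
 and "!!x. x:car A==>\<one>\<^bsub>A\<^esub> \<otimes>\<^bsub>A\<^esub> x = x" "!!x. x:car A==>x \<otimes>\<^bsub>A\<^esub> \<one>\<^bsub>A\<^esub> = x"
shows "k_algebra R A"
proof -
interpret module R A by fact
have r: "ring A"
 by (rule ringI[OF modD(2)[OF assms(1)] monoidI])
 (use assms(2-6) in \<open>auto simp: bilin_def mod_hom_def\<close>)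
interpret A: ring A by (rule r)
show ?thesis
 by unfold_locales (use assms(2) in \<open>auto simp: bilin_def mod_hom_def\<close>)
qed

lemma (in k_algebra) bilin_mult: "bilin R M M M (%x y. x \<otimes>\<^bsub>M\<^esub> y)"
by (rule bilinI) (rule rmult_hom lmult_hom lin_id | assumption)+

lemma opp_simps [simp]:
"car (opp A) = car A" "zero (opp A) = zero A" "add (opp A) = add A" "one (opp A) = one A"
"smult (opp A) = smult A" "x \<otimes>\<^bsub>opp A\<^esub> y = y \<otimes>\<^bsub>A\<^esub> x" "opp (opp A) = A"
by (simp_all add: opp_def)

text \<open>\<open>T\<close> and \<open>opp T\<close>, or an algebra and the bialgebra made from it,
  give literally the same cosets in tensor products. Linear calculations can therefore be done with
  plain \<open>tensor R T T\<close>, and only products remember the opposite structure.\<close>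

definition same_module :: "('k, 'a, 'm) module_scheme => ('k, 'a, 'n) module_scheme => bool"
where "same_module A B \<longleftrightarrow> car A = car B & add A = add B & zero A = zero B & smult A = smult B"

lemma same_refl: "same_module A A" and same_opp: "same_module (opp A) A"
by (auto simp: same_module_def)

lemma same_tensor_group:
"same_module A A'==>same_module B B'==>tensor_group R A B = tensor_group R A' B'"
and same_tens: "same_module A A'==>same_module B B'==>tens R A B = tens R A' B'"
unfolding tensor_group_def tensor_null_def tensor_rels_def tens_def same_module_def fun_eq_iff
by simp_all

lemma same_tensor:
"same_module A A'==>same_module B B'==>same_module (tp R A B) (tp R A' B')"
using same_tensor_group[of A A' B B' R] same_tens[of A A' B B' R]
by (simp add: same_module_def tsimps fun_eq_iff)

lemma same_mhom: "same_module A A'==>same_module B B'==>Hom R A B = Hom R A' B'"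
by (simp add: mod_hom_def same_module_def)

lemma same_module_module: "same_module A B==>module R A==>module R B"
proof -
assume s: "same_module A B" and "module R A"
then interpret A: module R A by simp
have e: "car B = car A" "add B = add A" "zero B = zero A" "smult B = smult A"
 using s by (simp_all add: same_module_def)
show ?thesis
proof (rule moduleI[OF A.is_cring abelian_groupI], unfold e)
 show "!!x. x:car A==>EX y:car A. y \<oplus>\<^bsub>A\<^esub> x = \<zero>\<^bsub>A\<^esub>" using A.l_neg A.a_inv_closed by blast
qed (simp_all add: A.a_ac A.smult_l_distr A.smult_r_distr A.smult_assoc1)
qed

lemma same_sw: "same_module A B==>sw A U f = sw B U f"
unfolding sw_def
by (simp add: formal_eval_def same_module_def finprod_def int_pow_def nat_pow_def m_inv_def Let_def cong: if_cong)

lemma group_lift_sw: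
assumes "module R A" "module R B" "module R M" "module R N" "bilin R A B (tp R M N) f" "U:car (tp R A B)"
shows "group_lift (tensor_group R M N) f U = sw (tp R M N) U f"
proof -
interpret AB: two_modules R A B by (rule two_modulesI; fact)
interpret MN: two_modules R M N by (rule two_modulesI; fact)
have b: "balanced R A B (tensor_group R M N) f"
 using bilin_balanced[OF assms(5)] by (simp add: balanced_def tsimps)
have "(%U. sw (tp R M N) U f):hom (tensor_group R A B) (tensor_group R M N)"
 using mod_hom_hom[OF sw_mhom[OF assms(5,1,2) mod_tens[OF assms(3,4)]]] by (simp add: hom_def tsimps)
then show ?thesis
 using AB.tensor_group_hom_eq[OF AB.group_lift_hom[OF MN.TG.comm_group_axioms b], of "%U. sw (tp R M N) U f" U]
 AB.group_lift_tens[OF MN.TG.comm_group_axioms b] sw_tens[OF assms(5) _ _ assms(1,2) mod_tens[OF assms(3,4)]]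
 assms(6) by (simp add: tsimps)
qed

lemma tensor_mult:
"X \<otimes>\<^bsub>tp R M N\<^esub> Y = group_lift (tensor_group R M N) (%x y. group_lift (tensor_group R M N)
  (%x' y'. tens R M N (x \<otimes>\<^bsub>M\<^esub> x') (y \<otimes>\<^bsub>N\<^esub> y')) Y) X"
by (simp add: tensor_def Let_def)

lemma bilin_cong:
assumes "!!x y. x:car A==>y:car B==>f x y = g x y" "module R A" "module R B"
shows "bilin R A B P f \<longleftrightarrow> bilin R A B P g"
unfolding bilin_def
by (intro arg_cong2[where f = "(&)"] ball_cong refl mod_hom_cong assms)

locale two_algebras = A: k_algebra R A + B: k_algebra R B
for R :: "('k, 'r) ring_scheme" and A :: "('k, 'a, 'm) module_scheme" and B :: "('k, 'b, 'n) module_scheme"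
begin

lemmas mods = A.module_axiom B.module_axiom
lemmas l = lin A.rmult_hom A.lmult_hom B.rmult_hom B.lmult_hom A.m_closed B.m_closed A.one_closed B.one_closed mods

lemma tensor_mult_sw:
assumes "X:car (tp R A B)" "Y:car (tp R A B)"
shows "X \<otimes>\<^bsub>tp R A B\<^esub> Y = sw (tp R A B) X (%x y. sw (tp R A B) Y
  (%x' y'. tens R A B (x \<otimes>\<^bsub>A\<^esub> x') (y \<otimes>\<^bsub>B\<^esub> y')))"
proof -
let ?G = "%x y. group_lift (tensor_group R A B) (%x' y'. tens R A B (x \<otimes>\<^bsub>A\<^esub> x') (y \<otimes>\<^bsub>B\<^esub> y')) Y"
let ?S = "%x y. sw (tp R A B) Y (%x' y'. tens R A B (x \<otimes>\<^bsub>A\<^esub> x') (y \<otimes>\<^bsub>B\<^esub> y'))"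
have eq: "?G x y = ?S x y" if "x:car A" "y:car B" for x y
 by (rule group_lift_sw[OF mods mods _ assms(2)]) (rule l that | assumption)+
have S: "bilin R A B (tp R A B) ?S" by (rule l assms | assumption)+
have G: "bilin R A B (tp R A B) ?G"
 using S by (simp only: bilin_cong[OF eq mods])
show ?thesis
 unfolding tensor_mult group_lift_sw[OF mods mods G assms(1)]
 by (rule sw_cong[OF refl assms(1) mods mod_tens[OF mods] eq bilin_in[OF G]])
qed

lemma bilin_tensor_mult: "bilin R (tp R A B) (tp R A B) (tp R A B)
(%X Y. sw (tp R A B) X (%x y. sw (tp R A B) Y (%x' y'. tens R A B (x \<otimes>\<^bsub>A\<^esub> x') (y \<otimes>\<^bsub>B\<^esub> y'))))"
by (rule l | assumption)+

lemma tens_mult: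
assumes "x:car A" "y:car B" "x':car A" "y':car B"
shows "tens R A B x y \<otimes>\<^bsub>tp R A B\<^esub> tens R A B x' y' = tens R A B (x \<otimes>\<^bsub>A\<^esub> x') (y \<otimes>\<^bsub>B\<^esub> y')"
proof -
have "tens R A B x y \<otimes>\<^bsub>tp R A B\<^esub> tens R A B x' y' =
 sw (tp R A B) (tens R A B x y) (%x y. sw (tp R A B) (tens R A B x' y') (%x' y'. tens R A B (x \<otimes>\<^bsub>A\<^esub> x') (y \<otimes>\<^bsub>B\<^esub> y')))"
 by (rule tensor_mult_sw) (rule l assms)+
also have "... = sw (tp R A B) (tens R A B x' y') (%x' y'. tens R A B (x \<otimes>\<^bsub>A\<^esub> x') (y \<otimes>\<^bsub>B\<^esub> y'))"
 by (rule sw_tens) (rule l assms | assumption)+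
also have "... = tens R A B (x \<otimes>\<^bsub>A\<^esub> x') (y \<otimes>\<^bsub>B\<^esub> y')"
 by (rule sw_tens) (rule l assms | assumption)+
finally show ?thesis .
qed

lemma bilin_mult_tensor: "bilin R (tp R A B) (tp R A B) (tp R A B) (%X Y. X \<otimes>\<^bsub>tp R A B\<^esub> Y)"
proof -
have m: "module R (tp R A B)" by (rule mod_tens[OF mods])
show ?thesis
 using bilin_tensor_mult by (simp only: bilin_cong[OF tensor_mult_sw m m])
qed

lemma tensor_algebra: "k_algebra R (tp R A B)"
proof -
have m: "module R (tp R A B)" by (rule mod_tens[OF mods])
have h1: "(%X. X \<otimes>\<^bsub>tp R A B\<^esub> Y):Hom R (tp R A B) (tp R A B)" if "Y:car (tp R A B)" for Y
 using bilin_mult_tensor that by (simp add: bilin_def)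
have h2: "(%Y. X \<otimes>\<^bsub>tp R A B\<^esub> Y):Hom R (tp R A B) (tp R A B)" if "X:car (tp R A B)" for X
 using bilin_mult_tensor that by (simp add: bilin_def)
note cl = hom_mem[OF h1]
have one: "\<one>\<^bsub>tp R A B\<^esub>:car (tp R A B)" unfolding tsimps(4) by (rule l)+
show ?thesis
proof (rule k_algebraI[OF m bilin_mult_tensor one])
 fix X Y Z assume X: "X:car (tp R A B)" and Y: "Y:car (tp R A B)" and Z: "Z:car (tp R A B)"
 show "X \<otimes>\<^bsub>tp R A B\<^esub> Y \<otimes>\<^bsub>tp R A B\<^esub> Z = X \<otimes>\<^bsub>tp R A B\<^esub> (Y \<otimes>\<^bsub>tp R A B\<^esub> Z)"
 proof (rule tens_heq[OF mods X hom_comp[OF h1[OF Z] h1[OF Y]] h1[OF cl[OF Z Y]]])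
 fix x y assume x: "x:car A" and y: "y:car B"
 have xy: "tens R A B x y:car (tp R A B)" by (rule l x y)+
 show "tens R A B x y \<otimes>\<^bsub>tp R A B\<^esub> Y \<otimes>\<^bsub>tp R A B\<^esub> Z = tens R A B x y \<otimes>\<^bsub>tp R A B\<^esub> (Y \<otimes>\<^bsub>tp R A B\<^esub> Z)"
 proof (rule tens_heq[OF mods Y hom_comp[OF h1[OF Z] h2[OF xy]] hom_comp[OF h2[OF xy] h1[OF Z]]])
  fix x' y' assume x': "x':car A" and y': "y':car B"
  have xy': "tens R A B x' y':car (tp R A B)" by (rule l x' y')+
  show "tens R A B x y \<otimes>\<^bsub>tp R A B\<^esub> tens R A B x' y' \<otimes>\<^bsub>tp R A B\<^esub> Z =
   tens R A B x y \<otimes>\<^bsub>tp R A B\<^esub> (tens R A B x' y' \<otimes>\<^bsub>tp R A B\<^esub> Z)"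
  proof (rule tens_heq[OF mods Z h2[OF cl[OF xy' xy]] hom_comp[OF h2[OF xy] h2[OF xy']]])
  fix x'' y'' assume x'': "x'':car A" and y'': "y'':car B"
  show "tens R A B x y \<otimes>\<^bsub>tp R A B\<^esub> tens R A B x' y' \<otimes>\<^bsub>tp R A B\<^esub> tens R A B x'' y'' =
   tens R A B x y \<otimes>\<^bsub>tp R A B\<^esub> (tens R A B x' y' \<otimes>\<^bsub>tp R A B\<^esub> tens R A B x'' y'')"
   using x y x' y' x'' y'' by (simp add: tens_mult A.m_assoc B.m_assoc)
  qed
 qed
 qed
next
 fix X assume X: "X:car (tp R A B)"
 show "\<one>\<^bsub>tp R A B\<^esub> \<otimes>\<^bsub>tp R A B\<^esub> X = X"
 by (rule tens_heq[OF mods X h2[OF one] lin_id]) (simp add: tsimps(4) tens_mult)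
 show "X \<otimes>\<^bsub>tp R A B\<^esub> \<one>\<^bsub>tp R A B\<^esub> = X"
 by (rule tens_heq[OF mods X h1[OF one] lin_id]) (simp add: tsimps(4) tens_mult)
qed
qed

end

lemma tensor_k_algebra: "k_algebra R A==>k_algebra R B==>k_algebra R (tp R A B)"
by (rule two_algebras.tensor_algebra) (rule two_algebras.intro)

lemma opp_algebra: "k_algebra R A==>k_algebra R (opp A)"
proof -
assume "k_algebra R A"
then interpret A: k_algebra R A .
show ?thesis
proof (rule k_algebraI)
 show "module R (opp A)" by (rule same_module_module[OF _ A.module_axiom]) (simp add: same_module_def)
 show "bilin R (opp A) (opp A) (opp A) (%x y. x \<otimes>\<^bsub>opp A\<^esub> y)"
 using A.bilin_mult by (auto simp: bilin_def mod_hom_def)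
qed (auto simp: A.m_assoc)
qed

lemma sub_algebra:
assumes "k_algebra R A" "submodule C R A" "\<one>\<^bsub>A\<^esub>:C" "!!x y. x:C==>y:C==>x \<otimes>\<^bsub>A\<^esub> y:C"
shows "k_algebra R (sub A C)"
proof -
interpret A: k_algebra R A by fact
note Cs = subsetD[OF submod_sub[OF assms(2)]]
show ?thesis
proof (rule k_algebraI)
 show "module R (sub A C)" by (rule sub_module[OF assms(2) A.module_axiom])
 show "bilin R (sub A C) (sub A C) (sub A C) (%x y. x \<otimes>\<^bsub>sub A C\<^esub> y)"
 using A.bilin_mult assms(4) Cs by (auto simp: bilin_def mod_hom_def)
qed (use assms(3,4) Cs in \<open>auto simp: A.m_assoc\<close>)
qed

lemma alg_homI:
assumes "f:Hom R A B" "!!x y. x:car A==>y:car A==>f (x \<otimes>\<^bsub>A\<^esub> y) = f x \<otimes>\<^bsub>B\<^esub> f y"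
 "f \<one>\<^bsub>A\<^esub> = \<one>\<^bsub>B\<^esub>"
shows "f:alg_hom R A B"
using assms by (auto simp: alg_hom_def mod_hom_def ring_hom_def)

lemma alg_homD:
assumes "f:alg_hom R A B"
shows "f:Hom R A B" "!!x y. x:car A==>y:car A==>f (x \<otimes>\<^bsub>A\<^esub> y) = f x \<otimes>\<^bsub>B\<^esub> f y"
 "f \<one>\<^bsub>A\<^esub> = \<one>\<^bsub>B\<^esub>"
using assms by (auto simp: alg_hom_def ring_hom_def)

lemma tensor_map_alg_hom:
assumes "k_algebra R A" "k_algebra R B" "k_algebra R A'" "k_algebra R B'" "f:alg_hom R A A'" "g:alg_hom R B B'"
shows "tmp R A' B' f g:alg_hom R (tp R A B) (tp R A' B')"
proof -
interpret P: two_algebras R A B by (rule two_algebras.intro; fact)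
interpret Q: two_algebras R A' B' by (rule two_algebras.intro; fact)
interpret PA: k_algebra R "tp R A B" by (rule P.tensor_algebra)
interpret QA: k_algebra R "tp R A' B'" by (rule Q.tensor_algebra)
note f = alg_homD[OF assms(5)] and g = alg_homD[OF assms(6)]
note h = tmap_hom[OF f(1) g(1) P.mods Q.mods]
note t = tmap_tens[OF f(1) g(1) P.mods Q.mods]
note fc = hom_mem[OF f(1)] hom_mem[OF g(1)]
let ?F = "tmp R A' B' f g"
show ?thesis
proof (rule alg_homI[OF h])
 show "?F \<one>\<^bsub>tp R A B\<^esub> = \<one>\<^bsub>tp R A' B'\<^esub>" using t f g by (simp add: tsimps(4))
 fix X Y assume X: "X:car (tp R A B)" and Y: "Y:car (tp R A B)"
 show "?F (X \<otimes>\<^bsub>tp R A B\<^esub> Y) = ?F X \<otimes>\<^bsub>tp R A' B'\<^esub> ?F Y"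
 proof (rule tens_heq[OF P.mods X hom_comp[OF h PA.rmult_hom[OF Y lin_id]] QA.rmult_hom[OF hom_mem[OF h Y] h]])
 fix x y assume x: "x:car A" and y: "y:car B"
 have xy: "tens R A B x y:car (tp R A B)" by (rule P.l x y)+
 show "?F (tens R A B x y \<otimes>\<^bsub>tp R A B\<^esub> Y) = ?F (tens R A B x y) \<otimes>\<^bsub>tp R A' B'\<^esub> ?F Y"
 proof (rule tens_heq[OF P.mods Y hom_comp[OF h PA.lmult_hom[OF xy lin_id]] QA.lmult_hom[OF hom_mem[OF h xy] h]])
  fix x' y' assume x': "x':car A" and y': "y':car B"
  show "?F (tens R A B x y \<otimes>\<^bsub>tp R A B\<^esub> tens R A B x' y') = ?F (tens R A B x y) \<otimes>\<^bsub>tp R A' B'\<^esub> ?F (tens R A B x' y')"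
  using x y x' y' by (simp add: P.tens_mult Q.tens_mult t fc f(2) g(2))
 qed
 qed
qed
qed

lemma tassoc_hom [lin]:
assumes "module R A" "module R B" "module R C"
shows "tassoc R A B C:Hom R (tp R (tp R A B) C) (tp R A (tp R B C))"
 and "U:car (tp R (tp R A B) C)==>tassoc R A B C U = sw (tp R A (tp R B C)) U
 (%w z. sw (tp R A (tp R B C)) w (%x y. tens R A (tp R B C) x (tens R B C y z)))"
proof -
let ?P = "tp R A (tp R B C)"
let ?L = "%w z. tensor_lift ?P (%x y. tens R A (tp R B C) x (tens R B C y z)) w"
let ?S = "%w z. sw ?P w (%x y. tens R A (tp R B C) x (tens R B C y z))"
note m = assms mod_tens[OF assms(1,2)] mod_tens[OF assms(1) mod_tens[OF assms(2,3)]]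
have eq: "?L w z = ?S w z" if "w:car (tp R A B)" "z:car C" for w z
 by (rule tlift_sw[OF assms(1,2) m(5) that(1)]) (rule lin that m | assumption)+
have S: "bilin R (tp R A B) C ?P ?S" by (rule lin m | assumption)+
have L: "bilin R (tp R A B) C ?P ?L" using S by (simp only: bilin_cong[OF eq m(4,3)])
show "tassoc R A B C:Hom R (tp R (tp R A B) C) (tp R A (tp R B C))"
 unfolding tassoc_def Let_def by (rule tensor_lift_hom[OF L m(4,3,5)])
show "tassoc R A B C U = sw ?P U ?S" if "U:car (tp R (tp R A B) C)"
 unfolding tassoc_def Let_def tlift_sw[OF m(4,3,5) that L]
 by (rule sw_cong[OF refl that m(4,3,5) eq bilin_in[OF L]])
qed

lemma tassoc_tens:
assumes "module R A" "module R B" "module R C" "x:car A" "y:car B" "z:car C"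
shows "tassoc R A B C (tens R (tp R A B) C (tens R A B x y) z) = tens R A (tp R B C) x (tens R B C y z)"
proof -
let ?P = "tp R A (tp R B C)"
have "tassoc R A B C (tens R (tp R A B) C (tens R A B x y) z) =
 sw ?P (tens R (tp R A B) C (tens R A B x y) z) (%w z. sw ?P w (%x y. tens R A (tp R B C) x (tens R B C y z)))"
 by (rule tassoc_hom(2)[OF assms(1-3)]) (rule lin assms)+
also have "... = sw ?P (tens R A B x y) (%x y. tens R A (tp R B C) x (tens R B C y z))"
 by (rule sw_tens) (rule lin assms | assumption)+
also have "... = tens R A (tp R B C) x (tens R B C y z)"
 by (rule sw_tens) (rule lin assms | assumption)+
finally show ?thesis .
qed

section \<open>Hopf algebras on subalgebras\<close>

lemma self_module_simps [simp]:
"car (self_module R) = car R" "mult (self_module R) = mult R" "one (self_module R) = one R"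
"zero (self_module R) = zero R" "add (self_module R) = add R" "smult (self_module R) = mult R"
by (simp_all add: self_module_def)

lemma self_module_module: "cring R==>module R (self_module R)"
proof -
assume "cring R"
then interpret R: cring R .
show ?thesis
 by (rule moduleI[OF \<open>cring R\<close> abelian_groupI])
 (auto simp: R.a_ac R.m_ac R.l_distr R.r_distr intro!: bexI[of _ "\<ominus>\<^bsub>R\<^esub> _"] R.r_neg)
qed

lemma make_bialg_simps [simp]:
"car (make_bialg A \<D> \<e>) = car A" "mult (make_bialg A \<D> \<e>) = mult A" "one (make_bialg A \<D> \<e>) = one A"
"zero (make_bialg A \<D> \<e>) = zero A" "add (make_bialg A \<D> \<e>) = add A" "smult (make_bialg A \<D> \<e>) = smult A"
"comult (make_bialg A \<D> \<e>) = \<D>" "counit (make_bialg A \<D> \<e>) = \<e>"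
by (simp_all add: make_bialg_def)

text \<open>Unlike \<open>same_module\<close> this relation also fixes products and units, which
  makes the tensor products equal as records, not only as modules.\<close>

definition same_algebra :: "('k, 'a, 'm) module_scheme => ('k, 'a, 'n) module_scheme => bool"
where "same_algebra A B \<longleftrightarrow> same_module A B & mult A = mult B & one A = one B"

lemma same_algebra_make_bialg: "same_algebra (make_bialg A \<D> \<e>) A"
by (simp add: same_algebra_def same_module_def)

lemma same_algebra_refl: "same_algebra A A"
by (simp add: same_algebra_def same_module_def)

lemma same_algebra_sym: "same_algebra A B==>same_algebra B A"
by (simp add: same_algebra_def same_module_def)

lemma same_algebra_module: "same_algebra A B==>same_module A B"
by (simp add: same_algebra_def)

lemma same_algebra_tensor:
"same_algebra A A'==>same_algebra B B'==>tp R A B = tp R A' B'"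
using same_tensor_group[of A A' B B' R] same_tens[of A A' B B' R]
by (simp add: same_algebra_def tensor_def) (simp add: same_module_def)

lemma same_algebra_alg_hom: "same_algebra A A'==>same_algebra B B'==>alg_hom R A B = alg_hom R A' B'"
by (simp add: alg_hom_def same_mhom same_algebra_def) (simp add: ring_hom_def same_module_def mod_hom_def)

lemma same_algebra_k_algebra: "same_algebra A B==>k_algebra R A==>k_algebra R B"
proof -
assume s: "same_algebra A B" and "k_algebra R A"
then interpret A: k_algebra R A by simp
have e: "car B = car A" "add B = add A" "smult B = smult A" "mult B = mult A" "one B = one A"
 using s by (simp_all add: same_algebra_def same_module_def)
show ?thesis
 by (rule k_algebraI[OF same_module_module[OF same_algebra_module[OF s] A.module_axiom]])
 (use A.bilin_mult in \<open>simp_all add: e bilin_def mod_hom_def A.m_assoc\<close>)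
qed

text \<open>Descent applied to the base ring as a module over itself, where
  \<open>r \<otimes> 1 = 1 \<otimes> r 1\<close>. It makes the counit, defined by
  \<open>THE\<close>, well defined.\<close>

lemma (in ff_algebra) unit_inj:
assumes "r:car R" "s:car R" "r *s eT = s *s eT"
shows "r = s"
proof -
let ?k = "self_module R"
have mk: "module R ?k" by (rule self_module_module[OF modD(1)[OF module_axiom]])
have *: "tn ?k T r eT = tn ?k T \<one>\<^bsub>R\<^esub> (r *s eT)" if "r:car R" for r
 using tensor_smult2[OF mk module_axiom that, of "\<one>\<^bsub>R\<^esub>" "eT"] that by simp
show ?thesis
 by (rule descent_eq[OF mk]) (use assms in \<open>simp_all add: *\<close>)
qed

text \<open>The common shape of \<open>Hr\<close>, \<open>Hl\<close> and \<open>L_hopf\<close>.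
  \<open>A\<close> is the ambient algebra, \<open>D\<close> and \<open>N\<close> are linear on all
  of \<open>A\<close>, and \<open>\<D>\<close>, \<open>\<e>\<close> are their corestrictions to
  \<open>C\<close>. The counit laws are stated in \<open>A \<otimes> T\<close> with \<open>N\<close>
  in place of \<open>\<e>\<close>, because \<open>N\<close>, unlike \<open>\<e>\<close>, makes sense
  on the whole ambient algebra.\<close>

locale sub_bialgebra = ff_algebra R T + A: k_algebra R A
for R :: "('k, 'r) ring_scheme" and T :: "('k, 't, 'm) module_scheme" and A :: "('k, 'a) module" +
fixes C :: "'a set" and D :: "'a => ('a, 'a) tensor" and N :: "'a => 't" and \<D> and \<e> :: "'a => 'k"
assumes C_sub: "submodule C R A" and C_one: "\<one>\<^bsub>A\<^esub>:C"
 and C_mult: "!!x y. x:C==>y:C==>x \<otimes>\<^bsub>A\<^esub> y:C"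
 and C_split: "split_after (sub A C) A id"
 and D_hom: "D:Hom R A (tp R A A)"
 and D_one: "D \<one>\<^bsub>A\<^esub> = tens R A A \<one>\<^bsub>A\<^esub> \<one>\<^bsub>A\<^esub>"
 and D_mult: "!!x y. x:C==>y:C==>D (x \<otimes>\<^bsub>A\<^esub> y) = D x \<otimes>\<^bsub>tp R A A\<^esub> D y"
 and D_coassoc: "!!c. c:C ==>
 sw (tp R A (tp R A A)) (D c) (%x y. sw (tp R A (tp R A A)) (D x) (%u v. tens R A (tp R A A) u (tens R A A v y))) =
 sw (tp R A (tp R A A)) (D c) (%x y. tens R A (tp R A A) x (D y))"
 and \<D>_closed: "!!c. c:C==>\<D> c:car (tp R (sub A C) (sub A C))"
 and \<D>_incl: "!!c. c:C==>tmp R A A id id (\<D> c) = D c"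
 and N_hom: "N:Hom R A T" and N_one: "N \<one>\<^bsub>A\<^esub> = \<one>\<^bsub>T\<^esub>"
 and N_mult: "!!x y. x:C==>y:C==>N (x \<otimes>\<^bsub>A\<^esub> y) = N x \<otimes>\<^bsub>T\<^esub> N y"
 and \<e>_closed: "!!c. c:C==>\<e> c:car R" and N_\<e>: "!!c. c:C==>N c = \<e> c \<odot>\<^bsub>T\<^esub> \<one>\<^bsub>T\<^esub>"
 and counit_l: "!!c. c:C==>sw (tp R A T) (D c) (%x y. tens R A T y (N x)) = tens R A T c \<one>\<^bsub>T\<^esub>"
 and counit_r: "!!c. c:C==>sw (tp R A T) (D c) (%x y. tens R A T x (N y)) = tens R A T c \<one>\<^bsub>T\<^esub>"
begin

abbreviation "B == sub A C"
abbreviation "H == make_bialg B \<D> \<e>"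

lemma Cs: "C <= car A" by (rule submod_sub[OF C_sub])
lemma CA: "x:C==>x:car A" using Cs by blast
lemma mB: "module R B" by (rule sub_module[OF C_sub A.module_axiom])
lemma B_alg: "k_algebra R B" by (rule sub_algebra[OF A.k_algebra_axioms C_sub C_one C_mult])

lemmas mT = module_axiom
lemmas mA = A.module_axiom
lemmas l = lin mB mT mA one_closed A.one_closed rmult_hom lmult_hom m_closed A.rmult_hom A.lmult_hom A.m_closed
hom_comp[OF D_hom] hom_mem[OF D_hom] hom_comp[OF N_hom] hom_mem[OF N_hom] CA

lemma incl: "id:Hom R B A" by (rule incl_hom(4)[OF Cs])

lemma incl2: "tmp R A A id id:Hom R (tp R B B) (tp R A A)"
by (rule tmap_hom[OF incl incl mB mB mA mA])

lemma split2: "split_after (tp R B B) (tp R A A) (tmp R A A id id)"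
by (rule split_tensor[OF mB mA mB mA C_split C_split])

text \<open>From here on, identities for the corestricted comultiplication are tested after
  inclusion into tensor powers of \<open>A\<close>, where they concern \<open>D\<close>.\<close>

lemma inj2: "x:car (tp R B B)==>y:car (tp R B B) ==>
 tmp R A A id id x = tmp R A A id id y==>x = y"
by (rule split_inj[OF mod_tens[OF mB mB] split2])

lemma inj3: "x:car (tp R B (tp R B B))==>y:car (tp R B (tp R B B)) ==>
 tmp R A (tp R A A) id (tmp R A A id id) x = tmp R A (tp R A A) id (tmp R A A id id) y==>x = y"
by (rule split_inj[OF mod_tens[OF mB mod_tens[OF mB mB]]
 split_tensor[OF mB mA mod_tens[OF mB mB] mod_tens[OF mA mA] C_split split2]])

lemma incl2_alg: "tmp R A A id id:alg_hom R (tp R B B) (tp R A A)"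
proof -
have "id:alg_hom R B A" by (rule alg_homI[OF incl]) auto
then show ?thesis
 by (intro tensor_map_alg_hom B_alg A.k_algebra_axioms)
qed

lemma \<D>_hom: "\<D>:Hom R B (tp R B B)"
proof -
interpret BB: module R "tp R B B" by (rule mod_tens[OF mB mB])
interpret B: module R B by (rule mB)
note b = B.a_closed B.smult_closed
show ?thesis
proof (rule mod_homI)
 show "\<D> (x \<oplus>\<^bsub>B\<^esub> y) = \<D> x \<oplus>\<^bsub>tp R B B\<^esub> \<D> y" if "x:car B" "y:car B" for x y
 by (rule inj2) (use that b(1)[of x y] \<D>_closed \<D>_incl mod_hom_add[OF incl2] mod_hom_add[OF D_hom] CA in simp_all)
 show "\<D> (r \<odot>\<^bsub>B\<^esub> x) = r \<odot>\<^bsub>tp R B B\<^esub> \<D> x" if "r:car R" "x:car B" for r x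
 by (rule inj2) (use that b(2)[of r x] \<D>_closed \<D>_incl hom_smult[OF incl2] hom_smult[OF D_hom] CA in simp_all)
qed (use \<D>_closed in simp)
qed

lemma \<D>_alg: "\<D>:alg_hom R B (tp R B B)"
proof -
interpret BB: k_algebra R "tp R B B" by (rule tensor_k_algebra[OF B_alg B_alg])
show ?thesis
proof (rule alg_homI[OF \<D>_hom])
 show "\<D> (x \<otimes>\<^bsub>B\<^esub> y) = \<D> x \<otimes>\<^bsub>tp R B B\<^esub> \<D> y" if "x:car B" "y:car B" for x y
 by (rule inj2) (use that C_mult \<D>_closed \<D>_incl alg_homD(2)[OF incl2_alg] D_mult in simp_all)
 show "\<D> \<one>\<^bsub>B\<^esub> = \<one>\<^bsub>tp R B B\<^esub>"
 by (rule inj2) (use BB.one_closed alg_homD(3)[OF incl2_alg] in \<open>simp_all add: C_one \<D>_closed \<D>_incl D_one tsimps(4)\<close>)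
qed
qed

lemma \<e>_alg: "\<e>:alg_hom R B (self_module R)"
proof -
interpret B: k_algebra R B by (rule B_alg)
show ?thesis
proof (rule alg_homI)
 show "\<e>:Hom R B (self_module R)"
 proof (rule mod_homI)
 show "\<e> (x \<oplus>\<^bsub>B\<^esub> y) = \<e> x \<oplus>\<^bsub>self_module R\<^esub> \<e> y" if "x:car B" "y:car B" for x y
  using that B.a_closed[OF that] \<e>_closed N_\<e>[symmetric] mod_hom_add[OF N_hom] CA
  by (intro unit_inj) (simp_all add: smult_l_distr)
 show "\<e> (r \<odot>\<^bsub>B\<^esub> x) = r \<odot>\<^bsub>self_module R\<^esub> \<e> x" if "r:car R" "x:car B" for r x
  using that B.smult_closed[OF that] \<e>_closed N_\<e>[symmetric] hom_smult[OF N_hom] CA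
  by (intro unit_inj) (simp_all add: smult_assoc1)
 qed (use \<e>_closed in simp)
 show "\<e> (x \<otimes>\<^bsub>B\<^esub> y) = \<e> x \<otimes>\<^bsub>self_module R\<^esub> \<e> y" if "x:car B" "y:car B" for x y
 proof (rule unit_inj)
 have xy: "x:C" "y:C" using that by auto
 have "\<e> (x \<otimes>\<^bsub>A\<^esub> y) *s eT = (\<e> x *s eT) ** (\<e> y *s eT)"
  using N_mult[OF xy] N_\<e> xy C_mult by simp
 also have "... = (\<e> x \<otimes>\<^bsub>R\<^esub> \<e> y) *s eT"
  using \<e>_closed xy by (simp add: smult_assoc_l smult_assoc1)
 finally show "\<e> (x \<otimes>\<^bsub>B\<^esub> y) *s eT = (\<e> x \<otimes>\<^bsub>self_module R\<^esub> \<e> y) *s eT" by simp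
 qed (use that \<e>_closed C_mult in simp_all)
 show "\<e> \<one>\<^bsub>B\<^esub> = \<one>\<^bsub>self_module R\<^esub>"
 by (rule unit_inj) (use \<e>_closed C_one N_\<e>[OF C_one] N_one in simp_all)
qed
qed

lemma sw_D:
assumes "c:C" "bilin R A A P F" "module R P"
shows "sw P (D c) F = sw P (\<D> c) F"
proof -
have Dc: "D c = sw (tp R A A) (\<D> c) (%x y. tn A A (id x) (id y))"
 unfolding \<D>_incl[OF assms(1), symmetric]
 by (rule tensor_map_sw[OF incl incl mB mB mA mA \<D>_closed[OF assms(1)]])
have "sw P (D c) F = sw P (\<D> c) (%x y. sw P (tn A A (id x) (id y)) F)"
 unfolding Dc
 by (rule sw_hom[OF sw_mhom[OF assms(2) mA mA assms(3)] \<D>_closed[OF assms(1)]])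
 (auto intro!: tens_in mod_tens mA mB assms(3) CA)
also have "... = sw P (\<D> c) F"
 by (rule sw_cong[OF refl \<D>_closed[OF assms(1)] mB mB assms(3)])
 (use sw_tens[OF assms(2) _ _ mA mA assms(3)] bilin_in[OF assms(2)] CA in auto)
finally show ?thesis .
qed

lemma mH: "module R H"
by (rule same_module_module[OF _ mB]) (simp add: same_module_def)

lemma same_H: "same_algebra H B" by (rule same_algebra_make_bialg)

lemma H_tensor:
"tp R H H = tp R B B" "tn H H = tn B B"
"tp R H (tp R B B) = tp R B (tp R B B)" "tn H (tp R B B) = tn B (tp R B B)"
"tp R (tp R B B) H = tp R (tp R B B) B" "tn (tp R B B) H = tn (tp R B B) B"
by (intro same_algebra_tensor same_tens same_algebra_module same_H same_algebra_refl)+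

lemma sw_H: "sw H = sw B"
by (intro ext same_sw same_algebra_module same_H)

lemma tensor_lift_H:
assumes "U:car (tp R B B)" "bilin R B B B F"
shows "tensor_lift H F U = sw B U F"
proof -
have "bilin R B B H F" using assms(2) by (simp add: bilin_def mod_hom_def)
from tlift_sw[OF mB mB mH assms(1) this] show ?thesis by (simp add: sw_H)
qed

lemma sw_\<D>_incl:
assumes "c:C" "bilin R A A A F" "!!x y. x:C==>y:C==>F x y:C"
shows "sw B (\<D> c) F = sw A (D c) F"
proof -
have "id (sw B (\<D> c) F) = sw A (\<D> c) (%x y. id (F x y))"
 by (rule sw_hom[OF incl \<D>_closed[OF assms(1)]]) (use assms(3) mB mA in auto)
then show ?thesis using sw_D[OF assms(1,2) mA] by simp
qed

text \<open>After the injective inclusion \<open>?I3\<close> the two sides become the two sides of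
  \<open>D_coassoc\<close>.\<close>

lemma comult_coassoc:
assumes c: "c:C"
shows "tassoc R B B B (tmp R (tp R B B) B \<D> id (\<D> c)) = tmp R B (tp R B B) id \<D> (\<D> c)"
proof (rule inj3)
note m2 = mod_tens[OF mB mB] mod_tens[OF mA mA]
note m3 = mod_tens[OF mB m2(1)] mod_tens[OF mA m2(2)]
let ?A3 = "tp R A (tp R A A)"
let ?I2 = "tmp R A A id id" and ?I3 = "tmp R A (tp R A A) id (tmp R A A id id)"
note \<D>c = \<D>_closed[OF c]
have m\<D>: "module R (tp R (tp R B B) B)" by (rule mod_tens[OF m2(1) mB])
have T1: "tmp R (tp R B B) B \<D> id (\<D> c):car (tp R (tp R B B) B)"
 by (rule tensor_map_closed[OF \<D>_hom id_hom mB mB m2(1) mB \<D>c])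
show "tassoc R B B B (tmp R (tp R B B) B \<D> id (\<D> c)):car (tp R B (tp R B B))"
 by (rule hom_mem[OF tassoc_hom(1)[OF mB mB mB] T1])
show "tmp R B (tp R B B) id \<D> (\<D> c):car (tp R B (tp R B B))"
 by (rule tensor_map_closed[OF id_hom \<D>_hom mB mB mB m2(1) \<D>c])
have I3: "?I3:Hom R (tp R B (tp R B B)) ?A3"
 by (rule tmap_hom[OF incl incl2 mB m2(1) mA m2(2)])
define L where "L = (%w. ?I3 (tassoc R B B B w))"
have L: "L:Hom R (tp R (tp R B B) B) ?A3"
 unfolding L_def by (rule hom_comp[OF I3 tassoc_hom(1)[OF mB mB mB]])
let ?G = "%x y. sw ?A3 (D x) (%u v. tn A (tp R A A) u (tn A A v y))"
have key: "L (tn (tp R B B) B \<zeta> y) = sw ?A3 (?I2 \<zeta>) (%u v. tn A (tp R A A) u (tn A A v y))"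
 if z: "\<zeta>:car (tp R B B)" and y: "y:C" for \<zeta> y
proof (rule tens_heq[OF mB mB z, where f = "%\<zeta>. L (tens R (tp R B B) B \<zeta> y)"])
 have yB: "y:car B" using y by simp
 show "(%\<zeta>. L (tn (tp R B B) B \<zeta> y)):Hom R (tp R B B) ?A3"
 by (rule hom_comp[OF L lin_tens1[OF lin_id yB m2(1) mB]])
 have bil: "bilin R A A ?A3 (%u v. tn A (tp R A A) u (tn A A v y))"
 by (assumption | rule l y)+
 show "(%\<zeta>. sw ?A3 (?I2 \<zeta>) (%u v. tn A (tp R A A) u (tn A A v y))):Hom R (tp R B B) ?A3"
 by (rule lin_sw1[OF incl2 bil mA mA m3(2)])
 fix u v assume u: "u:car B" and v: "v:car B"
 have uv: "u:car A" "v:car A" using u v CA by simp_all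
 have "L (tn (tp R B B) B (tn B B u v) y) = ?I3 (tn B (tp R B B) u (tn B B v y))"
 unfolding L_def using tassoc_tens[OF mB mB mB u v yB] by simp
 also have "... = tn A (tp R A A) u (tn A A v y)"
 using tmap_tens[OF incl incl2 mB m2(1) mA m2(2) u tens_in[OF v yB mB mB]]
  tmap_tens[OF incl incl mB mB mA mA v yB] by simp
 also have "... = sw ?A3 (tn A A u v) (%u v. tn A (tp R A A) u (tn A A v y))"
 by (rule sw_tens[OF bil uv mA mA m3(2), symmetric])
 finally show "L (tn (tp R B B) B (tn B B u v) y) = sw ?A3 (?I2 (tn B B u v)) (%u v. tn A (tp R A A) u (tn A A v y))"
 using tmap_tens[OF incl incl mB mB mA mA u v] by simp
qed
have bG: "bilin R A A ?A3 ?G" by (assumption | rule l)+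
have "?I3 (tassoc R B B B (tmp R (tp R B B) B \<D> id (\<D> c))) =
 L (sw (tp R (tp R B B) B) (\<D> c) (%x y. tn (tp R B B) B (\<D> x) (id y)))" (is "?lh = _")
 unfolding L_def tensor_map_sw[OF \<D>_hom id_hom mB mB m2(1) mB \<D>c] ..
also have "... = sw ?A3 (\<D> c) (%x y. L (tn (tp R B B) B (\<D> x) (id y)))"
 by (rule sw_hom[OF L \<D>c _ mB mB m\<D> m3(2)]) (rule tens_in mB m2(1) | simp add: \<D>_closed)+
also have "... = sw ?A3 (\<D> c) ?G"
 by (rule sw_cong[OF refl \<D>c mB mB m3(2)])
 (simp add: key \<D>_closed \<D>_incl, rule hom_mem[OF L], rule tens_in, simp_all add: \<D>_closed mB m2)
also have "... = sw ?A3 (D c) ?G" by (rule sw_D[OF c bG m3(2), symmetric])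
also have "... = sw ?A3 (D c) (%x y. tn A (tp R A A) x (D y))" by (rule D_coassoc[OF c])
also have "... = sw ?A3 (\<D> c) (%x y. tn A (tp R A A) x (D y))"
 by (rule sw_D[OF c _ m3(2)]) (assumption | rule l)+
also have "... = sw ?A3 (\<D> c) (%x y. ?I3 (tn B (tp R B B) (id x) (\<D> y)))"
 by (rule sw_cong[OF refl \<D>c mB mB m3(2)])
 (use tmap_tens[OF incl incl2 mB m2(1) mA m2(2)] in \<open>simp add: \<D>_closed \<D>_incl\<close>,
 (rule l | simp)+)
also have "... = ?I3 (sw (tp R B (tp R B B)) (\<D> c) (%x y. tn B (tp R B B) (id x) (\<D> y)))"
 by (rule sw_hom[OF I3 \<D>c _ mB mB m3, symmetric]) (rule tens_in mB m2(1) | simp add: \<D>_closed)+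
also have "... = ?I3 (tmp R B (tp R B B) id \<D> (\<D> c))"
 unfolding tensor_map_sw[OF id_hom \<D>_hom mB mB mB m2(1) \<D>c] ..
finally show "?lh = ..." .
qed

lemma \<e>_hom: "\<e>:Hom R B (self_module R)" by (rule alg_homD(1)[OF \<e>_alg])

lemma \<e>_smult: "f:Hom R X B==>y:C==>(%x. \<e> (f x) \<odot>\<^bsub>A\<^esub> y):Hom R X B"
"f:Hom R X B==>x:C==>(%y. \<e> x \<odot>\<^bsub>A\<^esub> f y):Hom R X B"
proof -
interpret B: module R B by (rule mB)
note b = B.smult_l_distr B.smult_r_distr B.smult_assoc1 B.smult_closed
have comm: "s \<odot>\<^bsub>A\<^esub> (r \<odot>\<^bsub>A\<^esub> m) = r \<odot>\<^bsub>A\<^esub> (s \<odot>\<^bsub>A\<^esub> m)" if "r:car R" "s:car R" "m:C" for r s m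
 using B.smult_assoc1[of r s m] B.smult_assoc1[of s r m] that R.m_comm[of r s] by simp
show "f:Hom R X B==>y:C==>(%x. \<e> (f x) \<odot>\<^bsub>A\<^esub> y):Hom R X B"
 using hom_comp[OF \<e>_hom, of f X] b by (simp add: mod_hom_def Pi_def)
show "f:Hom R X B==>x:C==>(%y. \<e> x \<odot>\<^bsub>A\<^esub> f y):Hom R X B"
 using b(2,4) comm \<e>_closed[of x] by (simp add: mod_hom_def Pi_def)
qed

text \<open>Both sides are compared after tensoring with 1 in \<open>T\<close>. There
  \<open>\<e>(x) y \<otimes> 1 = y \<otimes> N(x)\<close>, which turns the claim into the counit
  hypothesis for \<open>D\<close> and \<open>N\<close>, and descent removes the extra leg.\<close>

lemma counit_laws:
assumes c: "c:C"
shows "sw B (\<D> c) (%x y. \<e> x \<odot>\<^bsub>A\<^esub> y) = c" "sw B (\<D> c) (%x y. \<e> y \<odot>\<^bsub>A\<^esub> x) = c"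
proof -
interpret B: module R B by (rule mB)
note \<D>c = \<D>_closed[OF c]
note mAT = mod_tens[OF mA mT]
have in1: "(%z. tn A T z eT):Hom R B (tp R A T)"
 by (rule lin_tens1[OF _ one_closed mA mT]) (rule incl[unfolded id_def])
have cl: "\<e> x \<odot>\<^bsub>A\<^esub> y:C" if "x:C" "y:C" for x y
 using B.smult_closed[of "\<e> x" y] that \<e>_closed by simp
have eq: "tn A T (\<e> x \<odot>\<^bsub>A\<^esub> y) eT = tn A T y (N x)" if "x:C" "y:C" for x y
 using tensor_smult2[OF mA mT \<e>_closed[OF that(1)] CA[OF that(2)] one_closed] N_\<e>[OF that(1)] by simp
have "tn A T (sw B (\<D> c) (%x y. \<e> x \<odot>\<^bsub>A\<^esub> y)) eT = sw (tp R A T) (\<D> c) (%x y. tn A T (\<e> x \<odot>\<^bsub>A\<^esub> y) eT)"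
 by (rule sw_hom[OF in1 \<D>c _ mB mB mB mAT]) (simp add: cl)
also have "... = sw (tp R A T) (\<D> c) (%x y. tn A T y (N x))"
 by (rule sw_cong[OF refl \<D>c mB mB mAT]) (simp add: eq, rule hom_mem[OF in1], simp add: cl)
also have "... = sw (tp R A T) (D c) (%x y. tn A T y (N x))"
 by (rule sw_D[OF c _ mAT, symmetric]) (assumption | rule l)+
finally have "tn A T (sw B (\<D> c) (%x y. \<e> x \<odot>\<^bsub>A\<^esub> y)) eT = tn A T c eT"
 by (simp add: counit_l[OF c])
moreover have "sw B (\<D> c) (%x y. \<e> x \<odot>\<^bsub>A\<^esub> y):car B"
 by (rule sw_closed[OF \<D>c _ mB mB mB]) (simp add: cl)
ultimately show "sw B (\<D> c) (%x y. \<e> x \<odot>\<^bsub>A\<^esub> y) = c" using c CA by (intro descent_eq[OF mA]) auto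
have "tn A T (sw B (\<D> c) (%x y. \<e> y \<odot>\<^bsub>A\<^esub> x)) eT = sw (tp R A T) (\<D> c) (%x y. tn A T (\<e> y \<odot>\<^bsub>A\<^esub> x) eT)"
 by (rule sw_hom[OF in1 \<D>c _ mB mB mB mAT]) (simp add: cl)
also have "... = sw (tp R A T) (\<D> c) (%x y. tn A T x (N y))"
 by (rule sw_cong[OF refl \<D>c mB mB mAT]) (simp add: eq, rule hom_mem[OF in1], simp add: cl)
also have "... = sw (tp R A T) (D c) (%x y. tn A T x (N y))"
 by (rule sw_D[OF c _ mAT, symmetric]) (assumption | rule l)+
finally have "tn A T (sw B (\<D> c) (%x y. \<e> y \<odot>\<^bsub>A\<^esub> x)) eT = tn A T c eT"
 by (simp add: counit_r[OF c])
moreover have "sw B (\<D> c) (%x y. \<e> y \<odot>\<^bsub>A\<^esub> x):car B"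
 by (rule sw_closed[OF \<D>c _ mB mB mB]) (simp add: cl)
ultimately show "sw B (\<D> c) (%x y. \<e> y \<odot>\<^bsub>A\<^esub> x) = c" using c CA by (intro descent_eq[OF mA]) auto
qed

lemma H_bialgebra: "bialgebra R H"
proof -
have HX: "Hom R H X = Hom R B X" for X :: "('k, 'x) module" by (simp add: mod_hom_def)
have co: "coalgebra R H"
 unfolding coalgebra_def
proof (intro conjI ballI)
 show "module R H" by (rule mH)
 show "comult H:Hom R H (tp R H H)" using \<D>_hom by (simp add: H_tensor mod_hom_def)
 show "counit H:Hom R H (self_module R)" using \<e>_hom by (simp add: mod_hom_def)
 fix c assume "c:car H"
 then have c: "c:C" by simp
 show "tassoc R H H H (tmp R (tp R H H) H (comult H) id (comult H c)) =
  tmp R H (tp R H H) id (comult H) (comult H c)"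
 using comult_coassoc[OF c] by (simp add: tassoc_def tensor_map_def H_tensor)
 have "bilin R B B B (%x y. \<e> x \<odot>\<^bsub>A\<^esub> y)" "bilin R B B B (%x y. \<e> y \<odot>\<^bsub>A\<^esub> x)"
 by (rule bilinI; rule \<e>_smult; simp add: lin_id)+
 from this[THEN tensor_lift_H[OF \<D>_closed[OF c]]]
 show "tensor_lift H (%x y. counit H x \<odot>\<^bsub>H\<^esub> y) (comult H c) = c" "tensor_lift H (%x y. counit H y \<odot>\<^bsub>H\<^esub> x) (comult H c) = c"
 using counit_laws[OF c] by simp_all
qed
show ?thesis
 unfolding bialgebra_def
 using co same_algebra_k_algebra[OF same_algebra_sym[OF same_H] B_alg]
 \<D>_alg \<e>_alg same_algebra_alg_hom[OF same_H same_algebra_refl, of R "tp R B B"]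
 same_algebra_alg_hom[OF same_H same_algebra_refl, of R "self_module R"]
 by (simp add: H_tensor)
qed

lemma H_antipode:
assumes "S:Hom R A A" "S ` C <= C"
 and "!!c. c:C==>sw A (D c) (%x y. S x \<otimes>\<^bsub>A\<^esub> y) = \<e> c \<odot>\<^bsub>A\<^esub> \<one>\<^bsub>A\<^esub>"
 and "!!c. c:C==>sw A (D c) (%x y. x \<otimes>\<^bsub>A\<^esub> S y) = \<e> c \<odot>\<^bsub>A\<^esub> \<one>\<^bsub>A\<^esub>"
shows "is_antipode R H S"
proof -
interpret B: k_algebra R B by (rule B_alg)
have SB: "S:Hom R B B" by (rule sub_hom(1)[OF assms(1) Cs assms(2)])
have SC: "S x:C" if "x:C" for x using assms(2) that by blast
note ll = B.rmult_hom B.lmult_hom hom_comp[OF SB] lin_id hom_mem[OF SB]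
have b: "bilin R B B B (%x y. S x \<otimes>\<^bsub>B\<^esub> y)" "bilin R B B B (%x y. x \<otimes>\<^bsub>B\<^esub> S y)"
 by (rule bilinI; (rule ll | assumption)+)+
have bA: "bilin R A A A (%x y. S x \<otimes>\<^bsub>A\<^esub> y)" "bilin R A A A (%x y. x \<otimes>\<^bsub>A\<^esub> S y)"
 by (rule bilinI; (rule A.rmult_hom A.lmult_hom hom_comp[OF assms(1)] lin_id hom_mem[OF assms(1)] | assumption)+)+
show ?thesis
 unfolding is_antipode_def
proof (intro conjI ballI)
 show "S:Hom R H H" using SB by (simp add: mod_hom_def)
 fix c assume "c:car H"
 then have c: "c:C" by simp
 show "tensor_lift H (%x y. S x \<otimes>\<^bsub>H\<^esub> y) (comult H c) = counit H c \<odot>\<^bsub>H\<^esub> \<one>\<^bsub>H\<^esub>"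
 using tensor_lift_H[OF \<D>_closed[OF c] b(1)] sw_\<D>_incl[OF c bA(1)] assms(3)[OF c] SC C_mult by simp
 show "tensor_lift H (%x y. x \<otimes>\<^bsub>H\<^esub> S y) (comult H c) = counit H c \<odot>\<^bsub>H\<^esub> \<one>\<^bsub>H\<^esub>"
 using tensor_lift_H[OF \<D>_closed[OF c] b(2)] sw_\<D>_incl[OF c bA(2)] assms(4)[OF c] SC C_mult by simp
qed
qed

end

text \<open>\<open>M\<close> is the ambient algebra seen as a plain module, so all linear hypotheses
  can be checked without opposite algebras. The splitting makes the preimage under
  \<open>C \<otimes> C \<rightarrow> M \<otimes> M\<close> unique, which gives the
  \<open>THE\<close> in \<open>induced_comult\<close> its value; \<open>D'\<close> is the given
  expression for the comultiplication and \<open>D\<close> its Sweedler form.\<close>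

lemma (in ff_algebra) sub_bialgebraI:
fixes A M :: "('k, 'a) module" and D D' :: "'a => ('a, 'a) tensor"
assumes A: "k_algebra R A" and s: "same_module A M" and C: "submodule C R M" "\<one>\<^bsub>A\<^esub>:C"
 "!!x y. x:C==>y:C==>x \<otimes>\<^bsub>A\<^esub> y:C"
 and split: "split_after (sub M C) M id"
 and D: "D:Hom R M (tp R M M)" "D \<one>\<^bsub>A\<^esub> = tn M M \<one>\<^bsub>A\<^esub> \<one>\<^bsub>A\<^esub>"
 "!!x y. x:C==>y:C==>D (x \<otimes>\<^bsub>A\<^esub> y) = D x \<otimes>\<^bsub>tp R A A\<^esub> D y"
 "!!c. c:C ==>
  sw (tp R M (tp R M M)) (D c) (%x y. sw (tp R M (tp R M M)) (D x) (%u v. tn M (tp R M M) u (tn M M v y))) =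
  sw (tp R M (tp R M M)) (D c) (%x y. tn M (tp R M M) x (D y))"
 "!!c. c:C==>D c:tmp R M M id id ` car (tp R (sub M C) (sub M C))"
 "!!c. c:C==>D' c = D c"
 and N: "N:Hom R M T" "N \<one>\<^bsub>A\<^esub> = eT"
 "!!x y. x:C==>y:C==>N (x \<otimes>\<^bsub>A\<^esub> y) = N x ** N y"
 "!!c. c:C==>EX r:car R. N c = r *s eT"
 and counit: "!!c. c:C==>sw (tp R M T) (D c) (%x y. tn M T y (N x)) = tn M T c eT"
 "!!c. c:C==>sw (tp R M T) (D c) (%x y. tn M T x (N y)) = tn M T c eT"
shows "sub_bialgebra R T A C D N (induced_comult R A C D') (%c. THE r. r:car R & N c = r *s eT)"
proof -
interpret A: k_algebra R A by fact
note s2 = same_tensor[OF s s, of R] and r = same_refl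
note s3 = same_tensor[OF s s2, of R] and sT = same_tensor[OF s r[of T], of R]
have sC: "same_module (sub A C) (sub M C)" using s by (simp add: same_module_def)
have mM: "module R M" by (rule same_module_module[OF s A.module_axiom])
have CA: "submodule C R A"
 using module.module_incl_imp_submodule[OF A.module_axiom, of C] submod_sub[OF C(1)] s
 same_module_module[of "sub M C" "sub A C", OF _ sub_module[OF C(1) mM]] by (simp add: same_module_def)
have mB: "module R (sub M C)" by (rule sub_module[OF C(1) mM])
note eqs = same_tens[OF s s] same_tens[OF s s2] same_sw[OF s2] same_sw[OF s3] same_sw[OF sT]
 same_tens[OF s r[of T]] same_mhom[OF s s2] same_mhom[OF s r[of T]]
 same_mhom[OF same_refl same_tensor[OF sC r[of T], of R]]
have splitA: "split_after (sub A C) A id"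
 using split unfolding split_after_def same_mhom[OF sC s] same_tens[OF sC r[of T]]
 same_mhom[OF s same_tensor[OF sC r[of T], of R]] using s by (simp add: same_module_def)
have tmap: "tmp R A A id id U = tmp R M M id id U" if "U:car (tp R (sub M C) (sub M C))" for U
proof -
 have "id:Hom R (sub M C) A" "id:Hom R (sub M C) M"
 using incl_hom(4)[OF submod_sub[OF C(1)]] same_mhom[OF same_refl s] by auto
 from tensor_map_sw[OF this(1,1) mB mB A.module_axiom A.module_axiom that]
 tensor_map_sw[OF this(2,2) mB mB mM mM that] show ?thesis by (simp add: eqs)
qed
have cB: "car (tp R (sub A C) (sub A C)) = car (tp R (sub M C) (sub M C))"
 using same_tensor[OF sC sC, of R] by (simp add: same_module_def)
have sp2: "split_after (tp R (sub M C) (sub M C)) (tp R M M) (tmp R M M id id)"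
 by (rule split_tensor[OF mB mM mB mM split split])
have \<D>: "induced_comult R A C D' c:car (tp R (sub A C) (sub A C)) &
 tmp R A A id id (induced_comult R A C D' c) = D' c" if c: "c:C" for c
 unfolding induced_comult_def Let_def
proof (rule theI')
 obtain z where z: "z:car (tp R (sub M C) (sub M C))" "D c = tmp R M M id id z"
 using D(5)[OF c] by (elim imageE) simp
 show "EX! \<zeta>. \<zeta>:car (tp R (sub A C) (sub A C)) & tmp R A A id id \<zeta> = D' c"
 proof (rule ex1I[of _ z])
 show "z:car (tp R (sub A C) (sub A C)) & tmp R A A id id z = D' c"
  using z cB tmap D(6)[OF c] by simp
 show "\<zeta> = z" if "\<zeta>:car (tp R (sub A C) (sub A C)) & tmp R A A id id \<zeta> = D' c" for \<zeta>
  by (rule split_inj[OF mod_tens[OF mB mB] sp2]) (use that z cB tmap D(6)[OF c] in auto)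
 qed
qed
have \<e>: "(THE r. r:car R & N c = r *s eT):car R &
 N c = (THE r. r:car R & N c = r *s eT) *s eT" if c: "c:C" for c
proof (rule theI')
 obtain r where r: "r:car R" "N c = r *s eT" using N(4)[OF c] by (elim bexE)
 show "EX! r. r:car R & N c = r *s eT"
 by (rule ex1I[of _ r]) (use r unit_inj in auto)
qed
show ?thesis
proof (intro sub_bialgebra.intro sub_bialgebra_axioms.intro)
 show "D:Hom R A (tp R A A)" using D(1) by (simp add: eqs)
 show "N:Hom R A T" using N(1) by (simp add: eqs)
qed (use A CA C splitA D N counit \<D> \<e> ff_algebra_axioms in \<open>simp_all add: eqs\<close>)
qed

section \<open>Threefold Sweedler sums\<close>

definition sw3 :: "('d, 'm) ring_scheme => ('a, ('b, 'c) tensor) tensor => ('a => 'b => 'c => 'd) => 'd"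
where "sw3 P W F = sw P W (%a w. sw P w (F a))"

definition trilin ::
"('k, 'r) ring_scheme => ('k, 'a, 'm) module_scheme => ('k, 'b, 'n) module_scheme => ('k, 'c, 'q) module_scheme =>
 ('k, 'd, 'p) module_scheme => ('a => 'b => 'c => 'd) => bool"
where "trilin R A B C P F \<longleftrightarrow>
 (ALL b:car B. ALL c:car C. (%a. F a b c):Hom R A P) &
 (ALL a:car A. ALL c:car C. (%b. F a b c):Hom R B P) &
 (ALL a:car A. ALL b:car B. (%c. F a b c):Hom R C P)"

lemma trilinI [lin]:
assumes "!!b c. b:car B==>c:car C==>(%a. F a b c):Hom R A P"
 and "!!a c. a:car A==>c:car C==>(%b. F a b c):Hom R B P"
 and "!!a b. a:car A==>b:car B==>(%c. F a b c):Hom R C P"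
shows "trilin R A B C P F"
using assms by (simp add: trilin_def)

lemma trilin_closed: "trilin R A B C P F==>a:car A==>b:car B==>c:car C==>F a b c:car P"
using hom_mem[of "%a. F a b c" R A P a] by (simp add: trilin_def)

locale three_modules =
fixes R :: "('k, 'r) ring_scheme" and A :: "('k, 'a, 'm) module_scheme" and B :: "('k, 'b, 'n) module_scheme"
 and C :: "('k, 'c, 'q) module_scheme"
assumes mods: "module R A" "module R B" "module R C"
begin

abbreviation "ABC == tp R A (tp R B C)"

lemma mBC: "module R (tp R B C)" by (rule mod_tens[OF mods(2,3)])
lemma mABC: "module R ABC" by (rule mod_tens[OF mods(1) mBC])

lemma trilin_bilin:
assumes "trilin R A B C P F" "module R P"
shows "bilin R A (tp R B C) P (%a w. sw P w (F a))"
 and "a:car A==>bilin R B C P (F a)"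
proof -
have 1: "(%a. F a b c):Hom R A P" if "b:car B" "c:car C" for b c
 using assms that by (auto simp: trilin_def)
have 2: "(%b. F a b c):Hom R B P" if "a:car A" "c:car C" for a c
 using assms that by (auto simp: trilin_def)
have 3: "(%c. F a b c):Hom R C P" if "a:car A" "b:car B" for a b
 using assms that by (auto simp: trilin_def)
show "bilin R A (tp R B C) P (%a w. sw P w (F a))"
 by (assumption | rule lin 1 2 3 mods assms)+
show "bilin R B C P (F a)" if "a:car A" by (assumption | rule bilinI 2 3 that)+
qed

lemma closed:
assumes "W:car ABC" "!!a b c. a:car A==>b:car B==>c:car C==>F a b c:car P"
 "module R P"
shows "sw3 P W F:car P"
unfolding sw3_def by (assumption | rule sw_closed mods mBC assms)+

lemma lin1:
assumes "g:Hom R X ABC" "trilin R A B C P F" "module R P"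
shows "(%x. sw3 P (g x) F):Hom R X P"
unfolding sw3_def by (rule lin_sw1[OF assms(1) trilin_bilin(1)[OF assms(2,3)] mods(1) mBC assms(3)])

lemma lin2:
assumes "W:car ABC"
 "!!a b c. a:car A==>b:car B==>c:car C==>(%x. F x a b c):Hom R X P"
 "module R P" "module R X"
shows "(%x. sw3 P W (F x)):Hom R X P"
unfolding sw3_def by (assumption | rule lin_sw2 mods mBC assms)+

lemma cong:
assumes "W:car ABC" "module R P"
 "!!a b c. a:car A==>b:car B==>c:car C==>F a b c = G a b c"
 "!!a b c. a:car A==>b:car B==>c:car C==>F a b c:car P"
shows "sw3 P W F = sw3 P W G"
unfolding sw3_def
by (rule sw_cong[OF refl assms(1) mods(1) mBC assms(2)], rule sw_cong[OF refl _ mods(2,3) assms(2)])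
 (assumption | rule sw_closed mods mBC assms)+

lemma hom:
assumes "h:Hom R P Q" "W:car ABC"
 "!!a b c. a:car A==>b:car B==>c:car C==>F a b c:car P"
 "module R P" "module R Q"
shows "h (sw3 P W F) = sw3 Q W (%a b c. h (F a b c))"
proof -
have "h (sw3 P W F) = sw Q W (%a w. h (sw P w (F a)))"
 unfolding sw3_def by (rule sw_hom[OF assms(1,2) _ mods(1) mBC assms(4,5)]) (assumption | rule sw_closed mods mBC assms)+
also have "... = sw Q W (%a w. sw Q w (%b c. h (F a b c)))"
 by (rule sw_cong[OF refl assms(2) mods(1) mBC assms(5)], rule sw_hom[OF assms(1) _ _ mods(2,3) assms(4,5)])
 (assumption | rule sw_closed mods mBC assms hom_mem[OF assms(1)])+
finally show ?thesis unfolding sw3_def .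
qed

lemma tens:
assumes "trilin R A B C P F" "a:car A" "b:car B" "c:car C" "module R P"
shows "sw3 P (tens R A (tp R B C) a (tens R B C b c)) F = F a b c"
proof -
have bc: "tens R B C b c:car (tp R B C)" by (rule tens_in assms mods)+
have "sw3 P (tens R A (tp R B C) a (tens R B C b c)) F = sw P (tens R B C b c) (F a)"
 unfolding sw3_def by (rule sw_tens[OF trilin_bilin(1)[OF assms(1,5)] assms(2) bc mods(1) mBC assms(5)])
also have "... = F a b c"
 by (rule sw_tens[OF trilin_bilin(2)[OF assms(1,5,2)] assms(3,4) mods(2,3) assms(5)])
finally show ?thesis .
qed

lemma hom_eq:
assumes "W:car ABC" "f:Hom R ABC P" "g:Hom R ABC P"
 and eq: "!!a b c. a:car A==>b:car B==>c:car C ==>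
 f (tens R A (tp R B C) a (tens R B C b c)) = g (tens R A (tp R B C) a (tens R B C b c))"
shows "f W = g W"
proof (rule tens_heq[OF mods(1) mBC assms(1-3)])
fix a w assume a: "a:car A" and w: "w:car (tp R B C)"
show "f (tens R A (tp R B C) a w) = g (tens R A (tp R B C) a w)"
 by (rule tens_heq[OF mods(2,3) w hom_comp[OF assms(2) lin_tens2[OF lin_id a mods(1) mBC]]
  hom_comp[OF assms(3) lin_tens2[OF lin_id a mods(1) mBC]] eq[OF a]])
qed

lemma self:
assumes "W:car ABC"
shows "sw3 ABC W (%a b c. tens R A (tp R B C) a (tens R B C b c)) = W"
proof (rule hom_eq[OF assms])
have t: "trilin R A B C ABC (%a b c. tens R A (tp R B C) a (tens R B C b c))"
 by (assumption | rule lin mods)+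
show "(%W. sw3 ABC W (%a b c. tens R A (tp R B C) a (tens R B C b c))):Hom R ABC ABC"
 by (rule lin1[OF lin_id t mABC])
show "sw3 ABC (tens R A (tp R B C) a (tens R B C b c)) (%a b c. tens R A (tp R B C) a (tens R B C b c)) =
 tens R A (tp R B C) a (tens R B C b c)" if "a:car A" "b:car B" "c:car C" for a b c
 by (rule tens[OF t that mABC])
qed (rule lin_id)

text \<open>The standard way of turning a structural map such as \<open>tassoc4\<close> or an
  iterated \<open>tensor_map\<close> into a Sweedler sum: only its values on pure tensors have to be
  computed.\<close>

lemma eval:
assumes "f:Hom R ABC P" "module R P" "W:car ABC"
 and K: "!!a b c. a:car A==>b:car B==>c:car C ==>
 f (tens R A (tp R B C) a (tens R B C b c)) = K a b c"
shows "f W = sw3 P W K"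
proof -
have t: "tens R A (tp R B C) a (tens R B C b c):car ABC"
 if "a:car A" "b:car B" "c:car C" for a b c
 by (rule tens_in that mods mBC)+
have "f W = f (sw3 ABC W (%a b c. tens R A (tp R B C) a (tens R B C b c)))" by (simp add: self[OF assms(3)])
also have "... = sw3 P W (%a b c. f (tens R A (tp R B C) a (tens R B C b c)))"
 by (rule hom[OF assms(1,3) t mABC assms(2)])
also have "... = sw3 P W K"
 by (rule cong[OF assms(3,2) K hom_mem[OF assms(1) t]])
finally show ?thesis .
qed

end

lemma three_modulesI: "module R A==>module R B==>module R C==>three_modules R A B C"
by (rule three_modules.intro)

lemma nabla_hom:
assumes "k_algebra R T"
shows "nabla T:Hom R (tp R T T) T" "x:car T==>y:car T==>nabla T (tens R T T x y) = x \<otimes>\<^bsub>T\<^esub> y"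
 "nabla_op T:Hom R (tp R T T) T" "x:car T==>y:car T==>nabla_op T (tens R T T x y) = y \<otimes>\<^bsub>T\<^esub> x"
proof -
interpret k_algebra R T by fact
have b: "bilin R T T T (%x y. y \<otimes>\<^bsub>T\<^esub> x)" by (rule bilinI) (rule rmult_hom lmult_hom lin_id | assumption)+
note m = module_axiom
show "nabla T:Hom R (tp R T T) T" "nabla_op T:Hom R (tp R T T) T"
 unfolding nabla_def nabla_op_def by (rule tensor_lift_hom bilin_mult b m)+
assume xy: "x:car T" "y:car T"
have t: "tens R T T x y:car (tp R T T)" by (rule tens_in xy m)+
show "nabla T (tens R T T x y) = x \<otimes>\<^bsub>T\<^esub> y" "nabla_op T (tens R T T x y) = y \<otimes>\<^bsub>T\<^esub> x"
 unfolding nabla_def nabla_op_def tlift_sw[OF m m m t bilin_mult] tlift_sw[OF m m m t b]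
 by (rule sw_tens[OF bilin_mult xy m m m] sw_tens[OF b xy m m m])+
qed

section \<open>Pretorsors\<close>

text \<open>The torsor axioms that do not mention \<open>\<theta>\<close>, in Sweedler form over
  plain tensor powers of \<open>T\<close>. The opposite algebra survives only in the reversed middle
  product \<open>e ** b\<close> of \<open>\<mu>_mult\<close>. Quantum torsors and Galois objects
  both enter the development through this locale.\<close>

locale pretorsor = ff_algebra R T for R :: "('k, 'r) ring_scheme" and T :: "('k, 't) module" +
fixes \<mu> :: "'t => ('t, ('t, 't) tensor) tensor"
assumes \<mu>_hom: "\<mu>:Hom R T (tp R T (tp R T T))"
 and \<mu>_one: "\<mu> \<one>\<^bsub>T\<^esub> = tens R T (tp R T T) \<one>\<^bsub>T\<^esub> (tens R T T \<one>\<^bsub>T\<^esub> \<one>\<^bsub>T\<^esub>)"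
 and \<mu>_mult: "!!x y. x:car T==>y:car T==>\<mu> (x \<otimes>\<^bsub>T\<^esub> y) =
 sw3 (tp R T (tp R T T)) (\<mu> x) (%a b c. sw3 (tp R T (tp R T T)) (\<mu> y) (%d e f.
  tens R T (tp R T T) (a \<otimes>\<^bsub>T\<^esub> d) (tens R T T (e \<otimes>\<^bsub>T\<^esub> b) (c \<otimes>\<^bsub>T\<^esub> f))))"
 and \<mu>_right: "!!x. x:car T==>sw3 (tp R T T) (\<mu> x) (%a b c. tens R T T a (b \<otimes>\<^bsub>T\<^esub> c)) = tens R T T x \<one>\<^bsub>T\<^esub>"
 and \<mu>_left: "!!x. x:car T==>sw3 (tp R T T) (\<mu> x) (%a b c. tens R T T (a \<otimes>\<^bsub>T\<^esub> b) c) = tens R T T \<one>\<^bsub>T\<^esub> x"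
 and \<mu>_coassoc: "!!x. x:car T ==>
 sw3 (tp R T (tp R T (tp R T (tp R T T)))) (\<mu> x) (%a b c.
  sw3 (tp R T (tp R T (tp R T (tp R T T)))) (\<mu> c) (%d e f.
  tens R T (tp R T (tp R T (tp R T T))) a (tens R T (tp R T (tp R T T)) b
   (tens R T (tp R T T) d (tens R T T e f))))) =
 sw3 (tp R T (tp R T (tp R T (tp R T T)))) (\<mu> x) (%d e f.
  sw3 (tp R T (tp R T (tp R T (tp R T T)))) (\<mu> d) (%a b c.
  tens R T (tp R T (tp R T (tp R T T))) a (tens R T (tp R T (tp R T T)) b
   (tens R T (tp R T T) c (tens R T T e f)))))"
begin

abbreviation "smu P x \<equiv> sw3 P (\<mu> x)"

abbreviation "M2 == tp R T T"
abbreviation "M3 == tp R T M2"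
abbreviation "M4 == tp R T M3"
abbreviation "M5 == tp R T M4"
abbreviation "MM == tp R M2 M2"
abbreviation "t2 == tn T T"
abbreviation "t3 == (%a b c. tn T M2 a (t2 b c))"

lemmas mT = module_axiom
sublocale T3: three_modules R T T T by (rule three_modulesI[OF mT mT mT])

lemma mM2: "module R M2" by (rule mod_tens[OF mT mT])

lemmas \<mu>_closed = hom_mem[OF \<mu>_hom]
lemmas nab = nabla_hom[OF k_algebra_axioms]
lemmas l = lin mT one_closed rmult_hom lmult_hom m_closed hom_comp[OF \<mu>_hom] \<mu>_closed
T3.lin1 T3.lin2 T3.closed hom_comp[OF nab(1)] hom_mem[OF nab(1)]

text \<open>Coassociativity is an equation in the fivefold tensor power. Factoring a multilinear
  \<open>F\<close> through a linear map on \<open>M5\<close> lets it be used inside arbitrary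
  expressions, which is how \<open>coassoc\<close> is obtained.\<close>

lemma five_lift:
fixes F :: "'t => 't => 't => 't => 't => 'p" and P :: "('k, 'p, 'n) module_scheme"
assumes "module R P"
 and F: "!!b c d e. b:cT==>c:cT==>d:cT==>e:cT==>(%a. F a b c d e):Hom R T P"
 "!!a c d e. a:cT==>c:cT==>d:cT==>e:cT==>(%b. F a b c d e):Hom R T P"
 "!!a b d e. a:cT==>b:cT==>d:cT==>e:cT==>(%c. F a b c d e):Hom R T P"
 "!!a b c e. a:cT==>b:cT==>c:cT==>e:cT==>(%d. F a b c d e):Hom R T P"
 "!!a b c d. a:cT==>b:cT==>c:cT==>d:cT==>(%e. F a b c d e):Hom R T P"
obtains g where "g:Hom R M5 P" "!!a b c d e. a:cT==>b:cT==>c:cT ==>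
 d:cT==>e:cT==>g (tn T M4 a (tn T M3 b (t3 c d e))) = F a b c d e"
proof
let ?g = "%w. sw P w (%a w. sw P w (%b w. sw3 P w (F a b)))"
have t: "trilin R T T T P (F a b)" if "a:cT" "b:cT" for a b
 by (assumption | rule trilinI F that)+
have b2: "bilin R T M3 P (%b w. sw3 P w (F a b))" if "a:cT" for a
 by (assumption | rule l assms t that)+
have b1: "bilin R T M4 P (%a w. sw P w (%b w. sw3 P w (F a b)))"
 by (assumption | rule l assms t)+
show "?g:Hom R M5 P" by (rule sw_mhom[OF b1]) (assumption | rule l assms)+
fix a b c d e assume x: "a:cT" "b:cT" "c:cT" "d:cT" "e:cT"
have "?g (tn T M4 a (tn T M3 b (t3 c d e))) = sw P (tn T M3 b (t3 c d e)) (%b w. sw3 P w (F a b))" (is "?lh = _")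
 by (rule sw_tens[OF b1]) (assumption | rule l assms x)+
also have "... = sw3 P (t3 c d e) (F a b)"
 by (rule sw_tens[OF b2]) (assumption | rule l assms x)+
also have "... = F a b c d e" by (rule T3.tens[OF t]) (rule x assms)+
finally show "?lh = ..." .
qed

lemma coassoc:
assumes "x:cT" "module R P"
 and F: "!!b c d e. b:cT==>c:cT==>d:cT==>e:cT==>(%a. F a b c d e):Hom R T P"
 "!!a c d e. a:cT==>c:cT==>d:cT==>e:cT==>(%b. F a b c d e):Hom R T P"
 "!!a b d e. a:cT==>b:cT==>d:cT==>e:cT==>(%c. F a b c d e):Hom R T P"
 "!!a b c e. a:cT==>b:cT==>c:cT==>e:cT==>(%d. F a b c d e):Hom R T P"
 "!!a b c d. a:cT==>b:cT==>c:cT==>d:cT==>(%e. F a b c d e):Hom R T P"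
shows "smu P x (%a b c. smu P c (%d e f. F a b d e f)) =
 smu P x (%d e f. smu P d (%a b c. F a b c e f))"
proof -
obtain g where g: "g:Hom R M5 P" and gt: "!!a b c d e. a:cT==>b:cT==>c:cT ==>
 d:cT==>e:cT==>g (tn T M4 a (tn T M3 b (t3 c d e))) = F a b c d e"
 by (rule five_lift[where F = F, OF assms(2)], (assumption | rule F)+, rule that, simp_all)
have Fc: "F a b c d e:car P" if "a:cT" "b:cT" "c:cT" "d:cT" "e:cT" for a b c d e
 using hom_mem[OF F(1)] that by blast
note ll = l assms(1,2) Fc
have "smu P x (%a b c. smu P c (%d e f. F a b d e f)) =
 smu P x (%a b c. smu P c (%d e f. g (tn T M4 a (tn T M3 b (t3 d e f)))))"
 by (rule T3.cong, (assumption | rule ll)+, rule T3.cong) (assumption | rule ll gt[symmetric])+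
also have "... = smu P x (%a b c. g (smu M5 c (%d e f. tn T M4 a (tn T M3 b (t3 d e f)))))"
 by (rule T3.cong[symmetric], (assumption | rule ll)+, rule T3.hom[OF g]) (assumption | rule ll hom_mem[OF g])+
also have "... = g (smu M5 x (%a b c. smu M5 c (%d e f. tn T M4 a (tn T M3 b (t3 d e f)))))"
 by (rule T3.hom[OF g, symmetric]) (assumption | rule ll)+
also have "... = g (smu M5 x (%d e f. smu M5 d (%a b c. tn T M4 a (tn T M3 b (t3 c e f)))))"
 unfolding \<mu>_coassoc[OF assms(1)] ..
also have "... = smu P x (%d e f. g (smu M5 d (%a b c. tn T M4 a (tn T M3 b (t3 c e f)))))"
 by (rule T3.hom[OF g]) (assumption | rule ll)+
also have "... = smu P x (%d e f. smu P d (%a b c. g (tn T M4 a (tn T M3 b (t3 c e f)))))"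
 by (rule T3.cong, (assumption | rule ll)+, rule T3.hom[OF g]) (assumption | rule ll hom_mem[OF g])+
also have "... = smu P x (%d e f. smu P d (%a b c. F a b c e f))"
 by (rule T3.cong[symmetric], (assumption | rule ll)+, rule T3.cong) (assumption | rule ll gt[symmetric])+
finally show ?thesis .
qed

lemma \<mu>_mult':
assumes "x:cT" "y:cT" "trilin R T T T P F" "module R P"
shows "sw3 P (\<mu> (x ** y)) F =
 smu P x (%a b c. smu P y (%d e f. F (a ** d) (e ** b) (c ** f)))"
proof -
let ?h = "%w. sw3 P w F"
have h: "?h:Hom R M3 P" by (rule T3.lin1[OF lin_id assms(3,4)])
note ll = l assms trilin_closed[OF assms(3)]
have "sw3 P (\<mu> (x ** y)) F =
 smu P x (%a b c. ?h (smu M3 y (%d e f. t3 (a ** d) (e ** b) (c ** f))))"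
 unfolding \<mu>_mult[OF assms(1,2)] by (rule T3.hom[OF h]) (assumption | rule ll)+
also have "... = smu P x (%a b c. smu P y (%d e f. ?h (t3 (a ** d) (e ** b) (c ** f))))"
 by (rule T3.cong, (assumption | rule ll)+, rule T3.hom[OF h]) (assumption | rule ll)+
also have "... = smu P x (%a b c. smu P y (%d e f. F (a ** d) (e ** b) (c ** f)))"
 by (rule T3.cong, (assumption | rule ll)+, rule T3.cong, (assumption | rule ll)+, rule T3.tens[OF assms(3)])
 (assumption | rule ll)+
finally show ?thesis .
qed

lemma right:
assumes "x:cT" "bilin R T T P G" "module R P"
shows "smu P x (%a b c. G a (b ** c)) = G x eT"
proof -
let ?h = "%w. sw P w G"
have h: "?h:Hom R M2 P" by (rule sw_mhom[OF assms(2) mT mT assms(3)])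
note ll = l assms bilin_in[OF assms(2)]
have "smu P x (%a b c. G a (b ** c)) = smu P x (%a b c. ?h (t2 a (b ** c)))"
 by (rule T3.cong[symmetric], (assumption | rule ll)+, rule sw_tens[OF assms(2)]) (assumption | rule ll)+
also have "... = ?h (smu M2 x (%a b c. t2 a (b ** c)))"
 by (rule T3.hom[OF h, symmetric]) (assumption | rule ll)+
also have "... = G x eT" unfolding \<mu>_right[OF assms(1)] by (rule sw_tens[OF assms(2)]) (rule ll)+
finally show ?thesis .
qed

lemma left:
assumes "x:cT" "bilin R T T P G" "module R P"
shows "smu P x (%a b c. G (a ** b) c) = G eT x"
proof -
let ?h = "%w. sw P w G"
have h: "?h:Hom R M2 P" by (rule sw_mhom[OF assms(2) mT mT assms(3)])
note ll = l assms bilin_in[OF assms(2)]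
have "smu P x (%a b c. G (a ** b) c) = smu P x (%a b c. ?h (t2 (a ** b) c))"
 by (rule T3.cong[symmetric], (assumption | rule ll)+, rule sw_tens[OF assms(2)]) (assumption | rule ll)+
also have "... = ?h (smu M2 x (%a b c. t2 (a ** b) c))"
 by (rule T3.hom[OF h, symmetric]) (assumption | rule ll)+
also have "... = G eT x" unfolding \<mu>_left[OF assms(1)] by (rule sw_tens[OF assms(2)]) (rule ll)+
finally show ?thesis .
qed

abbreviation "tt == (%a b c d. tn M2 M2 (t2 a b) (t2 c d))"

text \<open>\<open>T \<otimes> \<mu>\<close> with its four legs grouped in pairs, that is, the
  comultiplication of \<open>Hr\<close> before corestriction. \<open>Dl\<close> below is
  \<open>\<mu> \<otimes> T\<close> grouped in the same way and serves \<open>Hl\<close> and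
  \<open>L_hopf\<close>.\<close>

definition Dr :: "('t, 't) tensor => (('t, 't) tensor, ('t, 't) tensor) tensor"
where "Dr U = sw MM U (%a b. smu MM b (%u v w. tt a u v w))"

definition Dl :: "('t, 't) tensor => (('t, 't) tensor, ('t, 't) tensor) tensor"
where "Dl U = sw MM U (%a b. smu MM a (%u v w. tt u v w b))"

lemma mMM: "module R MM" by (rule mod_tens[OF mM2 mM2])

lemma bilin_Dr: "bilin R T T MM (%a b. smu MM b (%u v w. tt a u v w))"
by (assumption | rule l)+

lemma bilin_Dl: "bilin R T T MM (%a b. smu MM a (%u v w. tt u v w b))"
by (assumption | rule l)+

lemma Dr_hom: "Dr:Hom R M2 MM" and Dl_hom: "Dl:Hom R M2 MM"
unfolding Dr_def Dl_def by (rule sw_mhom[OF bilin_Dr] sw_mhom[OF bilin_Dl]; rule mT mMM)+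

lemma Dr_t2: "a:cT==>b:cT==>Dr (t2 a b) = smu MM b (%u v w. tt a u v w)"
unfolding Dr_def by (rule sw_tens[OF bilin_Dr _ _ mT mT mMM])

lemma Dl_t2: "a:cT==>b:cT==>Dl (t2 a b) = smu MM a (%u v w. tt u v w b)"
unfolding Dl_def by (rule sw_tens[OF bilin_Dl _ _ mT mT mMM])

lemmas Dr_closed = hom_mem[OF Dr_hom] and Dl_closed = hom_mem[OF Dl_hom]

lemma sw_Dr:
assumes "a:cT" "b:cT" "bilin R M2 M2 P F" "module R P"
shows "sw P (Dr (t2 a b)) F = smu P b (%u v w. F (t2 a u) (t2 v w))"
proof -
note ll = l assms bilin_in[OF assms(3)]
have "sw P (Dr (t2 a b)) F = smu P b (%u v w. sw P (tt a u v w) F)"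
 unfolding Dr_t2[OF assms(1,2)] by (rule T3.hom[OF sw_mhom[OF assms(3)]]) (assumption | rule ll)+
also have "... = smu P b (%u v w. F (t2 a u) (t2 v w))"
 by (rule T3.cong, (assumption | rule ll)+, rule sw_tens[OF assms(3)]) (assumption | rule ll)+
finally show ?thesis .
qed

lemma sw_Dl:
assumes "a:cT" "b:cT" "bilin R M2 M2 P F" "module R P"
shows "sw P (Dl (t2 a b)) F = smu P a (%u v w. F (t2 u v) (t2 w b))"
proof -
note ll = l assms bilin_in[OF assms(3)]
have "sw P (Dl (t2 a b)) F = smu P a (%u v w. sw P (tt u v w b) F)"
 unfolding Dl_t2[OF assms(1,2)] by (rule T3.hom[OF sw_mhom[OF assms(3)]]) (assumption | rule ll)+
also have "... = smu P a (%u v w. F (t2 u v) (t2 w b))"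
 by (rule T3.cong, (assumption | rule ll)+, rule sw_tens[OF assms(3)]) (assumption | rule ll)+
finally show ?thesis .
qed

lemmas lD = l hom_comp[OF Dr_hom] hom_comp[OF Dl_hom] Dr_closed Dl_closed

abbreviation "MMM == tp R M2 MM"

lemma mMMM: "module R MMM" by (rule mod_tens[OF mM2 mMM])

lemma sw_D_hom:
assumes "D:Hom R M2 MM"
shows "(%c. sw MMM (D c) (%x y. sw MMM (D x) (%u v. tn M2 MM u (tn M2 M2 v y)))):Hom R M2 MMM"
 and "(%c. sw MMM (D c) (%x y. tn M2 MM x (D y))):Hom R M2 MMM"
 and "bilin R M2 M2 MMM (%x y. sw MMM (D x) (%u v. tn M2 MM u (tn M2 M2 v y)))"
 and "bilin R M2 M2 MMM (%x y. tn M2 MM x (D y))"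
 and "!!y. y:car M2==>bilin R M2 M2 MMM (%u v. tn M2 MM u (tn M2 M2 v y))"
by (assumption | rule l hom_comp[OF assms] hom_mem[OF assms])+

text \<open>Expanding both sides at \<open>a \<otimes> b\<close> leaves \<open>a\<close> untouched
  and produces the two iterated forms of \<open>\<mu>\<close> at \<open>b\<close>, which
  \<open>coassoc\<close> exchanges.\<close>

lemma Dr_coassoc:
assumes "U:car M2"
shows "sw MMM (Dr U) (%x y. sw MMM (Dr x) (%u v. tn M2 MM u (tn M2 M2 v y))) = sw MMM (Dr U) (%x y. tn M2 MM x (Dr y))"
proof (rule tens_heq[OF mT mT assms sw_D_hom(1,2)[OF Dr_hom]])
fix a b assume a: "a:cT" and b: "b:cT"
note ll = lD a b mMMM
have "sw MMM (Dr (t2 a b)) (%x y. sw MMM (Dr x) (%u v. tn M2 MM u (tn M2 M2 v y))) =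
 smu MMM b (%u v w. sw MMM (Dr (t2 a u)) (%p q. tn M2 MM p (tn M2 M2 q (t2 v w))))" (is "?lh = _")
 by (rule sw_Dr[OF a b sw_D_hom(3)[OF Dr_hom] mMMM])
also have "... = smu MMM b (%u v w. smu MMM u (%x y z. tn M2 MM (t2 a x) (tn M2 M2 (t2 y z) (t2 v w))))"
 by (rule T3.cong, (assumption | rule ll)+, rule sw_Dr[OF a _ sw_D_hom(5)[OF Dr_hom] mMMM]) (assumption | rule ll)+
also have "... = smu MMM b (%u v w. smu MMM w (%x y z. tn M2 MM (t2 a u) (tn M2 M2 (t2 v x) (t2 y z))))"
 by (rule coassoc[OF b mMMM, symmetric]) (assumption | rule ll)+
also have "... = smu MMM b (%u v w. tn M2 MM (t2 a u) (smu MM w (%x y z. tn M2 M2 (t2 v x) (t2 y z))))"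
 by (rule T3.cong[symmetric], (assumption | rule ll)+, rule T3.hom[OF lin_tens2[OF lin_id]]) (assumption | rule ll)+
also have "... = smu MMM b (%u v w. tn M2 MM (t2 a u) (Dr (t2 v w)))"
 by (rule T3.cong, (assumption | rule ll)+, simp add: Dr_t2) (assumption | rule ll)+
also have "... = sw MMM (Dr (t2 a b)) (%x y. tn M2 MM x (Dr y))"
 by (rule sw_Dr[OF a b sw_D_hom(4)[OF Dr_hom] mMMM, symmetric])
finally show "?lh = ..." .
qed

lemma Dl_coassoc:
assumes "U:car M2"
shows "sw MMM (Dl U) (%x y. sw MMM (Dl x) (%u v. tn M2 MM u (tn M2 M2 v y))) = sw MMM (Dl U) (%x y. tn M2 MM x (Dl y))"
proof (rule tens_heq[OF mT mT assms sw_D_hom(1,2)[OF Dl_hom]])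
fix a b assume a: "a:cT" and b: "b:cT"
note ll = lD a b mMMM
have "sw MMM (Dl (t2 a b)) (%x y. sw MMM (Dl x) (%u v. tn M2 MM u (tn M2 M2 v y))) =
 smu MMM a (%u v w. sw MMM (Dl (t2 u v)) (%p q. tn M2 MM p (tn M2 M2 q (t2 w b))))" (is "?lh = _")
 by (rule sw_Dl[OF a b sw_D_hom(3)[OF Dl_hom] mMMM])
also have "... = smu MMM a (%u v w. smu MMM u (%x y z. tn M2 MM (t2 x y) (tn M2 M2 (t2 z v) (t2 w b))))"
 by (rule T3.cong, (assumption | rule ll)+, rule sw_Dl[OF _ _ sw_D_hom(5)[OF Dl_hom] mMMM]) (assumption | rule ll)+
also have "... = smu MMM a (%u v w. smu MMM w (%x y z. tn M2 MM (t2 u v) (tn M2 M2 (t2 x y) (t2 z b))))"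
 by (rule coassoc[OF a mMMM, symmetric]) (assumption | rule ll)+
also have "... = smu MMM a (%u v w. tn M2 MM (t2 u v) (smu MM w (%x y z. tn M2 M2 (t2 x y) (t2 z b))))"
 by (rule T3.cong[symmetric], (assumption | rule ll)+, rule T3.hom[OF lin_tens2[OF lin_id]]) (assumption | rule ll)+
also have "... = smu MMM a (%u v w. tn M2 MM (t2 u v) (Dl (t2 w b)))"
 by (rule T3.cong, (assumption | rule ll)+, simp add: Dl_t2 b) (assumption | rule ll)+
also have "... = sw MMM (Dl (t2 a b)) (%x y. tn M2 MM x (Dl y))"
 by (rule sw_Dl[OF a b sw_D_hom(4)[OF Dl_hom] mMMM, symmetric])
finally show "?lh = ..." .
qed

abbreviation "MT == tp R M2 T"

lemma mMT: "module R MT" by (rule mod_tens[OF mM2 mT])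

lemma bilin_N: "bilin R M2 M2 MT (%x y. tn M2 T y (nabla T x))" "bilin R M2 M2 MT (%x y. tn M2 T x (nabla T y))"
by (assumption | rule l)+

text \<open>This counit law holds on the whole tensor square, directly from
  \<open>\<mu>_right\<close>. Its mirror image is established only on \<open>C\<close>, in
  \<open>right_sub\<close>.\<close>

lemma Dr_counit_r:
assumes "U:car M2"
shows "sw MT (Dr U) (%x y. tn M2 T x (nabla T y)) = tn M2 T U eT"
proof (rule tens_heq[OF mT mT assms])
show "(%U. sw MT (Dr U) (%x y. tn M2 T x (nabla T y))):Hom R M2 MT"
 by (assumption | rule lD bilin_N)+
show "(%U. tn M2 T U eT):Hom R M2 MT" by (assumption | rule l)+
fix a b assume a: "a:cT" and b: "b:cT"
note ll = l a b
have "sw MT (Dr (t2 a b)) (%x y. tn M2 T x (nabla T y)) = smu MT b (%u v w. tn M2 T (t2 a u) (nabla T (t2 v w)))" (is "?lh = _")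
 by (rule sw_Dr[OF a b bilin_N(2) mMT])
also have "... = smu MT b (%u v w. tn M2 T (t2 a u) (v ** w))"
 by (rule T3.cong, (assumption | rule ll)+, simp add: nab(2)) (assumption | rule ll)+
also have "... = tn M2 T (t2 a b) eT"
 by (rule right[OF b _ mMT, where G = "%u v. tens R M2 T (t2 a u) v"]) (assumption | rule ll)+
finally show "?lh = ..." .
qed

lemma Dl_counit_l:
assumes "U:car M2"
shows "sw MT (Dl U) (%x y. tn M2 T y (nabla T x)) = tn M2 T U eT"
proof (rule tens_heq[OF mT mT assms])
show "(%U. sw MT (Dl U) (%x y. tn M2 T y (nabla T x))):Hom R M2 MT"
 by (assumption | rule lD bilin_N)+
show "(%U. tn M2 T U eT):Hom R M2 MT" by (assumption | rule l)+
fix a b assume a: "a:cT" and b: "b:cT"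
note ll = l a b
have "sw MT (Dl (t2 a b)) (%x y. tn M2 T y (nabla T x)) = smu MT a (%u v w. tn M2 T (t2 w b) (nabla T (t2 u v)))" (is "?lh = _")
 by (rule sw_Dl[OF a b bilin_N(1) mMT])
also have "... = smu MT a (%u v w. tn M2 T (t2 w b) (u ** v))"
 by (rule T3.cong, (assumption | rule ll)+, simp add: nab(2)) (assumption | rule ll)+
also have "... = tn M2 T (t2 a b) eT"
 by (rule left[OF a _ mMT, where G = "%u v. tens R M2 T (t2 v b) u"]) (assumption | rule ll)+
finally show "?lh = ..." .
qed

end

lemma lift_through_injective:
assumes "module R A" "module R B" "module R X" "\<iota>:Hom R A B" "\<nu>:Hom R X B"
 and inj: "!!a b. a:car A==>b:car A==>\<iota> a = \<iota> b==>a = b"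
 and im: "!!x. x:car X==>\<nu> x:\<iota> ` car A"
obtains \<rho> where "\<rho>:Hom R X A" "!!x. x:car X==>\<iota> (\<rho> x) = \<nu> x"
proof
interpret A: module R A by fact
interpret X: module R X by fact
define \<rho> where "\<rho> = (%x. inv_into (car A) \<iota> (\<nu> x))"
show eq: "\<iota> (\<rho> x) = \<nu> x" if "x:car X" for x
 unfolding \<rho>_def by (rule f_inv_into_f[OF im[OF that]])
have cl: "\<rho> x:car A" if "x:car X" for x
 unfolding \<rho>_def by (rule inv_into_into[OF im[OF that]])
show "\<rho>:Hom R X A"
proof (rule mod_homI)
 show "\<rho> (x \<oplus>\<^bsub>X\<^esub> y) = \<rho> x \<oplus>\<^bsub>A\<^esub> \<rho> y" if "x:car X" "y:car X" for x y
 by (rule inj) (use that cl eq mod_hom_add[OF assms(4)] mod_hom_add[OF assms(5)] in simp_all)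
 show "\<rho> (r \<odot>\<^bsub>X\<^esub> x) = r \<odot>\<^bsub>A\<^esub> \<rho> x" if "r:car R" "x:car X" for r x
 by (rule inj) (use that cl eq hom_smult[OF assms(4)] hom_smult[OF assms(5)] in simp_all)
qed (rule cl)
qed

lemma alg_mult_hom:
assumes "k_algebra R A" "same_module A M"
shows "x:car M==>f:Hom R X M==>(%y. f y \<otimes>\<^bsub>A\<^esub> x):Hom R X M"
 "x:car M==>f:Hom R X M==>(%y. x \<otimes>\<^bsub>A\<^esub> f y):Hom R X M"
 "x:car M==>y:car M==>x \<otimes>\<^bsub>A\<^esub> y:car M"
proof -
interpret A: k_algebra R A by fact
have e: "Hom R X M = Hom R X A" by (rule same_mhom[OF same_refl]) (use assms(2) in \<open>simp add: same_module_def\<close>)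
have c: "car M = car A" using assms(2) by (simp add: same_module_def)
show "x:car M==>f:Hom R X M==>(%y. f y \<otimes>\<^bsub>A\<^esub> x):Hom R X M"
 "x:car M==>f:Hom R X M==>(%y. x \<otimes>\<^bsub>A\<^esub> f y):Hom R X M"
 "x:car M==>y:car M==>x \<otimes>\<^bsub>A\<^esub> y:car M"
 unfolding e c by (rule A.rmult_hom A.lmult_hom A.m_closed; assumption)+
qed

section \<open>Products on the tensor squares, and multiplicativity of \<open>Dr\<close> and
  \<open>Dl\<close>\<close>

context pretorsor
begin

abbreviation "T' == opp T"
abbreviation "P2 == tp R T' T"
abbreviation "Q2 == tp R T T'"

lemma T'_alg: "k_algebra R T'" by (rule opp_algebra[OF k_algebra_axioms])
lemma P2_alg: "k_algebra R P2" by (rule tensor_k_algebra[OF T'_alg k_algebra_axioms])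
lemma Q2_alg: "k_algebra R Q2" by (rule tensor_k_algebra[OF k_algebra_axioms T'_alg])

lemma same_P2: "same_module P2 M2" and same_Q2: "same_module Q2 M2"
by (rule same_tensor same_opp same_refl)+

lemma tens_opp: "tn T' T = t2" "tn T T' = t2"
by (rule same_tens same_opp same_refl)+

lemma P2_mult: "a:cT==>b:cT==>c:cT==>d:cT ==>
 t2 a b \<otimes>\<^bsub>P2\<^esub> t2 c d = t2 (c ** a) (b ** d)"
using two_algebras.tens_mult[OF two_algebras.intro[OF T'_alg k_algebra_axioms], of a b c d] by (simp add: tens_opp)

lemma Q2_mult: "a:cT==>b:cT==>c:cT==>d:cT ==>
 t2 a b \<otimes>\<^bsub>Q2\<^esub> t2 c d = t2 (a ** c) (d ** b)"
using two_algebras.tens_mult[OF two_algebras.intro[OF k_algebra_axioms T'_alg], of a b c d] by (simp add: tens_opp)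

lemma P2_one: "\<one>\<^bsub>P2\<^esub> = t2 eT eT" and Q2_one: "\<one>\<^bsub>Q2\<^esub> = t2 eT eT"
by (simp_all add: tsimps(4) tens_opp)

lemma Dr_one: "Dr (t2 eT eT) = tn M2 M2 (t2 eT eT) (t2 eT eT)"
proof -
have "Dr (t2 eT eT) = smu MM eT (%u v w. tt eT u v w)" by (rule Dr_t2) simp_all
also have "... = tn M2 M2 (t2 eT eT) (t2 eT eT)"
 unfolding \<mu>_one by (rule T3.tens) (assumption | rule l)+
finally show ?thesis .
qed

lemma Dl_one: "Dl (t2 eT eT) = tn M2 M2 (t2 eT eT) (t2 eT eT)"
proof -
have "Dl (t2 eT eT) = smu MM eT (%u v w. tt u v w eT)" by (rule Dl_t2) simp_all
also have "... = tn M2 M2 (t2 eT eT) (t2 eT eT)"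
 unfolding \<mu>_one by (rule T3.tens) (assumption | rule l)+
finally show ?thesis .
qed

lemma mult_reduce:
assumes A: "k_algebra R A" "same_module A M2" and E: "k_algebra R E" "same_module E N" and D: "D:Hom R M2 N"
 and pure: "!!a b c d. a:cT==>b:cT==>c:cT==>d:cT ==>
 D (t2 a b \<otimes>\<^bsub>A\<^esub> t2 c d) = D (t2 a b) \<otimes>\<^bsub>E\<^esub> D (t2 c d)"
 and X: "X:car M2" and Y: "Y:car M2"
shows "D (X \<otimes>\<^bsub>A\<^esub> Y) = D X \<otimes>\<^bsub>E\<^esub> D Y"
proof -
note am = alg_mult_hom[OF A]
note bm = alg_mult_hom[OF E]
note Dc = hom_mem[OF D] and Dm = hom_comp[OF D]
show ?thesis
proof (rule tens_heq[OF mT mT X Dm[OF am(1)[OF Y lin_id]] bm(1)[OF Dc[OF Y] D]])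
 fix a b assume ab: "a:cT" "b:cT"
 have t: "t2 a b:car M2" by (rule tens_in ab mT)+
 show "D (t2 a b \<otimes>\<^bsub>A\<^esub> Y) = D (t2 a b) \<otimes>\<^bsub>E\<^esub> D Y"
 by (rule tens_heq[OF mT mT Y Dm[OF am(2)[OF t lin_id]] bm(2)[OF Dc[OF t] D] pure[OF ab]])
qed
qed

lemma Dr_mult:
assumes "X:car M2" "Y:car M2"
shows "Dr (X \<otimes>\<^bsub>P2\<^esub> Y) = Dr X \<otimes>\<^bsub>tp R P2 P2\<^esub> Dr Y"
proof (rule mult_reduce[OF P2_alg same_P2 tensor_k_algebra[OF P2_alg P2_alg] same_tensor[OF same_P2 same_P2] Dr_hom _ assms])
let ?PP = "tp R P2 P2"
fix a b c d assume x: "a:cT" "b:cT" "c:cT" "d:cT"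
note bm = alg_mult_hom[OF tensor_k_algebra[OF P2_alg P2_alg] same_tensor[OF same_P2 same_P2]]
note ll = lD x bm
have tm: "tt a u v w \<otimes>\<^bsub>?PP\<^esub> tt c u' v' w' = tt (c ** a) (u ** u') (v' ** v) (w ** w')"
 if "u:cT" "v:cT" "w:cT" "u':cT" "v':cT" "w':cT" for u v w u' v' w'
proof -
 have eq: "tn P2 P2 = tn M2 M2" by (rule same_tens[OF same_P2 same_P2])
 have cP: "car P2 = car M2" using same_P2 by (simp add: same_module_def)
 have t: "t2 y z:car P2" if "y:cT" "z:cT" for y z
 unfolding cP by (rule tens_in that mT)+
 show ?thesis
 using two_algebras.tens_mult[OF two_algebras.intro[OF P2_alg P2_alg] t t t t, of a u v w c u' v' w'] that x
 by (simp add: eq P2_mult)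
qed
have "Dr (t2 a b \<otimes>\<^bsub>P2\<^esub> t2 c d) = sw3 MM (\<mu> (b ** d)) (%u v w. tt (c ** a) u v w)"
 unfolding P2_mult[OF x] by (rule Dr_t2) (rule ll)+
also have "... = smu MM b (%u v w. smu MM d (%u' v' w'. tt (c ** a) (u ** u') (v' ** v) (w ** w')))"
 by (rule \<mu>_mult') (assumption | rule ll)+
also have "... = smu MM b (%u v w. smu MM d (%u' v' w'. tt a u v w \<otimes>\<^bsub>?PP\<^esub> tt c u' v' w'))"
 by (rule T3.cong, (assumption | rule ll)+, rule T3.cong, (assumption | rule ll)+, simp only: tm) (assumption | rule ll)+
also have "... = smu MM b (%u v w. tt a u v w \<otimes>\<^bsub>?PP\<^esub> smu MM d (%u' v' w'. tt c u' v' w'))"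
 by (rule T3.cong[symmetric], (assumption | rule ll)+, rule T3.hom[OF bm(2)[OF _ lin_id]]) (assumption | rule ll)+
also have "... = smu MM b (%u v w. tt a u v w) \<otimes>\<^bsub>?PP\<^esub> smu MM d (%u' v' w'. tt c u' v' w')"
 by (rule T3.hom[OF bm(1)[OF _ lin_id], symmetric]) (assumption | rule ll)+
finally show "Dr (t2 a b \<otimes>\<^bsub>P2\<^esub> t2 c d) = Dr (t2 a b) \<otimes>\<^bsub>?PP\<^esub> Dr (t2 c d)"
 using x by (simp add: Dr_t2)
qed

lemma Dl_mult:
assumes "X:car M2" "Y:car M2"
shows "Dl (X \<otimes>\<^bsub>Q2\<^esub> Y) = Dl X \<otimes>\<^bsub>tp R Q2 Q2\<^esub> Dl Y"
proof (rule mult_reduce[OF Q2_alg same_Q2 tensor_k_algebra[OF Q2_alg Q2_alg] same_tensor[OF same_Q2 same_Q2] Dl_hom _ assms])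
let ?PP = "tp R Q2 Q2"
fix a b c d assume x: "a:cT" "b:cT" "c:cT" "d:cT"
note bm = alg_mult_hom[OF tensor_k_algebra[OF Q2_alg Q2_alg] same_tensor[OF same_Q2 same_Q2]]
note ll = lD x bm
have tm: "tt u v w b \<otimes>\<^bsub>?PP\<^esub> tt u' v' w' d = tt (u ** u') (v' ** v) (w ** w') (d ** b)"
 if "u:cT" "v:cT" "w:cT" "u':cT" "v':cT" "w':cT" for u v w u' v' w'
proof -
 have eq: "tn Q2 Q2 = tn M2 M2" by (rule same_tens[OF same_Q2 same_Q2])
 have cP: "car Q2 = car M2" using same_Q2 by (simp add: same_module_def)
 have t: "t2 y z:car Q2" if "y:cT" "z:cT" for y z
 unfolding cP by (rule tens_in that mT)+
 show ?thesis
 using two_algebras.tens_mult[OF two_algebras.intro[OF Q2_alg Q2_alg] t t t t, of u v w b u' v' w' d] that x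
 by (simp add: eq Q2_mult)
qed
have "Dl (t2 a b \<otimes>\<^bsub>Q2\<^esub> t2 c d) = sw3 MM (\<mu> (a ** c)) (%u v w. tt u v w (d ** b))"
 unfolding Q2_mult[OF x] by (rule Dl_t2) (rule ll)+
also have "... = smu MM a (%u v w. smu MM c (%u' v' w'. tt (u ** u') (v' ** v) (w ** w') (d ** b)))"
 by (rule \<mu>_mult') (assumption | rule ll)+
also have "... = smu MM a (%u v w. smu MM c (%u' v' w'. tt u v w b \<otimes>\<^bsub>?PP\<^esub> tt u' v' w' d))"
 by (rule T3.cong, (assumption | rule ll)+, rule T3.cong, (assumption | rule ll)+, simp only: tm) (assumption | rule ll)+
also have "... = smu MM a (%u v w. tt u v w b \<otimes>\<^bsub>?PP\<^esub> smu MM c (%u' v' w'. tt u' v' w' d))"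
 by (rule T3.cong[symmetric], (assumption | rule ll)+, rule T3.hom[OF bm(2)[OF _ lin_id]]) (assumption | rule ll)+
also have "... = smu MM a (%u v w. tt u v w b) \<otimes>\<^bsub>?PP\<^esub> smu MM c (%u' v' w'. tt u' v' w' d)"
 by (rule T3.hom[OF bm(1)[OF _ lin_id], symmetric]) (assumption | rule ll)+
finally show "Dl (t2 a b \<otimes>\<^bsub>Q2\<^esub> t2 c d) = Dl (t2 a b) \<otimes>\<^bsub>?PP\<^esub> Dl (t2 c d)"
 using x by (simp add: Dl_t2)
qed

end

section \<open>Bialgebras cut out of the tensor square by a coaction of \<open>T\<close>\<close>

text \<open>\<open>\<nu>\<close> is \<open>\<mu>\<close> with its three legs distributed over \<open>(T \<otimes> T) \<otimes> T\<close>.\<close>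

locale sub_coaction = pretorsor R T \<mu> for R :: "('k, 'r) ring_scheme" and T :: "('k, 't) module" and \<mu> +
fixes C :: "('t, 't) tensor set" and \<rho> \<nu>
assumes C: "submodule C R M2"
 and \<rho>_hom: "\<rho>:Hom R T (tp R (sub M2 C) T)"
 and \<nu>_hom: "\<nu>:Hom R T MT"
 and \<rho>_incl: "!!x. x:car T==>tmp R M2 T id id (\<rho> x) = \<nu> x"
begin

abbreviation "CM == sub M2 C"
abbreviation "CT == tp R CM T"

lemma Cs: "C <= car M2" by (rule submod_sub[OF C])
lemma CD: "x:C==>x:car M2" using Cs by blast
lemma mC: "module R CM" by (rule sub_module[OF C mM2])
lemma mCT: "module R CT" by (rule mod_tens[OF mC mT])
lemma inclC: "id:Hom R CM M2" by (rule incl_hom(4)[OF Cs])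
lemma inclCT: "tmp R M2 T id id:Hom R CT MT"
by (rule tmap_hom[OF inclC id_hom mC mT mM2 mT])

lemma inclCT_inj: "x:car CT==>y:car CT==>tmp R M2 T id id x = tmp R M2 T id id y==>x = y"
by (rule mod_hom_eq_zero_inj[OF mCT mMT inclCT])
 (rule flat_injective[OF faithfully_flat_imp_flat[OF ff] mC mM2 inclC]; simp)+

lemmas \<rho>_closed = hom_mem[OF \<rho>_hom] and \<nu>_closed = hom_mem[OF \<nu>_hom]

lemma sw_CC:
assumes "\<zeta>:car (tp R CM CM)" "bilin R M2 M2 P F" "module R P"
shows "sw P (tmp R M2 M2 id id \<zeta>) F = sw P \<zeta> F"
proof -
have "sw P (tmp R M2 M2 id id \<zeta>) F = sw P \<zeta> (%x y. sw P (tn M2 M2 (id x) (id y)) F)"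
 unfolding tensor_map_sw[OF inclC inclC mC mC mM2 mM2 assms(1)]
 by (rule sw_hom[OF sw_mhom[OF assms(2) mM2 mM2 assms(3)] assms(1) _ mC mC mMM assms(3)])
 (auto intro!: tens_in mM2 CD)
also have "... = sw P \<zeta> F"
 by (rule sw_cong[OF refl assms(1) mC mC assms(3)])
 (use sw_tens[OF assms(2) _ _ mM2 mM2 assms(3)] bilin_in[OF assms(2)] CD in auto)
finally show ?thesis .
qed

lemma sw_\<rho>:
assumes "x:cT" "bilin R M2 T P F" "module R P"
shows "sw P (\<nu> x) F = sw P (\<rho> x) F"
proof -
have \<rho>x: "\<rho> x:car CT" by (rule \<rho>_closed[OF assms(1)])
have "sw P (\<nu> x) F = sw P (\<rho> x) (%c t. sw P (tn M2 T (id c) (id t)) F)"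
 unfolding \<rho>_incl[OF assms(1), symmetric] tensor_map_sw[OF inclC id_hom mC mT mM2 mT \<rho>x]
 by (rule sw_hom[OF sw_mhom[OF assms(2) mM2 mT assms(3)] \<rho>x _ mC mT mMT assms(3)])
 (auto intro!: tens_in mM2 mT CD)
also have "... = sw P (\<rho> x) F"
 by (rule sw_cong[OF refl \<rho>x mC mT assms(3)])
 (use sw_tens[OF assms(2) _ _ mM2 mT assms(3)] bilin_in[OF assms(2)] CD in auto)
finally show ?thesis .
qed

text \<open>\<open>CC\<close> is the image of \<open>C \<otimes> C\<close>. To show that an element
  lies in it, descent asks only that its product tensor with 1 lie in \<open>CCT\<close>.\<close>

abbreviation "CC == tmp R M2 M2 id id ` car (tp R CM CM)"
abbreviation "CCT == tmp R MM T id id ` car (tp R (sub MM CC) T)"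

lemma CC: "submodule CC R MM"
by (rule image_submodule[OF mod_tens[OF mC mC] mMM tmap_hom[OF inclC inclC mC mC mM2 mM2]])

lemma CCT: "submodule CCT R (tp R MM T)"
by (rule image_submodule[OF mod_tens[OF sub_module[OF CC mMM] mT] mod_tens[OF mMM mT]
 tmap_hom[OF incl_hom(4)[OF submod_sub[OF CC]] id_hom sub_module[OF CC mMM] mT mMM mT]])

lemma CCT_pure: "c:C==>c':C==>t:cT==>tn MM T (tn M2 M2 c c') t:CCT"
proof -
assume c: "c:C" "c':C" "t:cT"
have cc: "tn M2 M2 c c':CC"
 using tmap_tens[OF inclC inclC mC mC mM2 mM2, of c c'] tens_in[of c CM c' CM, OF _ _ mC mC] c
 by (intro image_eqI[where x = "tens R CM CM c c'"]) simp_all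
show ?thesis
 using tmap_tens[OF incl_hom(4)[OF submod_sub[OF CC]] id_hom sub_module[OF CC mMM] mT mMM mT, of "tn M2 M2 c c'" t]
 tens_in[of "tn M2 M2 c c'" "sub MM CC" t T, OF _ _ sub_module[OF CC mMM] mT] cc c
 by (intro image_eqI[where x = "tens R (sub MM CC) T (tens R M2 M2 c c') t"]) simp_all
qed

lemma in_CC:
"m:car MM==>tn MM T m eT:CCT==>m:CC"
by (rule descent_submodule[OF mMM CC])

end

text \<open>The torsor equation yields an expansion of \<open>U \<otimes> 1\<close> whose last leg
  is not the product \<open>a ** u\<close> but a twisted one; \<open>g\<close> stands for it, later
  \<open>\<theta> u ** a\<close>. By \<open>g_unit\<close> the two agree on \<open>C\<close> after
  summation, and the point of the locale is to replace \<open>g\<close> by the product.\<close>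

locale right_sub = sub_coaction R T \<mu> C \<rho>
 "%x. sw3 (tp R (tp R T T) T) (\<mu> x) (%u v w. tens R (tp R T T) T (tens R T T v w) u)"
for R :: "('k, 'r) ring_scheme" and T :: "('k, 't) module" and \<mu> C \<rho> +
fixes g :: "'t => 't => 't"
assumes C_one: "t2 \<one>\<^bsub>T\<^esub> \<one>\<^bsub>T\<^esub>:C" and C_mult: "!!x y. x:C==>y:C==>x \<otimes>\<^bsub>P2\<^esub> y:C"
 and C_unit: "!!U. U:C==>EX r:car R. nabla T U = r \<odot>\<^bsub>T\<^esub> \<one>\<^bsub>T\<^esub>"
 and g: "bilin R T T T g" and g_unit: "!!U. U:C==>sw T U g = nabla T U"
 and expand_g: "!!U. U:C ==>
 sw MT U (%a b. sw3 MT (\<mu> b) (%u v w. tens R M2 T (t2 v w) (g a u))) = tens R M2 T U \<one>\<^bsub>T\<^esub>"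
begin

lemma sw_\<nu>:
assumes "x:cT" "bilin R M2 T P F" "module R P"
shows "sw P (smu MT x (%u v w. tn M2 T (t2 v w) u)) F = smu P x (%u v w. F (t2 v w) u)"
proof -
note ll = l assms bilin_in[OF assms(2)]
have "sw P (smu MT x (%u v w. tn M2 T (t2 v w) u)) F = smu P x (%u v w. sw P (tn M2 T (t2 v w) u) F)"
 by (rule T3.hom[OF sw_mhom[OF assms(2)]]) (assumption | rule ll)+
also have "... = smu P x (%u v w. F (t2 v w) u)"
 by (rule T3.cong, (assumption | rule ll)+, rule sw_tens[OF assms(2)]) (assumption | rule ll)+
finally show ?thesis .
qed

lemma sw_Dr_gen:
assumes "U:car M2" "bilin R M2 M2 P F" "module R P"
shows "sw P (Dr U) F = sw P U (%a b. smu P b (%u v w. F (t2 a u) (t2 v w)))"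
proof -
have F: "(%x. F (f x) y):Hom R X P" if "f:Hom R X M2" "y:car M2" for f y and X :: "('k, 'x) module"
 using assms(2) that by (intro hom_comp[OF _ that(1)]) (auto simp: bilin_def)
have F': "(%y. F x (f y)):Hom R X P" if "f:Hom R X M2" "x:car M2" for f x and X :: "('k, 'x) module"
 using assms(2) that by (intro hom_comp[OF _ that(1)]) (auto simp: bilin_def)
note ll = l F F' assms(3)
have b: "bilin R T T P (%a b. smu P b (%u v w. F (t2 a u) (t2 v w)))"
 by (assumption | rule ll)+
show ?thesis
proof (rule tens_heq[OF mT mT assms(1)])
 show "(%U. sw P (Dr U) F):Hom R M2 P" by (rule lin_sw1[OF Dr_hom assms(2) mM2 mM2 assms(3)])
 show "(%U. sw P U (%a b. smu P b (%u v w. F (t2 a u) (t2 v w)))):Hom R M2 P"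
 by (rule sw_mhom[OF b mT mT assms(3)])
 show "sw P (Dr (t2 x y)) F = sw P (t2 x y) (%a b. smu P b (%u v w. F (t2 a u) (t2 v w)))"
 if "x:cT" "y:cT" for x y
 by (simp add: sw_Dr[OF that assms(2,3)] sw_tens[OF b that mT mT assms(3)])
qed
qed

lemma g_lin: "f:Hom R X T==>a:cT==>(%x. g (f x) a):Hom R X T"
"f:Hom R X T==>a:cT==>(%x. g a (f x)):Hom R X T"
using g by (auto simp: bilin_def intro: hom_comp[of "%x. g x a"] hom_comp[of "g a"])

lemmas lg = lD g_lin bilin_in[OF g] mMM

text \<open>Expand \<open>U \<otimes> 1\<close> by \<open>expand_g\<close> and apply
  \<open>Dr\<close> to the leg in the tensor square. Coassociativity rewrites the result as two
  successive coactions on \<open>b\<close>; each has its tensor-square leg in \<open>C\<close>, so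
  the whole lies in the image of \<open>C \<otimes> C \<otimes> T\<close>, and descent removes
  \<open>T\<close>.\<close>

lemma Dr_in_CC:
assumes "U:C"
shows "Dr U:CC"
proof (rule in_CC[OF Dr_closed[OF CD[OF assms]]])
let ?X = "tp R MM T" and ?K = "%m t. tn MM T (Dr m) t"
have mX: "module R ?X" by (rule mod_tens[OF mMM mT])
note ll = lg mX mMT
have U: "U:car M2" by (rule CD[OF assms])
have K: "bilin R M2 T ?X ?K" by (assumption | rule ll)+
have "tn MM T (Dr U) eT = sw ?X (tn M2 T U eT) ?K"
 by (rule sw_tens[OF K U one_closed mM2 mT mX, symmetric])
also have "... = sw ?X U (%a b. sw ?X (smu MT b (%u v w. tn M2 T (t2 v w) (g a u))) ?K)"
 unfolding expand_g[OF assms, symmetric]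
 by (rule sw_hom[OF sw_mhom[OF K mM2 mT mX] U]) (assumption | rule ll)+
also have "...:CCT"
proof (rule sw_submodule[OF CCT U mT mT mX])
 fix a b assume a: "a:cT" and b: "b:cT"
 note la = ll a b
 have F1: "bilin R M2 T ?X (%c x. tn MM T (tn M2 M2 c m) (g a x))" if "m:car M2" for m
 by (assumption | rule la that)+
 have F2: "bilin R M2 T ?X (%c' u. smu ?X u (%x y z. tn MM T (tn M2 M2 (t2 y z) c') (g a x)))"
 by (assumption | rule la)+
 have "sw ?X (smu MT b (%u v w. tn M2 T (t2 v w) (g a u))) ?K =
  smu ?X b (%u v w. sw ?X (tn M2 T (t2 v w) (g a u)) ?K)"
 by (rule T3.hom[OF sw_mhom[OF K]]) (assumption | rule la)+
 also have "... = smu ?X b (%u v w. tn MM T (Dr (t2 v w)) (g a u))"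
 by (rule T3.cong, (assumption | rule la)+, rule sw_tens[OF K]) (assumption | rule la)+
 also have "... = smu ?X b (%u v w. smu ?X w (%x y z. tn MM T (tt v x y z) (g a u)))"
 by (rule T3.cong, (assumption | rule la)+, simp only: Dr_t2, rule T3.hom[OF lin_tens1[OF lin_id]]) (assumption | rule la)+
 also have "... = smu ?X b (%u v w. smu ?X u (%x y z. tn MM T (tn M2 M2 (t2 y z) (t2 v w)) (g a x)))"
 by (rule coassoc[OF b mX, where F = "%a' b c d e. tens R MM T (tt b c d e) (g a a')"]) (assumption | rule la)+
 also have "... = sw ?X (\<rho> b) (%c' u. smu ?X u (%x y z. tn MM T (tn M2 M2 (t2 y z) c') (g a x)))"
 unfolding sw_\<rho>[OF b F2 mX, symmetric] by (rule sw_\<nu>[OF b F2 mX, symmetric])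
 also have "...:CCT"
 proof (rule sw_submodule[OF CCT \<rho>_closed[OF b] mC mT mX])
 fix c' u assume c': "c':car CM" and u: "u:cT"
 have c'C: "c':C" using c' by simp
 have "smu ?X u (%x y z. tn MM T (tn M2 M2 (t2 y z) c') (g a x)) =
  sw ?X (\<rho> u) (%c x. tn MM T (tn M2 M2 c c') (g a x))"
  unfolding sw_\<rho>[OF u F1[OF CD[OF c'C]] mX, symmetric] by (rule sw_\<nu>[OF u F1[OF CD[OF c'C]] mX, symmetric])
 also have "...:CCT"
  by (rule sw_submodule[OF CCT \<rho>_closed[OF u] mC mT mX CCT_pure[OF _ c'C]])
  (simp, rule bilin_in[OF g a], assumption)
 finally show "smu ?X u (%x y z. tn MM T (tn M2 M2 (t2 y z) c') (g a x)):CCT" .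
 qed
 finally show "sw ?X (smu MT b (%u v w. tn M2 T (t2 v w) (g a u))) ?K:CCT" .
qed
finally show "tn MM T (Dr U) eT:CCT" .
qed

text \<open>Once \<open>Dr U\<close> is known to come from \<open>C \<otimes> C\<close>, the product
  on its first leg may be replaced by \<open>g\<close> through \<open>g_unit\<close>, and what
  remains is \<open>expand_g\<close>.\<close>

lemma counit_l:
assumes "U:C"
shows "sw MT (Dr U) (%x y. tn M2 T y (nabla T x)) = tn M2 T U eT"
proof -
have U: "U:car M2" by (rule CD[OF assms])
let ?G = "%m. sw T m g"
have G: "?G:Hom R M2 T" by (rule sw_mhom[OF g mT mT mT])
note ll = lg mMT hom_mem[OF G] hom_comp[OF G]
obtain z where z: "z:car (tp R CM CM)" "Dr U = tmp R M2 M2 id id z"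
 using Dr_in_CC[OF assms] by (elim imageE) simp
have b1: "bilin R M2 M2 MT (%x y. tn M2 T y (nabla T x))" "bilin R M2 M2 MT (%x y. tn M2 T y (?G x))"
 by (assumption | rule ll)+
have "sw MT (Dr U) (%x y. tn M2 T y (nabla T x)) = sw MT z (%x y. tn M2 T y (nabla T x))"
 unfolding z(2) by (rule sw_CC[OF z(1) b1(1) mMT])
also have "... = sw MT z (%x y. tn M2 T y (?G x))"
 by (rule sw_cong[OF refl z(1) mC mC mMT])
 (simp add: g_unit, rule bilin_in[OF b1(1)], simp_all add: CD)
also have "... = sw MT (Dr U) (%x y. tn M2 T y (?G x))"
 unfolding z(2) by (rule sw_CC[OF z(1) b1(2) mMT, symmetric])
also have "... = sw MT U (%a b. smu MT b (%u v w. tn M2 T (t2 v w) (?G (t2 a u))))"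
 by (rule sw_Dr_gen[OF U b1(2) mMT])
also have "... = sw MT U (%a b. smu MT b (%u v w. tn M2 T (t2 v w) (g a u)))"
 by (rule sw_cong[OF refl U mT mT mMT], rule T3.cong, (assumption | rule ll)+, simp only: sw_tens[OF g _ _ mT mT mT])
 (assumption | rule ll)+
also have "... = tn M2 T U eT" by (rule expand_g[OF assms])
finally show ?thesis .
qed

text \<open>The expansion with the genuine product, which is the counit law just proved written
  out.\<close>

lemma expand:
assumes "U:C"
shows "sw MT U (%a b. smu MT b (%u v w. tn M2 T (t2 v w) (a ** u))) = tn M2 T U eT"
proof -
have U: "U:car M2" by (rule CD[OF assms])
note ll = lg mMT
have "sw MT U (%a b. smu MT b (%u v w. tn M2 T (t2 v w) (a ** u))) =
 sw MT U (%a b. smu MT b (%u v w. tn M2 T (t2 v w) (nabla T (t2 a u))))"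
 by (rule sw_cong[OF refl U mT mT mMT], rule T3.cong, (assumption | rule ll)+, simp only: nab(2))
 (assumption | rule ll)+
also have "... = sw MT (Dr U) (%x y. tn M2 T y (nabla T x))"
 by (rule sw_Dr_gen[OF U bilin_N(1) mMT, symmetric])
finally show ?thesis unfolding counit_l[OF assms] .
qed

text \<open>\<open>expand\<close> lifted from \<open>M2 \<otimes> T\<close> to
  \<open>C \<otimes> T\<close>, which is possible because flatness of \<open>T\<close> makes the
  inclusion injective. Up to exchanging the legs, it says that the Galois map sends \<open>U\<close>
  to \<open>1 \<otimes> U\<close>.\<close>

lemma sw_\<nu>_mult:
assumes "U:C"
shows "sw CT U (%a b. sw CT (\<rho> b) (%c x. tn CM T c (a ** x))) = tn CM T U eT"
proof (rule inclCT_inj)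
have U: "U:car M2" by (rule CD[OF assms])
have UC: "U:car CM" using assms by simp
note ll = lg mMT mC \<rho>_closed mCT
show "sw CT U (%a b. sw CT (\<rho> b) (%c x. tn CM T c (a ** x))):car CT"
 by (assumption | rule ll U)+
show "tn CM T U eT:car CT" by (assumption | rule ll UC)+
let ?I = "tmp R M2 T id id"
have It: "?I (tn CM T c x) = tn M2 T c x" if "c:car CM" "x:cT" for c x
 using tmap_tens[OF inclC id_hom mC mT mM2 mT that] by simp
have "?I (sw CT U (%a b. sw CT (\<rho> b) (%c x. tn CM T c (a ** x)))) =
 sw MT U (%a b. ?I (sw CT (\<rho> b) (%c x. tn CM T c (a ** x))))" (is "?lh = _")
 by (rule sw_hom[OF inclCT U]) (assumption | rule ll)+
also have "... = sw MT U (%a b. smu MT b (%u v w. tn M2 T (t2 v w) (a ** u)))"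
proof (rule sw_cong[OF refl U mT mT mMT])
 fix a b assume a: "a:cT" and b: "b:cT"
 have bb: "bilin R M2 T MT (%c x. tn M2 T c (a ** x))" by (assumption | rule ll a)+
 have "?I (sw CT (\<rho> b) (%c x. tn CM T c (a ** x))) = sw MT (\<rho> b) (%c x. ?I (tn CM T c (a ** x)))" (is "?lh = _")
 by (rule sw_hom[OF inclCT \<rho>_closed[OF b]]) (assumption | rule ll a)+
 also have "... = sw MT (\<rho> b) (%c x. tn M2 T c (a ** x))"
 by (rule sw_cong[OF refl \<rho>_closed[OF b] mC mT mMT], rule It, assumption, rule m_closed[OF a], assumption)
  (rule hom_mem[OF inclCT], (assumption | rule ll a)+)
 also have "... = smu MT b (%u v w. tn M2 T (t2 v w) (a ** u))"
 unfolding sw_\<rho>[OF b bb mMT, symmetric] by (rule sw_\<nu>[OF b bb mMT])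
 finally show "?lh = ..." .
qed (rule hom_mem[OF inclCT], (assumption | rule ll)+)
also have "... = ?I (tn CM T U eT)" unfolding expand[OF assms] It[OF UC one_closed] ..
finally show "?lh = ..." .
qed

text \<open>The witness is the Galois map of the coaction \<open>\<rho>\<close> with its legs
  exchanged; \<open>sw_\<nu>_mult\<close> is the required property.\<close>

lemma split: "split_after CM M2 id"
unfolding split_after_def
proof (intro conjI inclC bexI ballI)
let ?\<kappa> = "%U. sw CT U (%a b. sw CT (\<rho> b) (%c x. tn CM T c (a ** x)))"
note ll = lg mC hom_comp[OF \<rho>_hom] \<rho>_closed mCT
show "?\<kappa>:Hom R M2 CT" by (assumption | rule ll)+
show "?\<kappa> (id c) = tn CM T c eT" if "c:car CM" for c
 using sw_\<nu>_mult that by simp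
qed

text \<open>In \<open>P2\<close> the product of \<open>a \<otimes> b\<close> and
  \<open>c \<otimes> d\<close> multiplies out to \<open>c a b d\<close>, with the first factor
  enclosed by the second. Since the enclosed product is a scalar on \<open>C\<close>, it can be
  moved out.\<close>

lemma nabla_mult:
assumes "x:C" "y:C"
shows "nabla T (x \<otimes>\<^bsub>P2\<^esub> y) = nabla T x ** nabla T y"
proof -
note am = alg_mult_hom[OF P2_alg same_P2]
note N = hom_comp[OF nab(1)] hom_mem[OF nab(1)]
obtain r where r: "r:car R" "nabla T x = r *s eT" using C_unit[OF assms(1)] by (elim bexE)
have x: "x:car M2" and y: "y:car M2" using assms CD by auto
have "nabla T (x \<otimes>\<^bsub>P2\<^esub> y) = r *s nabla T y"
proof (rule tens_heq[OF mT mT y N(1)[OF am(2)[OF x lin_id]]])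
 have "(%y. (r *s eT) ** nabla T y):Hom R M2 T"
 by (rule lmult_hom[OF _ nab(1)]) (use r in simp)
 moreover have "(r *s eT) ** nabla T y = r *s nabla T y" if "y:car M2" for y
 using that r hom_mem[OF nab(1) that] by (simp add: smult_assoc_l)
 ultimately show "(%y. r *s nabla T y):Hom R M2 T"
 using mod_hom_cong[OF _ mM2, of "%y. (r *s eT) ** nabla T y" "%y. r *s nabla T y" T] by simp
 fix c d assume c: "c:cT" and d: "d:cT"
 have cd: "t2 c d:car M2" by (rule l c d)+
 have "nabla T (x \<otimes>\<^bsub>P2\<^esub> t2 c d) = c ** nabla T x ** d" (is "?lh = _")
 proof (rule tens_heq[OF mT mT x N(1)[OF am(1)[OF cd lin_id]]])
 show "(%x. c ** nabla T x ** d):Hom R M2 T" by (assumption | rule rmult_hom lmult_hom nab(1) c d)+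
 show "nabla T (t2 a b \<otimes>\<^bsub>P2\<^esub> t2 c d) = c ** nabla T (t2 a b) ** d" if "a:cT" "b:cT" for a b
  using that c d by (simp add: P2_mult nab(2) m_assoc)
 qed
 also have "... = r *s nabla T (t2 c d)"
 using c d r by (simp add: nab(2) smult_assoc_l smult_assoc_r)
 finally show "?lh = ..." .
qed
then show ?thesis using r hom_mem[OF nab(1) y] by (simp add: smult_assoc_l)
qed

lemma bialg:
assumes "!!c. c:C==>D' c = Dr c"
shows "sub_bialgebra R T P2 C Dr (nabla T) (induced_comult R P2 C D') (induced_counit R T)"
unfolding induced_counit_def[abs_def]
by (rule sub_bialgebraI[OF P2_alg same_P2 C _ C_mult split Dr_hom])
 (use C_one C_unit nabla_mult nab Dr_one CD Dr_mult Dr_coassoc Dr_in_CC Dr_counit_r counit_l assms in \<open>simp_all add: P2_one\<close>)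

end

text \<open>Here the expansion is supplied with the genuine product, so the missing counit law for
  \<open>Dl\<close> follows from it at once.\<close>

locale left_sub = sub_coaction R T \<mu> C \<rho>
 "%x. sw3 (tp R (tp R T T) T) (\<mu> x) (%u v w. tens R (tp R T T) T (tens R T T u v) w)"
for R :: "('k, 'r) ring_scheme" and T :: "('k, 't) module" and \<mu> C \<rho> +
assumes C_one: "t2 \<one>\<^bsub>T\<^esub> \<one>\<^bsub>T\<^esub>:C" and C_mult: "!!x y. x:C==>y:C==>x \<otimes>\<^bsub>Q2\<^esub> y:C"
 and C_unit: "!!U. U:C==>EX r:car R. nabla T U = r \<odot>\<^bsub>T\<^esub> \<one>\<^bsub>T\<^esub>"
 and expand: "!!U. U:C ==>
 sw MT U (%a b. sw3 MT (\<mu> a) (%u v w. tens R M2 T (t2 u v) (w \<otimes>\<^bsub>T\<^esub> b))) = tens R M2 T U \<one>\<^bsub>T\<^esub>"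
begin

lemma sw_\<nu>:
assumes "x:cT" "bilin R M2 T P F" "module R P"
shows "sw P (smu MT x (%u v w. tn M2 T (t2 u v) w)) F = smu P x (%u v w. F (t2 u v) w)"
proof -
note ll = l assms bilin_in[OF assms(2)]
have "sw P (smu MT x (%u v w. tn M2 T (t2 u v) w)) F = smu P x (%u v w. sw P (tn M2 T (t2 u v) w) F)"
 by (rule T3.hom[OF sw_mhom[OF assms(2)]]) (assumption | rule ll)+
also have "... = smu P x (%u v w. F (t2 u v) w)"
 by (rule T3.cong, (assumption | rule ll)+, rule sw_tens[OF assms(2)]) (assumption | rule ll)+
finally show ?thesis .
qed

lemma sw_Dl_gen:
assumes "U:car M2" "bilin R M2 M2 P F" "module R P"
shows "sw P (Dl U) F = sw P U (%a b. smu P a (%u v w. F (t2 u v) (t2 w b)))"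
proof -
have F: "(%x. F (f x) y):Hom R X P" if "f:Hom R X M2" "y:car M2" for f y and X :: "('k, 'x) module"
 using assms(2) that by (intro hom_comp[OF _ that(1)]) (auto simp: bilin_def)
have F': "(%y. F x (f y)):Hom R X P" if "f:Hom R X M2" "x:car M2" for f x and X :: "('k, 'x) module"
 using assms(2) that by (intro hom_comp[OF _ that(1)]) (auto simp: bilin_def)
note ll = l F F' assms(3)
have b: "bilin R T T P (%a b. smu P a (%u v w. F (t2 u v) (t2 w b)))"
 by (assumption | rule ll)+
show ?thesis
proof (rule tens_heq[OF mT mT assms(1)])
 show "(%U. sw P (Dl U) F):Hom R M2 P" by (rule lin_sw1[OF Dl_hom assms(2) mM2 mM2 assms(3)])
 show "(%U. sw P U (%a b. smu P a (%u v w. F (t2 u v) (t2 w b)))):Hom R M2 P"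
 by (rule sw_mhom[OF b mT mT assms(3)])
 show "sw P (Dl (t2 x y)) F = sw P (t2 x y) (%a b. smu P a (%u v w. F (t2 u v) (t2 w b)))"
 if "x:cT" "y:cT" for x y
 by (simp add: sw_Dl[OF that assms(2,3)] sw_tens[OF b that mT mT assms(3)])
qed
qed

text \<open>The mirror of the argument for \<open>Dr\<close>: coassociativity turns
  \<open>Dl\<close> applied to the coaction of \<open>a\<close> into two successive coactions, both
  with values over \<open>C\<close>.\<close>

lemma Dl_in_CC:
assumes "U:C"
shows "Dl U:CC"
proof (rule in_CC[OF Dl_closed[OF CD[OF assms]]])
let ?X = "tp R MM T" and ?K = "%m t. tn MM T (Dl m) t"
have mX: "module R ?X" by (rule mod_tens[OF mMM mT])
note ll = lD mX mMT
have U: "U:car M2" by (rule CD[OF assms])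
have K: "bilin R M2 T ?X ?K" by (assumption | rule ll)+
have "tn MM T (Dl U) eT = sw ?X (tn M2 T U eT) ?K"
 by (rule sw_tens[OF K U one_closed mM2 mT mX, symmetric])
also have "... = sw ?X U (%a b. sw ?X (smu MT a (%u v w. tn M2 T (t2 u v) (w ** b))) ?K)"
 unfolding expand[OF assms, symmetric]
 by (rule sw_hom[OF sw_mhom[OF K mM2 mT mX] U]) (assumption | rule ll)+
also have "...:CCT"
proof (rule sw_submodule[OF CCT U mT mT mX])
 fix a b assume a: "a:cT" and b: "b:cT"
 note la = ll a b
 have F1: "bilin R M2 T ?X (%c x. tn MM T (tn M2 M2 m c) (x ** b))" if "m:car M2" for m
 by (assumption | rule la that)+
 have F2: "bilin R M2 T ?X (%c u. smu ?X u (%x y z. tn MM T (tn M2 M2 c (t2 x y)) (z ** b)))"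
 by (assumption | rule la)+
 have "sw ?X (smu MT a (%u v w. tn M2 T (t2 u v) (w ** b))) ?K =
  smu ?X a (%u v w. sw ?X (tn M2 T (t2 u v) (w ** b)) ?K)"
 by (rule T3.hom[OF sw_mhom[OF K]]) (assumption | rule la)+
 also have "... = smu ?X a (%u v w. tn MM T (Dl (t2 u v)) (w ** b))"
 by (rule T3.cong, (assumption | rule la)+, rule sw_tens[OF K]) (assumption | rule la)+
 also have "... = smu ?X a (%u v w. smu ?X u (%x y z. tn MM T (tt x y z v) (w ** b)))"
 by (rule T3.cong, (assumption | rule la)+, simp only: Dl_t2, rule T3.hom[OF lin_tens1[OF lin_id]]) (assumption | rule la)+
 also have "... = smu ?X a (%u v w. smu ?X w (%x y z. tn MM T (tn M2 M2 (t2 u v) (t2 x y)) (z ** b)))"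
 by (rule coassoc[OF a mX, where F = "%a' c d e f. tens R MM T (tt a' c d e) (f ** b)", symmetric]) (assumption | rule la)+
 also have "... = sw ?X (\<rho> a) (%c u. smu ?X u (%x y z. tn MM T (tn M2 M2 c (t2 x y)) (z ** b)))"
 unfolding sw_\<rho>[OF a F2 mX, symmetric] by (rule sw_\<nu>[OF a F2 mX, symmetric])
 also have "...:CCT"
 proof (rule sw_submodule[OF CCT \<rho>_closed[OF a] mC mT mX])
 fix c u assume c: "c:car CM" and u: "u:cT"
 have cC: "c:C" using c by simp
 have "smu ?X u (%x y z. tn MM T (tn M2 M2 c (t2 x y)) (z ** b)) =
  sw ?X (\<rho> u) (%c' x. tn MM T (tn M2 M2 c c') (x ** b))"
  unfolding sw_\<rho>[OF u F1[OF CD[OF cC]] mX, symmetric] by (rule sw_\<nu>[OF u F1[OF CD[OF cC]] mX, symmetric])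
 also have "...:CCT"
  by (rule sw_submodule[OF CCT \<rho>_closed[OF u] mC mT mX CCT_pure[OF cC]])
  (simp, rule m_closed[OF _ b], assumption)
 finally show "smu ?X u (%x y z. tn MM T (tn M2 M2 c (t2 x y)) (z ** b)):CCT" .
 qed
 finally show "sw ?X (smu MT a (%u v w. tn M2 T (t2 u v) (w ** b))) ?K:CCT" .
qed
finally show "tn MM T (Dl U) eT:CCT" .
qed

lemma counit_r:
assumes "U:C"
shows "sw MT (Dl U) (%x y. tn M2 T x (nabla T y)) = tn M2 T U eT"
proof -
have U: "U:car M2" by (rule CD[OF assms])
note ll = lD mMT
have "sw MT (Dl U) (%x y. tn M2 T x (nabla T y)) = sw MT U (%a b. smu MT a (%u v w. tn M2 T (t2 u v) (nabla T (t2 w b))))"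
 by (rule sw_Dl_gen[OF U bilin_N(2) mMT])
also have "... = sw MT U (%a b. smu MT a (%u v w. tn M2 T (t2 u v) (w ** b)))"
 by (rule sw_cong[OF refl U mT mT mMT], rule T3.cong, (assumption | rule ll)+, simp only: nab(2))
 (assumption | rule ll)+
finally show ?thesis unfolding expand[OF assms] .
qed

lemma sw_\<nu>_mult:
assumes "U:C"
shows "sw CT U (%a b. sw CT (\<rho> a) (%c x. tn CM T c (x ** b))) = tn CM T U eT"
proof (rule inclCT_inj)
have U: "U:car M2" by (rule CD[OF assms])
have UC: "U:car CM" using assms by simp
note ll = lD mMT mC \<rho>_closed mCT
show "sw CT U (%a b. sw CT (\<rho> a) (%c x. tn CM T c (x ** b))):car CT"
 by (assumption | rule ll U)+
show "tn CM T U eT:car CT" by (assumption | rule ll UC)+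
let ?I = "tmp R M2 T id id"
have It: "?I (tn CM T c x) = tn M2 T c x" if "c:car CM" "x:cT" for c x
 using tmap_tens[OF inclC id_hom mC mT mM2 mT that] by simp
have "?I (sw CT U (%a b. sw CT (\<rho> a) (%c x. tn CM T c (x ** b)))) =
 sw MT U (%a b. ?I (sw CT (\<rho> a) (%c x. tn CM T c (x ** b))))" (is "?lh = _")
 by (rule sw_hom[OF inclCT U]) (assumption | rule ll)+
also have "... = sw MT U (%a b. smu MT a (%u v w. tn M2 T (t2 u v) (w ** b)))"
proof (rule sw_cong[OF refl U mT mT mMT])
 fix a b assume a: "a:cT" and b: "b:cT"
 have bb: "bilin R M2 T MT (%c x. tn M2 T c (x ** b))" by (assumption | rule ll b)+
 have "?I (sw CT (\<rho> a) (%c x. tn CM T c (x ** b))) = sw MT (\<rho> a) (%c x. ?I (tn CM T c (x ** b)))" (is "?lh = _")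
 by (rule sw_hom[OF inclCT \<rho>_closed[OF a]]) (assumption | rule ll b)+
 also have "... = sw MT (\<rho> a) (%c x. tn M2 T c (x ** b))"
 by (rule sw_cong[OF refl \<rho>_closed[OF a] mC mT mMT], rule It, assumption, rule m_closed[OF _ b], assumption)
  (rule hom_mem[OF inclCT], (assumption | rule ll b)+)
 also have "... = smu MT a (%u v w. tn M2 T (t2 u v) (w ** b))"
 unfolding sw_\<rho>[OF a bb mMT, symmetric] by (rule sw_\<nu>[OF a bb mMT])
 finally show "?lh = ..." .
qed (rule hom_mem[OF inclCT], (assumption | rule ll)+)
also have "... = ?I (tn CM T U eT)" unfolding expand[OF assms] It[OF UC one_closed] ..
finally show "?lh = ..." .
qed

lemma split: "split_after CM M2 id"
unfolding split_after_def
proof (intro conjI inclC bexI ballI)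
let ?\<kappa> = "%U. sw CT U (%a b. sw CT (\<rho> a) (%c x. tn CM T c (x ** b)))"
note ll = lD mC hom_comp[OF \<rho>_hom] \<rho>_closed mCT
show "?\<kappa>:Hom R M2 CT" by (assumption | rule ll)+
show "?\<kappa> (id c) = tn CM T c eT" if "c:car CM" for c
 using sw_\<nu>_mult that by simp
qed

text \<open>In \<open>Q2\<close> it is the second factor that is enclosed, \<open>a c d b\<close>,
  so its product is the scalar that is moved out.\<close>

lemma nabla_mult:
assumes "x:C" "y:C"
shows "nabla T (x \<otimes>\<^bsub>Q2\<^esub> y) = nabla T x ** nabla T y"
proof -
note am = alg_mult_hom[OF Q2_alg same_Q2]
note N = hom_comp[OF nab(1)] hom_mem[OF nab(1)]
obtain r where r: "r:car R" "nabla T y = r *s eT" using C_unit[OF assms(2)] by (elim bexE)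
have x: "x:car M2" and y: "y:car M2" using assms CD by auto
have "nabla T (x \<otimes>\<^bsub>Q2\<^esub> y) = nabla T x ** (r *s eT)"
proof (rule tens_heq[OF mT mT x N(1)[OF am(1)[OF y lin_id]] rmult_hom[OF _ nab(1)]])
 show "r *s eT:cT" using r by simp
 fix a b assume a: "a:cT" and b: "b:cT"
 have ab: "t2 a b:car M2" by (rule l a b)+
 have "nabla T (t2 a b \<otimes>\<^bsub>Q2\<^esub> y) = a ** nabla T y ** b" (is "?lh = _")
 proof (rule tens_heq[OF mT mT y N(1)[OF am(2)[OF ab lin_id]]])
 show "(%x. a ** nabla T x ** b):Hom R M2 T" by (assumption | rule rmult_hom lmult_hom nab(1) a b)+
 show "nabla T (t2 a b \<otimes>\<^bsub>Q2\<^esub> t2 c d) = a ** nabla T (t2 c d) ** b" if "c:cT" "d:cT" for c d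
  using that a b by (simp add: Q2_mult nab(2) m_assoc)
 qed
 also have "... = nabla T (t2 a b) ** (r *s eT)"
 using a b r by (simp add: nab(2) smult_assoc_l smult_assoc_r)
 finally show "?lh = ..." .
qed
then show ?thesis using r by simp
qed

lemma bialg:
assumes "!!c. c:C==>D' c = Dl c"
shows "sub_bialgebra R T Q2 C Dl (nabla T) (induced_comult R Q2 C D') (induced_counit R T)"
unfolding induced_counit_def[abs_def]
by (rule sub_bialgebraI[OF Q2_alg same_Q2 C _ C_mult split Dl_hom])
 (use C_one C_unit nabla_mult nab Dl_one CD Dl_mult Dl_coassoc Dl_in_CC Dl_counit_l counit_r assms in \<open>simp_all add: Q2_one\<close>)

end

section \<open>Structural maps: independence of the products, values on pure tensors,
  equalizers\<close>

lemma same_tensor_lift: "same_module P (P' :: ('k, 'p) module)==>tensor_lift (P :: ('k, 'p) module) f = tensor_lift P' f"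
by (simp add: tensor_lift_def same_module_def)

lemma same_tmap:
"same_module M M'==>same_module N N'==>tmp R M N f g = tmp R M' N' f g"
unfolding tensor_map_def same_tens[of M M' N N' R] by (rule same_tensor_lift[OF same_tensor])

lemma same_tassoc:
assumes "same_module A A'" "same_module B B'" "same_module C C'"
shows "tassoc R A B C = tassoc R A' B' C'" "tassoc_inv R A B C = tassoc_inv R A' B' C'" "tau13 R A B C = tau13 R A' B' C'"
unfolding tassoc_def tassoc_inv_def tau13_def Let_def
 same_tens[OF assms(1) same_tensor[OF assms(2,3), of R]] same_tens[OF assms(2,3)]
 same_tens[OF same_tensor[OF assms(1,2), of R] assms(3)] same_tens[OF assms(1,2)]
 same_tens[OF assms(3) same_tensor[OF assms(2,1), of R]] same_tens[OF assms(2,1)]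
 same_tensor_lift[OF same_tensor[OF assms(1) same_tensor[OF assms(2,3)]]]
 same_tensor_lift[OF same_tensor[OF same_tensor[OF assms(1,2)] assms(3)]]
 same_tensor_lift[OF same_tensor[OF assms(3) same_tensor[OF assms(2,1)]]] by (rule refl)+

lemma same_tassoc4:
assumes "same_module A A'" "same_module B B'" "same_module C C'" "same_module D D'"
shows "tassoc4 R A B C D = tassoc4 R A' B' C' D'"
by (rule ext)
 (simp only: tassoc4_def same_tassoc(1)[OF assms(2-4), of R] same_tassoc(1)[OF assms(1) same_tensor[OF assms(2,3), of R] assms(4), of R]
 same_tmap[OF assms(1) same_tensor[OF assms(2) same_tensor[OF assms(3,4)]], of R])

lemma tensor_lift2:
assumes "module R A" "module R B" "module R C" "module R P" "trilin R A B C P F"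
shows "tensor_lift P (%x w. tensor_lift P (F x) w):Hom R (tp R A (tp R B C)) P"
 "a:car A==>b:car B==>c:car C ==>
 tensor_lift P (%x w. tensor_lift P (F x) w) (tens R A (tp R B C) a (tens R B C b c)) = F a b c"
proof -
interpret three_modules R A B C by (rule three_modulesI; fact)
note b = trilin_bilin[OF assms(5,4)]
have eq: "tensor_lift P (F x) w = sw P w (F x)" if "x:car A" "w:car (tp R B C)" for x w
 by (rule tlift_sw[OF assms(2-4) that(2) b(2)[OF that(1)]])
have bl: "bilin R A (tp R B C) P (%x w. tensor_lift P (F x) w)"
 using b(1) by (simp only: bilin_cong[OF eq assms(1) mBC])
show "tensor_lift P (%x w. tensor_lift P (F x) w):Hom R (tp R A (tp R B C)) P"
 by (rule tensor_lift_hom[OF bl assms(1) mBC assms(4)])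
assume x: "a:car A" "b:car B" "c:car C"
have bc: "tens R B C b c:car (tp R B C)" by (rule tens_in assms x)+
have abc: "tens R A (tp R B C) a (tens R B C b c):car ABC" by (rule tens_in assms x bc mBC)+
show "tensor_lift P (%x w. tensor_lift P (F x) w) (tens R A (tp R B C) a (tens R B C b c)) = F a b c"
 by (simp add: tlift_sw[OF assms(1) mBC assms(4) abc bl] sw_tens[OF bl x(1) bc assms(1) mBC assms(4)]
 eq[OF x(1) bc] sw_tens[OF b(2)[OF x(1)] x(2,3) assms(2-4)])
qed

lemma tassoc_inv:
assumes "module R A" "module R B" "module R C"
shows "tassoc_inv R A B C:Hom R (tp R A (tp R B C)) (tp R (tp R A B) C)"
 "x:car A==>y:car B==>z:car C ==>
 tassoc_inv R A B C (tens R A (tp R B C) x (tens R B C y z)) = tens R (tp R A B) C (tens R A B x y) z"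
unfolding tassoc_inv_def Let_def
by (rule tensor_lift2[OF assms, of "tp R (tp R A B) C" "%x y z. tens R (tp R A B) C (tens R A B x y) z"];
 (assumption | rule lin assms)+)+

lemma tau13:
assumes "module R A" "module R B" "module R C"
shows "tau13 R A B C:Hom R (tp R A (tp R B C)) (tp R C (tp R B A))"
 "x:car A==>y:car B==>z:car C ==>
 tau13 R A B C (tens R A (tp R B C) x (tens R B C y z)) = tens R C (tp R B A) z (tens R B A y x)"
unfolding tau13_def Let_def
by (rule tensor_lift2[OF assms, of "tp R C (tp R B A)" "%x y z. tens R C (tp R B A) z (tens R B A y x)"];
 (assumption | rule lin assms)+)+

lemma tassoc4:
assumes "module R A" "module R B" "module R C" "module R D"
shows "tassoc4 R A B C D:Hom R (tp R (tp R A (tp R B C)) D) (tp R A (tp R B (tp R C D)))"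
 "x:car A==>y:car B==>z:car C==>w:car D ==>
 tassoc4 R A B C D (tens R (tp R A (tp R B C)) D (tens R A (tp R B C) x (tens R B C y z)) w) =
 tens R A (tp R B (tp R C D)) x (tens R B (tp R C D) y (tens R C D z w))"
proof -
note m = assms mod_tens[OF assms(2,3)] mod_tens[OF mod_tens[OF assms(2,3)] assms(4)]
 mod_tens[OF assms(2) mod_tens[OF assms(3,4)]]
note h = tassoc_hom(1)[OF assms(1) m(5) assms(4)] and k = tmap_hom[OF id_hom tassoc_hom(1)[OF assms(2-4)] assms(1) m(6) assms(1) m(7)]
show "tassoc4 R A B C D:Hom R (tp R (tp R A (tp R B C)) D) (tp R A (tp R B (tp R C D)))"
 unfolding tassoc4_def[abs_def] by (rule hom_comp[OF k h])
assume x: "x:car A" "y:car B" "z:car C" "w:car D"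
have yz: "tens R B C y z:car (tp R B C)" by (rule tens_in assms x)+
have yzw: "tens R (tp R B C) D (tens R B C y z) w:car (tp R (tp R B C) D)" by (rule tens_in m x)+
show "tassoc4 R A B C D (tens R (tp R A (tp R B C)) D (tens R A (tp R B C) x (tens R B C y z)) w) =
 tens R A (tp R B (tp R C D)) x (tens R B (tp R C D) y (tens R C D z w))"
 unfolding tassoc4_def tassoc_tens[OF assms(1) m(5) assms(4) x(1) yz x(4)]
 tmap_tens[OF id_hom tassoc_hom(1)[OF assms(2-4)] assms(1) m(6) assms(1) m(7) x(1) yzw]
 tassoc_tens[OF assms(2-4) x(2-4)] by simp
qed

lemma tassoc4_eval:
fixes T :: "('k, 't) module"
assumes mT: "module R T"
 and f: "f:Hom R (tp R T (tp R T T)) (tp R T (tp R T T))"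
 "!!u v w. u:car T==>v:car T==>w:car T ==>
  f (tens R T (tp R T T) u (tens R T T v w)) = tens R T (tp R T T) (p u v w) (tens R T T (q u v w) (r u v w))"
 "!!u v w. u:car T==>v:car T==>w:car T==>p u v w:car T & q u v w:car T & r u v w:car T"
 and W: "W:car (tp R T (tp R T T))" "y:car X" "module R X"
shows "tassoc4 R T T T X (tens R (tp R T (tp R T T)) X (f W) y) = sw3 (tp R T (tp R T (tp R T X))) W
 (%u v w. tens R T (tp R T (tp R T X)) (p u v w) (tens R T (tp R T X) (q u v w) (tens R T X (r u v w) y)))"
proof -
interpret T3: three_modules R T T T by (rule three_modulesI[OF mT mT mT])
show ?thesis
proof (rule T3.eval[where f = "%W. tassoc4 R T T T X (tens R (tp R T (tp R T T)) X (f W) y)"])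
 show "(%W. tassoc4 R T T T X (tens R T3.ABC X (f W) y)):Hom R T3.ABC (tp R T (tp R T (tp R T X)))"
 by (rule hom_comp[OF tassoc4(1)[OF mT mT mT W(3)] lin_tens1[OF f(1) W(2) T3.mABC W(3)]])
 show "module R (tp R T (tp R T (tp R T X)))" by (rule lin mT W)+
 fix u v w assume x: "u:car T" "v:car T" "w:car T"
 show "tassoc4 R T T T X (tens R T3.ABC X (f (tens R T (tp R T T) u (tens R T T v w))) y) =
 tens R T (tp R T (tp R T X)) (p u v w) (tens R T (tp R T X) (q u v w) (tens R T X (r u v w) y))"
 using tassoc4(2)[OF mT mT mT W(3) _ _ _ W(2)] f(2,3)[OF x] by simp
qed (rule W)
qed

lemma mod_hom_minus:
assumes "module R A" "module R B" "f:Hom R A B" "g:Hom R A B"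
shows "(%x. f x \<ominus>\<^bsub>B\<^esub> g x):Hom R A B"
proof -
interpret B: module R B by fact
note c = hom_mem[OF assms(3)] hom_mem[OF assms(4)]
show ?thesis
 by (rule mod_homI)
 (simp_all add: c mod_hom_add[OF assms(3)] mod_hom_add[OF assms(4)] hom_smult[OF assms(3)] hom_smult[OF assms(4)]
  a_minus_def B.minus_add B.a_ac B.smult_r_distr B.smult_r_minus)
qed

lemma mod_hom_minus_zero:
assumes "module R B" "a:car B" "b:car B"
shows "a \<ominus>\<^bsub>B\<^esub> b = \<zero>\<^bsub>B\<^esub> \<longleftrightarrow> a = b"
proof -
interpret B: module R B by fact
show ?thesis
proof
 assume "a \<ominus>\<^bsub>B\<^esub> b = \<zero>\<^bsub>B\<^esub>"
 then have "a \<oplus>\<^bsub>B\<^esub> \<ominus>\<^bsub>B\<^esub> b = \<zero>\<^bsub>B\<^esub>" by (simp add: a_minus_def)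
 from B.minus_equality[OF this] show "a = b" using assms by simp
qed (use assms in \<open>simp add: a_minus_def B.r_neg\<close>)
qed

text \<open>An equalizer is the kernel of the difference, so \<open>flat_kernel\<close> applies.
  This is how values of a coaction are placed in \<open>C \<otimes> T\<close> when \<open>C\<close>
  is given by an equation.\<close>

lemma flat_equalizer:
fixes R :: "('k, 'r) ring_scheme" and A :: "('k, 'a, 'm) module_scheme" and B :: "('k, 'b, 'n) module_scheme"
assumes "flat R M" "module R A" "module R B" "f:Hom R A B" "g:Hom R A B" "U:car (tp R A M)"
 and "tmp R B M f id U = tmp R B M g id U"
shows "U:tmp R A M id id ` car (tp R (sub A {a:car A. f a = g a}) M)"
proof -
have mM: "module R M" using assms(1) by (simp add: flat_def)
note mAM = mod_tens[OF assms(2) mM] and mBM = mod_tens[OF assms(3) mM]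
let ?d = "%x. f x \<ominus>\<^bsub>B\<^esub> g x"
note d = mod_hom_minus[OF assms(2-5)]
note hf = tmap_hom[OF assms(4) id_hom assms(2) mM assms(3) mM]
note hg = tmap_hom[OF assms(5) id_hom assms(2) mM assms(3) mM]
have "tmp R B M ?d id U = tmp R B M f id U \<ominus>\<^bsub>tp R B M\<^esub> tmp R B M g id U"
proof (rule tens_heq[OF assms(2) mM assms(6) tmap_hom[OF d id_hom assms(2) mM assms(3) mM] mod_hom_minus[OF mAM mBM hf hg]])
 fix x y assume x: "x:car A" and y: "y:car M"
 show "tmp R B M ?d id (tens R A M x y) = tmp R B M f id (tens R A M x y) \<ominus>\<^bsub>tp R B M\<^esub> tmp R B M g id (tens R A M x y)"
 using tmap_tens[OF d id_hom assms(2) mM assms(3) mM x y] tmap_tens[OF assms(4) id_hom assms(2) mM assms(3) mM x y]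
  tmap_tens[OF assms(5) id_hom assms(2) mM assms(3) mM x y]
  mod_hom_zero_inv(3)[OF assms(3) mBM lin_tens1[OF lin_id y assms(3) mM], of "f x" "g x"]
  hom_mem[OF assms(4) x] hom_mem[OF assms(5) x] by simp
qed
then have "tmp R B M ?d id U = \<zero>\<^bsub>tp R B M\<^esub>"
 using assms(7) mod_hom_minus_zero[OF mBM] hom_mem[OF hg assms(6)] by simp
from flat_kernel[OF assms(1-3) d assms(6) this]
have "U:tmp R A M id id ` car (tp R (sub A {a:car A. ?d a = \<zero>\<^bsub>B\<^esub>}) M)" .
moreover have "{a:car A. ?d a = \<zero>\<^bsub>B\<^esub>} = {a:car A. f a = g a}"
 using mod_hom_minus_zero[OF assms(3)] hom_mem[OF assms(4)] hom_mem[OF assms(5)] by auto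
ultimately show ?thesis by simp
qed

lemma equalizer_submodule:
assumes "module R A" "module R B" "f:Hom R A B" "g:Hom R A B"
shows "submodule {a:car A. f a = g a} R A"
proof -
have "{a:car A. f a \<ominus>\<^bsub>B\<^esub> g a = \<zero>\<^bsub>B\<^esub>} = {a:car A. f a = g a}"
 using mod_hom_minus_zero[OF assms(2)] hom_mem[OF assms(3)] hom_mem[OF assms(4)] by auto
then show ?thesis using kernel_submodule[OF assms(1,2) mod_hom_minus[OF assms]] by simp
qed

section \<open>The defining equations of \<open>Hr\<close> and \<open>Hl\<close> in Sweedler
  form\<close>

locale pretorsor_theta = pretorsor R T \<mu> for R :: "('k, 'r) ring_scheme" and T :: "('k, 't) module" and \<mu> +
fixes \<theta> assumes \<theta>_hom: "\<theta>:Hom R T T"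
begin

lemmas \<theta>_closed = hom_mem[OF \<theta>_hom]
lemmas lt = lD mMM hom_comp[OF \<theta>_hom] \<theta>_closed

abbreviation "t4 == (%a b c d. tn T M3 a (t3 b c d))"

lemma mM4: "module R M4" by (rule mod_tens[OF mT T3.mABC])

text \<open>\<open>Fr\<close>, \<open>Gr\<close> are the two sides of the equation in
  \<open>Hr_carrier\<close>, and \<open>Fl\<close>, \<open>Gl\<close> those of the equation in
  \<open>Hl_carrier\<close>.\<close>

definition "Fr U = sw M4 U (%a b. smu M4 b (%u v w. t4 a (\<theta> u) v w))"
definition "Gr U = sw M4 U (%a b. smu M4 a (%u v w. t4 w v u b))"
definition "Fl U = sw M4 U (%a b. smu M4 a (%u v w. t4 u v (\<theta> w) b))"
definition "Gl U = sw M4 U (%a b. smu M4 b (%u v w. t4 a w v u))"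

lemma bilin_FG:
"bilin R T T M4 (%a b. smu M4 b (%u v w. t4 a (\<theta> u) v w))"
"bilin R T T M4 (%a b. smu M4 a (%u v w. t4 w v u b))"
"bilin R T T M4 (%a b. smu M4 a (%u v w. t4 u v (\<theta> w) b))"
"bilin R T T M4 (%a b. smu M4 b (%u v w. t4 a w v u))"
by (assumption | rule lt)+

lemma FG_hom: "Fr:Hom R M2 M4" "Gr:Hom R M2 M4" "Fl:Hom R M2 M4" "Gl:Hom R M2 M4"
unfolding Fr_def[abs_def] Gr_def[abs_def] Fl_def[abs_def] Gl_def[abs_def]
by (rule sw_mhom bilin_FG mT mM4)+

lemma FG_t2:
assumes "a:cT" "b:cT"
shows "Fr (t2 a b) = smu M4 b (%u v w. t4 a (\<theta> u) v w)" "Gr (t2 a b) = smu M4 a (%u v w. t4 w v u b)"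
 "Fl (t2 a b) = smu M4 a (%u v w. t4 u v (\<theta> w) b)" "Gl (t2 a b) = smu M4 b (%u v w. t4 a w v u)"
unfolding Fr_def Gr_def Fl_def Gl_def by (rule sw_tens bilin_FG assms mT mM4)+

lemma four_lift:
fixes F :: "'t => 't => 't => 't => 'p" and P :: "('k, 'p, 'n) module_scheme"
assumes "module R P"
 and F: "!!b c d. b:cT==>c:cT==>d:cT==>(%a. F a b c d):Hom R T P"
 "!!a c d. a:cT==>c:cT==>d:cT==>(%b. F a b c d):Hom R T P"
 "!!a b d. a:cT==>b:cT==>d:cT==>(%c. F a b c d):Hom R T P"
 "!!a b c. a:cT==>b:cT==>c:cT==>(%d. F a b c d):Hom R T P"
shows "EX g. g:Hom R M4 P & (ALL a:cT. ALL b:cT. ALL c:cT. ALL d:cT. g (t4 a b c d) = F a b c d)"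
proof (intro exI conjI ballI)
let ?g = "%w. sw P w (%a w. sw3 P w (F a))"
have t: "trilin R T T T P (F a)" if "a:cT" for a
 by (assumption | rule trilinI F that)+
have b: "bilin R T M3 P (%a w. sw3 P w (F a))"
 by (assumption | rule lt assms t)+
show "?g:Hom R M4 P" by (rule sw_mhom[OF b mT T3.mABC assms(1)])
fix a b' c d assume x: "a:cT" "b':cT" "c:cT" "d:cT"
have "?g (t4 a b' c d) = sw3 P (t3 b' c d) (F a)"
 by (rule sw_tens[OF b x(1) _ mT T3.mABC assms(1)]) (assumption | rule lt x)+
also have "... = F a b' c d" by (rule T3.tens[OF t]) (rule x assms)+
finally show "?g (t4 a b' c d) = ..." .
qed

lemma four_hom:
assumes g: "g:Hom R M4 P" "module R P" and U: "U:car M2"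
shows "g (Fr U) = sw P U (%a b. smu P b (%u v w. g (t4 a (\<theta> u) v w)))"
 "g (Gr U) = sw P U (%a b. smu P a (%u v w. g (t4 w v u b)))"
 "g (Fl U) = sw P U (%a b. smu P a (%u v w. g (t4 u v (\<theta> w) b)))"
 "g (Gl U) = sw P U (%a b. smu P b (%u v w. g (t4 a w v u)))"
proof -
note ll = lt hom_comp[OF g(1)] hom_mem[OF g(1)] g(2) mM4
have t3h: "h (sw M4 U (%a b. sw3 M4 (m a b) (K a b))) = sw P U (%a b. sw3 P (m a b) (%u v w. h (K a b u v w)))"
 if h: "h:Hom R M4 P" and m: "!!a b. a:cT==>b:cT==>m a b:car M3"
 and K: "!!a b u v w. a:cT==>b:cT==>u:cT==>v:cT==>w:cT==>K a b u v w:car M4"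
 for h m K
proof -
 have "h (sw M4 U (%a b. sw3 M4 (m a b) (K a b))) = sw P U (%a b. h (sw3 M4 (m a b) (K a b)))"
 by (rule sw_hom[OF h U _ mT mT mM4 g(2)]) (assumption | rule T3.closed m K mM4)+
 also have "... = sw P U (%a b. sw3 P (m a b) (%u v w. h (K a b u v w)))"
 by (rule sw_cong[OF refl U mT mT g(2)], rule T3.hom[OF h])
  (assumption | rule T3.closed m K mM4 g(2) hom_mem[OF h])+
 finally show ?thesis .
qed
show "g (Fr U) = sw P U (%a b. smu P b (%u v w. g (t4 a (\<theta> u) v w)))"
 "g (Gr U) = sw P U (%a b. smu P a (%u v w. g (t4 w v u b)))"
 "g (Fl U) = sw P U (%a b. smu P a (%u v w. g (t4 u v (\<theta> w) b)))"
 "g (Gl U) = sw P U (%a b. smu P b (%u v w. g (t4 a w v u)))"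
 unfolding Fr_def Gr_def Fl_def Gl_def by (rule t3h[OF g(1)], (assumption | rule ll)+)+
qed

lemma four_cong:
assumes "module R P" "U:car M2" "!!a b. a:cT==>b:cT==>m a b:car M3"
 "!!a b u v w. a:cT==>b:cT==>u:cT==>v:cT==>w:cT==>K a b u v w = K' a b u v w"
 "!!a b u v w. a:cT==>b:cT==>u:cT==>v:cT==>w:cT==>K a b u v w:car P"
shows "sw P U (%a b. sw3 P (m a b) (K a b)) = sw P U (%a b. sw3 P (m a b) (K' a b))"
by (rule sw_cong[OF refl assms(2) mT mT assms(1)], rule T3.cong) (assumption | rule T3.closed assms)+

text \<open>The working form of membership in \<open>Hr\<close> or \<open>Hl\<close>: the two sides
  of the equation may be compared under any expression linear in its four legs. Every later use
  consists in a choice of \<open>F\<close> that multiplies or permutes legs.\<close>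

lemma FG_apply:
assumes "module R P" and U: "U:car M2"
 and F: "!!b c d. b:cT==>c:cT==>d:cT==>(%a. F a b c d):Hom R T P"
 "!!a c d. a:cT==>c:cT==>d:cT==>(%b. F a b c d):Hom R T P"
 "!!a b d. a:cT==>b:cT==>d:cT==>(%c. F a b c d):Hom R T P"
 "!!a b c. a:cT==>b:cT==>c:cT==>(%d. F a b c d):Hom R T P"
shows "Fr U = Gr U==>sw P U (%a b. smu P b (%u v w. F a (\<theta> u) v w)) = sw P U (%a b. smu P a (%u v w. F w v u b))"
 "Fl U = Gl U==>sw P U (%a b. smu P a (%u v w. F u v (\<theta> w) b)) = sw P U (%a b. smu P b (%u v w. F a w v u))"
proof -
have "EX g. g:Hom R M4 P & (ALL a:cT. ALL b:cT. ALL c:cT. ALL d:cT. g (t4 a b c d) = F a b c d)"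
 by (rule four_lift[OF assms(1)]) (assumption | rule F)+
then obtain g where g: "g:Hom R M4 P" and "ALL a:cT. ALL b:cT. ALL c:cT. ALL d:cT. g (t4 a b c d) = F a b c d"
 by (elim exE conjE)
then have e: "a:cT==>b:cT==>c:cT==>d:cT==>g (t4 a b c d) = F a b c d" for a b c d
 by simp
have Fc: "F a b c d:car P" if "a:cT" "b:cT" "c:cT" "d:cT" for a b c d
 using hom_mem[OF F(1)] that by blast
note h = four_hom[OF g assms(1) U]
have h1: "g (Fr U) = sw P U (%a b. smu P b (%u v w. F a (\<theta> u) v w))"
 unfolding h(1) by (rule four_cong[OF assms(1) U]) (assumption | rule \<mu>_closed e \<theta>_closed hom_mem[OF g] | rule lt)+
have h2: "g (Gr U) = sw P U (%a b. smu P a (%u v w. F w v u b))"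
 unfolding h(2) by (rule four_cong[OF assms(1) U]) (assumption | rule \<mu>_closed e \<theta>_closed hom_mem[OF g] | rule lt)+
have h3: "g (Fl U) = sw P U (%a b. smu P a (%u v w. F u v (\<theta> w) b))"
 unfolding h(3) by (rule four_cong[OF assms(1) U]) (assumption | rule \<mu>_closed e \<theta>_closed hom_mem[OF g] | rule lt)+
have h4: "g (Gl U) = sw P U (%a b. smu P b (%u v w. F a w v u))"
 unfolding h(4) by (rule four_cong[OF assms(1) U]) (assumption | rule \<mu>_closed e \<theta>_closed hom_mem[OF g] | rule lt)+
show "Fr U = Gr U==>sw P U (%a b. smu P b (%u v w. F a (\<theta> u) v w)) = sw P U (%a b. smu P a (%u v w. F w v u b))"
 using h1 h2 by simp
show "Fl U = Gl U==>sw P U (%a b. smu P a (%u v w. F u v (\<theta> w) b)) = sw P U (%a b. smu P b (%u v w. F a w v u))"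
 using h3 h4 by simp
qed

lemma mop_hom: "(%x. tau13 R T T T (\<mu> x)):Hom R T M3"
by (rule hom_comp[OF tau13(1)[OF mT mT mT] \<mu>_hom])

lemma mop_eq: "torsor_mu_op R T \<mu> = (%x. tau13 R T T T (\<mu> x))"
by (rule ext) (simp only: torsor_mu_op_def same_tassoc(3)[OF same_opp same_refl same_opp])

lemma Fr_eq:
assumes "U:car M2"
shows "tmp R T M3 id (tmp R T M2 \<theta> id) (tmp R T M3 id \<mu> U) = Fr U"
proof (rule tens_heq[OF mT mT assms])
note m3 = T3.mABC
have th: "tmp R T M2 \<theta> id:Hom R M3 M3" by (rule tmap_hom[OF \<theta>_hom id_hom mT mM2 mT mM2])
have k: "tmp R T M3 id (tmp R T M2 \<theta> id):Hom R M4 M4" by (rule tmap_hom[OF id_hom th mT m3 mT m3])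
show "(%U. tmp R T M3 id (tmp R T M2 \<theta> id) (tmp R T M3 id \<mu> U)):Hom R M2 M4"
 by (rule hom_comp[OF k tmap_hom[OF id_hom \<mu>_hom mT mT mT m3]])
fix a b assume a: "a:cT" and b: "b:cT"
have "tmp R T M3 id (tmp R T M2 \<theta> id) (tmp R T M3 id \<mu> (t2 a b)) = tn T M3 a (tmp R T M2 \<theta> id (\<mu> b))"
 using tmap_tens[OF id_hom \<mu>_hom mT mT mT m3 a b] tmap_tens[OF id_hom th mT m3 mT m3 a \<mu>_closed[OF b]] by simp
also have "... = smu M4 b (%u v w. t4 a (\<theta> u) v w)"
proof (rule T3.eval[where f = "%W. tens R T M3 a (tmp R T M2 \<theta> id W)", OF lin_tens2[OF th a mT m3] mM4 \<mu>_closed[OF b]])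
 fix u v w assume "u:cT" "v:cT" "w:cT"
 then show "tn T M3 a (tmp R T M2 \<theta> id (t3 u v w)) = t4 a (\<theta> u) v w"
 using tmap_tens[OF \<theta>_hom id_hom mT mM2 mT mM2, of u "t2 v w"] tens_in[OF _ _ mT mT, of v w] by simp
qed
finally show "tmp R T M3 id (tmp R T M2 \<theta> id) (tmp R T M3 id \<mu> (t2 a b)) = Fr (t2 a b)"
 by (simp add: FG_t2 a b)
qed (rule FG_hom)

lemma Gr_eq:
assumes "U:car M2"
shows "tassoc4 R T T T T (tmp R M3 T (torsor_mu_op R T \<mu>) id U) = Gr U"
unfolding mop_eq
proof (rule tens_heq[OF mT mT assms])
note m3 = T3.mABC
show "(%U. tassoc4 R T T T T (tmp R M3 T (%x. tau13 R T T T (\<mu> x)) id U)):Hom R M2 M4"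
 by (rule hom_comp[OF tassoc4(1)[OF mT mT mT mT] tmap_hom[OF mop_hom id_hom mT mT m3 mT]])
fix a b assume a: "a:cT" and b: "b:cT"
have "tmp R M3 T (%x. tau13 R T T T (\<mu> x)) id (t2 a b) = tn M3 T (tau13 R T T T (\<mu> a)) b"
 using tmap_tens[OF mop_hom id_hom mT mT m3 mT a b] by simp
moreover have "tassoc4 R T T T T (tn M3 T (tau13 R T T T (\<mu> a)) b) = smu M4 a (%u v w. t4 w v u b)"
 by (rule tassoc4_eval[OF mT tau13(1)[OF mT mT mT] _ _ \<mu>_closed[OF a] b mT]) (simp_all add: tau13(2) mT)
ultimately show "tassoc4 R T T T T (tmp R M3 T (%x. tau13 R T T T (\<mu> x)) id (t2 a b)) = Gr (t2 a b)"
 by (simp add: FG_t2 a b)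
qed (rule FG_hom)

lemma muid_eq:
assumes "U:car M2"
shows "tassoc4 R T T T T (tmp R M3 T \<mu> id U) = sw M4 U (%a b. smu M4 a (%u v w. t4 u v w b))"
proof (rule tens_heq[OF mT mT assms])
note m3 = T3.mABC
have bl: "bilin R T T M4 (%a b. smu M4 a (%u v w. t4 u v w b))" by (assumption | rule lt)+
show "(%U. tassoc4 R T T T T (tmp R M3 T \<mu> id U)):Hom R M2 M4"
 by (rule hom_comp[OF tassoc4(1)[OF mT mT mT mT] tmap_hom[OF \<mu>_hom id_hom mT mT m3 mT]])
show "(%U. sw M4 U (%a b. smu M4 a (%u v w. t4 u v w b))):Hom R M2 M4"
 by (rule sw_mhom[OF bl mT mT mM4])
fix a b assume a: "a:cT" and b: "b:cT"
have "tmp R M3 T \<mu> id (t2 a b) = tn M3 T (\<mu> a) b"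
 using tmap_tens[OF \<mu>_hom id_hom mT mT m3 mT a b] by simp
moreover have "tassoc4 R T T T T (tn M3 T (\<mu> a) b) = smu M4 a (%u v w. t4 u v w b)"
 by (rule tassoc4_eval[OF mT lin_id _ _ \<mu>_closed[OF a] b mT]) simp_all
ultimately show "tassoc4 R T T T T (tmp R M3 T \<mu> id (t2 a b)) = sw M4 (t2 a b) (%a b. smu M4 a (%u v w. t4 u v w b))"
 by (simp add: sw_tens[OF bl a b mT mT mM4])
qed

lemma theta3_hom: "tmp R T M3 id (tmp R T M2 id (tmp R T T \<theta> id)):Hom R M4 M4"
"u:cT==>v:cT==>w:cT==>b:cT ==>
 tmp R T M3 id (tmp R T M2 id (tmp R T T \<theta> id)) (t4 u v w b) = t4 u v (\<theta> w) b"
proof -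
note m3 = T3.mABC
note h1 = tmap_hom[OF \<theta>_hom id_hom mT mT mT mT]
note h2 = tmap_hom[OF id_hom h1 mT mM2 mT mM2]
show "tmp R T M3 id (tmp R T M2 id (tmp R T T \<theta> id)):Hom R M4 M4"
 by (rule tmap_hom[OF id_hom h2 mT m3 mT m3])
assume x: "u:cT" "v:cT" "w:cT" "b:cT"
have 1: "t2 w b:car M2" by (rule lt x)+
have 2: "t3 v w b:car M3" by (rule lt x)+
show "tmp R T M3 id (tmp R T M2 id (tmp R T T \<theta> id)) (t4 u v w b) = t4 u v (\<theta> w) b"
 using tmap_tens[OF id_hom h2 mT m3 mT m3 x(1) 2] tmap_tens[OF id_hom h1 mT mM2 mT mM2 x(2) 1]
 tmap_tens[OF \<theta>_hom id_hom mT mT mT mT x(3,4)] by simp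
qed

lemma Fl_eq:
assumes "U:car M2"
shows "tmp R T M3 id (tmp R T M2 id (tmp R T T \<theta> id)) (tassoc4 R T T T T (tmp R M3 T \<mu> id U)) = Fl U"
proof -
let ?h = "tmp R T M3 id (tmp R T M2 id (tmp R T T \<theta> id))"
note ll = lt mM4
have "?h (sw M4 U (%a b. smu M4 a (%u v w. t4 u v w b))) = sw M4 U (%a b. ?h (smu M4 a (%u v w. t4 u v w b)))"
 by (rule sw_hom[OF theta3_hom(1) assms]) (assumption | rule ll)+
also have "... = sw M4 U (%a b. smu M4 a (%u v w. ?h (t4 u v w b)))"
 by (rule sw_cong[OF refl assms mT mT mM4], rule T3.hom[OF theta3_hom(1)])
 (assumption | rule hom_mem[OF theta3_hom(1)] | rule ll)+
also have "... = Fl U" unfolding Fl_def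
 by (rule four_cong[OF mM4 assms]) (simp add: \<mu>_closed, rule theta3_hom(2), assumption+, rule hom_mem[OF theta3_hom(1)], (assumption | rule ll)+)
finally show ?thesis unfolding muid_eq[OF assms] .
qed

lemma Gl_eq:
assumes "U:car M2"
shows "tmp R T M3 id (torsor_mu_op R T \<mu>) U = Gl U"
unfolding mop_eq
proof (rule tens_heq[OF mT mT assms])
note m3 = T3.mABC
show "tmp R T M3 id (%x. tau13 R T T T (\<mu> x)):Hom R M2 M4"
 by (rule tmap_hom[OF id_hom mop_hom mT mT mT m3])
fix a b assume a: "a:cT" and b: "b:cT"
have "tmp R T M3 id (%x. tau13 R T T T (\<mu> x)) (t2 a b) = tn T M3 a (tau13 R T T T (\<mu> b))"
 using tmap_tens[OF id_hom mop_hom mT mT mT m3 a b] by simp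
also have "... = smu M4 b (%u v w. t4 a w v u)"
 by (rule T3.eval[where f = "%W. tens R T M3 a (tau13 R T T T W)", OF lin_tens2[OF tau13(1)[OF mT mT mT] a mT m3] mM4 \<mu>_closed[OF b]])
 (simp add: tau13(2) mT)
finally show "tmp R T M3 id (%x. tau13 R T T T (\<mu> x)) (t2 a b) = Gl (t2 a b)"
 by (simp add: FG_t2 a b)
qed (rule FG_hom)

lemma carrier_M2: "car P2 = car M2" "car Q2 = car M2"
using same_P2 same_Q2 by (simp_all add: same_module_def)

lemma same_P3: "same_module (tp R T P2) M3" and same_Q3: "same_module (tp R T' Q2) M3"
and same_Q3': "same_module (tp R T' (tp R T T')) M3" and same_P3': "same_module (tp R T (tp R T' T)) M3"
by (rule same_tensor same_opp same_refl)+

lemma Hr_carrier_eq: "Hr_carrier R T \<mu> \<theta> = {U:car M2. Fr U = Gr U}"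
unfolding Hr_carrier_def Let_def carrier_M2
 same_tmap[OF same_opp same_P3] same_tmap[OF same_refl same_P2] same_tmap[OF same_Q3' same_refl]
 same_tassoc4[OF same_opp same_refl same_opp same_refl]
by (intro Collect_cong conj_cong refl) (simp add: Fr_eq Gr_eq)

lemma Hl_carrier_eq: "Hl_carrier R T \<mu> \<theta> = {U:car M2. Fl U = Gl U}"
unfolding Hl_carrier_def Let_def carrier_M2
 same_tmap[OF same_refl same_Q3] same_tmap[OF same_opp same_Q2] same_tmap[OF same_refl same_opp]
 same_tmap[OF same_P3 same_refl] same_tassoc4[OF same_refl same_opp same_refl same_opp]
by (intro Collect_cong conj_cong refl) (simp add: Fl_eq Gl_eq)

end

context pretorsor
begin

text \<open>Taking the identity for \<open>\<theta>\<close> makes the evaluation lemmas available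
  for expressions without \<open>\<theta>\<close>, such as the comultiplication computed in
  \<open>Dl_eq\<close>.\<close>

sublocale id_theta: pretorsor_theta R T \<mu> "%x. x" by unfold_locales (rule lin_id)

lemma Dr_eq:
assumes "U:car M2"
shows "tassoc_inv R T' T P2 (tmp R T' (tp R T P2) id \<mu> U) = Dr U"
unfolding same_tmap[OF same_opp id_theta.same_P3] same_tassoc(2)[OF same_opp same_refl same_P2]
proof (rule tens_heq[OF mT mT assms])
note m3 = T3.mABC
note ti = tassoc_inv[OF mT mT mM2]
show "(%U. tassoc_inv R T T M2 (tmp R T M3 id \<mu> U)):Hom R M2 MM"
 by (rule hom_comp[OF ti(1) tmap_hom[OF id_hom \<mu>_hom mT mT mT m3]])
fix a b assume a: "a:cT" and b: "b:cT"
have "tassoc_inv R T T M2 (tmp R T M3 id \<mu> (t2 a b)) = tassoc_inv R T T M2 (tn T M3 a (\<mu> b))"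
 using tmap_tens[OF id_hom \<mu>_hom mT mT mT m3 a b] by simp
also have "... = smu MM b (%u v w. tt a u v w)"
 by (rule T3.eval[where f = "%W. tassoc_inv R T T M2 (tens R T M3 a W)", OF hom_comp[OF ti(1) lin_tens2[OF lin_id a mT m3]] mMM \<mu>_closed[OF b]])
 (rule ti(2), (assumption | rule l a)+)
finally show "tassoc_inv R T T M2 (tmp R T M3 id \<mu> (t2 a b)) = Dr (t2 a b)"
 by (simp add: Dr_t2 a b)
qed (rule Dr_hom)

lemma Dl_eq:
assumes "U:car M2"
shows "tassoc_inv R T T' Q2 (tassoc4 R T T' T T' (tmp R (tp R T (tp R T' T)) T' \<mu> id U)) = Dl U"
unfolding same_tmap[OF id_theta.same_P3' same_opp] same_tassoc4[OF same_refl same_opp same_refl same_opp]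
 same_tassoc(2)[OF same_refl same_opp same_Q2] id_theta.muid_eq[OF assms]
proof -
note ti = tassoc_inv[OF mT mT mM2]
note ll = lD mMM id_theta.mM4
have "tassoc_inv R T T M2 (sw M4 U (%a b. smu M4 a (%u v w. tn T M3 u (t3 v w b)))) =
 sw MM U (%a b. tassoc_inv R T T M2 (smu M4 a (%u v w. tn T M3 u (t3 v w b))))" (is "?lh = _")
 by (rule sw_hom[OF ti(1) assms]) (assumption | rule ll)+
also have "... = sw MM U (%a b. smu MM a (%u v w. tassoc_inv R T T M2 (tn T M3 u (t3 v w b))))"
 by (rule sw_cong[OF refl assms mT mT mMM], rule T3.hom[OF ti(1)])
 (assumption | rule hom_mem[OF ti(1)] | rule ll)+
also have "... = Dl U" unfolding Dl_def
 by (rule id_theta.four_cong[OF mMM assms]) (simp add: \<mu>_closed, rule ti(2), (assumption | rule ll)+, rule hom_mem[OF ti(1)], (assumption | rule ll)+)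
finally show "?lh = ..." .
qed

end

section \<open>Quantum torsors\<close>

locale torsor = pretorsor_theta R T \<mu> \<theta> for R :: "('k, 'r) ring_scheme" and T :: "('k, 't) module" and \<mu> \<theta> +
assumes \<theta>_alg: "\<theta>:alg_hom R T T" and \<theta>_bij: "bij_betw \<theta> (car T) (car T)"
 and \<mu>_\<theta>_op: "!!x. x:car T ==>
 sw3 M5 (\<mu> x) (%d e f. sw3 M5 (\<mu> d) (%a b c. tens R T M4 a (t4 b (\<theta> c) e f))) =
 sw3 M5 (\<mu> x) (%a b c. sw3 M5 (\<mu> b) (%d e f. tens R T M4 a (t4 f e d c)))"
 and \<mu>_\<theta>: "!!x. x:car T==>\<mu> (\<theta> x) = sw3 M3 (\<mu> x) (%a b c. t3 (\<theta> a) (\<theta> b) (\<theta> c))"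

lemma M3_mult:
fixes T :: "('k, 't) module"
assumes "k_algebra R T" "W:car (tp R T (tp R T T))" "W':car (tp R T (tp R T T))"
shows "W \<otimes>\<^bsub>tp R T (tp R (opp T) T)\<^esub> W' = sw3 (tp R T (tp R T T)) W (%a b c. sw3 (tp R T (tp R T T)) W' (%d e f.
  tens R T (tp R T T) (a \<otimes>\<^bsub>T\<^esub> d) (tens R T T (e \<otimes>\<^bsub>T\<^esub> b) (c \<otimes>\<^bsub>T\<^esub> f))))"
proof -
interpret T: k_algebra R T by fact
note mT = T.module_axiom
interpret T3: three_modules R T T T by (rule three_modulesI[OF mT mT mT])
let ?M3 = "tp R T (tp R T T)" and ?E = "tp R T (tp R (opp T) T)"
note P2 = tensor_k_algebra[OF opp_algebra[OF assms(1)] assms(1)]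
note E = tensor_k_algebra[OF assms(1) P2]
have s2: "same_module (tp R (opp T) T) (tp R T T)" by (rule same_tensor[OF same_opp same_refl])
have s: "same_module ?E ?M3" by (rule same_tensor[OF same_refl s2])
note am = alg_mult_hom[OF E s]
have c2: "car (tp R (opp T) T) = car (tp R T T)" using s2 by (simp add: same_module_def)
have tt: "tens R T (tp R (opp T) T) = tens R T (tp R T T)" "tens R (opp T) T = tens R T T"
 by (rule same_tens[OF same_refl s2] same_tens[OF same_opp same_refl])+
have tcl: "tens R T T b c:car (tp R T T)" "tens R T (tp R T T) a (tens R T T b c):car ?M3"
 if "a:car T" "b:car T" "c:car T" for a b c
 by (rule tens_in that mT mod_tens)+
show ?thesis
proof (rule T3.eval[OF am(1)[OF assms(3) lin_id] T3.mABC assms(2)])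
 fix a b c assume x: "a:car T" "b:car T" "c:car T"
 show "tens R T (tp R T T) a (tens R T T b c) \<otimes>\<^bsub>?E\<^esub> W' = sw3 ?M3 W' (%d e f.
  tens R T (tp R T T) (a \<otimes>\<^bsub>T\<^esub> d) (tens R T T (e \<otimes>\<^bsub>T\<^esub> b) (c \<otimes>\<^bsub>T\<^esub> f)))"
 proof (rule T3.eval[OF am(2)[OF tcl(2)[OF x] lin_id] T3.mABC assms(3)])
 fix d e f assume y: "d:car T" "e:car T" "f:car T"
 show "tens R T (tp R T T) a (tens R T T b c) \<otimes>\<^bsub>?E\<^esub> tens R T (tp R T T) d (tens R T T e f) =
  tens R T (tp R T T) (a \<otimes>\<^bsub>T\<^esub> d) (tens R T T (e \<otimes>\<^bsub>T\<^esub> b) (c \<otimes>\<^bsub>T\<^esub> f))"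
  using two_algebras.tens_mult[OF two_algebras.intro[OF assms(1) P2] x(1) _ y(1), of "tens R T T b c" "tens R T T e f"]
  two_algebras.tens_mult[OF two_algebras.intro[OF opp_algebra[OF assms(1)] assms(1)], of b c e f] x y tcl
  by (simp add: c2 tt)
 qed
qed
qed

lemma alg_hom_pretorsor:
fixes T :: "('k, 't) module"
assumes "ff_algebra R T" and \<mu>: "\<mu>:alg_hom R T (tp R T (tp R (opp T) T))"
 and right: "!!x. x:car T==>tmp R T T id (nabla T) (\<mu> x) = tens R T T x \<one>\<^bsub>T\<^esub>"
 and left: "!!x. x:car T==>tmp R T T (nabla T) id (tassoc_inv R T T T (\<mu> x)) = tens R T T \<one>\<^bsub>T\<^esub> x"
 and coassoc: "!!x. x:car T ==>
 tmp R T (tp R T (tp R T (tp R T T))) id (tmp R T (tp R T (tp R T T)) id \<mu>) (\<mu> x) =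
 tassoc4 R T T T (tp R T T) (tmp R (tp R T (tp R T T)) (tp R T T) \<mu> id (\<mu> x))"
shows "pretorsor R T \<mu>"
proof -
interpret ff_algebra R T by fact
note mT = module_axiom
interpret T3: three_modules R T T T by (rule three_modulesI[OF mT mT mT])
let ?M2 = "tp R T T"
let ?M3 = "tp R T ?M2" and ?E = "tp R T (tp R (opp T) T)"
let ?M4 = "tp R T ?M3"
let ?M5 = "tp R T ?M4"
have m: "module R ?M2" "module R ?M3" "module R ?M4" "module R ?M5" by (rule mod_tens mT)+
have s: "same_module ?E ?M3" by (rule same_tensor[OF same_refl same_tensor[OF same_opp same_refl]])
have \<mu>h: "\<mu>:Hom R T ?M3"
 using alg_homD(1)[OF \<mu>] unfolding same_mhom[OF same_refl[of T] s, of R] .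
note \<mu>c = hom_mem[OF \<mu>h]
note nab = nabla_hom[OF k_algebra_axioms]
show ?thesis
proof (intro pretorsor.intro pretorsor_axioms.intro)
 show "\<mu> \<one>\<^bsub>T\<^esub> = tens R T ?M2 \<one>\<^bsub>T\<^esub> (tens R T T \<one>\<^bsub>T\<^esub> \<one>\<^bsub>T\<^esub>)"
 unfolding alg_homD(3)[OF \<mu>] tsimps(4) opp_simps
  same_tens[OF same_refl same_tensor[OF same_opp same_refl]] same_tens[OF same_opp same_refl] ..
 fix x assume x: "x:car T"
 show "\<mu> (x \<otimes>\<^bsub>T\<^esub> y) = sw3 ?M3 (\<mu> x) (%a b c. sw3 ?M3 (\<mu> y) (%d e f.
  tens R T ?M2 (a \<otimes>\<^bsub>T\<^esub> d) (tens R T T (e \<otimes>\<^bsub>T\<^esub> b) (c \<otimes>\<^bsub>T\<^esub> f))))" if y: "y:car T" for y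
 unfolding alg_homD(2)[OF \<mu> x y] by (rule M3_mult[OF k_algebra_axioms \<mu>c[OF x] \<mu>c[OF y]])
 have "tmp R T T id (nabla T) (\<mu> x) = sw3 ?M2 (\<mu> x) (%a b c. tens R T T a (b \<otimes>\<^bsub>T\<^esub> c))"
 by (rule T3.eval[OF tmap_hom[OF id_hom nab(1) mT m(1) mT mT] m(1) \<mu>c[OF x]])
  (simp add: tmap_tens[OF id_hom nab(1) mT m(1) mT mT _ tens_in[OF _ _ mT mT]] nab(2))
 then show "sw3 ?M2 (\<mu> x) (%a b c. tens R T T a (b \<otimes>\<^bsub>T\<^esub> c)) = tens R T T x \<one>\<^bsub>T\<^esub>"
 using right[OF x] by simp
 have "tmp R T T (nabla T) id (tassoc_inv R T T T (\<mu> x)) = sw3 ?M2 (\<mu> x) (%a b c. tens R T T (a \<otimes>\<^bsub>T\<^esub> b) c)"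
 by (rule T3.eval[where f = "%W. tmp R T T (nabla T) id (tassoc_inv R T T T W)",
  OF hom_comp[OF tmap_hom[OF nab(1) id_hom m(1) mT mT mT] tassoc_inv(1)[OF mT mT mT]] m(1) \<mu>c[OF x]])
  (simp add: tassoc_inv(2)[OF mT mT mT] tmap_tens[OF nab(1) id_hom m(1) mT mT mT tens_in[OF _ _ mT mT]] nab(2))
 then show "sw3 ?M2 (\<mu> x) (%a b c. tens R T T (a \<otimes>\<^bsub>T\<^esub> b) c) = tens R T T \<one>\<^bsub>T\<^esub> x"
 using left[OF x] by simp
 note h1 = tmap_hom[OF id_hom \<mu>h mT mT mT m(2)]
 have "tmp R T ?M4 id (tmp R T ?M3 id \<mu>) (\<mu> x) =
 sw3 ?M5 (\<mu> x) (%a b c. sw3 ?M5 (\<mu> c) (%d e f. tens R T ?M4 a (tens R T ?M3 b (tens R T ?M2 d (tens R T T e f)))))"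
 proof (rule T3.eval[OF tmap_hom[OF id_hom h1 mT m(1) mT m(3)] m(4) \<mu>c[OF x]])
 fix a b c assume y: "a:car T" "b:car T" "c:car T"
 have "tmp R T ?M4 id (tmp R T ?M3 id \<mu>) (tens R T ?M2 a (tens R T T b c)) = tens R T ?M4 a (tens R T ?M3 b (\<mu> c))" (is "?lh = _")
  using tmap_tens[OF id_hom h1 mT m(1) mT m(3) y(1) tens_in[OF y(2,3) mT mT]]
  tmap_tens[OF id_hom \<mu>h mT mT mT m(2) y(2,3)] by simp
 also have "... = sw3 ?M5 (\<mu> c) (%d e f. tens R T ?M4 a (tens R T ?M3 b (tens R T ?M2 d (tens R T T e f))))"
  by (rule T3.eval[where f = "%W. tens R T ?M4 a (tens R T ?M3 b W)",
  OF lin_tens2[OF lin_tens2[OF lin_id y(2) mT m(2)] y(1) mT m(3)] m(4) \<mu>c[OF y(3)]]) simp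
 finally show "?lh =
..." .
 qed
 moreover have "tassoc4 R T T T ?M2 (tmp R ?M3 ?M2 \<mu> id (\<mu> x)) = sw3 ?M5 (\<mu> x) (%d e f. sw3 ?M5 (\<mu> d) (%a b c.
 tens R T ?M4 a (tens R T ?M3 b (tens R T ?M2 c (tens R T T e f)))))"
 proof (rule T3.eval[where f = "%W. tassoc4 R T T T ?M2 (tmp R ?M3 ?M2 \<mu> id W)",
  OF hom_comp[OF tassoc4(1)[OF mT mT mT m(1)] tmap_hom[OF \<mu>h id_hom mT m(1) m(2) m(1)]] m(4) \<mu>c[OF x]])
 fix d e f assume y: "d:car T" "e:car T" "f:car T"
 have ef: "tens R T T e f:car ?M2" by (rule tens_in y mT)+
 have "tmp R ?M3 ?M2 \<mu> id (tens R T ?M2 d (tens R T T e f)) = tens R ?M3 ?M2 (\<mu> d) (tens R T T e f)"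
  using tmap_tens[OF \<mu>h id_hom mT m(1) m(2) m(1) y(1) ef] by simp
 moreover have "tassoc4 R T T T ?M2 (tens R ?M3 ?M2 (\<mu> d) (tens R T T e f)) = sw3 ?M5 (\<mu> d) (%a b c.
  tens R T ?M4 a (tens R T ?M3 b (tens R T ?M2 c (tens R T T e f))))"
  by (rule tassoc4_eval[OF mT lin_id _ _ \<mu>c[OF y(1)] ef m(1)]) simp_all
 ultimately show "tassoc4 R T T T ?M2 (tmp R ?M3 ?M2 \<mu> id (tens R T ?M2 d (tens R T T e f))) = sw3 ?M5 (\<mu> d) (%a b c.
  tens R T ?M4 a (tens R T ?M3 b (tens R T ?M2 c (tens R T T e f))))" by simp
 qed
 ultimately show "sw3 ?M5 (\<mu> x) (%a b c. sw3 ?M5 (\<mu> c) (%d e f. tens R T ?M4 a (tens R T ?M3 b (tens R T ?M2 d (tens R T T e f))))) =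
 sw3 ?M5 (\<mu> x) (%d e f. sw3 ?M5 (\<mu> d) (%a b c. tens R T ?M4 a (tens R T ?M3 b (tens R T ?M2 c (tens R T T e f)))))"
 using coassoc[OF x] by simp
qed (use \<mu>h ff_algebra_axioms in simp_all)
qed

lemma quantum_torsor_torsor:
fixes T :: "('k, 't) module"
assumes "quantum_torsor R T \<mu> \<theta>"
shows "torsor R T \<mu> \<theta>"
proof -
let ?T' = "opp T"
let ?P2 = "tp R ?T' T"
let ?P3 = "tp R T ?P2"
let ?P4 = "tp R ?T' ?P3"
let ?M2 = "tp R T T"
let ?M3 = "tp R T ?M2"
let ?M4 = "tp R T ?M3"
let ?M5 = "tp R T ?M4"
have s2: "same_module ?P2 ?M2" and s3: "same_module ?P3 ?M3" and s4: "same_module ?P4 ?M4"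
 and s3': "same_module (tp R ?T' (tp R T ?T')) ?M3"
 by (rule same_tensor same_opp same_refl)+
note q = assms[unfolded quantum_torsor_def Let_def same_tassoc4[OF same_refl same_opp same_refl s2]
 same_tassoc4[OF same_opp same_refl same_opp same_refl]
 same_tmap[OF s3 s2] same_tmap[OF same_refl s3] same_tmap[OF s3 same_refl] same_tmap[OF same_refl s4] same_tmap[OF same_opp s3]
 same_tmap[OF same_refl s2] same_tmap[OF same_opp same_refl] same_tmap[OF s3' same_refl]
 same_tassoc(2)[OF same_refl same_opp same_refl]]
have al: "k_algebra R T" using q by simp
have ff: "ff_algebra R T" using q by (simp add: ff_algebra_def ff_algebra_axioms_def)
have \<mu>: "\<mu>:alg_hom R T ?P3" and \<theta>: "\<theta>:alg_hom R T T" "bij_betw \<theta> (car T) (car T)" using q by simp_all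
interpret pretorsor R T \<mu>
 by (rule alg_hom_pretorsor[OF ff \<mu>]) (use q in simp_all)
interpret pretorsor_theta R T \<mu> \<theta> by unfold_locales (rule alg_homD(1)[OF \<theta>(1)])
have mM5: "module R M5" by (rule mod_tens[OF mT mM4])
note ll = lt mM4 mM5
have Gh: "(%w. tassoc4 R T T T T (tmp R M3 T (torsor_mu_op R T \<mu>) id w)):Hom R M2 M4"
 by (rule mod_hom_cong[THEN iffD2, OF Gr_eq mM2 FG_hom(2)])
have th: "tmp R T M2 \<theta> id:Hom R M3 M3" by (rule tmap_hom[OF \<theta>_hom id_hom mT mM2 mT mM2])
have th4: "tmp R T M3 id (tmp R T M2 \<theta> id):Hom R M4 M4" by (rule tmap_hom[OF id_hom th mT T3.mABC mT T3.mABC])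
let ?h = "tmp R T M4 id (tmp R T M3 id (tmp R T M2 \<theta> id))"
have h: "?h:Hom R M5 M5" by (rule tmap_hom[OF id_hom th4 mT mM4 mT mM4])
have h5: "?h (tens R T M4 a (t4 b c e f)) = tens R T M4 a (t4 b (\<theta> c) e f)"
 if "a:car T" "b:car T" "c:car T" "e:car T" "f:car T" for a b c e f
proof -
 have x: "t2 e f:car M2" "t3 c e f:car M3" "t4 b c e f:car M4" by (rule ll that)+
 show ?thesis
 using tmap_tens[OF id_hom th4 mT mM4 mT mM4 that(1) x(3)] tmap_tens[OF id_hom th mT T3.mABC mT T3.mABC that(2) x(2)]
  tmap_tens[OF \<theta>_hom id_hom mT mM2 mT mM2 that(3) x(1)] by simp
qed
show ?thesis
proof unfold_locales
 show "\<theta>:alg_hom R T T" "bij_betw \<theta> (car T) (car T)" by (rule \<theta>)+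
 fix x assume x: "x:car T"
 \<comment> \<open>The twisted axiom speaks about the regrouped
   \<open>(\<mu> \<otimes> T \<otimes> T) \<mu>\<close>. Its Sweedler form is obtained by passing
   through \<open>(T \<otimes> T \<otimes> \<mu>) \<mu>\<close> and back with
   \<open>\<mu>_coassoc\<close>.\<close>
 have "tassoc4 R T T T M2 (tmp R M3 M2 \<mu> id (\<mu> x)) = tmp R T M4 id (tmp R T M3 id \<mu>) (\<mu> x)"
 using q x by simp
 also have "... = sw3 M5 (\<mu> x) (%a b c. sw3 M5 (\<mu> c) (%d e f. tens R T M4 a (t4 b d e f)))"
 proof (rule T3.eval[OF tmap_hom[OF id_hom tmap_hom[OF id_hom \<mu>_hom mT mT mT T3.mABC] mT mM2 mT mM4] mM5 \<mu>_closed[OF x]])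
 fix a b c assume y: "a:car T" "b:car T" "c:car T"
 have "tmp R T M4 id (tmp R T M3 id \<mu>) (t3 a b c) = tens R T M4 a (tens R T M3 b (\<mu> c))" (is "?lh = _")
  using tmap_tens[OF id_hom tmap_hom[OF id_hom \<mu>_hom mT mT mT T3.mABC] mT mM2 mT mM4 y(1) tens_in[OF y(2,3) mT mT]]
  tmap_tens[OF id_hom \<mu>_hom mT mT mT T3.mABC y(2,3)] by simp
 also have "... = sw3 M5 (\<mu> c) (%d e f. tens R T M4 a (t4 b d e f))"
  by (rule T3.eval[where f = "%W. tens R T M4 a (tens R T M3 b W)",
  OF lin_tens2[OF lin_tens2[OF lin_id y(2) mT T3.mABC] y(1) mT mM4] mM5 \<mu>_closed[OF y(3)]]) simp
 finally show "?lh = ..." .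
 qed
 also have "... = sw3 M5 (\<mu> x) (%d e f. sw3 M5 (\<mu> d) (%a b c. tens R T M4 a (t4 b c e f)))"
 by (rule \<mu>_coassoc[OF x])
 finally have 1: "tassoc4 R T T T M2 (tmp R M3 M2 \<mu> id (\<mu> x)) = ..." .
 have "?h (sw3 M5 (\<mu> x) (%d e f. sw3 M5 (\<mu> d) (%a b c. tens R T M4 a (t4 b c e f)))) =
 sw3 M5 (\<mu> x) (%d e f. ?h (sw3 M5 (\<mu> d) (%a b c. tens R T M4 a (t4 b c e f))))"
 by (rule T3.hom[OF h]) (assumption | rule ll x)+
 also have "... = sw3 M5 (\<mu> x) (%d e f. sw3 M5 (\<mu> d) (%a b c. ?h (tens R T M4 a (t4 b c e f))))"
 by (rule T3.cong, (assumption | rule ll x)+, rule T3.hom[OF h]) (assumption | rule hom_mem[OF h] | rule ll x)+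
 also have "... = sw3 M5 (\<mu> x) (%d e f. sw3 M5 (\<mu> d) (%a b c. tens R T M4 a (t4 b (\<theta> c) e f)))"
 by (rule T3.cong, (assumption | rule ll x)+, rule T3.cong, (assumption | rule ll x)+, rule h5)
  (assumption | rule hom_mem[OF h] | rule ll x)+
 finally have 2: "?h (tassoc4 R T T T M2 (tmp R M3 M2 \<mu> id (\<mu> x))) = ..." unfolding 1 .
 have 3: "tmp R T M4 id (%w. tassoc4 R T T T T (tmp R M3 T (torsor_mu_op R T \<mu>) id w)) (\<mu> x) =
 sw3 M5 (\<mu> x) (%a b c. sw3 M5 (\<mu> b) (%d e f. tens R T M4 a (t4 f e d c)))"
 proof (rule T3.eval[OF tmap_hom[OF id_hom Gh mT mM2 mT mM4] mM5 \<mu>_closed[OF x]])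
 fix a b c assume y: "a:car T" "b:car T" "c:car T"
 have bc: "t2 b c:car M2" by (rule ll y)+
 have "tmp R T M4 id (%w. tassoc4 R T T T T (tmp R M3 T (torsor_mu_op R T \<mu>) id w)) (t3 a b c) =
  tens R T M4 a (Gr (t2 b c))" (is "?lh = _")
  using tmap_tens[OF id_hom Gh mT mM2 mT mM4 y(1) bc] Gr_eq[OF bc] by simp
 also have "... = sw3 M5 (\<mu> b) (%d e f. tens R T M4 a (t4 f e d c))"
  unfolding FG_t2(2)[OF y(2,3)] by (rule T3.hom[OF lin_tens2[OF lin_id y(1) mT mM4]]) (assumption | rule ll y)+
 finally show "?lh =
..." .
 qed
 show "sw3 M5 (\<mu> x) (%d e f. sw3 M5 (\<mu> d) (%a b c. tens R T M4 a (t4 b (\<theta> c) e f))) =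
 sw3 M5 (\<mu> x) (%a b c. sw3 M5 (\<mu> b) (%d e f. tens R T M4 a (t4 f e d c)))"
 using 2 3 q x by simp
 have tt: "tmp R T T \<theta> \<theta>:Hom R M2 M2" by (rule tmap_hom[OF \<theta>_hom \<theta>_hom mT mT mT mT])
 have "tmp R T M2 \<theta> (tmp R T T \<theta> \<theta>) (\<mu> x) = sw3 M3 (\<mu> x) (%a b c. t3 (\<theta> a) (\<theta> b) (\<theta> c))"
 by (rule T3.eval[OF tmap_hom[OF \<theta>_hom tt mT mM2 mT mM2] T3.mABC \<mu>_closed[OF x]])
  (simp add: tmap_tens[OF \<theta>_hom tt mT mM2 mT mM2 _ tens_in[OF _ _ mT mT]] tmap_tens[OF \<theta>_hom \<theta>_hom mT mT mT mT])
 then show "\<mu> (\<theta> x) = sw3 M3 (\<mu> x) (%a b c. t3 (\<theta> a) (\<theta> b) (\<theta> c))"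
 using q x by simp
qed
qed

section \<open>Hopf algebras of a torsor\<close>

text \<open>Multiplication gives \<open>x = y\<close>. Moreover
  \<open>x \<otimes> 1 = 1 \<otimes> y\<close> lies in the image of \<open>k \<otimes> T\<close>, so
  descent puts \<open>x\<close> into \<open>k\<close>. All statements that some element of
  \<open>T\<close> is a scalar rest on this.\<close>

lemma (in ff_algebra) unit_of_tens_eq:
assumes "x:cT" "y:cT" "tn T T x eT = tn T T eT y"
shows "x = y" "EX r:car R. x = r *s eT"
proof -
note mT = module_axiom and nab = nabla_hom[OF k_algebra_axioms]
show e: "x = y" using arg_cong[OF assms(3), of "nabla T"] assms(1,2) by (simp add: nab(2))
let ?k = "(%r. r *s eT) ` car (self_module R)"
have h: "(%r. r *s eT):Hom R (self_module R) T"
 by (rule mod_homI) (simp_all add: smult_l_distr smult_assoc1)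
have k: "submodule ?k R T" by (rule image_submodule[OF self_module_module[OF modD(1)[OF mT]] mT h])
have mk: "module R (sub T ?k)" by (rule sub_module[OF k mT])
have 1: "eT:?k" by (intro image_eqI[where x = "\<one>\<^bsub>R\<^esub>"]) simp_all
have "tn T T x eT:tmp R T T id id ` car (tp R (sub T ?k) T)"
 unfolding assms(3)
 using tmap_tens[OF incl_hom(4)[OF submod_sub[OF k]] id_hom mk mT mT mT, of "eT" y]
 tens_in[of "eT" "sub T ?k" y T, OF _ _ mk mT] 1 assms(2)
 by (intro image_eqI[where x = "tens R (sub T ?k) T eT y"]) simp_all
from descent_submodule[OF mT k assms(1) this] show "EX r:car R. x = r *s eT" by auto
qed

lemma (in ff_algebra) sub_tensor_inj:
assumes "module R M" "submodule C R M" "x:car (tp R (sub M C) T)" "y:car (tp R (sub M C) T)"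
 "tmp R M T id id x = tmp R M T id id y"
shows "x = y"
proof -
have mC: "module R (sub M C)" by (rule sub_module[OF assms(2,1)])
note mT = module_axiom and i = incl_hom(4)[OF submod_sub[OF assms(2)]]
show ?thesis
proof (rule mod_hom_eq_zero_inj[OF mod_tens[OF mC mT] mod_tens[OF assms(1) mT] tmap_hom[OF i id_hom mC mT assms(1) mT] _ assms(3-5)])
 fix x assume x: "x:car (tp R (sub M C) T)" "tmp R M T id id x = \<zero>\<^bsub>tp R M T\<^esub>"
 show "x = \<zero>\<^bsub>tp R (sub M C) T\<^esub>"
 by (rule flat_injective[OF faithfully_flat_imp_flat[OF ff] mC assms(1) i x]) simp
qed
qed

context pretorsor_theta
begin

lemma sw_right:
assumes "U:car M2" "module R P" "!!a b. a:cT==>b:cT==>m a b:cT"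
 "!!a b. a:cT==>b:cT==>bilin R T T P (G a b)"
shows "sw P U (%a b. sw3 P (\<mu> (m a b)) (%u v w. G a b u (v ** w))) = sw P U (%a b. G a b (m a b) eT)"
by (rule sw_cong[OF refl assms(1) mT mT assms(2) right]) (assumption | rule assms T3.closed \<mu>_closed bilin_in[OF assms(4)] m_closed)+

lemma sw_left:
assumes "U:car M2" "module R P" "!!a b. a:cT==>b:cT==>m a b:cT"
 "!!a b. a:cT==>b:cT==>bilin R T T P (G a b)"
shows "sw P U (%a b. sw3 P (\<mu> (m a b)) (%u v w. G a b (u ** v) w)) = sw P U (%a b. G a b eT (m a b))"
by (rule sw_cong[OF refl assms(1) mT mT assms(2) left]) (assumption | rule assms T3.closed \<mu>_closed bilin_in[OF assms(4)] m_closed)+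

lemma sw_nabla:
assumes "U:car M2" "h:Hom R T P" "module R P"
shows "sw P U (%a b. h (a ** b)) = h (nabla T U)"
unfolding nabla_def tlift_sw[OF mT mT mT assms(1) bilin_mult]
by (rule sw_hom[symmetric, OF assms(2,1) _ mT mT mT assms(3)]) (rule m_closed)

definition "Cr = {U:car M2. Fr U = Gr U}"
definition "Cl = {U:car M2. Fl U = Gl U}"
text \<open>The future antipodes of \<open>Hr\<close> and, below, of \<open>Hl\<close>.\<close>

definition "Sr U = sw M2 U (%a b. t2 (\<theta> b) a)"
definition "Sl U = sw M2 U (%a b. t2 b (\<theta> a))"

lemma Cr_D: "U:Cr==>U:car M2" "U:Cr==>Fr U = Gr U"
and Cl_D: "U:Cl==>U:car M2" "U:Cl==>Fl U = Gl U"
by (simp_all add: Cr_def Cl_def)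

lemma Cr_sub: "submodule Cr R M2" and Cl_sub: "submodule Cl R M2"
unfolding Cr_def Cl_def by (rule equalizer_submodule[OF mM2 mM4] FG_hom)+

lemma bilin_S: "bilin R T T M2 (%a b. t2 (\<theta> b) a)" "bilin R T T M2 (%a b. t2 b (\<theta> a))"
by (assumption | rule lt)+

lemma S_hom: "Sr:Hom R M2 M2" "Sl:Hom R M2 M2"
unfolding Sr_def[abs_def] Sl_def[abs_def] by (rule sw_mhom bilin_S mT mM2)+

lemma S_t2: "a:cT==>b:cT==>Sr (t2 a b) = t2 (\<theta> b) a"
"a:cT==>b:cT==>Sl (t2 a b) = t2 b (\<theta> a)"
unfolding Sr_def Sl_def by (rule sw_tens bilin_S mT mM2 | assumption)+

lemmas lm = lt mMT mM4 hom_comp[OF S_hom(1)] hom_comp[OF S_hom(2)] hom_mem[OF S_hom(1)] hom_mem[OF S_hom(2)]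

text \<open>In the defining equation the second leg is multiplied by the first and the product is
  put last. The side \<open>Gr\<close> then contains \<open>v ** w\<close>, which
  \<open>\<mu>_right\<close> contracts.\<close>

lemma Cr_expand:
assumes "U:Cr"
shows "sw MT U (%a b. smu MT b (%u v w. tn M2 T (t2 v w) (\<theta> u ** a))) = tn M2 T U eT"
proof -
note U = Cr_D[OF assms]
have "sw MT U (%a b. smu MT b (%u v w. tn M2 T (t2 v w) (\<theta> u ** a))) =
 sw MT U (%a b. smu MT a (%u v w. tn M2 T (t2 u b) (v ** w)))"
 by (rule FG_apply(1)[where F = "%a b c d. tens R M2 T (t2 c d) (b ** a)", OF mMT U(1) _ _ _ _ U(2)]) (assumption | rule lm)+
also have "... = sw MT U (%a b. tn M2 T (t2 a b) eT)"
 by (rule sw_right[where m = "%a b. a" and G = "%a b x y. tens R M2 T (t2 x b) y"]) (assumption | rule lm U)+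
also have "... = tn M2 T (sw M2 U t2) eT"
 by (rule sw_hom[symmetric, OF lin_tens1[OF lin_id]]) (assumption | rule lm U)+
finally show ?thesis unfolding sw_self[OF U(1) mT mT] .
qed

text \<open>Multiplying the four legs of the defining equation in two pairs and contracting by
  \<open>\<mu>_right\<close> gives an equation of the form
  \<open>x \<otimes> 1 = 1 \<otimes> y\<close> with \<open>y\<close> the product of
  \<open>U\<close>. Both claims are then instances of \<open>unit_of_tens_eq\<close>.\<close>

lemma Cr_unit:
assumes "U:Cr"
shows "sw T U (%a b. \<theta> b ** a) = nabla T U" "EX r:car R. nabla T U = r *s eT"
proof -
note U = Cr_D[OF assms]
have "t2 (sw T U (%a b. \<theta> b ** a)) eT = sw M2 U (%a b. t2 (\<theta> b ** a) eT)" (is "?lh = _")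
 by (rule sw_hom[OF lin_tens1[OF lin_id]]) (assumption | rule lm U)+
also have "... = sw M2 U (%a b. smu M2 b (%u v w. t2 (\<theta> u ** a) (v ** w)))"
 by (rule sw_right[symmetric, where m = "%a b. b" and G = "%a b x y. t2 (\<theta> x ** a) y"]) (assumption | rule lm U)+
also have "... = sw M2 U (%a b. smu M2 a (%u v w. t2 (v ** w) (u ** b)))"
 by (rule FG_apply(1)[where F = "%a b c d. t2 (b ** a) (c ** d)", OF mM2 U(1) _ _ _ _ U(2)]) (assumption | rule lm)+
also have "... = sw M2 U (%a b. t2 eT (a ** b))"
 by (rule sw_right[where m = "%a b. a" and G = "%a b x y. t2 y (x ** b)"]) (assumption | rule lm U)+
also have "... = t2 eT (nabla T U)"
 by (rule sw_nabla[OF U(1) lin_tens2[OF lin_id]]) (rule lm)+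
finally have e: "?lh = ..." .
have c: "sw T U (%a b. \<theta> b ** a):cT" "nabla T U:cT" by (assumption | rule lm U)+
show "sw T U (%a b. \<theta> b ** a) = nabla T U" by (rule unit_of_tens_eq(1)[OF c e])
then show "EX r:car R. nabla T U = r *s eT" using unit_of_tens_eq(2)[OF c e] by simp
qed

text \<open>The same pairing of legs as for \<open>Cr\<close>, contracted on both sides by
  \<open>\<mu>_left\<close>.\<close>

lemma Cl_unit:
assumes "U:Cl"
shows "sw T U (%a b. b ** \<theta> a) = nabla T U" "EX r:car R. nabla T U = r *s eT"
proof -
note U = Cl_D[OF assms]
have "t2 eT (sw T U (%a b. b ** \<theta> a)) = sw M2 U (%a b. t2 eT (b ** \<theta> a))"
 by (rule sw_hom[OF lin_tens2[OF lin_id]]) (assumption | rule lm U)+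
also have "... = sw M2 U (%a b. smu M2 a (%u v w. t2 (u ** v) (b ** \<theta> w)))"
 by (rule sw_left[symmetric, where m = "%a b. a" and G = "%a b x y. t2 x (b ** \<theta> y)"]) (assumption | rule lm U)+
also have "... = sw M2 U (%a b. smu M2 b (%u v w. t2 (a ** w) (u ** v)))"
 by (rule FG_apply(2)[where F = "%a b c d. t2 (a ** b) (d ** c)", OF mM2 U(1) _ _ _ _ U(2)]) (assumption | rule lm)+
also have "... = sw M2 U (%a b. t2 (a ** b) eT)"
 by (rule sw_left[where m = "%a b. b" and G = "%a b x y. t2 (a ** y) x"]) (assumption | rule lm U)+
also have "... = t2 (nabla T U) eT"
 by (rule sw_nabla[OF U(1) lin_tens1[OF lin_id]]) (rule lm)+
finally have e: "t2 (nabla T U) eT = t2 eT (sw T U (%a b. b ** \<theta> a))" by simp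
have c: "nabla T U:cT" "sw T U (%a b. b ** \<theta> a):cT" by (assumption | rule lm U)+
show "sw T U (%a b. b ** \<theta> a) = nabla T U" by (rule unit_of_tens_eq(1)[OF c e, symmetric])
show "EX r:car R. nabla T U = r *s eT" by (rule unit_of_tens_eq(2)[OF c e])
qed

lemma scalar_t2:
assumes "r:car R"
shows "t2 (r *s eT) eT = r \<odot>\<^bsub>M2\<^esub> t2 eT eT" "t2 eT (r *s eT) = r \<odot>\<^bsub>M2\<^esub> t2 eT eT"
using hom_smult[OF lin_tens1[OF lin_id one_closed mT mT] assms one_closed]
 hom_smult[OF lin_tens2[OF lin_id one_closed mT mT] assms one_closed] by simp_all

lemma P2_m_lin: "x:car M2==>f:Hom R X M2==>(%y. f y \<otimes>\<^bsub>P2\<^esub> x):Hom R X M2"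
 "x:car M2==>f:Hom R X M2==>(%y. x \<otimes>\<^bsub>P2\<^esub> f y):Hom R X M2"
and Q2_m_lin: "x:car M2==>f:Hom R X M2==>(%y. f y \<otimes>\<^bsub>Q2\<^esub> x):Hom R X M2"
 "x:car M2==>f:Hom R X M2==>(%y. x \<otimes>\<^bsub>Q2\<^esub> f y):Hom R X M2"
by (rule alg_mult_hom[OF P2_alg same_P2] alg_mult_hom[OF Q2_alg same_Q2]; assumption)+

text \<open>The hypotheses are the closure properties that have different proofs in the two
  settings: from the torsor axioms for a quantum torsor, and from the identification of
  \<open>Cr\<close> with the image of \<open>\<gamma>\<close> for a Galois object.\<close>

lemma Hr_hopf:
assumes one: "t2 eT eT:Cr" and mult: "!!x y. x:Cr==>y:Cr==>x \<otimes>\<^bsub>P2\<^esub> y:Cr"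
 and \<nu>: "!!x. x:cT==>smu MT x (%u v w. tn M2 T (t2 v w) u):tmp R M2 T id id ` car (tp R (sub M2 Cr) T)"
 and S: "!!U. U:Cr==>Sr U:Cr"
obtains \<rho> D' where "right_sub R T \<mu> Cr \<rho> (%a u. \<theta> u ** a)" "Hr R T \<mu> \<theta> = make_bialg (sub P2 Cr) (induced_comult R P2 Cr D') (induced_counit R T)"
 "sub_bialgebra R T P2 Cr Dr (nabla T) (induced_comult R P2 Cr D') (induced_counit R T)"
 "bialgebra R (Hr R T \<mu> \<theta>)" "is_antipode R (Hr R T \<mu> \<theta>) Sr"
proof -
have mC: "module R (sub M2 Cr)" by (rule sub_module[OF Cr_sub mM2])
have i: "tmp R M2 T id id:Hom R (tp R (sub M2 Cr) T) MT"
 by (rule tmap_hom[OF incl_hom(4)[OF submod_sub[OF Cr_sub]] id_hom mC mT mM2 mT])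
have \<nu>h: "(%x. smu MT x (%u v w. tn M2 T (t2 v w) u)):Hom R T MT"
 by (assumption | rule lm)+
obtain \<rho> where \<rho>: "\<rho>:Hom R T (tp R (sub M2 Cr) T)"
 "!!x. x:cT==>tmp R M2 T id id (\<rho> x) = smu MT x (%u v w. tn M2 T (t2 v w) u)"
 by (rule lift_through_injective[OF mod_tens[OF mC mT] mMT mT i \<nu>h sub_tensor_inj[OF mM2 Cr_sub] \<nu>], assumption+, rule that, assumption, simp)
interpret right_sub R T \<mu> Cr \<rho> "%a u. \<theta> u ** a"
 by (intro right_sub.intro sub_coaction.intro sub_coaction_axioms.intro right_sub_axioms.intro)
 (assumption | rule pretorsor_axioms Cr_sub \<rho> \<nu>h one mult Cr_unit Cr_expand | rule lm)+
let ?D = "%U. tassoc_inv R T' T P2 (tmp R T' (tp R T P2) id \<mu> U)"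
have Hr: "Hr R T \<mu> \<theta> = make_bialg (sub P2 Cr) (induced_comult R P2 Cr ?D) (induced_counit R T)"
 by (simp add: Hr_def Let_def Hr_carrier_eq Cr_def)
have sb: "sub_bialgebra R T P2 Cr Dr (nabla T) (induced_comult R P2 Cr ?D) (induced_counit R T)"
 by (rule bialg) (rule Dr_eq[OF Cr_D(1)])
interpret B: sub_bialgebra R T P2 Cr Dr "nabla T" "induced_comult R P2 Cr ?D" "induced_counit R T" by (rule sb)
have "is_antipode R B.H Sr"
proof (rule B.H_antipode)
 show "Sr:Hom R P2 P2" using S_hom(1) unfolding same_mhom[OF same_P2 same_P2] .
 show "Sr ` Cr <= Cr" using S by auto
 fix c assume c: "c:Cr"
 note U = Cr_D[OF c]
 have sm: "r \<odot>\<^bsub>P2\<^esub> \<one>\<^bsub>P2\<^esub> = r \<odot>\<^bsub>M2\<^esub> t2 eT eT" for r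
 using same_P2 by (simp add: same_module_def P2_one)
 note r = B.\<e>_closed[OF c] B.N_\<e>[OF c]
 have b: "bilin R M2 M2 M2 (%x y. Sr x \<otimes>\<^bsub>P2\<^esub> y)" "bilin R M2 M2 M2 (%x y. x \<otimes>\<^bsub>P2\<^esub> Sr y)"
 by (assumption | rule lm P2_m_lin)+
 have "sw M2 (Dr c) (%x y. Sr x \<otimes>\<^bsub>P2\<^esub> y) = sw M2 c (%a b. smu M2 b (%u v w. Sr (t2 a u) \<otimes>\<^bsub>P2\<^esub> t2 v w))"
 by (rule sw_Dr_gen[OF U(1) b(1) mM2])
 also have "... = sw M2 c (%a b. smu M2 b (%u v w. t2 (v ** \<theta> u) (a ** w)))"
 by (rule four_cong[OF mM2 U(1)]) (simp_all add: S_t2 P2_mult \<mu>_closed \<theta>_closed tens_in[OF _ _ mT mT])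
 \<comment> \<open>The defining equation of \<open>Cr\<close> removes \<open>\<theta>\<close> and
   leaves a product that \<open>\<mu>_left\<close> contracts. The other convolution identity below
   follows from \<open>\<mu>_left\<close> and \<open>Cr_unit\<close>.\<close>
 also have "... = sw M2 c (%a b. smu M2 a (%u v w. t2 (u ** v) (w ** b)))"
 by (rule FG_apply(1)[where F = "%a b c d. t2 (c ** b) (a ** d)", OF mM2 U(1) _ _ _ _ U(2)]) (assumption | rule lm)+
 also have "... = sw M2 c (%a b. t2 eT (a ** b))"
 by (rule sw_left[where m = "%a b. a" and G = "%a b x y. t2 x (y ** b)"]) (assumption | rule lm U)+
 also have "... = t2 eT (nabla T c)" by (rule sw_nabla[OF U(1) lin_tens2[OF lin_id]]) (rule lm)+
 finally show "sw P2 (Dr c) (%x y. Sr x \<otimes>\<^bsub>P2\<^esub> y) = induced_counit R T c \<odot>\<^bsub>P2\<^esub> \<one>\<^bsub>P2\<^esub>"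
 unfolding same_sw[OF same_P2] sm r(2) scalar_t2[OF r(1)] .
 have "sw M2 (Dr c) (%x y. x \<otimes>\<^bsub>P2\<^esub> Sr y) = sw M2 c (%a b. smu M2 b (%u v w. t2 a u \<otimes>\<^bsub>P2\<^esub> Sr (t2 v w)))"
 by (rule sw_Dr_gen[OF U(1) b(2) mM2])
 also have "... = sw M2 c (%a b. smu M2 b (%u v w. t2 (\<theta> w ** a) (u ** v)))"
 by (rule four_cong[OF mM2 U(1)]) (simp_all add: S_t2 P2_mult \<mu>_closed \<theta>_closed tens_in[OF _ _ mT mT])
 also have "... = sw M2 c (%a b. t2 (\<theta> b ** a) eT)"
 by (rule sw_left[where m = "%a b. b" and G = "%a b x y. t2 (\<theta> y ** a) x"]) (assumption | rule lm U)+
 also have "... = t2 (sw T c (%a b. \<theta> b ** a)) eT"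
 by (rule sw_hom[symmetric, OF lin_tens1[OF lin_id]]) (assumption | rule lm U)+
 finally show "sw P2 (Dr c) (%x y. x \<otimes>\<^bsub>P2\<^esub> Sr y) = induced_counit R T c \<odot>\<^bsub>P2\<^esub> \<one>\<^bsub>P2\<^esub>"
 unfolding same_sw[OF same_P2] sm Cr_unit(1)[OF c] r(2) scalar_t2[OF r(1)] .
qed
then show ?thesis
 using that[OF right_sub_axioms Hr sb] B.H_bialgebra unfolding Hr by simp
qed

text \<open>\<open>D'\<close> is a parameter because \<open>Hl\<close> and \<open>L_hopf\<close>
  write their comultiplications by different expressions, both equal to \<open>Dl\<close> on
  \<open>Cl\<close>.\<close>

lemma left_hopf:
assumes one: "t2 eT eT:Cl" and mult: "!!x y. x:Cl==>y:Cl==>x \<otimes>\<^bsub>Q2\<^esub> y:Cl"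
 and \<nu>: "!!x. x:cT==>smu MT x (%u v w. tn M2 T (t2 u v) w):tmp R M2 T id id ` car (tp R (sub M2 Cl) T)"
 and expand: "!!U. U:Cl ==>
 sw MT U (%a b. smu MT a (%u v w. tn M2 T (t2 u v) (w ** b))) = tn M2 T U eT"
 and D': "!!U. U:Cl==>D' U = Dl U"
shows "hopf_algebra R (make_bialg (sub Q2 Cl) (induced_comult R Q2 Cl D') (induced_counit R T))"
proof -
have mC: "module R (sub M2 Cl)" by (rule sub_module[OF Cl_sub mM2])
have i: "tmp R M2 T id id:Hom R (tp R (sub M2 Cl) T) MT"
 by (rule tmap_hom[OF incl_hom(4)[OF submod_sub[OF Cl_sub]] id_hom mC mT mM2 mT])
have \<nu>h: "(%x. smu MT x (%u v w. tn M2 T (t2 u v) w)):Hom R T MT"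
 by (assumption | rule lm)+
obtain \<rho> where \<rho>: "\<rho>:Hom R T (tp R (sub M2 Cl) T)"
 "!!x. x:cT==>tmp R M2 T id id (\<rho> x) = smu MT x (%u v w. tn M2 T (t2 u v) w)"
 by (rule lift_through_injective[OF mod_tens[OF mC mT] mMT mT i \<nu>h sub_tensor_inj[OF mM2 Cl_sub] \<nu>], assumption+, rule that, assumption, simp)
interpret left_sub R T \<mu> Cl \<rho>
 by (intro left_sub.intro sub_coaction.intro sub_coaction_axioms.intro left_sub_axioms.intro)
 (assumption | rule pretorsor_axioms Cl_sub \<rho> \<nu>h one mult Cl_unit expand)+
have S: "Sl U:Cl" if "U:Cl" for U
proof -
 note U = Cl_D[OF that]
 \<comment> \<open>Stability under \<open>Sl\<close> is obtained by descent: \<open>?E\<close> takes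
   all of \<open>M2\<close> into the image of \<open>Cl \<otimes> T\<close>, so it suffices that
   \<open>?E (Sl U)\<close> equals \<open>Sl U \<otimes> 1\<close>.\<close>
 let ?E = "%\<eta>. sw MT \<eta> (%a b. smu MT a (%u v w. tn M2 T (t2 u v) (w ** b)))"
 have bE: "bilin R T T MT (%a b. smu MT a (%u v w. tn M2 T (t2 u v) (w ** b)))" by (assumption | rule lm)+
 have E: "?E:Hom R M2 MT" by (rule sw_mhom[OF bE mT mT mMT])
 \<comment> \<open>A factor 1 is inserted so that \<open>\<mu>_left\<close> can expand it; the
   defining equation of \<open>Cl\<close> then gives a form of \<open>Sl U\<close> that is free of
   \<open>\<theta>\<close> and on which \<open>?E\<close> can be computed by
   coassociativity.\<close>
 have "Sl U = sw M2 U (%a b. t2 b (\<theta> a ** eT))"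
 unfolding Sl_def by (rule sw_cong[OF refl U(1) mT mT mM2], simp add: \<theta>_closed) (assumption | rule lm)+
 also have "... = sw M2 U (%a b. smu M2 a (%u v w. t2 b (\<theta> w ** (u ** v))))"
 by (rule sw_left[symmetric, where m = "%a b. a" and G = "%a b x y. t2 b (\<theta> y ** x)"]) (assumption | rule lm U)+
 also have "... = sw M2 U (%a b. smu M2 b (%u v w. t2 u (v ** (a ** w))))"
 by (rule FG_apply(2)[where F = "%a b c d. t2 d (c ** (a ** b))", OF mM2 U(1) _ _ _ _ U(2)]) (assumption | rule lm)+
 finally have "?E (Sl U) = ?E ..." by simp
 also have "... = sw MT U (%a b. ?E (smu M2 b (%u v w. t2 u (v ** (a ** w)))))"
 by (rule sw_hom[OF E U(1) _ mT mT mM2 mMT]) (assumption | rule lm)+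
 also have "... = sw MT U (%a b. smu MT b (%u v w. tn M2 T (t2 u v) (a ** w)))"
 proof (rule sw_cong[OF refl U(1) mT mT mMT])
 fix a b assume ab: "a:cT" "b:cT"
 note ll = lm ab
 have "?E (smu M2 b (%u v w. t2 u (v ** (a ** w)))) =
  smu MT b (%u v w. ?E (t2 u (v ** (a ** w))))" (is "?lh = _")
  by (rule T3.hom[OF E]) (assumption | rule ll)+
 also have "... = smu MT b (%d e f. smu MT d (%u v w. tn M2 T (t2 u v) (w ** (e ** (a ** f)))))"
  by (rule T3.cong, (assumption | rule ll)+, rule sw_tens[OF bE]) (assumption | rule ll)+
 also have "... = smu MT b (%u v w. smu MT w (%d e f. tn M2 T (t2 u v) (d ** (e ** (a ** f)))))"
  by (rule coassoc[symmetric, where F = "%u v d e f. tens R M2 T (t2 u v) (d ** (e ** (a ** f)))"]) (assumption | rule ll)+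
 also have "... = smu MT b (%u v w. tn M2 T (t2 u v) (a ** w))"
 proof (rule T3.cong[OF \<mu>_closed[OF ab(2)] mMT])
  fix u v w assume y: "u:cT" "v:cT" "w:cT"
  have "smu MT w (%d e f. tn M2 T (t2 u v) (d ** (e ** (a ** f)))) =
  smu MT w (%d e f. tn M2 T (t2 u v) (d ** e ** (a ** f)))"
  by (rule T3.cong[OF \<mu>_closed[OF y(3)] mMT], simp add: m_assoc ab) (assumption | rule ll y)+
  also have "... = tn M2 T (t2 u v) (eT ** (a ** w))"
  by (rule left[where G = "%x y. tens R M2 T (t2 u v) (x ** (a ** y))", OF y(3) _ mMT]) (assumption | rule ll y)+
  finally show "smu MT w (%d e f. tn M2 T (t2 u v) (d ** (e ** (a ** f)))) = tn M2 T (t2 u v) (a ** w)"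
  using ab y by simp
 qed (assumption | rule ll)+
 finally show "?lh = ..." .
 qed (assumption | rule lm)+
 also have "... = sw MT U (%a b. smu MT a (%u v w. tn M2 T (t2 b (\<theta> w)) (u ** v)))"
 by (rule FG_apply(2)[symmetric, where F = "%a b c d. tens R M2 T (t2 d c) (a ** b)", OF mMT U(1) _ _ _ _ U(2)]) (assumption | rule lm)+
 also have "... = sw MT U (%a b. tn M2 T (t2 b (\<theta> a)) eT)"
 by (rule sw_left[where m = "%a b. a" and G = "%a b x y. tens R M2 T (t2 b (\<theta> y)) x"]) (assumption | rule lm U)+
 also have "... = tn M2 T (Sl U) eT"
 unfolding Sl_def by (rule sw_hom[symmetric, OF lin_tens1[OF lin_id]]) (assumption | rule lm U)+
 finally have e: "?E (Sl U) = ..." .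
 let ?N = "tmp R M2 T id id ` car (tp R (sub M2 Cl) T)"
 have N: "submodule ?N R MT" by (rule image_submodule[OF mod_tens[OF mC mT] mMT i])
 have c: "Sl U:car M2" by (rule hom_mem[OF S_hom(2) U(1)])
 have "?E (Sl U):?N"
 proof (rule sw_submodule[OF N c mT mT mMT])
 fix a b assume ab: "a:cT" "b:cT"
 have bb: "bilin R M2 T MT (%c x. tn M2 T c (x ** b))" by (assumption | rule lm ab)+
 have "sw MT (\<rho> a) (%c x. tn M2 T c (x ** b)):?N"
 proof (rule sw_submodule[OF N \<rho>_closed[OF ab(1)] mC mT mMT])
  fix c x assume c: "c:car (sub M2 Cl)" and x: "x:cT"
  show "tn M2 T c (x ** b):?N"
  using tmap_tens[OF inclC id_hom mC mT mM2 mT c m_closed[OF x ab(2)]] tens_in[OF c m_closed[OF x ab(2)] mC mT]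
  by (intro image_eqI[where x = "tens R (sub M2 Cl) T c (x ** b)"]) simp_all
 qed
 then show "smu MT a (%u v w. tn M2 T (t2 u v) (w ** b)):?N"
  unfolding sw_\<rho>[OF ab(1) bb mMT, symmetric] sw_\<nu>[OF ab(1) bb mMT] .
 qed
 then show "Sl U:Cl" unfolding e by (rule descent_submodule[OF mM2 Cl_sub c])
qed
interpret B: sub_bialgebra R T Q2 Cl Dl "nabla T" "induced_comult R Q2 Cl D'" "induced_counit R T"
 by (rule bialg[OF D'])
have "is_antipode R B.H Sl"
proof (rule B.H_antipode)
 show "Sl:Hom R Q2 Q2" using S_hom(2) unfolding same_mhom[OF same_Q2 same_Q2] .
 show "Sl ` Cl <= Cl" using S by auto
 fix c assume c: "c:Cl"
 note U = Cl_D[OF c]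
 have sm: "r \<odot>\<^bsub>Q2\<^esub> \<one>\<^bsub>Q2\<^esub> = r \<odot>\<^bsub>M2\<^esub> t2 eT eT" for r
 using same_Q2 by (simp add: same_module_def Q2_one)
 note r = B.\<e>_closed[OF c] B.N_\<e>[OF c]
 have b: "bilin R M2 M2 M2 (%x y. Sl x \<otimes>\<^bsub>Q2\<^esub> y)" "bilin R M2 M2 M2 (%x y. x \<otimes>\<^bsub>Q2\<^esub> Sl y)"
 by (assumption | rule lm Q2_m_lin)+
 have "sw M2 (Dl c) (%x y. Sl x \<otimes>\<^bsub>Q2\<^esub> y) = sw M2 c (%a b. smu M2 a (%u v w. Sl (t2 u v) \<otimes>\<^bsub>Q2\<^esub> t2 w b))"
 by (rule sw_Dl_gen[OF U(1) b(1) mM2])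
 also have "... = sw M2 c (%a b. smu M2 a (%u v w. t2 (v ** w) (b ** \<theta> u)))"
 by (rule four_cong[OF mM2 U(1)]) (simp_all add: S_t2 Q2_mult \<mu>_closed \<theta>_closed tens_in[OF _ _ mT mT])
 also have "... = sw M2 c (%a b. t2 eT (b ** \<theta> a))"
 by (rule sw_right[where m = "%a b. a" and G = "%a b x y. t2 y (b ** \<theta> x)"]) (assumption | rule lm U)+
 also have "... = t2 eT (sw T c (%a b. b ** \<theta> a))"
 by (rule sw_hom[symmetric, OF lin_tens2[OF lin_id]]) (assumption | rule lm U)+
 finally show "sw Q2 (Dl c) (%x y. Sl x \<otimes>\<^bsub>Q2\<^esub> y) = induced_counit R T c \<odot>\<^bsub>Q2\<^esub> \<one>\<^bsub>Q2\<^esub>"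
 unfolding same_sw[OF same_Q2] sm Cl_unit(1)[OF c] r(2) scalar_t2[OF r(1)] .
 have "sw M2 (Dl c) (%x y. x \<otimes>\<^bsub>Q2\<^esub> Sl y) = sw M2 c (%a b. smu M2 a (%u v w. t2 u v \<otimes>\<^bsub>Q2\<^esub> Sl (t2 w b)))"
 by (rule sw_Dl_gen[OF U(1) b(2) mM2])
 also have "... = sw M2 c (%a b. smu M2 a (%u v w. t2 (u ** b) (\<theta> w ** v)))"
 by (rule four_cong[OF mM2 U(1)]) (simp_all add: S_t2 Q2_mult \<mu>_closed \<theta>_closed tens_in[OF _ _ mT mT])
 also have "... = sw M2 c (%a b. smu M2 b (%u v w. t2 (a ** u) (v ** w)))"
 by (rule FG_apply(2)[where F = "%a b c d. t2 (a ** d) (c ** b)", OF mM2 U(1) _ _ _ _ U(2)]) (assumption | rule lm)+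
 also have "... = sw M2 c (%a b. t2 (a ** b) eT)"
 by (rule sw_right[where m = "%a b. b" and G = "%a b x y. t2 (a ** x) y"]) (assumption | rule lm U)+
 also have "... = t2 (nabla T c) eT" by (rule sw_nabla[OF U(1) lin_tens1[OF lin_id]]) (rule lm)+
 finally show "sw Q2 (Dl c) (%x y. x \<otimes>\<^bsub>Q2\<^esub> Sl y) = induced_counit R T c \<odot>\<^bsub>Q2\<^esub> \<one>\<^bsub>Q2\<^esub>"
 unfolding same_sw[OF same_Q2] sm r(2) scalar_t2[OF r(1)] .
qed
then show ?thesis using B.H_bialgebra unfolding hopf_algebra_def by auto
qed

end

section \<open>Sweedler calculus in Hopf algebras\<close>

text \<open>The twofold counterpart of \<open>eval\<close>: a linear map is rewritten as a Sweedler
  sum from its values on pure tensors.\<close>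

lemma tensor_eval:
assumes "f:Hom R (tp R A B) P" "module R A" "module R B" "module R P" "U:car (tp R A B)"
 and "!!a b. a:car A==>b:car B==>f (tens R A B a b) = K a b"
shows "f U = sw P U K"
proof -
note t = tens_in[OF _ _ assms(2,3)]
have "f U = f (sw (tp R A B) U (tens R A B))" by (simp add: sw_self assms(2,3,5))
also have "... = sw P U (%a b. f (tens R A B a b))"
 by (rule sw_hom[OF assms(1,5) t assms(2,3) mod_tens[OF assms(2,3)] assms(4)])
also have "... = sw P U K" by (rule sw_cong[OF refl assms(5,2-4,6) hom_mem[OF assms(1) t]])
finally show ?thesis .
qed

lemma lin_smult:
assumes "module R P" "f:Hom R X P" "r:car R"
shows "(%x. r \<odot>\<^bsub>P\<^esub> f x):Hom R X P"
proof -
interpret P: module R P by fact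
have c: "r \<odot>\<^bsub>P\<^esub> (s \<odot>\<^bsub>P\<^esub> x) = s \<odot>\<^bsub>P\<^esub> (r \<odot>\<^bsub>P\<^esub> x)" if "s:car R" "x:car P" for s x
 using P.smult_assoc1[of r s x] P.smult_assoc1[of s r x] that assms(3) P.R.m_comm[of r s] by simp
show ?thesis using assms(2,3) c by (auto simp: mod_hom_def Pi_def P.smult_r_distr)
qed

lemma lin_scalar:
assumes "module R P" "f:Hom R X (self_module R)" "m:car P"
shows "(%x. f x \<odot>\<^bsub>P\<^esub> m):Hom R X P"
proof -
interpret P: module R P by fact
show ?thesis using assms(2,3) by (auto simp: mod_hom_def Pi_def P.smult_l_distr P.smult_assoc1)
qed

lemma sw_mult:
assumes "k_algebra R A" "k_algebra R B" "x:car (tp R A B)" "y:car (tp R A B)" "bilin R A B P F" "module R P"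
shows "sw P (x \<otimes>\<^bsub>tp R A B\<^esub> y) F = sw P x (%a b. sw P y (%c d. F (a \<otimes>\<^bsub>A\<^esub> c) (b \<otimes>\<^bsub>B\<^esub> d)))"
proof -
interpret A: k_algebra R A by fact
interpret B: k_algebra R B by fact
interpret AB: k_algebra R "tp R A B" by (rule tensor_k_algebra[OF assms(1,2)])
note m = A.module_axiom B.module_axiom
let ?f = "%z. sw P z F"
have f: "?f:Hom R (tp R A B) P" by (rule sw_mhom[OF assms(5) m assms(6)])
show ?thesis
proof (rule tensor_eval[OF hom_comp[OF f AB.rmult_hom[OF assms(4) lin_id]] m assms(6,3)])
 fix a b assume ab: "a:car A" "b:car B"
 have t: "tens R A B a b:car (tp R A B)" by (rule tens_in ab m)+
 show "?f (tens R A B a b \<otimes>\<^bsub>tp R A B\<^esub> y) = sw P y (%c d. F (a \<otimes>\<^bsub>A\<^esub> c) (b \<otimes>\<^bsub>B\<^esub> d))"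
 by (rule tensor_eval[OF hom_comp[OF f AB.lmult_hom[OF t lin_id]] m assms(6,4)])
  (simp add: two_algebras.tens_mult[OF two_algebras.intro[OF assms(1,2)]] ab sw_tens[OF assms(5) _ _ m assms(6)])
qed
qed

text \<open>Stated for a coaction on an arbitrary \<open>T\<close>; the case \<open>T = H\<close> is
  coassociativity of the comultiplication.\<close>

lemma coassoc_sw:
assumes mT: "module R T" and mH: "module R H" and \<rho>: "\<rho>:Hom R T (tp R T H)" and \<D>: "\<D>:Hom R H (tp R H H)"
 and t: "t:car T"
 and co: "tassoc R T H H (tmp R (tp R T H) H \<rho> id (\<rho> t)) = tmp R T (tp R H H) id \<D> (\<rho> t)"
 and F: "trilin R T H H P F" "module R P"
shows "sw P (\<rho> t) (%x y. sw P (\<rho> x) (%u v. F u v y)) = sw P (\<rho> t) (%x y. sw P (\<D> y) (%u v. F x u v))"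
proof -
interpret three_modules R T H H by (rule three_modulesI[OF mT mH mH])
let ?TH = "tp R T H" and ?HH = "tp R H H" and ?g = "%w. sw3 P w F"
let ?l = "%U. tassoc R T H H (tmp R ?TH H \<rho> id U)" and ?r = "tmp R T ?HH id \<D>"
note mTH = mod_tens[OF mT mH] and \<rho>t = hom_mem[OF \<rho> t]
have g: "?g:Hom R ABC P" by (rule lin1[OF lin_id F])
have l: "?l:Hom R ?TH ABC"
 by (rule hom_comp[OF tassoc_hom(1)[OF mT mH mH] tmap_hom[OF \<rho> id_hom mT mH mTH mH]])
have "?g (?l (\<rho> t)) = sw P (\<rho> t) (%x y. sw P (\<rho> x) (%u v. F u v y))"
proof (rule tensor_eval[where f = "%U. ?g (?l U)", OF hom_comp[OF g l] mT mH F(2) \<rho>t])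
 fix x y assume x: "x:car T" "y:car H"
 show "?g (?l (tens R T H x y)) = sw P (\<rho> x) (%u v. F u v y)"
 using tmap_tens[OF \<rho> id_hom mT mH mTH mH x]
  tensor_eval[where f = "%z. ?g (tassoc R T H H (tens R ?TH H z y))" and K = "%u v. F u v y",
  OF hom_comp[OF g hom_comp[OF tassoc_hom(1)[OF mT mH mH] lin_tens1[OF lin_id x(2) mTH mH]]] mT mH F(2) hom_mem[OF \<rho> x(1)]]
 by (simp add: tassoc_tens[OF mT mH mH _ _ x(2)] tens[OF F(1) _ _ x(2) F(2)])
qed
moreover have "?g (?r (\<rho> t)) = sw P (\<rho> t) (%x y. sw P (\<D> y) (%u v. F x u v))"
proof (rule tensor_eval[where f = "%U. ?g (?r U)", OF hom_comp[OF g tmap_hom[OF id_hom \<D> mT mH mT mBC]] mT mH F(2) \<rho>t])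
 fix x y assume x: "x:car T" "y:car H"
 show "?g (?r (tens R T H x y)) = sw P (\<D> y) (%u v. F x u v)"
 using tmap_tens[OF id_hom \<D> mT mH mT mBC x]
  tensor_eval[where f = "%z. ?g (tens R T ?HH x z)" and K = "%u v. F x u v",
  OF hom_comp[OF g lin_tens2[OF lin_id x(1) mT mBC]] mH mH F(2) hom_mem[OF \<D> x(2)]]
 by (simp add: tens[OF F(1) x(1) _ _ F(2)])
qed
ultimately show ?thesis using co by simp
qed

locale bialgebra_calculus =
fixes R :: "('k, 'r) ring_scheme" and H :: "('k, 'h) bialg"
assumes bialgebra: "bialgebra R H"
begin

abbreviation times_H (infixl "\<star>" 70) where "x \<star> y \<equiv> x \<otimes>\<^bsub>H\<^esub> y"
abbreviation "eH \<equiv> \<one>\<^bsub>H\<^esub>"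
abbreviation "cH \<equiv> carrier H"
abbreviation "tnH \<equiv> tens R"
abbreviation "sde P x \<equiv> sw P (comult H x)"

sublocale H: k_algebra R H using bialgebra by (simp add: bialgebra_def)

abbreviation "HH == tp R H H"
abbreviation "\<D> == comult H"
abbreviation "\<e> == counit H"

lemmas mH = H.module_axiom
lemma mHH: "module R HH" by (rule mod_tens[OF mH mH])
lemma HH_alg: "k_algebra R HH" by (rule tensor_k_algebra) (rule H.k_algebra_axioms)+
lemma \<D>_alg: "\<D>:alg_hom R H HH" and \<e>_alg: "\<e>:alg_hom R H (self_module R)"
using bialgebra by (simp_all add: bialgebra_def)
lemmas \<D>_hom = alg_homD(1)[OF \<D>_alg] and \<e>_hom = alg_homD(1)[OF \<e>_alg]
lemmas \<D>_closed = hom_mem[OF \<D>_hom]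
lemmas Delta_cong = sw_cong[OF refl \<D>_closed mH mH]
lemma \<e>_closed: "h:cH==>\<e> h:car R" using hom_mem[OF \<e>_hom] by simp
lemmas \<e>_lin = lin_scalar[OF _ hom_comp[OF \<e>_hom]] lin_smult[OF _ _ \<e>_closed]
lemmas lh = lin mH mHH H.one_closed H.rmult_hom H.lmult_hom H.m_closed hom_comp[OF \<D>_hom] \<D>_closed \<e>_lin \<e>_closed module.smult_closed

sublocale H3: three_modules R H H H by (rule three_modulesI[OF mH mH mH])

lemma comult_coassoc:
assumes "h:cH" "trilin R H H H P F" "module R P"
shows "sde P h (%x y. sde P x (%u v. F u v y)) = sde P h (%x y. sde P y (%u v. F x u v))"
by (rule coassoc_sw[OF mH mH \<D>_hom \<D>_hom assms(1) _ assms(2,3)])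
 (use bialgebra assms(1) in \<open>simp add: bialgebra_def coalgebra_def\<close>)

lemma comult_counit:
assumes "h:cH" "g:Hom R H P" "module R P"
shows "sde P h (%x y. \<e> x \<odot>\<^bsub>P\<^esub> g y) = g h" "sde P h (%x y. \<e> y \<odot>\<^bsub>P\<^esub> g x) = g h"
proof -
note \<D>h = \<D>_closed[OF assms(1)]
have b: "bilin R H H H (%x y. \<e> x \<odot>\<^bsub>H\<^esub> y)" "bilin R H H H (%x y. \<e> y \<odot>\<^bsub>H\<^esub> x)" by (assumption | rule lh)+
have e: "tensor_lift H (%x y. \<e> x \<odot>\<^bsub>H\<^esub> y) (\<D> h) = h" "tensor_lift H (%x y. \<e> y \<odot>\<^bsub>H\<^esub> x) (\<D> h) = h"
 using bialgebra assms(1) by (simp_all add: bialgebra_def coalgebra_def)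
note e' = e[unfolded tlift_sw[OF mH mH mH \<D>h b(1)] tlift_sw[OF mH mH mH \<D>h b(2)]]
have "sde P h (%x y. \<e> x \<odot>\<^bsub>P\<^esub> g y) = sde P h (%x y. g (\<e> x \<odot>\<^bsub>H\<^esub> y))"
 by (rule sw_cong[OF refl \<D>h mH mH assms(3)], simp add: hom_smult[OF assms(2)] \<e>_closed)
 (assumption | rule lh assms hom_mem[OF assms(2)])+
also have "... = g (sde H h (%x y. \<e> x \<odot>\<^bsub>H\<^esub> y))"
 by (rule sw_hom[symmetric, OF assms(2) \<D>h _ mH mH mH assms(3)]) (assumption | rule lh)+
finally show "sde P h (%x y. \<e> x \<odot>\<^bsub>P\<^esub> g y) = g h" unfolding e' .
have "sde P h (%x y. \<e> y \<odot>\<^bsub>P\<^esub> g x) = sde P h (%x y. g (\<e> y \<odot>\<^bsub>H\<^esub> x))"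
 by (rule sw_cong[OF refl \<D>h mH mH assms(3)], simp add: hom_smult[OF assms(2)] \<e>_closed)
 (assumption | rule lh assms hom_mem[OF assms(2)])+
also have "... = g (sde H h (%x y. \<e> y \<odot>\<^bsub>H\<^esub> x))"
 by (rule sw_hom[symmetric, OF assms(2) \<D>h _ mH mH mH assms(3)]) (assumption | rule lh)+
finally show "sde P h (%x y. \<e> y \<odot>\<^bsub>P\<^esub> g x) = g h" unfolding e' .
qed

text \<open>The usual argument that a left and a right inverse coincide, in the convolution algebra:
  f = f * (g * k) = (f * g) * k = k.\<close>

lemma convolution_inverse_unique:
assumes "k_algebra R A" and f: "f:Hom R H A" and g: "g:Hom R H A" and k: "k:Hom R H A"
 and fg: "!!h. h:cH==>sde A h (%x y. f x \<otimes>\<^bsub>A\<^esub> g y) = \<e> h \<odot>\<^bsub>A\<^esub> \<one>\<^bsub>A\<^esub>"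
 and gk: "!!h. h:cH==>sde A h (%x y. g x \<otimes>\<^bsub>A\<^esub> k y) = \<e> h \<odot>\<^bsub>A\<^esub> \<one>\<^bsub>A\<^esub>"
 and h: "h:cH"
shows "f h = k h"
proof -
interpret A: k_algebra R A by fact
note mA = A.module_axiom
note c = hom_mem[OF f] hom_mem[OF g] hom_mem[OF k]
note ll = lh mA c A.one_closed A.m_closed A.lmult_hom A.rmult_hom hom_comp[OF f] hom_comp[OF g] hom_comp[OF k]
note \<D>h = \<D>_closed[OF h]
have "f h = sde A h (%x y. \<e> y \<odot>\<^bsub>A\<^esub> f x)" by (rule comult_counit(2)[OF h f mA, symmetric])
also have "... = sde A h (%x y. f x \<otimes>\<^bsub>A\<^esub> sde A y (%u v. g u \<otimes>\<^bsub>A\<^esub> k v))"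
 by (rule sw_cong[OF refl \<D>h mH mH mA], simp add: gk A.smult_assoc_r c \<e>_closed) (assumption | rule ll)+
also have "... = sde A h (%x y. sde A y (%u v. f x \<otimes>\<^bsub>A\<^esub> (g u \<otimes>\<^bsub>A\<^esub> k v)))"
 by (rule sw_cong[OF refl \<D>h mH mH mA], rule sw_hom[OF A.lmult_hom[OF _ lin_id]]) (assumption | rule ll)+
also have "... = sde A h (%x y. sde A x (%u v. f u \<otimes>\<^bsub>A\<^esub> (g v \<otimes>\<^bsub>A\<^esub> k y)))"
 by (rule comult_coassoc[symmetric, where F = "%x u v. f x \<otimes>\<^bsub>A\<^esub> (g u \<otimes>\<^bsub>A\<^esub> k v)", OF h _ mA]) (assumption | rule ll)+
also have "... = sde A h (%x y. sde A x (%u v. (f u \<otimes>\<^bsub>A\<^esub> g v) \<otimes>\<^bsub>A\<^esub> k y))"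
 by (rule sw_cong[OF refl \<D>h mH mH mA], rule sw_cong[OF refl _ mH mH mA]) (assumption | rule A.m_assoc[symmetric] ll)+
also have "... = sde A h (%x y. sde A x (%u v. f u \<otimes>\<^bsub>A\<^esub> g v) \<otimes>\<^bsub>A\<^esub> k y)"
 by (rule sw_cong[OF refl \<D>h mH mH mA], rule sw_hom[OF A.rmult_hom[OF _ lin_id], symmetric]) (assumption | rule ll)+
also have "... = sde A h (%x y. \<e> x \<odot>\<^bsub>A\<^esub> k y)"
 by (rule sw_cong[OF refl \<D>h mH mH mA], simp add: fg A.smult_assoc_l c \<e>_closed) (assumption | rule ll)+
also have "... = k h" by (rule comult_counit(1)[OF h k mA])
finally show ?thesis .
qed

lemma antipodeD:
assumes "is_antipode R H S"
shows "S:Hom R H H"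
 "h:cH==>sde H h (%x y. S x \<star> y) = \<e> h \<odot>\<^bsub>H\<^esub> eH"
 "h:cH==>sde H h (%x y. x \<star> S y) = \<e> h \<odot>\<^bsub>H\<^esub> eH"
proof -
show S: "S:Hom R H H" using assms by (simp add: is_antipode_def)
note ll = lh hom_comp[OF S] hom_mem[OF S]
have b: "bilin R H H H (%x y. S x \<star> y)" "bilin R H H H (%x y. x \<star> S y)" by (assumption | rule ll)+
assume h: "h:cH"
show "sde H h (%x y. S x \<star> y) = \<e> h \<odot>\<^bsub>H\<^esub> eH" "sde H h (%x y. x \<star> S y) = \<e> h \<odot>\<^bsub>H\<^esub> eH"
 unfolding tlift_sw[OF mH mH mH \<D>_closed[OF h] b(1), symmetric] tlift_sw[OF mH mH mH \<D>_closed[OF h] b(2), symmetric]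
 using assms h by (simp_all add: is_antipode_def)
qed

text \<open>\<open>antipode\<close> is a choice by \<open>SOME\<close>. As a left and a right
  convolution inverse of the identity agree on the carrier, the choice can be computed from any
  known antipode.\<close>

lemma antipode_eq:
assumes "is_antipode R H S" "h:cH"
shows "antipode R H h = S h"
proof -
have a: "is_antipode R H (antipode R H)" unfolding antipode_def by (rule someI[of _ S]) (rule assms)
show ?thesis
 by (rule convolution_inverse_unique[OF H.k_algebra_axioms antipodeD(1)[OF a] lin_id antipodeD(1)[OF assms(1)]
  antipodeD(2)[OF a] antipodeD(3)[OF assms(1)] assms(2)])
qed

text \<open>The antipode reverses the comultiplication: \<open>\<D> \<circ> S\<close> and the
  flipped \<open>(S \<otimes> S) \<D>\<close> are both convolution inverses of \<open>\<D>\<close>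
  among the linear maps from \<open>H\<close> to \<open>H \<otimes> H\<close>.\<close>

lemma antipode_comult:
assumes S: "is_antipode R H S" and h: "h:cH" and F: "bilin R H H P F" "module R P"
shows "sw P (\<D> (S h)) F = sde P h (%x y. F (S y) (S x))"
proof -
interpret HH: k_algebra R HH by (rule HH_alg)
note Sh = antipodeD(1)[OF S]
note ll = lh hom_comp[OF Sh] hom_mem[OF Sh] HH.rmult_hom HH.lmult_hom HH.m_closed HH.one_closed
let ?t = "tnH H H"
let ?k = "%h. sde HH h (%x y. ?t (S y) (S x))"
have b: "bilin R H H HH (%x y. ?t (S y) (S x))" by (assumption | rule ll)+
have k: "?k:Hom R H HH" by (assumption | rule ll)+
have sm: "r \<odot>\<^bsub>HH\<^esub> \<one>\<^bsub>HH\<^esub> = ?t (r \<odot>\<^bsub>H\<^esub> eH) eH" if "r:car R" for r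
 using hom_smult[OF lin_tens1[OF lin_id H.one_closed mH mH] that H.one_closed] by (simp add: tsimps(4))
have "\<D> (S h) = ?k h"
proof (rule convolution_inverse_unique[OF HH_alg hom_comp[OF \<D>_hom Sh] \<D>_hom k _ _ h])
 fix h assume h: "h:cH"
 note \<D>h = \<D>_closed[OF h]
 have "sde HH h (%x y. \<D> (S x) \<otimes>\<^bsub>HH\<^esub> \<D> y) = sde HH h (%x y. \<D> (S x \<star> y))" (is "?lh = _")
 by (rule sw_cong[OF refl \<D>h mH mH mHH], rule alg_homD(2)[OF \<D>_alg, symmetric]) (assumption | rule ll)+
 also have "... = \<D> (sde H h (%x y. S x \<star> y))"
 by (rule sw_hom[symmetric, OF \<D>_hom \<D>h _ mH mH mH mHH]) (assumption | rule ll)+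
 also have "... = \<e> h \<odot>\<^bsub>HH\<^esub> \<one>\<^bsub>HH\<^esub>"
 unfolding antipodeD(2)[OF S h] hom_smult[OF \<D>_hom \<e>_closed[OF h] H.one_closed] alg_homD(3)[OF \<D>_alg] ..
 finally show "?lh = ..." .
 have m: "\<D> x \<otimes>\<^bsub>HH\<^esub> ?k y = sde HH x (%a b. sde HH y (%p q. ?t (a \<star> S q) (b \<star> S p)))"
 if x: "x:cH" "y:cH" for x y
 proof (rule tensor_eval[OF HH.rmult_hom[OF _ lin_id] mH mH mHH \<D>_closed[OF x(1)]])
 show "?k y:car HH" by (rule hom_mem[OF k x(2)])
 fix a b assume ab: "a:cH" "b:cH"
 have t: "?t a b:car HH" by (rule ll ab)+
 have "?t a b \<otimes>\<^bsub>HH\<^esub> ?k y = sde HH y (%p q. ?t a b \<otimes>\<^bsub>HH\<^esub> ?t (S q) (S p))" (is "?lh = _")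
  by (rule sw_hom[OF HH.lmult_hom[OF t lin_id] \<D>_closed[OF x(2)] _ mH mH mHH mHH]) (assumption | rule ll)+
 also have "... = sde HH y (%p q. ?t (a \<star> S q) (b \<star> S p))"
  by (rule Delta_cong[OF x(2) mHH])
  (simp_all add: two_algebras.tens_mult[OF two_algebras.intro[OF H.k_algebra_axioms H.k_algebra_axioms]] ab hom_mem[OF Sh] tens_in[OF _ _ mH mH])
 finally show "?lh = ..." .
 qed
 have "sde HH h (%x y. \<D> x \<otimes>\<^bsub>HH\<^esub> ?k y) =
 sde HH h (%x y. sde HH x (%a b. sde HH y (%p q. ?t (a \<star> S q) (b \<star> S p))))" (is "?lh = _")
 by (rule sw_cong[OF refl \<D>h mH mH mHH m]) (assumption | rule ll)+
 also have "... = sde HH h (%x y. sde HH y (%u v. sde HH v (%p q. ?t (x \<star> S q) (u \<star> S p))))"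
 by (rule comult_coassoc[where F = "%a b y. sde HH y (%p q. ?t (a \<star> S q) (b \<star> S p))", OF h _ mHH]) (assumption | rule ll)+
 also have "... = sde HH h (%x y. ?t (x \<star> S y) eH)"
 proof (rule sw_cong[OF refl \<D>h mH mH mHH])
 fix x y assume x: "x:cH" "y:cH"
 note \<D>y = \<D>_closed[OF x(2)]
 have "sde HH y (%u v. sde HH v (%p q. ?t (x \<star> S q) (u \<star> S p))) =
  sde HH y (%u v. sde HH u (%p q. ?t (x \<star> S v) (p \<star> S q)))" (is "?lh = _")
  by (rule comult_coassoc[symmetric, where F = "%u p q. ?t (x \<star> S q) (u \<star> S p)", OF x(2) _ mHH]) (assumption | rule ll x)+
 also have "... = sde HH y (%u v. \<e> u \<odot>\<^bsub>HH\<^esub> ?t (x \<star> S v) eH)"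
 proof (rule sw_cong[OF refl \<D>y mH mH mHH])
  fix u v assume u: "u:cH" "v:cH"
  have xv: "x \<star> S v:cH" by (rule ll x u)+
  have "sde HH u (%p q. ?t (x \<star> S v) (p \<star> S q)) = ?t (x \<star> S v) (sde H u (%p q. p \<star> S q))" (is "?lh = _")
  by (rule sw_hom[symmetric, OF lin_tens2[OF lin_id xv mH mH]]) (assumption | rule ll u)+
  also have "... = \<e> u \<odot>\<^bsub>HH\<^esub> ?t (x \<star> S v) eH"
  unfolding antipodeD(3)[OF S u(1)] by (rule hom_smult[OF lin_tens2[OF lin_id xv mH mH] \<e>_closed[OF u(1)] H.one_closed])
  finally show "?lh = ..." .
 qed (assumption | rule ll x)+
 also have "... = ?t (x \<star> S y) eH"
  by (rule comult_counit(1)[where g = "%v. ?t (x \<star> S v) eH", OF x(2) _ mHH]) (assumption | rule ll x)+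
 finally show "?lh = ..." .
 qed (assumption | rule ll)+
 also have "... = ?t (sde H h (%x y. x \<star> S y)) eH"
 by (rule sw_hom[symmetric, OF lin_tens1[OF lin_id H.one_closed mH mH]]) (assumption | rule ll h)+
 also have "... = \<e> h \<odot>\<^bsub>HH\<^esub> \<one>\<^bsub>HH\<^esub>" unfolding antipodeD(3)[OF S h] sm[OF \<e>_closed[OF h]] ..
 finally show "?lh = ..." .
qed
then have "sw P (\<D> (S h)) F = sde P h (%x y. sw P (?t (S y) (S x)) F)"
 using sw_hom[OF sw_mhom[OF F(1) mH mH F(2)] \<D>_closed[OF h] bilin_in[OF b] mH mH mHH F(2)] by simp
also have "... = sde P h (%x y. F (S y) (S x))"
 by (rule Delta_cong[OF h F(2)])
 (simp_all add: sw_tens[OF F(1) _ _ mH mH F(2)] hom_mem[OF Sh] bilin_in[OF F(1)])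
finally show ?thesis .
qed

end

lemma tensor_lift_sw':
assumes "module R A" "module R B" "module R P" "U:car (tp R A B)" "bilin R A B P g"
 and "!!x y. x:car A==>y:car B==>f x y = g x y"
shows "tensor_lift P f U = sw P U g"
proof -
have "bilin R A B P f" by (rule bilin_cong[THEN iffD2, OF assms(6,1,2,5)])
from tlift_sw[OF assms(1-4) this] show ?thesis
 using sw_cong[OF refl assms(4,1,2,3), of g f] assms(6) bilin_in[OF assms(5)] by simp
qed

text \<open>Reversing the four legs of the defining equation for \<open>U\<close> and applying
  \<open>\<theta>\<close> to the two that come first gives the defining equation for
  \<open>Sr U\<close>, because \<open>\<mu>\<close> commutes with \<open>\<theta>\<close>.\<close>

lemma (in pretorsor_theta) S_in:
assumes "!!x. x:cT==>\<mu> (\<theta> x) = smu M3 x (%a b c. t3 (\<theta> a) (\<theta> b) (\<theta> c))"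
 and U: "U:Cr"
shows "Sr U:Cr"
proof -
have mt: "sw3 M4 (\<mu> (\<theta> x)) F = smu M4 x (%a b c. F (\<theta> a) (\<theta> b) (\<theta> c))" if x: "x:cT" and F: "trilin R T T T M4 F" for x F
proof -
 have "sw3 M4 (\<mu> (\<theta> x)) F = smu M4 x (%a b c. sw3 M4 (t3 (\<theta> a) (\<theta> b) (\<theta> c)) F)"
 unfolding assms(1)[OF x] by (rule T3.hom[OF T3.lin1[OF lin_id F mM4]]) (assumption | rule lm x)+
 also have "... = smu M4 x (%a b c. F (\<theta> a) (\<theta> b) (\<theta> c))"
 by (rule T3.cong, (assumption | rule lm x)+, rule T3.tens[OF F]) (assumption | rule lm x trilin_closed[OF F])+
 finally show ?thesis .
qed
show ?thesis
proof -
 note U' = Cr_D[OF U]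
 have "Fr (Sr U) = sw M4 U (%a b. Fr (t2 (\<theta> b) a))" unfolding Sr_def
 by (rule sw_hom[OF FG_hom(1)]) (assumption | rule lm U')+
 also have "... = sw M4 U (%a b. smu M4 a (%u v w. t4 (\<theta> b) (\<theta> u) v w))"
 by (rule sw_cong[OF refl U'(1) mT mT mM4], rule FG_t2(1)) (assumption | rule lm hom_mem[OF FG_hom(1)])+
 also have "... = sw M4 U (%a b. smu M4 b (%u v w. t4 (\<theta> w) (\<theta> v) (\<theta> u) a))"
 by (rule FG_apply(1)[symmetric, where F = "%a b c d. t4 (\<theta> d) (\<theta> c) b a", OF mM4 U'(1) _ _ _ _ U'(2)]) (assumption | rule lm)+
 also have "... = sw M4 U (%a b. sw3 M4 (\<mu> (\<theta> b)) (%u v w. t4 w v u a))"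
 by (rule sw_cong[OF refl U'(1) mT mT mM4], rule mt[symmetric]) (assumption | rule lm)+
 also have "... = sw M4 U (%a b. Gr (t2 (\<theta> b) a))"
 by (rule sw_cong[OF refl U'(1) mT mT mM4], rule FG_t2(2)[symmetric]) (assumption | rule lm)+
 also have "... = Gr (Sr U)" unfolding Sr_def
 by (rule sw_hom[symmetric, OF FG_hom(2)]) (assumption | rule lm U')+
 finally show ?thesis using hom_mem[OF S_hom(1) U'(1)] by (simp add: Cr_def)
qed
qed

section \<open>Closure properties of \<open>Cr\<close> for a quantum torsor\<close>

context torsor
begin

lemma Cr_one: "t2 eT eT:Cr"
proof -
have "Fr (t2 eT eT) = t4 eT (\<theta> eT) eT eT"
 unfolding FG_t2[OF one_closed one_closed] \<mu>_one by (rule T3.tens) (assumption | rule lm)+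
moreover have "Gr (t2 eT eT) = t4 eT eT eT eT"
 unfolding FG_t2[OF one_closed one_closed] \<mu>_one by (rule T3.tens) (assumption | rule lm)+
moreover have "t2 eT eT:car M2" by (rule lm)+
ultimately show ?thesis using alg_homD(3)[OF \<theta>_alg] by (simp add: Cr_def)
qed

text \<open>\<open>Fr\<close> and \<open>Gr\<close> are multiplicative on \<open>P2\<close> with
  values in the algebra \<open>?E\<close>, so their equalizer is closed under products.\<close>

lemma Cr_mult:
assumes X: "X:Cr" "Y:Cr"
shows "X \<otimes>\<^bsub>P2\<^esub> Y:Cr"
proof -
let ?P3 = "tp R T P2"
let ?E = "tp R T' ?P3"
have P3: "k_algebra R ?P3" by (rule tensor_k_algebra[OF k_algebra_axioms P2_alg])
have E: "k_algebra R ?E" by (rule tensor_k_algebra[OF T'_alg P3])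
have s: "same_module ?E M4" by (rule same_tensor[OF same_opp same_P3])
note bm = alg_mult_hom[OF E s]
note lb = lm bm
have t: "tn T' ?P3 = tn T M3" "tn T P2 = tn T M2"
 by (rule same_tens[OF same_opp same_P3] same_tens[OF same_refl same_P2])+
have cP: "car ?P3 = car M3" using same_P3 by (simp add: same_module_def)
have tm: "t4 a b c d \<otimes>\<^bsub>?E\<^esub> t4 a' b' c' d' = t4 (a' ** a) (b ** b') (c' ** c) (d ** d')"
 if x: "a:cT" "b:cT" "c:cT" "d:cT" "a':cT" "b':cT" "c':cT" "d':cT"
 for a b c d a' b' c' d'
proof -
 have c2: "t2 c d:car P2" "t2 c' d':car P2" "t3 b c d:car ?P3" "t3 b' c' d':car ?P3"
 unfolding carrier_M2 cP by (rule lm x)+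
 show ?thesis
 using two_algebras.tens_mult[OF two_algebras.intro[OF T'_alg P3], of a "t3 b c d" a' "t3 b' c' d'"]
  two_algebras.tens_mult[OF two_algebras.intro[OF k_algebra_axioms P2_alg], of b "t2 c d" b' "t2 c' d'"] x c2
 by (simp add: t P2_mult)
qed
have F: "Fr (X \<otimes>\<^bsub>P2\<^esub> Y) = Fr X \<otimes>\<^bsub>?E\<^esub> Fr Y"
proof (rule mult_reduce[OF P2_alg same_P2 E s FG_hom(1) _ Cr_D(1)[OF X(1)] Cr_D(1)[OF X(2)]])
 fix a b c d assume x: "a:cT" "b:cT" "c:cT" "d:cT"
 note ll = lb x
 have "Fr (t2 a b \<otimes>\<^bsub>P2\<^esub> t2 c d) = sw3 M4 (\<mu> (b ** d)) (%u v w. t4 (c ** a) (\<theta> u) v w)"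
 unfolding P2_mult[OF x] by (rule FG_t2) (rule ll)+
 also have "... = smu M4 b (%u v w. smu M4 d (%u' v' w'. t4 (c ** a) (\<theta> (u ** u')) (v' ** v) (w ** w')))"
 by (rule \<mu>_mult') (assumption | rule ll)+
 also have "... = smu M4 b (%u v w. smu M4 d (%u' v' w'. t4 a (\<theta> u) v w \<otimes>\<^bsub>?E\<^esub> t4 c (\<theta> u') v' w'))"
 by (rule T3.cong, (assumption | rule ll)+, rule T3.cong, (assumption | rule ll)+, simp only: alg_homD(2)[OF \<theta>_alg] tm \<theta>_closed x) (assumption | rule ll)+
 also have "... = smu M4 b (%u v w. t4 a (\<theta> u) v w \<otimes>\<^bsub>?E\<^esub> smu M4 d (%u' v' w'. t4 c (\<theta> u') v' w'))"
 by (rule T3.cong[symmetric], (assumption | rule ll)+, rule T3.hom[OF bm(2)[OF _ lin_id]]) (assumption | rule ll)+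
 also have "... = smu M4 b (%u v w. t4 a (\<theta> u) v w) \<otimes>\<^bsub>?E\<^esub> smu M4 d (%u' v' w'. t4 c (\<theta> u') v' w')"
 by (rule T3.hom[OF bm(1)[OF _ lin_id], symmetric]) (assumption | rule ll)+
 finally show "Fr (t2 a b \<otimes>\<^bsub>P2\<^esub> t2 c d) = Fr (t2 a b) \<otimes>\<^bsub>?E\<^esub> Fr (t2 c d)"
 using x by (simp add: FG_t2)
qed
have G: "Gr (X \<otimes>\<^bsub>P2\<^esub> Y) = Gr X \<otimes>\<^bsub>?E\<^esub> Gr Y"
proof (rule mult_reduce[OF P2_alg same_P2 E s FG_hom(2) _ Cr_D(1)[OF X(1)] Cr_D(1)[OF X(2)]])
 fix a b c d assume x: "a:cT" "b:cT" "c:cT" "d:cT"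
 note ll = lb x
 have "Gr (t2 a b \<otimes>\<^bsub>P2\<^esub> t2 c d) = sw3 M4 (\<mu> (c ** a)) (%u v w. t4 w v u (b ** d))"
 unfolding P2_mult[OF x] by (rule FG_t2) (rule ll)+
 also have "... = smu M4 c (%u v w. smu M4 a (%u' v' w'. t4 (w ** w') (v' ** v) (u ** u') (b ** d)))"
 by (rule \<mu>_mult') (assumption | rule ll)+
 also have "... = smu M4 c (%u v w. smu M4 a (%u' v' w'. t4 w' v' u' b \<otimes>\<^bsub>?E\<^esub> t4 w v u d))"
 by (rule T3.cong, (assumption | rule ll)+, rule T3.cong, (assumption | rule ll)+, simp only: tm x) (assumption | rule ll)+
 also have "... = smu M4 c (%u v w. smu M4 a (%u' v' w'. t4 w' v' u' b) \<otimes>\<^bsub>?E\<^esub> t4 w v u d)"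
 by (rule T3.cong[symmetric], (assumption | rule ll)+, rule T3.hom[OF bm(1)[OF _ lin_id]]) (assumption | rule ll)+
 also have "... = smu M4 a (%u' v' w'. t4 w' v' u' b) \<otimes>\<^bsub>?E\<^esub> smu M4 c (%u v w. t4 w v u d)"
 by (rule T3.hom[OF bm(2)[OF _ lin_id], symmetric]) (assumption | rule ll)+
 finally show "Gr (t2 a b \<otimes>\<^bsub>P2\<^esub> t2 c d) = Gr (t2 a b) \<otimes>\<^bsub>?E\<^esub> Gr (t2 c d)"
 using x by (simp add: FG_t2)
qed
show ?thesis
 using F G Cr_D[OF X(1)] Cr_D[OF X(2)] alg_mult_hom(3)[OF P2_alg same_P2] by (simp add: Cr_def)
qed

text \<open>The twisted torsor axiom says that the last two legs of \<open>\<mu>(x)\<close> satisfy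
  the equation of \<open>Hr\<close>, with the first leg as a spectator. Flatness of \<open>T\<close>
  turns this into membership in the image of \<open>Cr \<otimes> T\<close>.\<close>

lemma \<nu>_in:
assumes x: "x:cT"
shows "smu MT x (%u v w. tn M2 T (t2 v w) u):tmp R M2 T id id ` car (tp R (sub M2 Cr) T)"
proof -
let ?Q = "tp R M4 T" and ?\<nu> = "smu MT x (%u v w. tn M2 T (t2 v w) u)"
have mQ: "module R ?Q" by (rule mod_tens[OF mM4 mT])
note ll = lm mQ x
\<comment> \<open>The spectator leg is moved to the end, since the flatness lemmas tensor with
  \<open>T\<close> on the right.\<close>
let ?f = "%z. sw ?Q z (%a m. tn M4 T m a)"
have bf: "bilin R T M4 ?Q (%a m. tn M4 T m a)" by (assumption | rule ll)+
have f: "?f:Hom R M5 ?Q" by (rule sw_mhom[OF bf mT mM4 mQ])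
have f5: "?f (smu M5 x (%a b c. sw3 M5 (\<mu> (m a b c)) (%d e f. tn T M4 (p a b c d e f) (q a b c d e f)))) =
 smu ?Q x (%a b c. sw3 ?Q (\<mu> (m a b c)) (%d e f. tn M4 T (q a b c d e f) (p a b c d e f)))"
 if m: "!!a b c. a:cT==>b:cT==>c:cT==>m a b c:cT"
 "!!a b c d e f. a:cT==>b:cT==>c:cT==>d:cT==>e:cT==>f:cT==>p a b c d e f:cT"
 "!!a b c d e f. a:cT==>b:cT==>c:cT==>d:cT==>e:cT==>f:cT==>q a b c d e f:car M4"
 for m p q
proof -
 have "?f (smu M5 x (%a b c. sw3 M5 (\<mu> (m a b c)) (%d e f. tn T M4 (p a b c d e f) (q a b c d e f)))) =
 smu ?Q x (%a b c. ?f (sw3 M5 (\<mu> (m a b c)) (%d e f. tn T M4 (p a b c d e f) (q a b c d e f))))"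
 by (rule T3.hom[OF f]) (assumption | rule m ll)+
 also have "... = smu ?Q x (%a b c. sw3 ?Q (\<mu> (m a b c)) (%d e f. ?f (tn T M4 (p a b c d e f) (q a b c d e f))))"
 by (rule T3.cong, (assumption | rule ll)+, rule T3.hom[OF f]) (assumption | rule m hom_mem[OF f] | rule ll)+
 also have "... = smu ?Q x (%a b c. sw3 ?Q (\<mu> (m a b c)) (%d e f. tn M4 T (q a b c d e f) (p a b c d e f)))"
 by (rule T3.cong, (assumption | rule ll)+, rule T3.cong, (assumption | rule m ll)+, rule sw_tens[OF bf _ _ mT mM4 mQ])
  (assumption | rule m hom_mem[OF f] | rule ll)+
 finally show ?thesis .
qed
have h: "tmp R M4 T \<phi> id ?\<nu> = smu ?Q x (%a b c. tn M4 T (\<phi> (t2 b c)) a)" if \<phi>: "\<phi>:Hom R M2 M4" for \<phi>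
proof -
 note t = tmap_hom[OF \<phi> id_hom mM2 mT mM4 mT]
 have "tmp R M4 T \<phi> id ?\<nu> = smu ?Q x (%a b c. tmp R M4 T \<phi> id (tn M2 T (t2 b c) a))"
 by (rule T3.hom[OF t]) (assumption | rule ll)+
 also have "... = smu ?Q x (%a b c. tn M4 T (\<phi> (t2 b c)) a)"
 by (rule T3.cong, (assumption | rule ll)+, simp add: tmap_tens[OF \<phi> id_hom mM2 mT mM4 mT] tens_in[OF _ _ mT mT])
  (assumption | rule ll hom_mem[OF t])+
 finally show ?thesis .
qed
have "tmp R M4 T Fr id ?\<nu> = smu ?Q x (%a b c. smu ?Q c (%d e f. tn M4 T (t4 b (\<theta> d) e f) a))" (is "?lh = _")
 unfolding h[OF FG_hom(1)]
 by (rule T3.cong, (assumption | rule ll)+, simp only: FG_t2, rule T3.hom[OF lin_tens1[OF lin_id]]) (assumption | rule ll hom_mem[OF FG_hom(1)])+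
also have "... = smu ?Q x (%d e f. smu ?Q d (%a b c. tn M4 T (t4 b (\<theta> c) e f) a))"
 by (rule coassoc[OF x mQ, where F = "%a b d e f. tens R M4 T (t4 b (\<theta> d) e f) a"]) (assumption | rule ll)+
also have "... = ?f (smu M5 x (%d e f. smu M5 d (%a b c. tn T M4 a (t4 b (\<theta> c) e f))))"
 by (rule f5[of "%d e f. d" "%d e f a b c. a" "%d e f a b c. t4 b (\<theta> c) e f", symmetric]) (assumption | rule ll)+
also have "... = ?f (smu M5 x (%a b c. smu M5 b (%d e f. tn T M4 a (t4 f e d c))))"
 unfolding \<mu>_\<theta>_op[OF x] ..
also have "... = smu ?Q x (%a b c. smu ?Q b (%d e f. tn M4 T (t4 f e d c) a))"
 by (rule f5[of "%a b c. b" "%a b c d e f. a" "%a b c d e f. t4 f e d c"]) (assumption | rule ll)+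
also have "... = tmp R M4 T Gr id ?\<nu>"
 unfolding h[OF FG_hom(2)]
 by (rule T3.cong[symmetric], (assumption | rule ll)+, simp only: FG_t2, rule T3.hom[OF lin_tens1[OF lin_id]]) (assumption | rule ll hom_mem[OF FG_hom(2)])+
finally have e: "?lh = ..." .
show ?thesis
 unfolding Cr_def by (rule flat_equalizer[OF faithfully_flat_imp_flat[OF ff] mM2 mM4 FG_hom(1,2) _ e]) (assumption | rule ll)+
qed

definition "\<theta>i = inv_into (cT) \<theta>"

lemma \<theta>i: "x:cT==>\<theta>i x:cT" "x:cT==>\<theta> (\<theta>i x) = x" "x:cT==>\<theta>i (\<theta> x) = x"
unfolding \<theta>i_def using \<theta>_bij inv_into_into[of x \<theta> "cT"] f_inv_into_f[of x \<theta> "cT"] inv_into_f_f[of \<theta> "cT" x]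
by (auto simp: bij_betw_def)

lemma \<theta>i_hom: "\<theta>i:Hom R T T"
proof (rule mod_homI)
show "\<theta>i (x \<oplus>\<^bsub>T\<^esub> y) = \<theta>i x \<oplus>\<^bsub>T\<^esub> \<theta>i y" if "x:cT" "y:cT" for x y
 using \<theta>i(3)[of "\<theta>i x \<oplus>\<^bsub>T\<^esub> \<theta>i y"] that by (simp add: \<theta>i mod_hom_add[OF \<theta>_hom])
show "\<theta>i (r *s x) = r *s \<theta>i x" if "r:car R" "x:cT" for r x
 using \<theta>i(3)[of "r *s \<theta>i x"] that by (simp add: \<theta>i hom_smult[OF \<theta>_hom])
qed (rule \<theta>i)

text \<open>The inverse of \<open>Sr\<close>, from which bijectivity of the antipode of
  \<open>Hr\<close> is read off.\<close>

definition "Si U = sw M2 U (%a b. t2 b (\<theta>i a))"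

lemmas li = lm hom_comp[OF \<theta>i_hom] \<theta>i(1)

lemma bilin_Si: "bilin R T T M2 (%a b. t2 b (\<theta>i a))" by (assumption | rule li)+

lemma Si_hom: "Si:Hom R M2 M2"
unfolding Si_def[abs_def] by (rule sw_mhom bilin_Si mT mM2)+

lemma Si_t2: "a:cT==>b:cT==>Si (t2 a b) = t2 b (\<theta>i a)"
unfolding Si_def by (rule sw_tens bilin_Si mT mM2 | assumption)+

lemma Sr_Si: "U:car M2==>Sr (Si U) = U" "U:car M2==>Si (Sr U) = U"
by (rule tens_heq[OF mT mT _ hom_comp[OF S_hom(1) Si_hom] lin_id]
 tens_heq[OF mT mT _ hom_comp[OF Si_hom S_hom(1)] lin_id], assumption, simp add: S_t2 Si_t2 \<theta>i \<theta>_closed)+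

text \<open>The inverse of \<open>\<theta>\<close> commutes with \<open>\<mu>\<close> as
  \<open>\<theta>\<close> does, so the leg-reversing argument for \<open>Sr\<close> runs with it as
  well.\<close>

lemma Si_in:
assumes U: "U:Cr"
shows "Si U:Cr"
proof -
have mt: "sw3 M4 (\<mu> (\<theta>i x)) F = smu M4 x (%a b c. F (\<theta>i a) (\<theta>i b) (\<theta>i c))" if x: "x:cT" and F: "trilin R T T T M4 F" for x F
proof -
 have F': "trilin R T T T M4 (%a b c. F (\<theta>i a) (\<theta>i b) (\<theta>i c))"
 using F by (auto simp: trilin_def \<theta>i intro!: hom_comp[OF _ \<theta>i_hom, of "%a. F a y z" for y z]
  hom_comp[OF _ \<theta>i_hom, of "%b. F y b z" for y z] hom_comp[OF _ \<theta>i_hom, of "%c. F y z c" for y z])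
 have x': "\<theta>i x:cT" by (rule \<theta>i x)+
 have "sw3 M4 (\<mu> (\<theta> (\<theta>i x))) (%a b c. F (\<theta>i a) (\<theta>i b) (\<theta>i c)) = sw3 M4 (\<mu> (\<theta>i x)) (%a b c. sw3 M4 (t3 (\<theta> a) (\<theta> b) (\<theta> c)) (%a b c. F (\<theta>i a) (\<theta>i b) (\<theta>i c)))"
 unfolding \<mu>_\<theta>[OF x'] by (rule T3.hom[OF T3.lin1[OF lin_id F' mM4]]) (assumption | rule lm x')+
 also have "... = sw3 M4 (\<mu> (\<theta>i x)) (%a b c. F (\<theta>i (\<theta> a)) (\<theta>i (\<theta> b)) (\<theta>i (\<theta> c)))"
 by (rule T3.cong, (assumption | rule lm x')+, rule T3.tens[OF F']) (assumption | rule lm x' trilin_closed[OF F'])+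
 also have "... = sw3 M4 (\<mu> (\<theta>i x)) F"
 by (rule T3.cong, (assumption | rule lm x')+, simp add: \<theta>i) (assumption | rule lm trilin_closed[OF F'])+
 finally show ?thesis using x by (simp add: \<theta>i)
qed
note U' = Cr_D[OF U]
have "Fr (Si U) = sw M4 U (%a b. Fr (t2 b (\<theta>i a)))" unfolding Si_def
 by (rule sw_hom[OF FG_hom(1)]) (assumption | rule li U')+
also have "... = sw M4 U (%a b. sw3 M4 (\<mu> (\<theta>i a)) (%u v w. t4 b (\<theta> u) v w))"
 by (rule sw_cong[OF refl U'(1) mT mT mM4], rule FG_t2(1)) (assumption | rule li hom_mem[OF FG_hom(1)])+
also have "... = sw M4 U (%a b. smu M4 a (%u v w. t4 b (\<theta> (\<theta>i u)) (\<theta>i v) (\<theta>i w)))"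
 by (rule sw_cong[OF refl U'(1) mT mT mM4], rule mt) (assumption | rule li)+
also have "... = sw M4 U (%a b. smu M4 a (%u v w. t4 b u (\<theta>i v) (\<theta>i w)))"
 by (rule four_cong[OF mM4 U'(1)], rule \<mu>_closed, assumption, simp add: \<theta>i) (assumption | rule li)+
also have "... = sw M4 U (%a b. smu M4 b (%u v w. t4 w v (\<theta>i (\<theta> u)) (\<theta>i a)))"
 by (rule FG_apply(1)[symmetric, where F = "%a b c d. t4 d c (\<theta>i b) (\<theta>i a)", OF mM4 U'(1) _ _ _ _ U'(2)]) (assumption | rule li)+
also have "... = sw M4 U (%a b. smu M4 b (%u v w. t4 w v u (\<theta>i a)))"
 by (rule four_cong[OF mM4 U'(1)], rule \<mu>_closed, assumption, simp add: \<theta>i) (assumption | rule li)+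
also have "... = sw M4 U (%a b. Gr (t2 b (\<theta>i a)))"
 by (rule sw_cong[OF refl U'(1) mT mT mM4], rule FG_t2(2)[symmetric]) (assumption | rule li)+
also have "... = Gr (Si U)" unfolding Si_def
 by (rule sw_hom[symmetric, OF FG_hom(2)]) (assumption | rule li U')+
finally show ?thesis using hom_mem[OF Si_hom U'(1)] by (simp add: Cr_def)
qed

lemma \<mu>_alg: "\<mu>:alg_hom R T (tp R T P2)"
proof (rule alg_homI)
show "\<mu>:Hom R T (tp R T P2)" using \<mu>_hom unfolding same_mhom[OF same_refl[of T] same_P3, of R] .
show "\<mu> (x ** y) = \<mu> x \<otimes>\<^bsub>tp R T P2\<^esub> \<mu> y" if "x:cT" "y:cT" for x y
 unfolding M3_mult[OF k_algebra_axioms \<mu>_closed[OF that(1)] \<mu>_closed[OF that(2)]] by (rule \<mu>_mult[OF that])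
show "\<mu> eT = \<one>\<^bsub>tp R T P2\<^esub>"
 unfolding \<mu>_one tsimps(4) by (simp add: tens_opp same_tens[OF same_refl same_P2])
qed

end

section \<open>The Galois object of a torsor\<close>

locale torsor_hopf = torsor R T \<mu> \<theta> + right_sub R T \<mu> "pretorsor_theta.Cr R T \<mu> \<theta>" \<rho> "%a u. \<theta> u \<otimes>\<^bsub>T\<^esub> a"
for R :: "('k, 'r) ring_scheme" and T :: "('k, 't) module" and \<mu> \<theta> \<rho> +
fixes D'
assumes Hr: "Hr R T \<mu> \<theta> = make_bialg (sub (tp R (opp T) T) Cr) (induced_comult R (tp R (opp T) T) Cr D') (induced_counit R T)"
 and sub_bialg: "sub_bialgebra R T (tp R (opp T) T) Cr Dr (nabla T) (induced_comult R (tp R (opp T) T) Cr D') (induced_counit R T)"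
 and Hr_bialgebra: "bialgebra R (Hr R T \<mu> \<theta>)" and Hr_antipode: "is_antipode R (Hr R T \<mu> \<theta>) Sr"
begin

abbreviation "K == Hr R T \<mu> \<theta>"
abbreviation "\<rho>2 == Hr_coaction R T \<mu> \<theta>"
abbreviation "TC == tp R T CM"
abbreviation "J == tmp R T M2 id id"

sublocale B: sub_bialgebra R T P2 Cr Dr "nabla T" "induced_comult R P2 Cr D'" "induced_counit R T" by (rule sub_bialg)

lemma same_K: "same_module K CM" and same_alg_K: "same_algebra K (sub P2 Cr)"
and carrier_K: "car K = Cr" and one_K: "\<one>\<^bsub>K\<^esub> = t2 eT eT"
using same_P2 unfolding Hr by (simp_all add: same_module_def same_algebra_def P2_one)

lemma same_TK: "same_module (tp R T K) TC" by (rule same_tensor[OF same_refl same_K])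
lemma tens_TK: "tn T K = tn T CM" by (rule same_tens[OF same_refl same_K])
lemma carrier_TK: "car (tp R T K) = car TC" using same_TK by (simp add: same_module_def)

lemma mTC: "module R TC" by (rule mod_tens[OF mT mC])
lemma J_hom: "J:Hom R TC M3" by (rule tmap_hom[OF id_hom inclC mT mC mT mM2])
lemma J_tens: "t:cT==>c:Cr==>J (tn T CM t c) = tn T M2 t c"
using tmap_tens[OF id_hom inclC mT mC mT mM2, of t c] by simp

lemma split_J: "split_after TC M3 J"
by (rule split_tensor[OF mT mT mC mM2 split_id[OF mT] split])

lemma J_inj: "x:car TC==>y:car TC==>J x = J y==>x = y"
by (rule split_inj[OF mTC split_J])

text \<open>\<open>\<rho>\<close> carries its \<open>T\<close> leg last for the sake of descent.
  This is the same coaction with the order used in \<open>Hr_coaction\<close>.\<close>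

definition "\<rho>f x = sw TC (\<rho> x) (%c t. tn T CM t c)"

lemmas lc = li mC mTC mCT hom_comp[OF \<rho>_hom] \<rho>_closed

lemma \<rho>f_hom: "\<rho>f:Hom R T TC"
unfolding \<rho>f_def[abs_def] by (assumption | rule lc)+

lemma J_\<rho>f:
assumes x: "x:cT"
shows "J (\<rho>f x) = \<mu> x"
proof -
have b: "bilin R M2 T M3 (%c t. tn T M2 t c)" by (assumption | rule lc)+
have "J (\<rho>f x) = sw M3 (\<rho> x) (%c t. J (tn T CM t c))"
 unfolding \<rho>f_def by (rule sw_hom[OF J_hom \<rho>_closed[OF x] _ mC mT mTC T3.mABC]) (assumption | rule lc)+
also have "... = sw M3 (\<rho> x) (%c t. tn T M2 t c)"
 by (rule sw_cong[OF refl \<rho>_closed[OF x] mC mT T3.mABC])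
 (simp add: J_tens, rule hom_mem[OF J_hom], (assumption | rule lc)+)
also have "... = \<mu> x"
 unfolding sw_\<rho>[OF x b T3.mABC, symmetric] sw_\<nu>[OF x b T3.mABC] by (rule T3.self[OF \<mu>_closed[OF x]])
finally show ?thesis .
qed

lemma J_P2: "tmp R T P2 id id = J"
by (rule same_tmap[OF same_refl same_P2])

lemma \<rho>2_eq:
assumes x: "x:cT"
shows "\<rho>2 x = \<rho>f x"
unfolding Hr_coaction_def J_P2 carrier_TK
proof (rule the_equality)
show "\<rho>f x:car TC & J (\<rho>f x) = \<mu> x" using J_\<rho>f[OF x] hom_mem[OF \<rho>f_hom x] by simp
show "\<zeta> = \<rho>f x" if "\<zeta>:car TC & J \<zeta> = \<mu> x" for \<zeta>
 by (rule J_inj) (use that J_\<rho>f[OF x] hom_mem[OF \<rho>f_hom x] in simp_all)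
qed

lemma \<rho>2_hom: "\<rho>2:Hom R T TC"
by (rule mod_hom_cong[THEN iffD2, OF \<rho>2_eq mT \<rho>f_hom])

lemmas \<rho>2_closed = hom_mem[OF \<rho>2_hom]
lemma J_\<rho>2: "x:cT==>J (\<rho>2 x) = \<mu> x" by (simp add: \<rho>2_eq J_\<rho>f)

text \<open>Translates sums over the coaction into sums over \<open>\<mu>\<close>; the Galois axioms
  below become torsor identities through it.\<close>

lemma sw_\<rho>2:
assumes "x:cT" "bilin R T M2 P F" "module R P"
shows "sw P (\<rho>2 x) F = smu P x (%u v w. F u (t2 v w))"
proof -
have f: "(%W. sw P W F):Hom R M3 P" by (rule sw_mhom[OF assms(2) mT mM2 assms(3)])
have "sw P (J (\<rho>2 x)) F = sw P (\<rho>2 x) F"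
 by (rule tensor_eval[OF hom_comp[OF f J_hom] mT mC assms(3) \<rho>2_closed[OF assms(1)]])
 (simp add: J_tens sw_tens[OF assms(2) _ _ mT mM2 assms(3)] CD)
moreover have "sw P (\<mu> x) F = smu P x (%u v w. F u (t2 v w))"
 by (rule T3.eval[OF f assms(3) \<mu>_closed[OF assms(1)]], rule sw_tens[OF assms(2)]) (assumption | rule lc assms)+
ultimately show ?thesis by (simp add: J_\<rho>2[OF assms(1)])
qed

lemmas lr = lc hom_comp[OF \<rho>2_hom] \<rho>2_closed

text \<open>All identities are tested after the injective maps \<open>J\<close> and
  \<open>?J2\<close>. Multiplicativity becomes that of \<open>\<mu>\<close>, coassociativity becomes
  torsor coassociativity, and the counit law becomes \<open>\<mu>_right\<close>.\<close>

lemma comodule_algebra: "right_comodule_algebra R K T \<rho>2"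
unfolding right_comodule_algebra_def
proof (intro conjI ballI)
show "k_algebra R T" by (rule k_algebra_axioms)
have E: "tp R T K = tp R T (sub P2 Cr)"
 by (rule same_algebra_tensor[OF same_algebra_refl same_alg_K])
have I: "J:alg_hom R (tp R T K) (tp R T P2)"
 unfolding E J_P2[symmetric]
 by (rule tensor_map_alg_hom[OF k_algebra_axioms B.B_alg k_algebra_axioms P2_alg alg_homI[OF id_hom] alg_homI[OF B.incl]]) simp_all
interpret E: k_algebra R "tp R T K" unfolding E by (rule tensor_k_algebra[OF k_algebra_axioms B.B_alg])
have c: "\<rho>2 x:car (tp R T K)" if "x:cT" for x using \<rho>2_closed[OF that] by (simp add: carrier_TK)
show "\<rho>2:alg_hom R T (tp R T K)"
proof (rule alg_homI)
 show "\<rho>2:Hom R T (tp R T K)" using \<rho>2_hom unfolding same_mhom[OF same_refl[of T] same_TK, of R] .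
 show "\<rho>2 (x ** y) = \<rho>2 x \<otimes>\<^bsub>tp R T K\<^esub> \<rho>2 y" if "x:cT" "y:cT" for x y
 by (rule J_inj) (use that c E.m_closed in \<open>simp_all add: carrier_TK[symmetric] alg_homD(2)[OF I] J_\<rho>2 alg_homD(2)[OF \<mu>_alg]\<close>)
 show "\<rho>2 eT = \<one>\<^bsub>tp R T K\<^esub>"
 by (rule J_inj) (use c E.one_closed in \<open>simp_all add: carrier_TK[symmetric] alg_homD(3)[OF I] J_\<rho>2 alg_homD(3)[OF \<mu>_alg]\<close>)
qed
fix t assume t: "t:cT"
let ?CC = "tp R CM CM" and ?X = "tp R T MM"
let ?I2 = "tmp R M2 M2 id id"
let ?J2 = "tmp R T MM id ?I2"
have mCC: "module R ?CC" by (rule mod_tens[OF mC mC])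
have mX: "module R ?X" by (rule mod_tens[OF mT mMM])
have I2: "?I2:Hom R ?CC MM" by (rule tmap_hom[OF inclC inclC mC mC mM2 mM2])
have J2: "?J2:Hom R (tp R T ?CC) ?X" by (rule tmap_hom[OF id_hom I2 mT mCC mT mMM])
have J2i: "x = y" if "x:car (tp R T ?CC)" "y:car (tp R T ?CC)" "?J2 x = ?J2 y" for x y
 by (rule split_inj[OF mod_tens[OF mT mCC] split_tensor[OF mT mT mCC mMM split_id[OF mT] split_tensor[OF mC mM2 mC mM2 split split]] that])
let ?\<D> = "comult K"
have sB: "same_module (sub P2 Cr) CM" using same_P2 by (simp add: same_module_def)
have \<D>: "?\<D>:Hom R CM ?CC" "!!c. c:Cr==>?I2 (?\<D> c) = Dr c"
 using B.\<D>_hom B.\<D>_incl unfolding Hr make_bialg_simps same_mhom[OF sB same_tensor[OF sB sB]] same_tmap[OF same_P2 same_P2] .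
note ll = lr mX mCC
let ?l = "tmp R TC CM \<rho>2 id"
have l: "?l:Hom R TC (tp R TC CM)" by (rule tmap_hom[OF \<rho>2_hom id_hom mT mC mTC mC])
note ta = tassoc_hom(1)[OF mT mC mC]
have "?J2 (tassoc R T CM CM (?l (\<rho>2 t))) = sw ?X (\<rho>2 t) (%s c. smu ?X s (%u v w. tn T MM u (tn M2 M2 (t2 v w) c)))" (is "?lh = _")
proof (rule tensor_eval[where f = "%z. ?J2 (tassoc R T CM CM (?l z))", OF hom_comp[OF J2 hom_comp[OF ta l]] mT mC mX \<rho>2_closed[OF t]])
 fix s c assume s: "s:cT" and c: "c:car CM"
 have cC: "c:Cr" and cM: "c:car M2" using c CD by simp_all
 have b: "bilin R T M2 ?X (%u d. tn T MM u (tn M2 M2 d c))" by (assumption | rule ll cM)+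
 have "?J2 (tassoc R T CM CM (?l (tn T CM s c))) = ?J2 (tassoc R T CM CM (tn TC CM (\<rho>2 s) c))" (is "?lh = _")
 using tmap_tens[OF \<rho>2_hom id_hom mT mC mTC mC s c] by simp
 also have "... = sw ?X (\<rho>2 s) (%u d. tn T MM u (tn M2 M2 d c))"
 proof (rule tensor_eval[where f = "%z. ?J2 (tassoc R T CM CM (tens R TC CM z c))",
  OF hom_comp[OF J2 hom_comp[OF ta lin_tens1[OF lin_id c mTC mC]]] mT mC mX \<rho>2_closed[OF s]])
 fix u d assume u: "u:cT" and d: "d:car CM"
 have dc: "tn CM CM d c:car ?CC" by (rule tens_in c d mC)+
 show "?J2 (tassoc R T CM CM (tn TC CM (tn T CM u d) c)) = tn T MM u (tn M2 M2 d c)"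
  using tmap_tens[OF id_hom I2 mT mCC mT mMM u dc] tmap_tens[OF inclC inclC mC mC mM2 mM2 d c]
  by (simp add: tassoc_tens[OF mT mC mC u d c])
 qed
 also have "... = smu ?X s (%u v w. tn T MM u (tn M2 M2 (t2 v w) c))" by (rule sw_\<rho>2[OF s b mX])
 finally show "?lh = ..." .
qed
also have "... = smu ?X t (%d e f. smu ?X d (%a b c. tn T MM a (tt b c e f)))"
 by (rule sw_\<rho>2[OF t _ mX]) (assumption | rule ll)+
also have "... = smu ?X t (%a b c. smu ?X c (%d e f. tn T MM a (tt b d e f)))"
 by (rule coassoc[OF t mX, where F = "%a b d e f. tens R T MM a (tt b d e f)", symmetric]) (assumption | rule ll)+
also have "... = smu ?X t (%a b c. tn T MM a (Dr (t2 b c)))"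
proof (rule T3.cong[OF \<mu>_closed[OF t] mX])
 fix a b c assume y: "a:cT" "b:cT" "c:cT"
 show "smu ?X c (%d e f. tn T MM a (tt b d e f)) = tn T MM a (Dr (t2 b c))"
 unfolding Dr_t2[OF y(2,3)] by (rule T3.hom[symmetric, OF lin_tens2[OF lin_id]]) (assumption | rule ll y)+
qed (assumption | rule ll)+
also have "... = sw ?X (\<rho>2 t) (%u c. tn T MM u (Dr c))"
 by (rule sw_\<rho>2[OF t _ mX, symmetric]) (assumption | rule ll)+
also have "... = ?J2 (tmp R T ?CC id ?\<D> (\<rho>2 t))"
proof (rule tensor_eval[where f = "%z. ?J2 (tmp R T ?CC id ?\<D> z)", symmetric,
  OF hom_comp[OF J2 tmap_hom[OF id_hom \<D>(1) mT mC mT mCC]] mT mC mX \<rho>2_closed[OF t]])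
 fix u c assume u: "u:cT" and c: "c:car CM"
 show "?J2 (tmp R T ?CC id ?\<D> (tn T CM u c)) = tn T MM u (Dr c)"
 using tmap_tens[OF id_hom \<D>(1) mT mC mT mCC u c] tmap_tens[OF id_hom I2 mT mCC mT mMM u hom_mem[OF \<D>(1) c]] \<D>(2) c
 by simp
qed
finally have e: "?lh = ..." .
have "tassoc R T CM CM (?l (\<rho>2 t)) = tmp R T ?CC id ?\<D> (\<rho>2 t)"
 by (rule J2i[OF hom_mem[OF hom_comp[OF ta l]] hom_mem[OF tmap_hom[OF id_hom \<D>(1) mT mC mT mCC]] e]; rule \<rho>2_closed[OF t])
then show "tassoc R T K K (tmp R (tp R T K) K \<rho>2 id (\<rho>2 t)) = tmp R T (tp R K K) id (comult K) (\<rho>2 t)"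
 unfolding same_tassoc(1)[OF same_refl same_K same_K] same_tmap[OF same_TK same_K] same_tmap[OF same_refl same_tensor[OF same_K same_K]] .
have b: "bilin R T M2 T (%x c. x ** nabla T c)" by (assumption | rule ll)+
have b': "bilin R T CM T (%x c. x ** nabla T c)" by (assumption | rule ll hom_comp[OF sub_hom(2)[OF nab(1) Cs]] hom_mem[OF sub_hom(2)[OF nab(1) Cs]])+
have "tensor_lift T (%x h. counit K h *s x) (\<rho>2 t) = sw T (\<rho>2 t) (%x c. x ** nabla T c)"
 by (rule tensor_lift_sw'[OF mT mC mT \<rho>2_closed[OF t] b']) (simp add: Hr B.N_\<e> B.\<e>_closed smult_assoc_r)
also have "... = smu T t (%u v w. u ** nabla T (t2 v w))" by (rule sw_\<rho>2[OF t b mT])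
also have "... = smu T t (%u v w. u ** (v ** w))"
 by (rule T3.cong[OF \<mu>_closed[OF t] mT], simp add: nab(2)) (assumption | rule ll)+
also have "... = t ** eT"
 by (rule right[OF t bilin_mult mT])
finally show "tensor_lift T (%x h. counit K h *s x) (\<rho>2 t) = t" using t by simp
qed

text \<open>For a coinvariant \<open>t\<close> one has
  \<open>\<mu>(t) = t \<otimes> 1 \<otimes> 1\<close>. Then \<open>\<mu>_left\<close> reads
  \<open>t \<otimes> 1 = 1 \<otimes> t\<close>, which forces \<open>t\<close> to be a
  scalar.\<close>

lemma coinvariants_eq: "bij_betw (%r. r *s eT) (car R) (coinvariants R K T \<rho>2)"
unfolding bij_betw_def
proof (intro conjI inj_onI equalityI subsetI)
show "r = s" if "r:car R" "s:car R" "r *s eT = s *s eT" for r s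
 by (rule unit_inj[OF that])
note ll = lr
have 1: "\<one>\<^bsub>K\<^esub>:car CM" by (simp add: one_K C_one)
show "t:coinvariants R K T \<rho>2" if "t:(%r. r *s eT) ` car R" for t
proof -
 obtain r where r: "r:car R" "t = r *s eT" using \<open>t:_\<close> by (elim imageE)
 have t: "t:cT" using r by simp
 have "\<mu> t = tn T M2 t (t2 eT eT)"
 using hom_smult[OF \<mu>_hom r(1) one_closed] hom_smult[OF lin_tens1[OF lin_id _ mT mM2] r(1) one_closed, of "t2 eT eT"]
  CD[OF C_one] by (simp add: r(2) \<mu>_one)
 then have "J (\<rho>2 t) = J (tn T CM t \<one>\<^bsub>K\<^esub>)" using J_tens[OF t C_one] by (simp add: J_\<rho>2[OF t] one_K)
 then have "\<rho>2 t = tn T K t \<one>\<^bsub>K\<^esub>" unfolding tens_TK by (rule J_inj[OF \<rho>2_closed[OF t] tens_in[OF t 1 mT mC]])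
 then show ?thesis using t by (simp add: coinvariants_def)
qed
show "t:(%r. r *s eT) ` car R" if t: "t:coinvariants R K T \<rho>2" for t
proof -
 have x: "t:cT" "\<rho>2 t = tn T CM t (t2 eT eT)" using t by (simp_all add: coinvariants_def tens_TK one_K)
 have \<mu>: "\<mu> t = t3 t eT eT" using J_\<rho>2[OF x(1)] J_tens[OF x(1) C_one] by (simp add: x(2))
 have "smu M2 t (%a b c. t2 (a ** b) c) = t2 (t ** eT) eT"
 unfolding \<mu> by (rule T3.tens) (assumption | rule ll x)+
 then have "t2 t eT = t2 eT t" using \<mu>_left[OF x(1)] x(1) by simp
 then show ?thesis using unit_of_tens_eq(2)[OF x(1) x(1)] by auto
qed
qed

abbreviation "\<beta> == galois_map R K T \<rho>2"

lemma \<beta>_eq: "\<beta> = tensor_lift TC (%x y. tensor_lift TC (%y0 y1. tn T CM (x ** y0) y1) (\<rho>2 y))"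
unfolding galois_map_def same_tensor_lift[OF same_TK] tens_TK ..

lemma bilin_\<beta>: "bilin R T T TC (%x y. sw TC (\<rho>2 y) (%y0 y1. tn T CM (x ** y0) y1))"
by (assumption | rule lr)+

lemma \<beta>_sw: "U:car M2==>\<beta> U = sw TC U (%x y. sw TC (\<rho>2 y) (%y0 y1. tn T CM (x ** y0) y1))"
unfolding \<beta>_eq
proof (rule tensor_lift_sw'[OF mT mT mTC _ bilin_\<beta>], assumption)
fix x y assume x: "x:cT" and y: "y:cT"
show "tensor_lift TC (%y0 y1. tn T CM (x ** y0) y1) (\<rho>2 y) = sw TC (\<rho>2 y) (%y0 y1. tn T CM (x ** y0) y1)"
 by (rule tlift_sw[OF mT mC mTC \<rho>2_closed[OF y]]) (assumption | rule lr x)+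
qed

lemma \<beta>_hom: "\<beta>:Hom R M2 TC"
by (rule mod_hom_cong[THEN iffD2, OF \<beta>_sw mM2 sw_mhom[OF bilin_\<beta> mT mT mTC]])

lemma \<beta>_t2: "x:cT==>y:cT==>\<beta> (t2 x y) = sw TC (\<rho>2 y) (%y0 y1. tn T CM (x ** y0) y1)"
using \<beta>_sw[of "t2 x y"] sw_tens[OF bilin_\<beta> _ _ mT mT mTC] tens_in[OF _ _ mT mT] by simp

definition "\<beta>' \<zeta> = sw M2 \<zeta> (%t c. sw M2 c (%a b. t2 (t ** a) b))"

lemma bilin_\<beta>': "bilin R T M2 M2 (%t c. sw M2 c (%a b. t2 (t ** a) b))"
by (assumption | rule lr)+

lemma \<beta>'_tens:
assumes "t:cT" "c:Cr"
shows "\<beta>' (tn T CM t c) = sw M2 c (%a b. t2 (t ** a) b)"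
proof -
have b: "bilin R T CM M2 (%t c. sw M2 c (%a b. t2 (t ** a) b))"
 using bilin_\<beta>' CD by (auto simp: bilin_def mod_hom_def)
show ?thesis unfolding \<beta>'_def by (rule sw_tens[OF b assms(1) _ mT mC mM2]) (simp add: assms)
qed

lemma \<beta>'_hom: "\<beta>':Hom R TC M2"
proof -
have b: "bilin R T CM M2 (%t c. sw M2 c (%a b. t2 (t ** a) b))"
 using bilin_\<beta>' CD by (auto simp: bilin_def mod_hom_def)
show ?thesis unfolding \<beta>'_def[abs_def] by (rule sw_mhom[OF b mT mC mM2])
qed

text \<open>Writing the coaction through \<open>\<mu>\<close> produces \<open>x ** (u ** v)\<close>
  in the first leg, and \<open>\<mu>_left\<close> removes the inner product.\<close>

lemma \<beta>'_\<beta>: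
assumes "U:car M2"
shows "\<beta>' (\<beta> U) = U"
proof (rule tens_heq[OF mT mT assms hom_comp[OF \<beta>'_hom \<beta>_hom] lin_id])
fix x y assume x: "x:cT" and y: "y:cT"
note ll = lr x y
have "\<beta>' (\<beta> (t2 x y)) = sw M2 (\<rho>2 y) (%y0 c. \<beta>' (tn T CM (x ** y0) c))"
 unfolding \<beta>_t2[OF x y] by (rule sw_hom[OF \<beta>'_hom \<rho>2_closed[OF y] _ mT mC mTC mM2]) (assumption | rule ll)+
also have "... = sw M2 (\<rho>2 y) (%y0 c. sw M2 c (%a b. t2 (x ** y0 ** a) b))"
 by (rule sw_cong[OF refl \<rho>2_closed[OF y] mT mC mM2])
 (simp add: \<beta>'_tens x, rule hom_mem[OF \<beta>'_hom], (assumption | rule ll)+)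
also have "... = smu M2 y (%u v w. sw M2 (t2 v w) (%a b. t2 (x ** u ** a) b))"
 by (rule sw_\<rho>2[OF y _ mM2]) (assumption | rule ll)+
also have "... = smu M2 y (%u v w. t2 (x ** u ** v) w)"
 by (rule T3.cong, (assumption | rule ll)+, rule sw_tens) (assumption | rule ll)+
also have "... = smu M2 y (%u v w. t2 (x ** (u ** v)) w)"
 by (rule T3.cong, (assumption | rule ll)+, simp add: m_assoc x) (assumption | rule ll)+
also have "... = t2 (x ** eT) y"
 by (rule left[where G = "%p q. t2 (x ** p) q", OF y _ mM2]) (assumption | rule ll)+
finally show "\<beta>' (\<beta> (t2 x y)) = t2 x y" using x by simp
qed

text \<open>For \<open>t = 1\<close> this is \<open>sw_\<nu>_mult\<close>. The map \<open>?h\<close>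
  restores the order of the legs and multiplies by a general \<open>t\<close>.\<close>

lemma \<beta>_\<beta>':
assumes "\<zeta>:car TC"
shows "\<beta> (\<beta>' \<zeta>) = \<zeta>"
proof (rule tens_heq[OF mT mC assms hom_comp[OF \<beta>_hom \<beta>'_hom] lin_id])
fix t c assume t: "t:cT" and "c:car CM"
then have c: "c:Cr" "c:car M2" "c:car CM" using CD by simp_all
note ll = lr t c
let ?h = "%z. sw TC z (%d x. tn T CM (t ** x) d)"
have bh: "bilin R CM T TC (%d x. tn T CM (t ** x) d)" by (assumption | rule ll)+
have h: "?h:Hom R CT TC" by (rule sw_mhom[OF bh mC mT mTC])
have bf: "bilin R T CM TC (%y0 y1. tn T CM (t ** a ** y0) y1)" if "a:cT" for a
 by (assumption | rule ll that)+
have "\<beta> (\<beta>' (tn T CM t c)) = sw TC c (%a b. \<beta> (t2 (t ** a) b))"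
 unfolding \<beta>'_tens[OF t c(1)] by (rule sw_hom[OF \<beta>_hom c(2) _ mT mT mM2 mTC]) (assumption | rule ll)+
also have "... = sw TC c (%a b. sw TC (\<rho> b) (%d x. tn T CM (t ** (a ** x)) d))"
proof (rule sw_cong[OF refl c(2) mT mT mTC])
 fix a b assume a: "a:cT" and b: "b:cT"
 have "\<beta> (t2 (t ** a) b) = sw TC (\<rho>f b) (%y0 y1. tn T CM (t ** a ** y0) y1)" (is "?lh = _")
 using \<beta>_t2 t a b by (simp add: \<rho>2_eq)
 also have "... = sw TC (\<rho> b) (%d x. sw TC (tn T CM x d) (%y0 y1. tn T CM (t ** a ** y0) y1))"
 unfolding \<rho>f_def by (rule sw_hom[OF sw_mhom[OF bf[OF a] mT mC mTC] \<rho>_closed[OF b] _ mC mT mTC mTC]) (assumption | rule ll)+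
 also have "... = sw TC (\<rho> b) (%d x. tn T CM (t ** (a ** x)) d)"
 by (rule sw_cong[OF refl \<rho>_closed[OF b] mC mT mTC], simp add: sw_tens[OF bf[OF a] _ _ mT mC mTC] m_assoc t a)
  (assumption | rule ll a)+
 finally show "?lh = ..." .
qed (rule hom_mem[OF \<beta>_hom], (assumption | rule ll)+)
also have "... = sw TC c (%a b. sw TC (\<rho> b) (%d x. ?h (tn CM T d (a ** x))))"
 by (rule sw_cong[OF refl c(2) mT mT mTC], rule sw_cong[OF refl _ mC mT mTC], (assumption | rule ll)+, rule sw_tens[OF bh, symmetric])
 (assumption | rule ll)+
also have "... = sw TC c (%a b. ?h (sw CT (\<rho> b) (%d x. tn CM T d (a ** x))))"
 by (rule sw_cong[OF refl c(2) mT mT mTC], rule sw_hom[OF h _ _ mC mT mCT mTC, symmetric])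
 (assumption | rule ll)+
also have "... = ?h (sw CT c (%a b. sw CT (\<rho> b) (%d x. tn CM T d (a ** x))))"
 by (rule sw_hom[OF h c(2) _ mT mT mCT mTC, symmetric]) (assumption | rule ll)+
also have "... = tn T CM (t ** eT) c"
 unfolding sw_\<nu>_mult[OF c(1)] by (rule sw_tens[OF bh]) (assumption | rule ll)+
finally show "\<beta> (\<beta>' (tn T CM t c)) = tn T CM t c" using t by simp
qed

lemma \<beta>_bij: "bij_betw \<beta> (car M2) (car TC)"
by (rule bij_betw_byWitness[where f' = \<beta>'])
 (use \<beta>'_\<beta> \<beta>_\<beta>' hom_mem[OF \<beta>_hom] hom_mem[OF \<beta>'_hom] in auto)

lemma galois: "right_galois_object R K T \<rho>2"
unfolding right_galois_object_def carrier_TK using comodule_algebra coinvariants_eq \<beta>_bij by simp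

lemma gamma_eq:
assumes c: "c:Cr"
shows "galois_gamma R K T \<rho>2 c = c"
unfolding galois_gamma_def tens_TK
proof (rule inv_into_f_eq)
show "inj_on \<beta> (car M2)" using \<beta>_bij by (simp add: bij_betw_def)
show "c:car M2" by (rule CD[OF c])
have 1: "tn T CM eT c:car TC" by (rule tens_in[OF one_closed _ mT mC]) (simp add: c)
have "\<beta>' (tn T CM eT c) = c"
 unfolding \<beta>'_tens[OF one_closed c]
 using sw_cong[OF refl CD[OF c] mT mT mM2, of "%a b. t2 (eT ** a) b" t2] sw_self[OF CD[OF c] mT mT] tens_in[OF _ _ mT mT] by simp
then show "\<beta> c = tn T CM eT c" using \<beta>_\<beta>'[OF 1] by simp
qed

lemma assoc_mu_eq:
assumes x: "x:cT"
shows "assoc_torsor_mu R K T \<rho>2 x = \<mu> x"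
unfolding assoc_torsor_mu_def same_tmap[OF same_refl same_P2] J_\<rho>2[OF x, symmetric]
by (rule tensor_map_cong[OF id_hom inclC mT mC mT mM2 _ _ \<rho>2_closed[OF x]]) (simp_all add: gamma_eq)

text \<open>Since the translation map is the inclusion and the antipode is \<open>Sr\<close>, the
  formula becomes the sum of \<open>(u ** v) ** \<theta> w\<close> over \<open>\<mu>(x)\<close>, and
  \<open>\<mu>_left\<close> leaves \<open>\<theta> x\<close>.\<close>

lemma assoc_theta_eq:
assumes x: "x:cT"
shows "assoc_torsor_theta R K T \<rho>2 x = \<theta> x"
proof -
interpret K: bialgebra_calculus R K by unfold_locales (rule Hr_bialgebra)
have SC: "Sr c:Cr" if "c:Cr" for c
 using hom_mem[OF K.antipodeD(1)[OF Hr_antipode], of c] that by (simp add: carrier_K)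
note ll = lr hom_comp[OF nab(3)] hom_mem[OF nab(3)]
have b: "bilin R T M2 T (%t c. t ** nabla_op T (Sr c))" by (assumption | rule ll)+
have b': "bilin R T CM T (%t c. t ** nabla_op T (Sr c))" using b CD by (auto simp: bilin_def mod_hom_def)
have "assoc_torsor_theta R K T \<rho>2 x = sw T (\<rho>2 x) (%t c. t ** nabla_op T (Sr c))"
 unfolding assoc_torsor_theta_def
 by (rule tensor_lift_sw'[OF mT mC mT \<rho>2_closed[OF x] b']) (simp add: K.antipode_eq[OF Hr_antipode] carrier_K gamma_eq SC)
also have "... = smu T x (%u v w. u ** nabla_op T (Sr (t2 v w)))" by (rule sw_\<rho>2[OF x b mT])
also have "... = smu T x (%u v w. (u ** v) ** \<theta> w)"
 by (rule T3.cong[OF \<mu>_closed[OF x] mT], simp add: S_t2 nab(4) \<theta>_closed m_assoc) (assumption | rule ll)+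
also have "... = eT ** \<theta> x"
 by (rule left[where G = "%p q. p ** \<theta> q", OF x _ mT]) (assumption | rule ll)+
finally show ?thesis using \<theta>_closed[OF x] by simp
qed

lemma antipode_bij: "bij_betw (antipode R K) (car K) (car K)"
proof -
interpret K: bialgebra_calculus R K by unfold_locales (rule Hr_bialgebra)
have SC: "Sr c:Cr" if "c:Cr" for c
 using hom_mem[OF K.antipodeD(1)[OF Hr_antipode], of c] that by (simp add: carrier_K)
show ?thesis
 by (rule bij_betw_byWitness[where f' = Si])
 (auto simp: K.antipode_eq[OF Hr_antipode] carrier_K Sr_Si CD SC Si_in)
qed

end

lemma quantum_torsor_galois:
fixes T :: "('k, 't) module"
assumes "quantum_torsor R T \<mu> \<theta>"
shows "hopf_algebra R (Hr R T \<mu> \<theta>)" "bij_betw (antipode R (Hr R T \<mu> \<theta>)) (car (Hr R T \<mu> \<theta>)) (car (Hr R T \<mu> \<theta>))"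
 "right_galois_object R (Hr R T \<mu> \<theta>) T (Hr_coaction R T \<mu> \<theta>)"
 "x:car T==>assoc_torsor_mu R (Hr R T \<mu> \<theta>) T (Hr_coaction R T \<mu> \<theta>) x = \<mu> x"
 "x:car T==>assoc_torsor_theta R (Hr R T \<mu> \<theta>) T (Hr_coaction R T \<mu> \<theta>) x = \<theta> x"
proof -
interpret torsor R T \<mu> \<theta> by (rule quantum_torsor_torsor[OF assms])
obtain \<rho> D' where h: "right_sub R T \<mu> Cr \<rho> (%a u. \<theta> u \<otimes>\<^bsub>T\<^esub> a)" "Hr R T \<mu> \<theta> = make_bialg (sub P2 Cr) (induced_comult R P2 Cr D') (induced_counit R T)"
 "sub_bialgebra R T P2 Cr Dr (nabla T) (induced_comult R P2 Cr D') (induced_counit R T)"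
 "bialgebra R (Hr R T \<mu> \<theta>)" "is_antipode R (Hr R T \<mu> \<theta>) Sr"
proof (rule Hr_hopf)
 note ob = that
 show "t2 \<one>\<^bsub>T\<^esub> \<one>\<^bsub>T\<^esub>:Cr" by (rule Cr_one)
 show "x \<otimes>\<^bsub>P2\<^esub> y:Cr" if xy: "x:Cr" "y:Cr" for x y by (rule Cr_mult[OF xy])
 show "Sr U:Cr" if x: "U:Cr" for U by (rule S_in[OF \<mu>_\<theta> x])
 show "sw3 MT (\<mu> x) (%u v w. tens R M2 T (t2 v w) u):tmp R M2 T id id ` car (tp R (sub M2 Cr) T)" if x: "x:car T" for x
 by (rule \<nu>_in[OF x])
 fix \<rho> D' assume h: "right_sub R T \<mu> Cr \<rho> (%a u. \<theta> u \<otimes>\<^bsub>T\<^esub> a)" "Hr R T \<mu> \<theta> = make_bialg (sub P2 Cr) (induced_comult R P2 Cr D') (induced_counit R T)"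
 "sub_bialgebra R T P2 Cr Dr (nabla T) (induced_comult R P2 Cr D') (induced_counit R T)"
 "bialgebra R (Hr R T \<mu> \<theta>)" "is_antipode R (Hr R T \<mu> \<theta>) Sr"
 show thesis by (rule ob[OF h])
qed
interpret torsor_hopf R T \<mu> \<theta> \<rho> D'
 by (intro torsor_hopf.intro torsor_hopf_axioms.intro h torsor_axioms)
show "hopf_algebra R (Hr R T \<mu> \<theta>)" using h(4,5) unfolding hopf_algebra_def by auto
show "bij_betw (antipode R (Hr R T \<mu> \<theta>)) (car (Hr R T \<mu> \<theta>)) (car (Hr R T \<mu> \<theta>))" by (rule antipode_bij)
show "right_galois_object R (Hr R T \<mu> \<theta>) T (Hr_coaction R T \<mu> \<theta>)" by (rule galois)
show "x:car T==>assoc_torsor_mu R (Hr R T \<mu> \<theta>) T (Hr_coaction R T \<mu> \<theta>) x = \<mu> x" by (rule assoc_mu_eq)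
show "x:car T==>assoc_torsor_theta R (Hr R T \<mu> \<theta>) T (Hr_coaction R T \<mu> \<theta>) x = \<theta> x" by (rule assoc_theta_eq)
qed

section \<open>Hopf-Galois objects\<close>

lemma bilin_lin:
assumes "bilin R A B P F"
shows "f:Hom R X A==>b:car B==>(%x. F (f x) b):Hom R X P"
 "g:Hom R X B==>a:car A==>(%x. F a (g x)):Hom R X P"
using assms hom_comp[of "%x. F x b" R A P f X] hom_comp[of "F a" R B P g X] by (auto simp: bilin_def)

lemma trilin_lin:
assumes "trilin R A B C P F"
shows "f:Hom R X A==>b:car B==>c:car C==>(%x. F (f x) b c):Hom R X P"
 "g:Hom R X B==>a:car A==>c:car C==>(%x. F a (g x) c):Hom R X P"
 "k:Hom R X C==>a:car A==>b:car B==>(%x. F a b (k x)):Hom R X P"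
using assms hom_comp[of "%x. F x b c" R A P f X] hom_comp[of "%x. F a x c" R B P g X]
 hom_comp[of "F a b" R C P k X] by (auto simp: trilin_def)

locale hopf_galois = bialgebra_calculus R H + ff_algebra R T
for R :: "('k, 'r) ring_scheme" and H :: "('k, 'h) bialg" and T :: "('k, 't) module" +
fixes S :: "'h => 'h" and \<rho> :: "'t => ('t, 'h) tensor"
assumes antipode: "is_antipode R H S" and galois: "right_galois_object R H T \<rho>"
begin

abbreviation "srh P x \<equiv> sw P (\<rho> x)"
abbreviation "sga P x \<equiv> sw P (galois_gamma R H T \<rho> x)"

abbreviation "TH == tp R T H"
abbreviation "TT == tp R T T"
abbreviation "tTH == tn T H"
abbreviation "tTT == tn T T"
abbreviation "\<beta> == galois_map R H T \<rho>"
abbreviation "\<gamma> == galois_gamma R H T \<rho>"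

lemmas mT = module_axiom
lemma mTH: "module R TH" by (rule mod_tens[OF mT mH])
lemma mTT: "module R TT" by (rule mod_tens[OF mT mT])

lemma \<rho>_alg: "\<rho>:alg_hom R T TH"
using galois by (simp add: right_galois_object_def right_comodule_algebra_def)
lemmas \<rho>_hom = alg_homD(1)[OF \<rho>_alg]
lemmas \<rho>_closed = hom_mem[OF \<rho>_hom]
lemmas rho_cong = sw_cong[OF refl \<rho>_closed mT mH]
lemmas S_hom = antipodeD(1)[OF antipode]
lemmas lg0 = lh mT mTH mTT one_closed rmult_hom lmult_hom m_closed hom_comp[OF \<rho>_hom] \<rho>_closed
hom_comp[OF S_hom] hom_mem[OF S_hom]

lemma coact_coassoc:
assumes "x:cT" "trilin R T H H P F" "module R P"
shows "srh P x (%x y. srh P x (%u v. F u v y)) = srh P x (%x y. sde P y (%u v. F x u v))"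
by (rule coassoc_sw[OF mT mH \<rho>_hom \<D>_hom assms(1) _ assms(2,3)])
 (use galois assms(1) in \<open>simp add: right_galois_object_def right_comodule_algebra_def\<close>)

lemma coact_counit:
assumes "x:cT" "g:Hom R T P" "module R P"
shows "srh P x (%a h. \<e> h \<odot>\<^bsub>P\<^esub> g a) = g x"
proof -
have b: "bilin R T H T (%a h. \<e> h *s a)" by (assumption | rule lg0)+
have "g (srh T x (%a h. \<e> h *s a)) = srh P x (%a h. g (\<e> h *s a))"
 by (rule sw_hom[OF assms(2) \<rho>_closed[OF assms(1)] _ mT mH mT assms(3)]) (assumption | rule lg0)+
also have "... = srh P x (%a h. \<e> h \<odot>\<^bsub>P\<^esub> g a)"
 by (rule rho_cong[OF assms(1) assms(3)])
 (assumption | rule hom_smult[OF assms(2)] hom_mem[OF assms(2)] lg0)+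
finally show ?thesis
 using galois assms(1) unfolding tlift_sw[OF mT mH mT \<rho>_closed[OF assms(1)] b, symmetric]
 by (simp add: right_galois_object_def right_comodule_algebra_def)
qed

lemma coact_mult:
assumes "x:cT" "y:cT" "bilin R T H P F" "module R P"
shows "sw P (\<rho> (x ** y)) F = srh P x (%a g. srh P y (%b h. F (a ** b) (g \<star> h)))"
unfolding alg_homD(2)[OF \<rho>_alg assms(1,2)]
by (rule sw_mult) (assumption | rule k_algebra_axioms H.k_algebra_axioms \<rho>_closed assms)+

lemma bilin_\<beta>: "bilin R T T TH (%x y. srh TH y (%a k. tTH (x ** a) k))"
by (assumption | rule lg0)+

lemma \<beta>_eq: "U:car TT==>\<beta> U = sw TH U (%x y. srh TH y (%a k. tTH (x ** a) k))"
unfolding galois_map_def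
proof (rule tensor_lift_sw'[OF mT mT mTH _ bilin_\<beta>], assumption)
fix x y assume x: "x:cT" and y: "y:cT"
show "tensor_lift TH (%a k. tTH (x ** a) k) (\<rho> y) = srh TH y (%a k. tTH (x ** a) k)"
 by (rule tlift_sw[OF mT mH mTH \<rho>_closed[OF y]]) (assumption | rule lg0 x)+
qed

lemma \<beta>_hom: "\<beta>:Hom R TT TH"
by (rule mod_hom_cong[THEN iffD2, OF \<beta>_eq mTT sw_mhom[OF bilin_\<beta> mT mT mTH]])

lemma \<beta>_t2: "x:cT==>y:cT==>\<beta> (tTT x y) = srh TH y (%a k. tTH (x ** a) k)"
using \<beta>_eq[of "tTT x y"] sw_tens[OF bilin_\<beta> _ _ mT mT mTH] tens_in[OF _ _ mT mT] by simp

lemma \<beta>_bij: "bij_betw \<beta> (car TT) (car TH)"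
using galois by (simp add: right_galois_object_def)

lemma \<beta>_inj: "x:car TT==>y:car TT==>\<beta> x = \<beta> y==>x = y"
using \<beta>_bij by (auto simp: bij_betw_def inj_on_def)

lemma \<gamma>: "h:cH==>\<gamma> h:car TT" "h:cH==>\<beta> (\<gamma> h) = tTH eT h"
proof -
assume h: "h:cH"
have "tTH eT h:\<beta> ` car TT"
 using \<beta>_bij tens_in[OF one_closed h mT mH] by (simp add: bij_betw_def)
then show "\<gamma> h:car TT" "\<beta> (\<gamma> h) = tTH eT h"
 unfolding galois_gamma_def by (rule inv_into_into, rule f_inv_into_f)
qed

lemma \<gamma>_hom: "\<gamma>:Hom R H TT"
proof (rule mod_homI)
interpret TT: module R TT by (rule mTT)
note t = lin_tens2[OF lin_id one_closed mT mH]
show "\<gamma> (x \<oplus>\<^bsub>H\<^esub> y) = \<gamma> x \<oplus>\<^bsub>TT\<^esub> \<gamma> y" if "x:cH" "y:cH" for x y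
 by (rule \<beta>_inj) (use that mod_hom_add[OF t] in \<open>simp_all add: \<gamma> mod_hom_add[OF \<beta>_hom]\<close>)
show "\<gamma> (r \<odot>\<^bsub>H\<^esub> x) = r \<odot>\<^bsub>TT\<^esub> \<gamma> x" if "r:car R" "x:cH" for r x
 by (rule \<beta>_inj) (use that hom_smult[OF t] in \<open>simp_all add: \<gamma> hom_smult[OF \<beta>_hom]\<close>)
qed (rule \<gamma>)

lemmas lg = lg0 hom_comp[OF \<gamma>_hom] \<gamma>(1)
lemmas gamma_cong = sw_cong[OF refl \<gamma>(1) mT mT]

text \<open>The equation \<open>\<beta>(\<gamma>(h)) = 1 \<otimes> h\<close> under a bilinear
  \<open>F\<close>; it removes an occurrence of \<open>\<gamma>\<close>.\<close>

lemma gamma_contract: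
assumes h: "h:cH" and F: "bilin R T H P F" "module R P"
shows "sga P h (%x y. srh P y (%a k. F (x ** a) k)) = F eT h"
proof -
note f = sw_mhom[OF F(1) mT mH F(2)]
note ll = lg bilin_lin[OF F(1)] bilin_in[OF F(1)] F(2)
have "sw P (\<beta> (\<gamma> h)) F = sga P h (%x y. srh P y (%a k. F (x ** a) k))"
proof (rule tensor_eval[OF hom_comp[OF f \<beta>_hom] mT mT F(2) \<gamma>(1)[OF h]])
 fix x y assume x: "x:cT" "y:cT"
 have "sw P (\<beta> (tTT x y)) F = srh P y (%a k. sw P (tTH (x ** a) k) F)" (is "?lh = _")
 unfolding \<beta>_t2[OF x] by (rule sw_hom[OF f \<rho>_closed[OF x(2)] _ mT mH mTH F(2)]) (assumption | rule ll x)+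
 also have "... = srh P y (%a k. F (x ** a) k)"
 by (rule rho_cong[OF x(2) F(2)], rule sw_tens[OF F(1) _ _ mT mH F(2)]) (assumption | rule ll x)+
 finally show "?lh = ..." .
qed
then show ?thesis unfolding \<gamma>(2)[OF h] sw_tens[OF F(1) one_closed h mT mH F(2)] by simp
qed

text \<open>The map \<open>t \<otimes> g \<mapsto> t \<gamma>(g)\<close> is a right inverse of
  \<open>\<beta>\<close>, hence its inverse by injectivity. Applied to
  \<open>\<beta>(x \<otimes> y)\<close> it introduces an occurrence of
  \<open>\<gamma>\<close>.\<close>

lemma gamma_expand:
assumes x: "x:cT" "y:cT" and F: "bilin R T T P F" "module R P"
shows "F x y = srh P y (%b g. sga P g (%p q. F (x ** b ** p) q))"
proof -
let ?k = "%\<zeta>. sw TT \<zeta> (%t g. sga TT g (%p q. tTT (t ** p) q))"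
note ll = lg bilin_lin[OF F(1)] bilin_in[OF F(1)] F(2)
have b: "bilin R T H TT (%t g. sga TT g (%p q. tTT (t ** p) q))" by (assumption | rule ll)+
have k: "?k:Hom R TH TT" by (rule sw_mhom[OF b mT mH mTT])
have \<beta>k: "\<beta> (?k \<zeta>) = \<zeta>" if "\<zeta>:car TH" for \<zeta>
proof (rule tens_heq[OF mT mH that hom_comp[OF \<beta>_hom k] lin_id])
 fix t g assume t: "t:cT" "g:cH"
 have "\<beta> (?k (tTH t g)) = sga TH g (%p q. \<beta> (tTT (t ** p) q))"
 unfolding sw_tens[OF b t mT mH mTT] by (rule sw_hom[OF \<beta>_hom \<gamma>(1)[OF t(2)] _ mT mT mTT mTH]) (assumption | rule ll t)+
 also have "... = sga TH g (%p q. srh TH q (%a k. tTH (t ** (p ** a)) k))"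
 proof (rule gamma_cong[OF t(2) mTH])
 fix p q assume p: "p:cT" "q:cT"
 show "\<beta> (tTT (t ** p) q) = srh TH q (%a k. tTH (t ** (p ** a)) k)"
  unfolding \<beta>_t2[OF m_closed[OF t(1) p(1)] p(2)]
  by (rule rho_cong[OF p(2) mTH], simp add: m_assoc t p) (assumption | rule ll t p)+
 qed (rule hom_mem[OF \<beta>_hom], (assumption | rule ll t)+)
 also have "... = tTH (t ** eT) g"
 by (rule gamma_contract[where F = "%x k. tTH (t ** x) k", OF t(2) _ mTH]) (assumption | rule ll t)+
 finally show "\<beta> (?k (tTH t g)) = tTH t g" using t by simp
qed
have xy: "tTT x y:car TT" by (rule ll x)+
have b2: "bilin R T H P (%t g. sga P g (%p q. F (t ** p) q))" by (assumption | rule ll)+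
have f: "(%z. sw P z F):Hom R TT P" by (rule sw_mhom[OF F(1) mT mT F(2)])
have 1: "sw P (?k \<zeta>) F = sw P \<zeta> (%t g. sga P g (%p q. F (t ** p) q))" if \<zeta>: "\<zeta>:car TH" for \<zeta>
proof (rule tensor_eval[OF hom_comp[OF f k] mT mH F(2) \<zeta>])
 fix t g assume t: "t:cT" "g:cH"
 have "sw P (?k (tTH t g)) F = sga P g (%p q. sw P (tTT (t ** p) q) F)" (is "?lh = _")
 unfolding sw_tens[OF b t mT mH mTT] by (rule sw_hom[OF f \<gamma>(1)[OF t(2)] _ mT mT mTT F(2)]) (assumption | rule ll t)+
 also have "... = sga P g (%p q. F (t ** p) q)"
 by (rule gamma_cong[OF t(2) F(2)], rule sw_tens[OF F(1) _ _ mT mT F(2)]) (assumption | rule ll t)+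
 finally show "?lh = ..." .
qed
have c: "\<beta> (tTT x y):car TH" by (rule hom_mem[OF \<beta>_hom xy])
have "?k (\<beta> (tTT x y)) = tTT x y"
 by (rule \<beta>_inj[OF hom_mem[OF k c] xy \<beta>k[OF c]])
then have "F x y = sw P (\<beta> (tTT x y)) (%t g. sga P g (%p q. F (t ** p) q))"
 using 1[OF c] sw_tens[OF F(1) x mT mT F(2)] by simp
also have "... = srh P y (%b g. sw P (tTH (x ** b) g) (%t g. sga P g (%p q. F (t ** p) q)))"
 unfolding \<beta>_t2[OF x] by (rule sw_hom[OF sw_mhom[OF b2 mT mH F(2)] \<rho>_closed[OF x(2)] _ mT mH mTH F(2)]) (assumption | rule ll x)+
also have "... = srh P y (%b g. sga P g (%p q. F (x ** b ** p) q))"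
 by (rule rho_cong[OF x(2) F(2)], rule sw_tens[OF b2 _ _ mT mH F(2)]) (assumption | rule ll x)+
finally show ?thesis .
qed

lemma gamma_expand_one:
assumes y: "y:cT" and F: "bilin R T T P F" "module R P"
shows "srh P y (%b g. sga P g (%p q. F (b ** p) q)) = F eT y"
unfolding gamma_expand[OF one_closed y F]
by (rule rho_cong[OF y F(2)], simp) (assumption | rule lg bilin_in[OF F(1)] F(2))+

text \<open>Inserting the counit on the second factor of \<open>p ** q\<close> creates the pattern
  that \<open>gamma_contract\<close> evaluates.\<close>

lemma gamma_mult_one:
assumes h: "h:cH" and f: "f:Hom R T P" "module R P"
shows "sga P h (%p q. f (p ** q)) = \<e> h \<odot>\<^bsub>P\<^esub> f eT"
proof -
note ll = lg hom_comp[OF f(1)] hom_mem[OF f(1)] f(2)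
have "sga P h (%p q. f (p ** q)) = sga P h (%p q. srh P q (%a k. \<e> k \<odot>\<^bsub>P\<^esub> f (p ** a)))"
 by (rule gamma_cong[OF h f(2)], rule coact_counit[symmetric]) (assumption | rule ll)+
also have "... = \<e> h \<odot>\<^bsub>P\<^esub> f eT"
 by (rule gamma_contract[where F = "%x k. \<e> k \<odot>\<^bsub>P\<^esub> f x", OF h _ f(2)]) (assumption | rule ll)+
finally show ?thesis .
qed

text \<open>Coacting on the second leg of \<open>\<gamma>(h)\<close> amounts to splitting
  \<open>h\<close> and keeping its second part. The coacted leg is re-expanded by
  \<open>gamma_expand\<close>, coassociativity moves the coaction inward, and the original
  \<open>\<gamma>(h)\<close> is contracted.\<close>

lemma gamma_coact2:
assumes h: "h:cH" and F: "trilin R T T H P F" "module R P"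
shows "sga P h (%x y. srh P y (%a k. F x a k)) = sde P h (%g k. sga P g (%x y. F x y k))"
proof -
note ll = lg trilin_lin[OF F(1)] trilin_closed[OF F(1)] F(2)
have "sga P h (%x y. srh P y (%a k. F x a k)) =
 sga P h (%x y. srh P y (%a k. srh P a (%b g. sga P g (%p q. F (x ** b ** p) q k))))"
 by (rule gamma_cong[OF h F(2)], rule sw_cong[OF refl _ mT mH F(2)], (assumption | rule ll)+,
  rule gamma_expand[where F = "%x y. F x y k" for k]) (assumption | rule ll)+
also have "... = sga P h (%x y. srh P y (%b l. sde P l (%g k. sga P g (%p q. F (x ** b ** p) q k))))"
 by (rule gamma_cong[OF h F(2)],
  rule coact_coassoc[where F = "%b g k. sga P g (%p q. F (x ** b ** p) q k)" for x, OF _ _ F(2)]) (assumption | rule ll)+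
also have "... = sde P h (%g k. sga P g (%p q. F (eT ** p) q k))"
 by (rule gamma_contract[where F = "%z l. sde P l (%g k. sga P g (%p q. F (z ** p) q k))", OF h _ F(2)]) (assumption | rule ll)+
also have "... = sde P h (%g k. sga P g (%p q. F p q k))"
 by (rule Delta_cong[OF h F(2)], rule sw_cong[OF refl _ mT mT F(2)], (assumption | rule ll)+, simp) (assumption | rule ll)+
finally show ?thesis .
qed

text \<open>Coacting on the first leg yields the antipode of the first part of \<open>h\<close>. A
  product in \<open>H\<close> must be created first, so that the coaction of a product in
  \<open>T\<close> becomes visible and \<open>gamma_contract\<close> applies to it.\<close>

lemma gamma_coact1:
assumes h: "h:cH" and F: "trilin R T H T P F" "module R P"
shows "sga P h (%x y. srh P x (%a k. F a k y)) = sde P h (%g k. sga P k (%x y. F x (S g) y))"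
proof -
note ll = lg trilin_lin[OF F(1)] trilin_closed[OF F(1)] F(2)
let ?G = "%t g k. sga P g (%p q. F (t ** p) k q)"
\<comment> \<open>The target shape: \<open>m\<close> will be the \<open>H\<close> leg of the product
  \<open>x ** b\<close>, and the factor \<open>S r\<close> compensates for the part of
  \<open>m\<close> that came from \<open>b\<close>.\<close>
let ?K = "%z g. srh P z (%c m. sde P g (%r s. ?G c s (m \<star> S r)))"
have inner: "srh P y (%b g. srh P b (%c l. sde P g (%r s. ?G (a ** c) s (k \<star> l \<star> S r)))) =
 srh P y (%b g. ?G (a ** b) g k)" if x: "y:cT" "a:cT" "k:cH" for y a k
proof -
 note lx = ll x
 have "srh P y (%b g. srh P b (%c l. sde P g (%r s. ?G (a ** c) s (k \<star> l \<star> S r)))) =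
 srh P y (%b g. sde P g (%l g. sde P g (%r s. ?G (a ** b) s (k \<star> l \<star> S r))))"
 by (rule coact_coassoc[where F = "%c l g. sde P g (%r s. ?G (a ** c) s (k \<star> l \<star> S r))", OF x(1) _ F(2)]) (assumption | rule lx)+
 also have "... = srh P y (%b g. ?G (a ** b) g k)"
 proof (rule rho_cong[OF x(1) F(2)])
 fix b g assume b: "b:cT" "g:cH"
 note lb = lx b
 have "sde P g (%l g. sde P g (%r s. ?G (a ** b) s (k \<star> l \<star> S r))) =
  sde P g (%g s. sde P g (%l r. ?G (a ** b) s (k \<star> l \<star> S r)))" (is "?lh = _")
  by (rule comult_coassoc[symmetric, where F = "%l r s. ?G (a ** b) s (k \<star> l \<star> S r)", OF b(2) _ F(2)]) (assumption | rule lb)+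
 also have "... = sde P g (%g s. \<e> g \<odot>\<^bsub>P\<^esub> ?G (a ** b) s k)"
 proof (rule Delta_cong[OF b(2) F(2)])
  fix g s assume g: "g:cH" "s:cH"
  have h: "(%z. ?G (a ** b) s (k \<star> z)):Hom R H P" by (assumption | rule lb g)+
  have "sde P g (%l r. ?G (a ** b) s (k \<star> l \<star> S r)) = sde P g (%l r. ?G (a ** b) s (k \<star> (l \<star> S r)))" (is "?lh = _")
  by (rule Delta_cong[OF g(1) F(2)], simp add: H.m_assoc x hom_mem[OF S_hom]) (assumption | rule lb g)+
  also have "... = ?G (a ** b) s (k \<star> sde H g (%l r. l \<star> S r))"
  by (rule sw_hom[OF h \<D>_closed[OF g(1)] _ mH mH mH F(2), symmetric]) (assumption | rule lb g)+
  also have "... = \<e> g \<odot>\<^bsub>P\<^esub> ?G (a ** b) s k"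
  unfolding antipodeD(3)[OF antipode g(1)] hom_smult[OF h \<e>_closed[OF g(1)] H.one_closed] using x by simp
  finally show "?lh = ..." .
 qed (assumption | rule lb)+
 also have "... = ?G (a ** b) g k"
  by (rule comult_counit(1)[where g = "%s. ?G (a ** b) s k", OF b(2) _ F(2)]) (assumption | rule lb)+
 finally show "?lh = ..." .
 qed (assumption | rule lx)+
 finally show ?thesis .
qed
have "sga P h (%x y. srh P x (%a k. F a k y)) = sga P h (%x y. srh P y (%b g. ?K (x ** b) g))"
proof (rule gamma_cong[OF h F(2)])
 fix x y assume x: "x:cT" "y:cT"
 note lx = ll x
 have "srh P x (%a k. F a k y) = srh P x (%a k. srh P y (%b g. ?G (a ** b) g k))" (is "?lh = _")
 by (rule rho_cong[OF x(1) F(2)], rule gamma_expand[where F = "%x y. F x k y" for k]) (assumption | rule lx)+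
 also have "... = srh P x (%a k. srh P y (%b g. srh P b (%c l. sde P g (%r s. ?G (a ** c) s (k \<star> l \<star> S r)))))"
 by (rule rho_cong[OF x(1) F(2)], rule inner[symmetric]) (assumption | rule lx)+
 also have "... = srh P y (%b g. srh P x (%a k. srh P b (%c l. sde P g (%r s. ?G (a ** c) s (k \<star> l \<star> S r)))))"
 by (rule sw_swap[OF \<rho>_closed[OF x(1)] \<rho>_closed[OF x(2)] mT mH mT mH F(2)]) (assumption | rule lx)+
 also have "... = srh P y (%b g. ?K (x ** b) g)"
 by (rule rho_cong[OF x(2) F(2)],
  rule coact_mult[where F = "%c m. sde P g (%r s. ?G c s (m \<star> S r))" for g, symmetric, OF x(1) _ _ F(2)]) (assumption | rule lx)+
 finally show "?lh = ..." .
qed (assumption | rule ll)+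
also have "... = ?K eT h"
 by (rule gamma_contract[OF h _ F(2)]) (assumption | rule ll)+
also have "... = sde P h (%r s. ?G eT s (eH \<star> S r))"
 unfolding alg_homD(3)[OF \<rho>_alg] tsimps(4)
 by (rule sw_tens[OF _ one_closed H.one_closed mT mH F(2)]) (assumption | rule ll h)+
also have "... = sde P h (%g k. sga P k (%x y. F x (S g) y))"
 by (rule Delta_cong[OF h F(2)], rule sw_cong[OF refl _ mT mT F(2)], (assumption | rule ll)+, simp add: hom_mem[OF S_hom])
 (assumption | rule ll)+
finally show ?thesis .
qed

end

section \<open>The translation map as an algebra map, and the torsor of a Galois object\<close>

context hopf_galois
begin

lemma opp_T_alg: "k_algebra R (opp T)" by (rule opp_algebra[OF k_algebra_axioms])
lemma opp_TT_alg: "k_algebra R (tp R (opp T) T)" by (rule tensor_k_algebra[OF opp_T_alg k_algebra_axioms])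
lemma same_opp_TT: "same_module (tp R (opp T) T) TT" by (rule same_tensor[OF same_opp same_refl])

lemma sw_opp_mult:
assumes "X:car TT" "Y:car TT" "bilin R T T P F" "module R P"
shows "sw P (X \<otimes>\<^bsub>tp R (opp T) T\<^esub> Y) F = sw P X (%a b. sw P Y (%c d. F (c ** a) (b ** d)))"
proof -
have b: "bilin R (opp T) T P F" using assms(3) by (simp add: bilin_def mod_hom_def)
have c: "car (tp R (opp T) T) = car TT" using same_opp_TT by (simp add: same_module_def)
show ?thesis using sw_mult[OF opp_T_alg k_algebra_axioms _ _ b assms(4), of X Y] assms(1,2) by (simp add: c)
qed

lemma gamma_one: "\<gamma> eH = tTT eT eT"
proof (rule \<beta>_inj)
show "\<gamma> eH:car TT" "tTT eT eT:car TT" by (rule lg)+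
have "\<beta> (tTT eT eT) = tTH (eT ** eT) eH"
 unfolding \<beta>_t2[OF one_closed one_closed] alg_homD(3)[OF \<rho>_alg] tsimps(4)
 by (rule sw_tens) (assumption | rule lg)+
then show "\<beta> (\<gamma> eH) = \<beta> (tTT eT eT)" by (simp add: \<gamma>)
qed

text \<open>Compared under the injective \<open>\<beta>\<close>. The opposite product places the
  legs of \<open>\<gamma>(h)\<close> inside those of \<open>\<gamma>(k)\<close>, so \<open>h\<close>
  is contracted first and \<open>k\<close> afterwards.\<close>

lemma gamma_mult:
assumes h: "h:cH" "k:cH"
shows "\<gamma> (h \<star> k) = \<gamma> h \<otimes>\<^bsub>tp R (opp T) T\<^esub> \<gamma> k"
proof (rule \<beta>_inj)
note ll = lg h
note c = alg_mult_hom(3)[OF opp_TT_alg same_opp_TT \<gamma>(1)[OF h(1)] \<gamma>(1)[OF h(2)]]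
show "\<gamma> (h \<star> k):car TT" "\<gamma> h \<otimes>\<^bsub>tp R (opp T) T\<^esub> \<gamma> k:car TT" by (rule ll c)+
have "\<beta> (\<gamma> h \<otimes>\<^bsub>tp R (opp T) T\<^esub> \<gamma> k) =
 sga TH h (%a b. sga TH k (%c d. sw TH (\<rho> (b ** d)) (%e l. tTH (c ** a ** e) l)))"
 unfolding \<beta>_eq[OF c] by (rule sw_opp_mult[OF _ _ bilin_\<beta> mTH]) (rule ll)+
also have "... = sga TH k (%c d. sga TH h (%a b. sw TH (\<rho> (b ** d)) (%e l. tTH (c ** a ** e) l)))"
 by (rule sw_swap[OF \<gamma>(1)[OF h(1)] \<gamma>(1)[OF h(2)] mT mT mT mT mTH]) (assumption | rule ll)+
also have "... = sga TH k (%c d. srh TH d (%e l. tTH (c ** e) (h \<star> l)))"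
proof (rule gamma_cong[OF h(2) mTH])
 fix c d assume x: "c:cT" "d:cT"
 note lx = ll x
 have "sga TH h (%a b. sw TH (\<rho> (b ** d)) (%e l. tTH (c ** a ** e) l)) =
 sga TH h (%a b. srh TH b (%e l. srh TH d (%e' l'. tTH (c ** (a ** e ** e')) (l \<star> l'))))" (is "?lh = _")
 proof (rule gamma_cong[OF h(1) mTH])
 fix a b assume y: "a:cT" "b:cT"
 have "sw TH (\<rho> (b ** d)) (%e l. tTH (c ** a ** e) l) =
  srh TH b (%e l. srh TH d (%e' l'. tTH (c ** a ** (e ** e')) (l \<star> l')))" (is "?lh = _")
  by (rule coact_mult[OF y(2) x(2) _ mTH]) (assumption | rule lx y)+
 also have "... = srh TH b (%e l. srh TH d (%e' l'. tTH (c ** (a ** e ** e')) (l \<star> l')))"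
  by (rule rho_cong[OF y(2) mTH], rule rho_cong[OF x(2) mTH], simp add: m_assoc x y)
  (assumption | rule lx y)+
 finally show "?lh =
..." .
 qed (assumption | rule lx)+
 also have "... = srh TH d (%e l. tTH (c ** (eT ** e)) (h \<star> l))"
 by (rule gamma_contract[where F = "%x l. srh TH d (%e' l'. tTH (c ** (x ** e')) (l \<star> l'))", OF h(1) _ mTH]) (assumption | rule lx)+
 also have "... = srh TH d (%e l. tTH (c ** e) (h \<star> l))"
 by (rule rho_cong[OF x(2) mTH], simp) (assumption | rule lx)+
 finally show "?lh =
..." .
qed (assumption | rule ll)+
also have "... = tTH eT (h \<star> k)"
 by (rule gamma_contract[where F = "%x l. tTH x (h \<star> l)", OF h(2) _ mTH]) (assumption | rule ll)+
finally show "\<beta> (\<gamma> (h \<star> k)) = \<beta> (\<gamma> h \<otimes>\<^bsub>tp R (opp T) T\<^esub> \<gamma> k)" using h by (simp add: \<gamma>)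
qed

lemma gamma_alg: "\<gamma>:alg_hom R H (tp R (opp T) T)"
proof (rule alg_homI)
show "\<gamma>:Hom R H (tp R (opp T) T)" using \<gamma>_hom unfolding same_mhom[OF same_refl[of H] same_opp_TT, of R] .
show "\<gamma> eH = \<one>\<^bsub>tp R (opp T) T\<^esub>" by (simp add: gamma_one tsimps(4) same_tens[OF same_opp same_refl])
qed (rule gamma_mult)

lemma sw_gamma_mult:
assumes "h:cH" "k:cH" "bilin R T T P F" "module R P"
shows "sw P (\<gamma> (h \<star> k)) F = sga P h (%a b. sga P k (%c d. F (c ** a) (b ** d)))"
unfolding gamma_mult[OF assms(1,2)] by (rule sw_opp_mult) (assumption | rule \<gamma> assms)+

definition "Nop h = sga T h (%p q. q ** p)"

abbreviation "\<theta> == assoc_torsor_theta R H T \<rho>"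

lemma Nop_hom: "Nop:Hom R H T"
unfolding Nop_def[abs_def] by (assumption | rule lg)+

lemmas ln = lg hom_comp[OF Nop_hom] hom_mem[OF Nop_hom]

lemma \<theta>_eq:
assumes x: "x:cT"
shows "\<theta> x = srh T x (%a k. a ** Nop (S k))"
unfolding assoc_torsor_theta_def
proof (rule tensor_lift_sw'[OF mT mH mT \<rho>_closed[OF x]])
show "bilin R T H T (%a k. a ** Nop (S k))" by (assumption | rule ln)+
fix a k assume k: "k:cH"
have b: "bilin R T T T (%p q. q ** p)" by (assumption | rule ln)+
show "a ** nabla_op T (\<gamma> (antipode R H k)) = a ** Nop (S k)"
 unfolding nabla_op_def antipode_eq[OF antipode k] Nop_def
 tlift_sw[OF mT mT mT \<gamma>(1)[OF hom_mem[OF S_hom k]] b] ..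
qed

lemma \<theta>_hom: "\<theta>:Hom R T T"
by (rule mod_hom_cong[THEN iffD2, OF \<theta>_eq mT]) (assumption | rule ln)+

lemmas lq = ln hom_comp[OF \<theta>_hom] hom_mem[OF \<theta>_hom]

text \<open>For the two parts of \<open>h\<close>, the adjacent inner legs of their translation maps
  cancel: h(1)[1] \<otimes> h(1)[2] h(2)[1] \<otimes> h(2)[2] = h[1] \<otimes> 1 \<otimes>
  h[2].\<close>

lemma gamma_comult_contract:
assumes h: "h:cH" and L: "trilin R T T T P L" "module R P"
shows "sde P h (%n k. sga P k (%c d. sga P n (%p q. L p (q ** c) d))) = sga P h (%p d. L p eT d)"
proof -
note ll = lg trilin_lin[OF L(1)] trilin_closed[OF L(1)] L(2)
have "sde P h (%n k. sga P k (%c d. sga P n (%p q. L p (q ** c) d))) =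
 sde P h (%n k. sga P n (%p q. sga P k (%c d. L p (q ** c) d)))"
 by (rule Delta_cong[OF h L(2)], rule sw_swap[OF _ _ mT mT mT mT L(2)]) (assumption | rule ll)+
also have "... = sga P h (%p q. srh P q (%a k. sga P k (%c d. L p (a ** c) d)))"
 by (rule gamma_coact2[where F = "%p q k. sga P k (%c d. L p (q ** c) d)", OF h _ L(2), symmetric]) (assumption | rule ll)+
also have "... = sga P h (%p q. L p eT q)"
 by (rule gamma_cong[OF h L(2)], rule gamma_expand_one[where F = "L p" for p, OF _ _ L(2)]) (assumption | rule ll)+
finally show ?thesis .
qed

text \<open>The scalar \<epsilon>(h(1)) is inserted as h(1) S(h(2)), and multiplicativity of
  \<open>\<gamma>\<close> splits it. The two antipodes combine into the comultiplication of
  \<open>S\<close> at the last part, whose inner legs cancel by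
  \<open>gamma_comult_contract\<close>; the product that is left is the one defining
  \<open>\<theta>\<close>.\<close>

lemma gamma_theta:
assumes h: "h:cH" and F: "bilin R T T P F" "module R P"
shows "sga P h (%x y. F x (\<theta> y)) = sw P (\<gamma> (S h)) (%p q. F q p)"
proof -
note ll = lq bilin_lin[OF F(1)] bilin_in[OF F(1)] F(2)
let ?L = "%k w. sga P w (%u v. sw P (\<gamma> (S k)) (%p q. F (q ** u) (v ** p)))"
let ?W = "%m n k. sga P m (%a b. sw P (\<gamma> (S n)) (%c d. sw P (\<gamma> (S k)) (%p q. F (q ** c ** a) (b ** (d ** p)))))"
\<comment> \<open>\<open>?L\<close> places \<open>\<gamma>\<close> of an inserted element around the
  expression and has no effect at the unit of \<open>H\<close>; linearity allows it to be applied to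
  the antipode relation.\<close>
have e: "\<e> g \<odot>\<^bsub>P\<^esub> sw P (\<gamma> (S k)) (%p q. F q p) = sde P g (%m n. ?W m n k)" if g: "g:cH" "k:cH" for g k
proof -
 note lx = ll g
 have L: "?L k:Hom R H P" by (assumption | rule lx)+
 have "sde P g (%m n. ?W m n k) = sde P g (%m n. ?L k (m \<star> S n))"
 proof (rule Delta_cong[OF g(1) F(2)])
 fix m n assume m: "m:cH" "n:cH"
 have "?L k (m \<star> S n) = sga P m (%a b. sw P (\<gamma> (S n)) (%c d. sw P (\<gamma> (S k)) (%p q. F (q ** (c ** a)) (b ** d ** p))))"
  by (rule sw_gamma_mult[OF m(1) hom_mem[OF S_hom m(2)] _ F(2)]) (assumption | rule lx)+
 also have "... = ?W m n k"
  by (rule gamma_cong[OF m(1) F(2)], rule sw_cong[OF refl _ mT mT F(2)], (assumption | rule lx m)+,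
   rule sw_cong[OF refl _ mT mT F(2)], (assumption | rule lx m)+, simp add: m_assoc) (assumption | rule lx m)+
 finally show "?W m n k = ?L k (m \<star> S n)" by (rule sym)
 qed (assumption | rule lx)+
 also have "... = ?L k (\<e> g \<odot>\<^bsub>H\<^esub> eH)"
 unfolding antipodeD(3)[OF antipode g(1), symmetric]
 by (rule sw_hom[OF L \<D>_closed[OF g(1)] _ mH mH mH F(2), symmetric]) (assumption | rule lx)+
 also have "... = \<e> g \<odot>\<^bsub>P\<^esub> ?L k eH" by (rule hom_smult[OF L \<e>_closed[OF g(1)] H.one_closed])
 also have "?L k eH = sw P (\<gamma> (S k)) (%p q. F (q ** eT) (eT ** p))"
 unfolding gamma_one by (rule sw_tens[OF _ one_closed one_closed mT mT F(2)]) (assumption | rule lx)+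
 also have "... = sw P (\<gamma> (S k)) (%p q. F q p)"
 by (rule sw_cong[OF refl _ mT mT F(2)], (assumption | rule lx)+, simp) (assumption | rule lx)+
 finally show ?thesis by (rule sym)
qed
have lin: "(%k. sw P (\<gamma> (S k)) (%p q. F q p)):Hom R H P" by (assumption | rule ll)+
have "sw P (\<gamma> (S h)) (%p q. F q p) = sde P h (%g k. \<e> g \<odot>\<^bsub>P\<^esub> sw P (\<gamma> (S k)) (%p q. F q p))"
 by (rule comult_counit(1)[OF h lin F(2), symmetric])
also have "... = sde P h (%g k. sde P g (%m n. ?W m n k))"
 by (rule Delta_cong[OF h F(2)], rule e) (assumption | rule ll)+
also have "... = sde P h (%m g. sde P g (%n k. ?W m n k))"
 by (rule comult_coassoc[OF h _ F(2)]) (assumption | rule ll)+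
also have "... = sde P h (%m g. sga P m (%a b. F a (b ** Nop (S g))))"
proof (rule Delta_cong[OF h F(2)])
 fix m g assume m: "m:cH" "g:cH"
 note lx = ll m
 have "sde P g (%n k. ?W m n k) = sga P m (%a b. sde P g (%n k. sw P (\<gamma> (S n)) (%c d. sw P (\<gamma> (S k))
 (%p q. F (q ** c ** a) (b ** (d ** p))))))" (is "?lh = _")
 by (rule sw_swap[OF \<D>_closed[OF m(2)] \<gamma>(1)[OF m(1)] mH mH mT mT F(2)]) (assumption | rule lx)+
 also have "... = sga P m (%a b. F a (b ** Nop (S g)))"
 proof (rule gamma_cong[OF m(1) F(2)])
 fix a b assume a: "a:cT" "b:cT"
 note la = lx a
 have Sg: "S g:cH" by (rule la)+
 have "sde P g (%n k. sw P (\<gamma> (S n)) (%c d. sw P (\<gamma> (S k)) (%p q. F (q ** c ** a) (b ** (d ** p))))) =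
  sw P (\<D> (S g)) (%k n. sga P n (%c d. sga P k (%p q. F (q ** c ** a) (b ** (d ** p)))))"
  by (rule antipode_comult[OF antipode m(2) _ F(2), symmetric]) (assumption | rule la)+
 also have "... = sw P (\<gamma> (S g)) (%p d. F (eT ** a) (b ** (d ** p)))"
  by (rule gamma_comult_contract[where L = "%p x d. F (x ** a) (b ** (d ** p))", OF Sg _ F(2)]) (assumption | rule la)+
 also have "... = F (eT ** a) (b ** Nop (S g))"
  unfolding Nop_def by (rule sw_hom[symmetric, where h = "%z. F (eT ** a) (b ** z)", OF _ \<gamma>(1)[OF Sg] _ mT mT mT F(2)]) (assumption | rule la)+
 finally show "sde P g (%n k. sw P (\<gamma> (S n)) (%c d. sw P (\<gamma> (S k)) (%p q. F (q ** c ** a) (b ** (d ** p))))) =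
  F a (b ** Nop (S g))" using a by simp
 qed (assumption | rule lx)+
 finally show "?lh = ..." .
qed (assumption | rule ll)+
also have "... = sga P h (%x y. srh P y (%b g. F x (b ** Nop (S g))))"
 by (rule gamma_coact2[where F = "%x b g. F x (b ** Nop (S g))", OF h _ F(2), symmetric]) (assumption | rule ll)+
also have "... = sga P h (%x y. F x (\<theta> y))"
proof (rule gamma_cong[OF h F(2)])
 fix x y assume x: "x:cT" "y:cT"
 show "srh P y (%b g. F x (b ** Nop (S g))) = F x (\<theta> y)"
 unfolding \<theta>_eq[OF x(2)] by (rule sw_hom[symmetric, where h = "F x", OF _ \<rho>_closed[OF x(2)] _ mT mH mT F(2)])
  (use F(1) x in \<open>simp add: bilin_def\<close>, (assumption | rule ll)+)
qed (assumption | rule ll)+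
finally show ?thesis by (rule sym)
qed

abbreviation "\<mu> == assoc_torsor_mu R H T \<rho>"
abbreviation "T3 == tp R T TT"

sublocale T3: three_modules R T T T by (rule three_modulesI[OF mT mT mT])

lemma \<mu>_eq: "\<mu> x = tmp R T TT id \<gamma> (\<rho> x)"
unfolding assoc_torsor_mu_def same_tmap[OF same_refl same_opp_TT] ..

lemma \<mu>_hom: "\<mu>:Hom R T T3"
unfolding \<mu>_eq[abs_def] by (rule hom_comp[OF tmap_hom[OF id_hom \<gamma>_hom mT mH mT mTT] \<rho>_hom])

lemma sw_\<mu>:
assumes x: "x:cT" and F: "trilin R T T T P F" "module R P"
shows "sw3 P (\<mu> x) F = srh P x (%a h. sga P h (%p q. F a p q))"
unfolding \<mu>_eq
proof (rule tensor_eval[where f = "%z. sw3 P (tmp R T TT id \<gamma> z) F", OF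
 hom_comp[OF T3.lin1[OF lin_id F] tmap_hom[OF id_hom \<gamma>_hom mT mH mT mTT]] mT mH F(2) \<rho>_closed[OF x]])
fix a h assume a: "a:cT" "h:cH"
show "sw3 P (tmp R T TT id \<gamma> (tTH a h)) F = sga P h (%p q. F a p q)"
 using tmap_tens[OF id_hom \<gamma>_hom mT mH mT mTT a] sw_tens[OF T3.trilin_bilin(1)[OF F] a(1) \<gamma>(1)[OF a(2)] mT mTT F(2)]
 by (simp add: sw3_def)
qed

lemma \<mu>_alg: "\<mu>:alg_hom R T (tp R T (tp R (opp T) T))"
proof (rule alg_homI)
have g: "tmp R T (tp R (opp T) T) id \<gamma>:alg_hom R TH (tp R T (tp R (opp T) T))"
 by (rule tensor_map_alg_hom[OF k_algebra_axioms H.k_algebra_axioms k_algebra_axioms opp_TT_alg alg_homI[OF id_hom] gamma_alg]) simp_all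
show "\<mu>:Hom R T (tp R T (tp R (opp T) T))"
 unfolding assoc_torsor_mu_def[abs_def] by (rule hom_comp[OF alg_homD(1)[OF g] \<rho>_hom])
show "\<mu> (x ** y) = \<mu> x \<otimes>\<^bsub>tp R T (tp R (opp T) T)\<^esub> \<mu> y" if "x:cT" "y:cT" for x y
 unfolding assoc_torsor_mu_def using that \<rho>_closed by (simp add: alg_homD(2)[OF g] alg_homD(2)[OF \<rho>_alg])
show "\<mu> eT = \<one>\<^bsub>tp R T (tp R (opp T) T)\<^esub>"
 unfolding assoc_torsor_mu_def by (simp add: alg_homD(3)[OF g] alg_homD(3)[OF \<rho>_alg])
qed

lemmas lm0 = lq hom_comp[OF \<mu>_hom] hom_mem[OF \<mu>_hom] T3.lin1 T3.lin2 T3.closed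

text \<open>From here the constructions \<open>Cr\<close>, \<open>Cl\<close>, \<open>Sr\<close>,
  \<open>Sl\<close>, \<open>Dr\<close>, \<open>Dl\<close> are available for the Galois object. The
  two unit axioms are \<open>gamma_mult_one\<close> and \<open>gamma_expand_one\<close>, and
  coassociativity combines \<open>gamma_coact2\<close> with that of \<open>\<rho>\<close>.\<close>

sublocale PT: pretorsor_theta R T "assoc_torsor_mu R H T \<rho>" "assoc_torsor_theta R H T \<rho>"
proof (intro pretorsor_theta.intro pretorsor_theta_axioms.intro pretorsor.intro pretorsor_axioms.intro ff_algebra_axioms \<mu>_hom \<theta>_hom)
let ?t3 = "%a b c. tn T TT a (tTT b c)"
show "\<mu> eT = ?t3 eT eT eT"
 using alg_homD(3)[OF \<mu>_alg] by (simp add: tsimps(4) same_tens[OF same_refl same_opp_TT] same_tens[OF same_opp same_refl])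
fix x assume x: "x:cT"
note ll = lm0 x
show "\<mu> (x ** y) = sw3 T3 (\<mu> x) (%a b c. sw3 T3 (\<mu> y) (%d e f. ?t3 (a ** d) (e ** b) (c ** f)))" if y: "y:cT" for y
 unfolding alg_homD(2)[OF \<mu>_alg x y] by (rule M3_mult[OF k_algebra_axioms]) (rule hom_mem[OF \<mu>_hom] x y)+
have "sw3 TT (\<mu> x) (%a b c. tTT a (b ** c)) = srh TT x (%a h. sga TT h (%b c. tTT a (b ** c)))" (is "?lh = _")
 by (rule sw_\<mu>[OF x _ mTT]) (assumption | rule ll)+
also have "... = srh TT x (%a h. \<e> h \<odot>\<^bsub>TT\<^esub> tTT a eT)"
 by (rule rho_cong[OF x mTT], rule gamma_mult_one[where f = "tTT a" for a, OF _ lin_tens2[OF lin_id] mTT]) (assumption | rule ll)+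
also have "... = tTT x eT"
 by (rule coact_counit[where g = "%a. tTT a eT", OF x _ mTT]) (assumption | rule ll)+
finally show "?lh = ..." .
have "sw3 TT (\<mu> x) (%a b c. tTT (a ** b) c) = srh TT x (%a h. sga TT h (%b c. tTT (a ** b) c))" (is "?lh = _")
 by (rule sw_\<mu>[OF x _ mTT]) (assumption | rule ll)+
also have "... = tTT eT x"
 by (rule gamma_expand_one[where F = tTT, OF x _ mTT]) (assumption | rule ll)+
finally show "?lh = ..." .
let ?M4 = "tp R T T3"
let ?M5 = "tp R T ?M4"
let ?G = "%a b c d e. tn T ?M4 a (tn T T3 b (?t3 c d e))"
have m: "module R T3" "module R ?M4" "module R ?M5" by (rule lin mT)+
note l5 = ll m
have "sw3 ?M5 (\<mu> x) (%a b c. sw3 ?M5 (\<mu> c) (%d e f. ?G a b d e f)) =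
 srh ?M5 x (%a h. sga ?M5 h (%b c. sw3 ?M5 (\<mu> c) (%d e f. ?G a b d e f)))" (is "?lh = _")
 by (rule sw_\<mu>[OF x _ m(3)]) (assumption | rule l5)+
also have "... = srh ?M5 x (%a h. sga ?M5 h (%b c. srh ?M5 c (%d k. sga ?M5 k (%e f. ?G a b d e f))))"
 by (rule rho_cong[OF x m(3)], rule sw_cong[OF refl _ mT mT m(3)], (assumption | rule l5)+, rule sw_\<mu>[OF _ _ m(3)]) (assumption | rule l5)+
also have "... = srh ?M5 x (%a h. sde ?M5 h (%g k. sga ?M5 g (%b d. sga ?M5 k (%e f. ?G a b d e f))))"
 by (rule rho_cong[OF x m(3)], rule gamma_coact2[where F = "%b d k. sga ?M5 k (%e f. ?G a b d e f)" for a, OF _ _ m(3)]) (assumption | rule l5)+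
also have "... = srh ?M5 x (%d k. srh ?M5 d (%a g. sga ?M5 g (%b c. sga ?M5 k (%e f. ?G a b c e f))))"
 by (rule coact_coassoc[where F = "%a g k. sga ?M5 g (%b c. sga ?M5 k (%e f. ?G a b c e f))", OF x _ m(3), symmetric]) (assumption | rule l5)+
also have "... = srh ?M5 x (%d k. srh ?M5 d (%a g. sga ?M5 k (%e f. sga ?M5 g (%b c. ?G a b c e f))))"
 by (rule rho_cong[OF x m(3)], rule sw_cong[OF refl _ mT mH m(3)], (assumption | rule l5)+,
  rule sw_swap[OF _ _ mT mT mT mT m(3)]) (assumption | rule l5)+
also have "... = srh ?M5 x (%d k. sga ?M5 k (%e f. srh ?M5 d (%a g. sga ?M5 g (%b c. ?G a b c e f))))"
 by (rule rho_cong[OF x m(3)], rule sw_swap[OF _ _ mT mH mT mT m(3)]) (assumption | rule l5)+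
also have "... = srh ?M5 x (%d k. sga ?M5 k (%e f. sw3 ?M5 (\<mu> d) (%a b c. ?G a b c e f)))"
 by (rule rho_cong[OF x m(3)], rule sw_cong[OF refl _ mT mT m(3)], (assumption | rule l5)+, rule sw_\<mu>[OF _ _ m(3), symmetric]) (assumption | rule l5)+
also have "... = sw3 ?M5 (\<mu> x) (%d e f. sw3 ?M5 (\<mu> d) (%a b c. ?G a b c e f))"
 by (rule sw_\<mu>[OF x _ m(3), symmetric]) (assumption | rule l5)+
finally show "?lh = ..." .
qed

end

section \<open>Identification of \<open>Hr\<close> with \<open>H\<close>\<close>

context hopf_galois
begin

abbreviation "K == Hr R T \<mu> \<theta>"

lemmas lk = lm0 PT.mM2 PT.mM4 PT.mMT PT.mMM

text \<open>Both sides of the equation equal S(h(1))[2] \<otimes> S(h(1))[1] \<otimes> h(2)[1]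
  \<otimes> h(2)[2]: \<open>Fr\<close> by \<open>gamma_coact2\<close> and
  \<open>gamma_theta\<close>, \<open>Gr\<close> by \<open>gamma_coact1\<close>.\<close>

lemma gamma_in_Cr:
assumes h: "h:cH"
shows "\<gamma> h:PT.Cr"
proof -
note ll = lk h
note gh = \<gamma>(1)[OF h]
have "PT.Fr (\<gamma> h) = sga PT.M4 h (%a b. srh PT.M4 b (%u k. sga PT.M4 k (%v w. PT.t4 a (\<theta> u) v w)))"
 unfolding PT.Fr_def by (rule sw_cong[OF refl gh mT mT PT.mM4], rule sw_\<mu>[OF _ _ PT.mM4]) (assumption | rule ll)+
also have "... = sde PT.M4 h (%g k. sga PT.M4 g (%a b. sga PT.M4 k (%v w. PT.t4 a (\<theta> b) v w)))"
 by (rule gamma_coact2[where F = "%a u k. sga PT.M4 k (%v w. PT.t4 a (\<theta> u) v w)", OF h _ PT.mM4]) (assumption | rule ll)+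
also have "... = sde PT.M4 h (%g k. sw PT.M4 (\<gamma> (S g)) (%p q. sga PT.M4 k (%v w. PT.t4 q p v w)))"
 by (rule Delta_cong[OF h PT.mM4],
  rule gamma_theta[where F = "%a b. sga PT.M4 k (%v w. PT.t4 a b v w)" for k, OF _ _ PT.mM4]) (assumption | rule ll)+
also have "... = sde PT.M4 h (%g k. sga PT.M4 k (%u b. sw PT.M4 (\<gamma> (S g)) (%v w. PT.t4 w v u b)))"
 by (rule Delta_cong[OF h PT.mM4], rule sw_swap[OF _ _ mT mT mT mT PT.mM4]) (assumption | rule ll)+
also have "... = sga PT.M4 h (%a b. srh PT.M4 a (%u k. sga PT.M4 k (%v w. PT.t4 w v u b)))"
 by (rule gamma_coact1[where F = "%u k b. sga PT.M4 k (%v w. PT.t4 w v u b)", OF h _ PT.mM4, symmetric]) (assumption | rule ll)+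
also have "... = PT.Gr (\<gamma> h)"
 unfolding PT.Gr_def by (rule sw_cong[OF refl gh mT mT PT.mM4], rule sw_\<mu>[OF _ _ PT.mM4, symmetric]) (assumption | rule ll)+
finally show ?thesis using gh by (simp add: PT.Cr_def)
qed

lemma gamma_image: "submodule (\<gamma> ` cH) R TT"
by (rule image_submodule[OF mH mTT \<gamma>_hom])

lemma gamma_tens_in:
assumes "h:cH" "t:cT"
shows "tn TT T (\<gamma> h) t:tmp R TT T id id ` car (tp R (sub TT (\<gamma> ` cH)) T)"
proof -
note mC = sub_module[OF gamma_image mTT]
have c: "\<gamma> h:car (sub TT (\<gamma> ` cH))" using assms by simp
show ?thesis
 using tmap_tens[OF incl_hom(4)[OF submod_sub[OF gamma_image]] id_hom mC mT mTT mT c assms(2)] tens_in[OF c assms(2) mC mT]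
 by (intro image_eqI[where x = "tens R (sub TT (\<gamma> ` cH)) T (\<gamma> h) t"]) simp_all
qed

lemma im_gamma: "submodule (tmp R TT T id id ` car (tp R (sub TT (\<gamma> ` cH)) T)) R PT.MT"
by (rule image_submodule[OF mod_tens[OF sub_module[OF gamma_image mTT] mT] PT.mMT
 tmap_hom[OF incl_hom(4)[OF submod_sub[OF gamma_image]] id_hom sub_module[OF gamma_image mTT] mT mTT mT]])

lemma coact_gamma_MT:
assumes x: "x:cT" and g: "g:Hom R T T"
shows "sw3 PT.MT (\<mu> x) (%u v w. tn TT T (tTT v w) (g u)):tmp R TT T id id ` car (tp R (sub TT (\<gamma> ` cH)) T)"
proof -
note ll = lk x hom_comp[OF g] hom_mem[OF g]
have "sw3 PT.MT (\<mu> x) (%u v w. tn TT T (tTT v w) (g u)) = srh PT.MT x (%u h. sga PT.MT h (%v w. tn TT T (tTT v w) (g u)))"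
 by (rule sw_\<mu>[OF x _ PT.mMT]) (assumption | rule ll)+
also have "... = srh PT.MT x (%u h. tn TT T (\<gamma> h) (g u))"
proof (rule rho_cong[OF x PT.mMT])
 fix u h assume u: "u:cT" "h:cH"
 have "tn TT T (sw TT (\<gamma> h) tTT) (g u) = sga PT.MT h (%v w. tn TT T (tTT v w) (g u))"
 by (rule sw_hom[OF lin_tens1[OF lin_id] \<gamma>(1)[OF u(2)] _ mT mT mTT PT.mMT]) (assumption | rule ll u)+
 then show "sga PT.MT h (%v w. tn TT T (tTT v w) (g u)) = tn TT T (\<gamma> h) (g u)"
 by (simp add: sw_self[OF \<gamma>(1)[OF u(2)] mT mT])
qed (assumption | rule ll)+
also have "...:tmp R TT T id id ` car (tp R (sub TT (\<gamma> ` cH)) T)"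
 by (rule sw_submodule[OF im_gamma \<rho>_closed[OF x] mT mH PT.mMT], rule gamma_tens_in) (assumption | rule ll)+
finally show ?thesis .
qed

text \<open>For the inclusion into the image, \<open>Cr_expand\<close> writes
  \<open>U \<otimes> 1\<close> with its tensor-square legs taken from \<open>\<mu>\<close>, and
  these already lie in the image of \<open>\<gamma>\<close>. Descent then applies to that
  image.\<close>

lemma Cr_eq: "PT.Cr = \<gamma> ` cH"
proof
show "\<gamma> ` cH <= PT.Cr" using gamma_in_Cr by auto
show "PT.Cr <= \<gamma> ` cH"
proof
 fix U assume U: "U:PT.Cr"
 have c: "U:car TT" by (rule PT.Cr_D(1)[OF U])
 show "U:\<gamma> ` cH"
 proof (rule descent_submodule[OF mTT gamma_image c])
 show "tn TT T U eT:tmp R TT T id id ` car (tp R (sub TT (\<gamma> ` cH)) T)"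
  unfolding PT.Cr_expand[OF U, symmetric]
  by (rule sw_submodule[OF im_gamma c mT mT PT.mMT], rule coact_gamma_MT) (assumption | rule lk)+
 qed
qed
qed

text \<open>\<open>\<beta>\<close> recovers \<open>1 \<otimes> h\<close> from
  \<open>\<gamma>(h)\<close>, and descent recovers \<open>h\<close>.\<close>

lemma gamma_inj:
assumes "h:cH" "k:cH" "\<gamma> h = \<gamma> k"
shows "h = k"
proof (rule descent_eq[OF mH assms(1,2)])
have b: "bilin R T H (tp R H T) (%t h. tn H T h t)" by (assumption | rule lk)+
note m = mod_tens[OF mH mT]
have "tTH eT h = tTH eT k" using \<gamma>(2)[OF assms(1)] \<gamma>(2)[OF assms(2)] assms(3) by simp
then show "tn H T h eT = tn H T k eT"
 using sw_tens[OF b one_closed assms(1) mT mH m] sw_tens[OF b one_closed assms(2) mT mH m] by simp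
qed

text \<open>The isomorphism is the inverse of \<open>\<gamma>\<close> on its image. Compatibility
  with comultiplication comes from \<open>gamma_coact2\<close>, compatibility with the counit from
  \<open>gamma_mult_one\<close>.\<close>

lemma Hr_isomorphic: "hopf_isomorphic R K H"
proof -
obtain \<rho>' D' where h: "right_sub R T \<mu> PT.Cr \<rho>' (%a u. \<theta> u ** a)" "K = make_bialg (sub PT.P2 PT.Cr) (induced_comult R PT.P2 PT.Cr D') (induced_counit R T)"
 "sub_bialgebra R T PT.P2 PT.Cr PT.Dr (nabla T) (induced_comult R PT.P2 PT.Cr D') (induced_counit R T)"
 "bialgebra R K" "is_antipode R K PT.Sr"
proof (rule PT.Hr_hopf)
 note ob = that
 show "tTT eT eT:PT.Cr" using gamma_in_Cr[OF H.one_closed] by (simp add: gamma_one)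
 show "x \<otimes>\<^bsub>PT.P2\<^esub> y:PT.Cr" if xy: "x:PT.Cr" "y:PT.Cr" for x y
 proof -
 obtain k l where "k:cH" "l:cH" "x = \<gamma> k" "y = \<gamma> l" using xy unfolding Cr_eq by (elim imageE) simp
 then show ?thesis using gamma_in_Cr[OF H.m_closed[of k l]] by (simp add: gamma_mult)
 qed
 show "sw3 PT.MT (\<mu> x) (%u v w. tn TT T (tTT v w) u):tmp R TT T id id ` car (tp R (sub TT PT.Cr) T)" if x: "x:cT" for x
 unfolding Cr_eq by (rule coact_gamma_MT[OF x lin_id])
 show "PT.Sr U:PT.Cr" if U: "U:PT.Cr" for U
 proof -
 obtain k where k: "k:cH" "U = \<gamma> k" using U unfolding Cr_eq by (elim imageE) simp
 have Sk: "S k:cH" by (rule lk k)+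
 \<comment> \<open>\<open>gamma_theta\<close> with the two legs exchanged says that
   \<open>\<gamma>\<close> carries \<open>S\<close> to \<open>Sr\<close>.\<close>
 have "PT.Sr (\<gamma> k) = sw TT (\<gamma> (S k)) (%p q. tTT p q)"
  unfolding PT.Sr_def by (rule gamma_theta[where F = "%x y. tTT y x", OF k(1) _ mTT]) (assumption | rule lk)+
 then show ?thesis using gamma_in_Cr[OF Sk] sw_self[OF \<gamma>(1)[OF Sk] mT mT] k by simp
 qed
 fix \<rho>' D' assume h: "right_sub R T \<mu> PT.Cr \<rho>' (%a u. \<theta> u ** a)" "K = make_bialg (sub PT.P2 PT.Cr) (induced_comult R PT.P2 PT.Cr D') (induced_counit R T)"
 "sub_bialgebra R T PT.P2 PT.Cr PT.Dr (nabla T) (induced_comult R PT.P2 PT.Cr D') (induced_counit R T)"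
 "bialgebra R K" "is_antipode R K PT.Sr"
 show thesis by (rule ob[OF h])
qed
interpret B: sub_bialgebra R T PT.P2 PT.Cr PT.Dr "nabla T" "induced_comult R PT.P2 PT.Cr D'" "induced_counit R T" by (rule h(3))
define f where "f = inv_into (cH) \<gamma>"
have f: "f (\<gamma> k) = k" if "k:cH" for k
 unfolding f_def by (rule inv_into_f_f[OF _ that]) (rule inj_onI[OF gamma_inj])
have K: "car K = \<gamma> ` cH" "x \<oplus>\<^bsub>K\<^esub> y = x \<oplus>\<^bsub>TT\<^esub> y" "r \<odot>\<^bsub>K\<^esub> x = r \<odot>\<^bsub>TT\<^esub> x" "x \<otimes>\<^bsub>K\<^esub> y = x \<otimes>\<^bsub>PT.P2\<^esub> y" "\<one>\<^bsub>K\<^esub> = \<gamma> eH" for x y r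
 using PT.same_P2 Cr_eq unfolding h(2) by (simp_all add: same_module_def gamma_one PT.P2_one)
have fh: "f:Hom R K H"
proof (rule mod_homI)
 fix x y assume "x:car K" "y:car K"
 then obtain k l where k: "k:cH" "l:cH" "x = \<gamma> k" "y = \<gamma> l" unfolding K(1) by (elim imageE) simp
 then show "f (x \<oplus>\<^bsub>K\<^esub> y) = f x \<oplus>\<^bsub>H\<^esub> f y" using f[OF H.a_closed[OF k(1,2)]] by (simp add: K f mod_hom_add[OF \<gamma>_hom])
next
 fix x r assume "x:car K" and r: "r:car R"
 then obtain k where k: "k:cH" "x = \<gamma> k" unfolding K(1) by (elim imageE) simp
 then show "f (r \<odot>\<^bsub>K\<^esub> x) = r \<odot>\<^bsub>H\<^esub> f x" using f[OF H.smult_closed[OF r k(1)]] r by (simp add: K f hom_smult[OF \<gamma>_hom])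
next
 fix x assume "x:car K"
 then obtain k where k: "k:cH" "x = \<gamma> k" unfolding K(1) by (elim imageE) simp
 then show "f x:cH" by (simp add: f)
qed
have fa: "f:alg_hom R K H"
proof (rule alg_homI[OF fh])
 fix x y assume "x:car K" "y:car K"
 then obtain k l where k: "k:cH" "l:cH" "x = \<gamma> k" "y = \<gamma> l" unfolding K(1) by (elim imageE) simp
 then show "f (x \<otimes>\<^bsub>K\<^esub> y) = f x \<star> f y" using f[OF H.m_closed[OF k(1,2)]] by (simp add: K f gamma_mult)
qed (simp add: K f)
have bij: "bij_betw f (car K) (cH)"
 by (rule bij_betw_byWitness[where f' = \<gamma>]) (use f in \<open>auto simp: K\<close>)
have cc: "comult H (f c) = tmp R H H f f (comult K c) & counit H (f c) = counit K c" if cK: "c:car K" for c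
proof -
 obtain k where k: "k:cH" "c = \<gamma> k" using cK unfolding K(1) by (elim imageE) simp
 have c: "c:PT.Cr" using k gamma_in_Cr by simp
 let ?\<D> = "induced_comult R PT.P2 PT.Cr D'"
 note \<D>k = \<D>_closed[OF k(1)]
 have \<gamma>B: "\<gamma>:Hom R H B.B"
 using gamma_in_Cr alg_homD(1)[OF gamma_alg] by (intro sub_hom(3)) auto
 have g2: "tmp R B.B B.B \<gamma> \<gamma>:Hom R HH (tp R B.B B.B)"
 by (rule tmap_hom[OF \<gamma>B \<gamma>B mH mH B.mB B.mB])
 note ll = lk k
 \<comment> \<open>This shows that \<open>Dr\<close> after \<open>\<gamma>\<close> is
   \<open>(\<gamma> \<otimes> \<gamma>)\<close> after the comultiplication; injectivity of the
   inclusion transfers it to the corestriction.\<close>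
 have "PT.Dr (\<gamma> k) = sga PT.MM k (%a b. srh PT.MM b (%u l. sga PT.MM l (%v w. PT.tt a u v w)))"
 unfolding PT.Dr_def by (rule gamma_cong[OF k(1) PT.mMM], rule sw_\<mu>[OF _ _ PT.mMM]) (assumption | rule ll)+
 also have "... = sde PT.MM k (%g l. sga PT.MM g (%a u. sga PT.MM l (%v w. PT.tt a u v w)))"
 by (rule gamma_coact2[where F = "%a u l. sga PT.MM l (%v w. PT.tt a u v w)", OF k(1) _ PT.mMM]) (assumption | rule ll)+
 also have "... = sde PT.MM k (%g l. tn TT TT (\<gamma> g) (\<gamma> l))"
 proof (rule sw_cong[OF refl \<D>k mH mH PT.mMM])
 fix g l assume g: "g:cH" "l:cH"
 have "sga PT.MM g (%a u. sga PT.MM l (%v w. PT.tt a u v w)) = sga PT.MM g (%a u. tn TT TT (tTT a u) (sw TT (\<gamma> l) tTT))"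
  by (rule gamma_cong[OF g(1) PT.mMM], rule sw_hom[OF lin_tens2[OF lin_id] \<gamma>(1)[OF g(2)] _ mT mT mTT PT.mMM, symmetric])
  (assumption | rule ll g)+
 also have "... = tn TT TT (sw TT (\<gamma> g) tTT) (sw TT (\<gamma> l) tTT)"
  by (rule sw_hom[OF lin_tens1[OF lin_id] \<gamma>(1)[OF g(1)] _ mT mT mTT PT.mMM, symmetric]) (assumption | rule ll g)+
 finally show "sga PT.MM g (%a u. sga PT.MM l (%v w. PT.tt a u v w)) = tn TT TT (\<gamma> g) (\<gamma> l)"
  by (simp add: sw_self[OF \<gamma>(1)[OF g(1)] mT mT] sw_self[OF \<gamma>(1)[OF g(2)] mT mT])
 qed (assumption | rule ll)+
 also have "... = tmp R TT TT id id (tmp R B.B B.B \<gamma> \<gamma> (\<D> k))"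
 proof -
 have i: "id:Hom R B.B TT" using B.incl unfolding same_mhom[OF same_refl PT.same_P2] .
 show ?thesis
  unfolding tensor_map_comp[OF \<gamma>B \<gamma>B i i mH mH B.mB B.mB mTT mTT \<D>k] id_apply
  by (rule tensor_map_sw[OF \<gamma>_hom \<gamma>_hom mH mH mTT mTT \<D>k, symmetric])
 qed
 finally have "?\<D> c = tmp R B.B B.B \<gamma> \<gamma> (\<D> k)"
 by (intro B.inj2[OF B.\<D>_closed[OF c] hom_mem[OF g2 \<D>k]])
  (simp add: B.\<D>_incl[OF c, unfolded same_tmap[OF PT.same_P2 PT.same_P2] k(2)] k(2) same_tmap[OF PT.same_P2 PT.same_P2])
 moreover have fB: "f:Hom R B.B H" using fh unfolding h(2) by (simp add: mod_hom_def)
 ultimately have "tmp R H H f f (comult K c) = tmp R H H (%x. f (\<gamma> x)) (%x. f (\<gamma> x)) (\<D> k)"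
 using tensor_map_comp[OF \<gamma>B \<gamma>B fB fB mH mH B.mB B.mB mH mH \<D>k] unfolding h(2) by simp
 then have 1: "tmp R H H f f (comult K c) = \<D> (f c)"
 using tensor_map_id[OF mH mH \<D>k] f by (simp add: k)
 have "nabla T (\<gamma> k) = sga T k (%a b. a ** b)"
 by (rule PT.sw_nabla[OF \<gamma>(1)[OF k(1)] lin_id mT, symmetric])
 also have "... = \<e> k *s eT" by (rule gamma_mult_one[OF k(1) lin_id mT])
 finally have "induced_counit R T c = \<e> k"
 using B.N_\<e>[OF c] B.\<e>_closed[OF c] \<e>_closed[OF k(1)] k(2) by (intro unit_inj) simp_all
 then show ?thesis using 1 k(1) unfolding h(2) by (simp add: k(2) f)
qed
show ?thesis
 unfolding hopf_isomorphic_def hopf_algebra_def using h(4,5) bialgebra antipode fa bij cc by (intro conjI exI bexI[of _ f] ballI) auto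
qed

end

section \<open>Identification of \<open>Hl\<close> with \<open>L_hopf\<close>\<close>

context hopf_galois
begin

abbreviation "TTH == tp R TT H"
abbreviation "tQ == tn TT H"

lemma mTTH: "module R TTH" by (rule mod_tens[OF mTT mH])

lemmas lc = lk mTTH

definition "cod U = sw TTH U (%a b. srh TTH a (%s k. srh TTH b (%t l. tQ (tTT s t) (k \<star> l))))"

lemma bilin_cod: "bilin R T T TTH (%a b. srh TTH a (%s k. srh TTH b (%t l. tQ (tTT s t) (k \<star> l))))"
by (assumption | rule lc)+

lemma cod_hom: "cod:Hom R TT TTH"
unfolding cod_def[abs_def] by (rule sw_mhom[OF bilin_cod mT mT mTTH])

lemma cod_t2: "a:cT==>b:cT==>cod (tTT a b) = srh TTH a (%s k. srh TTH b (%t l. tQ (tTT s t) (k \<star> l)))"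
unfolding cod_def by (rule sw_tens[OF bilin_cod _ _ mT mT mTTH])

lemma codiagonal_eq:
assumes "U:car TT"
shows "codiagonal_coaction R H T \<rho> U = cod U"
unfolding codiagonal_coaction_def Let_def cod_def
proof (rule tensor_lift_sw'[OF mT mT mTTH assms bilin_cod], rule tensor_lift_sw'[OF mT mH mTTH])
fix x y s k assume x: "x:cT" "y:cT" "s:cT" "k:cH"
show "tensor_lift TTH (%t l. tQ (tTT s t) (k \<star> l)) (\<rho> y) = srh TTH y (%t l. tQ (tTT s t) (k \<star> l))"
 by (rule tlift_sw[OF mT mH mTTH]) (assumption | rule lc x)+
qed (assumption | rule lc)+

text \<open>Coassociativity of \<open>\<rho>\<close> brings the two neighbouring \<open>H\<close>
  legs together, where the antipode relation and the counit remove them.\<close>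

lemma coact_cancel:
assumes a: "a:cT" and F: "bilin R T H P F" "module R P"
shows "srh P a (%s k. srh P s (%t m. F t (S m \<star> k))) = F a eH"
 "srh P a (%s k. srh P s (%t m. F t (m \<star> S k))) = F a eH"
proof -
note ll = lc bilin_lin[OF F(1)] bilin_in[OF F(1)] F(2)
have e: "srh P a (%s k. sde P k (%m k. F s (G m k))) = F a eH"
 if G: "!!k. k:cH==>sw H (\<D> k) G = \<e> k \<odot>\<^bsub>H\<^esub> eH" and b: "bilin R H H H G" for G
proof -
 note lG = bilin_lin[OF b] bilin_in[OF b]
 have "srh P a (%s k. sde P k (%m k. F s (G m k))) = srh P a (%s k. \<e> k \<odot>\<^bsub>P\<^esub> F s eH)"
 proof (rule rho_cong[OF a F(2)])
 fix s k assume s: "s:cT" "k:cH"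
 have f: "F s:Hom R H P" using F(1) s by (simp add: bilin_def)
 have "sde P k (%m k. F s (G m k)) = F s (sw H (\<D> k) G)"
  by (rule sw_hom[OF f \<D>_closed[OF s(2)] _ mH mH mH F(2), symmetric]) (assumption | rule lG)+
 then show "sde P k (%m k. F s (G m k)) = \<e> k \<odot>\<^bsub>P\<^esub> F s eH"
  by (simp add: G[OF s(2)] hom_smult[OF f \<e>_closed[OF s(2)]])
 qed (assumption | rule ll lG)+
 also have "... = F a eH" by (rule coact_counit[where g = "%s. F s eH", OF a _ F(2)]) (assumption | rule ll)+
 finally show ?thesis .
qed
have b: "bilin R H H H (%m k. S m \<star> k)" "bilin R H H H (%m k. m \<star> S k)" by (assumption | rule ll)+
have "srh P a (%s k. srh P s (%t m. F t (S m \<star> k))) = srh P a (%s k. sde P k (%m k. F s (S m \<star> k)))"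
 by (rule coact_coassoc[where F = "%t m k. F t (S m \<star> k)", OF a _ F(2)]) (assumption | rule ll)+
then show "srh P a (%s k. srh P s (%t m. F t (S m \<star> k))) = F a eH"
 using e[OF antipodeD(2)[OF antipode] b(1)] by simp
have "srh P a (%s k. srh P s (%t m. F t (m \<star> S k))) = srh P a (%s k. sde P k (%m k. F s (m \<star> S k)))"
 by (rule coact_coassoc[where F = "%t m k. F t (m \<star> S k)", OF a _ F(2)]) (assumption | rule ll)+
then show "srh P a (%s k. srh P s (%t m. F t (m \<star> S k))) = F a eH"
 using e[OF antipodeD(3)[OF antipode] b(2)] by simp
qed

text \<open>Coinvariance \<open>a\<^sub>0 \<otimes> b\<^sub>0 \<otimes> a\<^sub>1 b\<^sub>1 = a \<otimes> b \<otimes> 1\<close> is equivalent to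
\<open>a\<^sub>0 \<otimes> b \<otimes> S(a\<^sub>1) = a \<otimes> b\<^sub>0 \<otimes> b\<^sub>1\<close>, which no longer involves products in \<open>H\<close>.\<close>

definition "colin_l U = sw TTH U (%a b. srh TTH a (%u k. tQ (tTT u b) (S k)))"
definition "colin_r U = sw TTH U (%a b. srh TTH b (%u k. tQ (tTT a u) k))"

lemma bilin_colin: "bilin R T T TTH (%a b. srh TTH a (%u k. tQ (tTT u b) (S k)))"
"bilin R T T TTH (%a b. srh TTH b (%u k. tQ (tTT a u) k))"
by (assumption | rule lc)+

lemma colin_hom: "colin_l:Hom R TT TTH" "colin_r:Hom R TT TTH"
unfolding colin_l_def[abs_def] colin_r_def[abs_def] by (rule sw_mhom bilin_colin mT mTTH)+

lemma colin_t2: "a:cT==>b:cT==>colin_l (tTT a b) = srh TTH a (%u k. tQ (tTT u b) (S k))"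
"a:cT==>b:cT==>colin_r (tTT a b) = srh TTH b (%u k. tQ (tTT a u) k)"
unfolding colin_l_def colin_r_def by (rule sw_tens bilin_colin mT mTTH | assumption)+

text \<open>The auxiliary map \<open>A c\<close> coacts on the first leg and multiplies
  \<open>c\<close> of the new \<open>H\<close> leg from the left. For \<open>c = S\<close> it
  carries \<open>cod U\<close> to \<open>colin_r U\<close> and \<open>U \<otimes> 1\<close> to
  \<open>colin_l U\<close>, and for the identity it leads back, so the two equations are
  equivalent.\<close>

lemma cod_iff_colin:
assumes U: "U:car TT"
shows "cod U = tQ U eH \<longleftrightarrow> colin_l U = colin_r U"
proof -
define A where "A c \<zeta> = sw TTH \<zeta> (%m k. sw TTH m (%s t. srh TTH s (%s' l. tQ (tTT s' t) (c l \<star> k))))" for c \<zeta>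
have A: "A c:Hom R TTH TTH" and At: "!!s t k. s:cT==>t:cT==>k:cH ==>
 A c (tQ (tTT s t) k) = srh TTH s (%s' l. tQ (tTT s' t) (c l \<star> k))" if c: "c:Hom R H H" for c
proof -
 note ll = lc hom_comp[OF c] hom_mem[OF c]
 have b: "bilin R TT H TTH (%m k. sw TTH m (%s t. srh TTH s (%s' l. tQ (tTT s' t) (c l \<star> k))))" by (assumption | rule ll)+
 show "A c:Hom R TTH TTH" unfolding A_def[abs_def] by (rule sw_mhom[OF b mTT mH mTTH])
 fix s t k assume x: "s:cT" "t:cT" "k:cH"
 have b': "bilin R T T TTH (%s t. srh TTH s (%s' l. tQ (tTT s' t) (c l \<star> k)))" by (assumption | rule ll x)+
 have st: "tTT s t:car TT" by (rule ll x)+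
 show "A c (tQ (tTT s t) k) = srh TTH s (%s' l. tQ (tTT s' t) (c l \<star> k))"
 unfolding A_def sw_tens[OF b st x(3) mTT mH mTTH] by (rule sw_tens[OF b' x(1,2) mT mT mTTH])
qed
note i = lin_id[of R H]
note l1 = lin_tens1[OF lin_id H.one_closed mTT mH]
have "A S (cod U) = colin_r U"
proof (rule tens_heq[OF mT mT U hom_comp[OF A[OF S_hom] cod_hom] colin_hom(2)])
 fix a b assume ab: "a:cT" "b:cT"
 note ll = lc ab
 have "A S (cod (tTT a b)) = srh TTH a (%s k. A S (srh TTH b (%t l. tQ (tTT s t) (k \<star> l))))" (is "?lh = _")
 unfolding cod_t2[OF ab] by (rule sw_hom[OF A[OF S_hom] \<rho>_closed[OF ab(1)] _ mT mH mTTH mTTH]) (assumption | rule ll)+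
 also have "... = srh TTH a (%s k. srh TTH b (%t l. srh TTH s (%s' m. tQ (tTT s' t) (S m \<star> k \<star> l))))"
 proof (rule rho_cong[OF ab(1) mTTH])
 fix s k assume s: "s:cT" "k:cH"
 have "A S (srh TTH b (%t l. tQ (tTT s t) (k \<star> l))) = srh TTH b (%t l. A S (tQ (tTT s t) (k \<star> l)))" (is "?lh = _")
  by (rule sw_hom[OF A[OF S_hom] \<rho>_closed[OF ab(2)] _ mT mH mTTH mTTH]) (assumption | rule ll s)+
 also have "... = srh TTH b (%t l. srh TTH s (%s' m. tQ (tTT s' t) (S m \<star> (k \<star> l))))"
  by (rule rho_cong[OF ab(2) mTTH], rule At[OF S_hom]) (assumption | rule hom_mem[OF A[OF S_hom]] | rule ll s)+
 also have "... = srh TTH b (%t l. srh TTH s (%s' m. tQ (tTT s' t) (S m \<star> k \<star> l)))"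
  by (rule rho_cong[OF ab(2) mTTH], rule rho_cong[OF s(1) mTTH],
   simp add: H.m_assoc s hom_mem[OF S_hom]) (assumption | rule ll s)+
 finally show "?lh =
..." .
 qed (assumption | rule hom_mem[OF A[OF S_hom]] | rule ll)+
 also have "... = srh TTH b (%t l. srh TTH a (%s k. srh TTH s (%s' m. tQ (tTT s' t) (S m \<star> k \<star> l))))"
 by (rule sw_swap[OF \<rho>_closed[OF ab(1)] \<rho>_closed[OF ab(2)] mT mH mT mH mTTH]) (assumption | rule ll)+
 also have "... = srh TTH b (%t l. tQ (tTT a t) (eH \<star> l))"
 by (rule rho_cong[OF ab(2) mTTH],
  rule coact_cancel(1)[where F = "%s h. tQ (tTT s t) (h \<star> l)" for t l, OF ab(1) _ mTTH]) (assumption | rule ll)+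
 also have "... = colin_r (tTT a b)"
 unfolding colin_t2[OF ab] by (rule rho_cong[OF ab(2) mTTH], simp) (assumption | rule ll)+
 finally show "?lh = ..." .
qed
moreover have "A S (tQ U eH) = colin_l U"
proof (rule tens_heq[OF mT mT U hom_comp[OF A[OF S_hom] l1] colin_hom(1)])
 fix a b assume ab: "a:cT" "b:cT"
 show "A S (tQ (tTT a b) eH) = colin_l (tTT a b)"
 unfolding colin_t2[OF ab] At[OF S_hom ab H.one_closed]
 by (rule rho_cong[OF ab(1) mTTH], simp add: hom_mem[OF S_hom]) (assumption | rule lc ab)+
qed
moreover have "A (%x. x) (colin_r U) = cod U"
proof (rule tens_heq[OF mT mT U hom_comp[OF A[OF i] colin_hom(2)] cod_hom])
 fix a b assume ab: "a:cT" "b:cT"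
 note ll = lc ab
 have "A (%x. x) (colin_r (tTT a b)) = srh TTH b (%u k. A (%x. x) (tQ (tTT a u) k))" (is "?lh = _")
 unfolding colin_t2[OF ab] by (rule sw_hom[OF A[OF i] \<rho>_closed[OF ab(2)] _ mT mH mTTH mTTH]) (assumption | rule ll)+
 also have "... = srh TTH b (%u k. srh TTH a (%s l. tQ (tTT s u) (l \<star> k)))"
 by (rule rho_cong[OF ab(2) mTTH], rule At[OF i]) (assumption | rule hom_mem[OF A[OF i]] | rule ll)+
 also have "... = cod (tTT a b)"
 unfolding cod_t2[OF ab] by (rule sw_swap[OF \<rho>_closed[OF ab(2)] \<rho>_closed[OF ab(1)] mT mH mT mH mTTH]) (assumption | rule ll)+
 finally show "?lh = ..." .
qed
moreover have "A (%x. x) (colin_l U) = tQ U eH"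
proof (rule tens_heq[OF mT mT U hom_comp[OF A[OF i] colin_hom(1)] l1])
 fix a b assume ab: "a:cT" "b:cT"
 note ll = lc ab
 have "A (%x. x) (colin_l (tTT a b)) = srh TTH a (%u k. A (%x. x) (tQ (tTT u b) (S k)))" (is "?lh = _")
 unfolding colin_t2[OF ab] by (rule sw_hom[OF A[OF i] \<rho>_closed[OF ab(1)] _ mT mH mTTH mTTH]) (assumption | rule ll)+
 also have "... = srh TTH a (%u k. srh TTH u (%s l. tQ (tTT s b) (l \<star> S k)))"
 by (rule rho_cong[OF ab(1) mTTH], rule At[OF i]) (assumption | rule hom_mem[OF A[OF i]] | rule ll)+
 also have "... = tQ (tTT a b) eH"
 by (rule coact_cancel(2)[where F = "%s h. tQ (tTT s b) h", OF ab(1) _ mTTH]) (assumption | rule ll)+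
 finally show "?lh = ..." .
qed
ultimately show ?thesis by metis
qed

text \<open>Replacing the \<open>H\<close> leg by its translation map, as \<open>Q\<close> does,
  turns the two sides into \<open>Fl\<close> and \<open>Gl\<close>; for the side with
  \<open>S\<close> this is \<open>gamma_theta\<close>. Conversely \<open>?F\<close> recovers the
  \<open>H\<close> leg by \<open>gamma_contract\<close>, at the price of an additional leg 1 that
  descent removes.\<close>

lemma colin_iff_Cl:
assumes U: "U:car TT"
shows "colin_l U = colin_r U \<longleftrightarrow> PT.Fl U = PT.Gl U"
proof
let ?M = PT.M4
define Q where "Q \<zeta> = sw ?M \<zeta> (%m k. sw ?M m (%s t. sga ?M k (%p q. PT.t4 s q p t)))" for \<zeta>
have b: "bilin R TT H ?M (%m k. sw ?M m (%s t. sga ?M k (%p q. PT.t4 s q p t)))" by (assumption | rule lc)+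
have Q: "Q:Hom R TTH ?M" unfolding Q_def[abs_def] by (rule sw_mhom[OF b mTT mH PT.mM4])
have Qt: "Q (tQ (tTT s t) k) = sga ?M k (%p q. PT.t4 s q p t)" if x: "s:cT" "t:cT" "k:cH" for s t k
proof -
 have st: "tTT s t:car TT" by (rule lc x)+
 show ?thesis unfolding Q_def sw_tens[OF b st x(3) mTT mH PT.mM4] by (rule sw_tens[OF _ x(1,2) mT mT PT.mM4]) (assumption | rule lc x)+
qed
have "PT.Fl U = Q (colin_l U)"
proof (rule tens_heq[OF mT mT U PT.FG_hom(3) hom_comp[OF Q colin_hom(1)]])
 fix a b assume ab: "a:cT" "b:cT"
 note ll = lc ab hom_mem[OF Q]
 have "PT.Fl (tTT a b) = srh ?M a (%u k. sga ?M k (%v w. PT.t4 u v (\<theta> w) b))"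
 unfolding PT.FG_t2(3)[OF ab] by (rule sw_\<mu>[OF ab(1) _ PT.mM4]) (assumption | rule ll)+
 also have "... = srh ?M a (%u k. sw ?M (\<gamma> (S k)) (%p q. PT.t4 u q p b))"
 by (rule rho_cong[OF ab(1) PT.mM4], rule gamma_theta[where F = "%v w. PT.t4 u v w b" for u, OF _ _ PT.mM4]) (assumption | rule ll)+
 also have "... = srh ?M a (%u k. Q (tQ (tTT u b) (S k)))"
 by (rule rho_cong[OF ab(1) PT.mM4], rule Qt[symmetric]) (assumption | rule ll)+
 also have "... = Q (colin_l (tTT a b))"
 unfolding colin_t2[OF ab] by (rule sw_hom[OF Q \<rho>_closed[OF ab(1)] _ mT mH mTTH PT.mM4, symmetric]) (assumption | rule ll)+
 finally show "PT.Fl (tTT a b) = ..." .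
qed
moreover have "PT.Gl U = Q (colin_r U)"
proof (rule tens_heq[OF mT mT U PT.FG_hom(4) hom_comp[OF Q colin_hom(2)]])
 fix a b assume ab: "a:cT" "b:cT"
 note ll = lc ab hom_mem[OF Q]
 have "PT.Gl (tTT a b) = srh ?M b (%u k. sga ?M k (%v w. PT.t4 a w v u))"
 unfolding PT.FG_t2(4)[OF ab] by (rule sw_\<mu>[OF ab(2) _ PT.mM4]) (assumption | rule ll)+
 also have "... = srh ?M b (%u k. Q (tQ (tTT a u) k))"
 by (rule rho_cong[OF ab(2) PT.mM4], rule Qt[symmetric]) (assumption | rule ll)+
 also have "... = Q (colin_r (tTT a b))"
 unfolding colin_t2[OF ab] by (rule sw_hom[OF Q \<rho>_closed[OF ab(2)] _ mT mH mTTH PT.mM4, symmetric]) (assumption | rule ll)+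
 finally show "PT.Gl (tTT a b) = ..." .
qed
ultimately show "colin_l U = colin_r U==>PT.Fl U = PT.Gl U" by simp
assume FG: "PT.Fl U = PT.Gl U"
let ?X = "tp R TTH T"
have mX: "module R ?X" by (rule mod_tens[OF mTTH mT])
note lx = lc mX
let ?F = "%s q p t. srh ?X q (%c l. tn TTH T (tQ (tTT s t) l) (p ** c))"
have con: "sga ?X k (%p q. ?F s q p t) = tn TTH T (tQ (tTT s t) k) eT" if x: "s:cT" "t:cT" "k:cH" for s t k
 by (rule gamma_contract[where F = "%x l. tens R TTH T (tQ (tTT s t) l) x", OF x(3) _ mX]) (assumption | rule lx x)+
have "tn TTH T (colin_l U) eT = sw ?X U (%a b. sw3 ?X (\<mu> a) (%u v w. ?F u v (\<theta> w) b))"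
proof (rule tensor_eval[OF lin_tens1[OF colin_hom(1) one_closed mTTH mT] mT mT mX U])
 fix a b assume ab: "a:cT" "b:cT"
 note ll = lx ab
 have "sw3 ?X (\<mu> a) (%u v w. ?F u v (\<theta> w) b) = srh ?X a (%u k. sga ?X k (%v w. ?F u v (\<theta> w) b))"
 by (rule sw_\<mu>[OF ab(1) _ mX]) (assumption | rule ll)+
 also have "... = srh ?X a (%u k. sw ?X (\<gamma> (S k)) (%p q. ?F u q p b))"
 by (rule rho_cong[OF ab(1) mX], rule gamma_theta[where F = "%v w. ?F u v w b" for u, OF _ _ mX]) (assumption | rule ll)+
 also have "... = srh ?X a (%u k. tn TTH T (tQ (tTT u b) (S k)) eT)"
 by (rule rho_cong[OF ab(1) mX], rule con) (assumption | rule ll)+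
 also have "... = tn TTH T (colin_l (tTT a b)) eT"
 unfolding colin_t2[OF ab] by (rule sw_hom[OF lin_tens1[OF lin_id] \<rho>_closed[OF ab(1)] _ mT mH mTTH mX, symmetric]) (assumption | rule ll)+
 finally show "tn TTH T (colin_l (tTT a b)) eT = sw3 ?X (\<mu> a) (%u v w. ?F u v (\<theta> w) b)" by (rule sym)
qed
also have "... = sw ?X U (%a b. sw3 ?X (\<mu> b) (%u v w. ?F a w v u))"
 by (rule PT.FG_apply(2)[where F = ?F, OF mX U _ _ _ _ FG]) (assumption | rule lx)+
also have "... = tn TTH T (colin_r U) eT"
proof (rule tensor_eval[OF lin_tens1[OF colin_hom(2) one_closed mTTH mT] mT mT mX U, symmetric])
 fix a b assume ab: "a:cT" "b:cT"
 note ll = lx ab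
 have "sw3 ?X (\<mu> b) (%u v w. ?F a w v u) = srh ?X b (%u k. sga ?X k (%v w. ?F a w v u))"
 by (rule sw_\<mu>[OF ab(2) _ mX]) (assumption | rule ll)+
 also have "... = srh ?X b (%u k. tn TTH T (tQ (tTT a u) k) eT)"
 by (rule rho_cong[OF ab(2) mX], rule con) (assumption | rule ll)+
 also have "... = tn TTH T (colin_r (tTT a b)) eT"
 unfolding colin_t2[OF ab] by (rule sw_hom[OF lin_tens1[OF lin_id] \<rho>_closed[OF ab(2)] _ mT mH mTTH mX, symmetric]) (assumption | rule ll)+
 finally show "tn TTH T (colin_r (tTT a b)) eT = sw3 ?X (\<mu> b) (%u v w. ?F a w v u)" by (rule sym)
qed
finally show "colin_l U = colin_r U"
 by (rule descent_eq[OF mTTH hom_mem[OF colin_hom(1) U] hom_mem[OF colin_hom(2) U]])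
qed

lemma Cl_eq: "PT.Cl = {U:car TT. cod U = tQ U eH}"
using cod_iff_colin colin_iff_Cl by (auto simp: PT.Cl_def)

lemma coinvariants_Cl: "coinvariants R H TT (codiagonal_coaction R H T \<rho>) = PT.Cl"
unfolding Cl_eq coinvariants_def using codiagonal_eq by auto

lemma Cl_one: "tTT eT eT:PT.Cl"
proof -
have "cod (tTT eT eT) = srh TTH eT (%t l. tQ (tTT eT t) (eH \<star> l))"
 unfolding cod_t2[OF one_closed one_closed] alg_homD(3)[OF \<rho>_alg] tsimps(4)
 by (rule sw_tens[OF _ one_closed H.one_closed mT mH mTTH]) (assumption | rule lc)+
also have "... = tQ (tTT eT eT) (eH \<star> eH)"
 unfolding alg_homD(3)[OF \<rho>_alg] tsimps(4) by (rule sw_tens[OF _ one_closed H.one_closed mT mH mTTH]) (assumption | rule lc)+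
moreover have "tTT eT eT:car TT" by (rule lc)+
ultimately show ?thesis by (simp add: Cl_eq)
qed

text \<open>\<open>Q\<close> trades the \<open>H\<close> leg for its translation map, with the
  middle leg multiplied in from the left. It sends \<open>U \<otimes> 1\<close> to the right-hand
  side; by expanding \<open>v \<otimes> (w ** b)\<close> with \<open>gamma_expand\<close> and
  contracting, it sends \<open>cod U\<close> to the left-hand side.\<close>

lemma Cl_expand:
assumes U: "U:PT.Cl"
shows "sw PT.MT U (%a b. sw3 PT.MT (\<mu> a) (%u v w. tn TT T (tTT u v) (w ** b))) = tn TT T U eT"
proof -
have c: "U:car TT" "cod U = tQ U eH" using U by (simp_all add: Cl_eq)
let ?P = PT.MT
let ?G = "%u t g. sga ?P g (%p q. tn TT T (tTT u (t ** p)) q)"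
define Q where "Q \<zeta> = sw ?P \<zeta> (%m k. sw ?P m (%s t. ?G s t k))" for \<zeta>
have b: "bilin R TT H ?P (%m k. sw ?P m (%s t. ?G s t k))" by (assumption | rule lc)+
have Q: "Q:Hom R TTH ?P" unfolding Q_def[abs_def] by (rule sw_mhom[OF b mTT mH PT.mMT])
have Qt: "Q (tQ (tTT s t) k) = ?G s t k" if x: "s:cT" "t:cT" "k:cH" for s t k
proof -
 have st: "tTT s t:car TT" by (rule lc x)+
 show ?thesis unfolding Q_def sw_tens[OF b st x(3) mTT mH PT.mMT] by (rule sw_tens[OF _ x(1,2) mT mT PT.mMT]) (assumption | rule lc x)+
qed
have "Q (cod U) = sw ?P U (%a b. sw3 ?P (\<mu> a) (%u v w. tn TT T (tTT u v) (w ** b)))"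
proof (rule tensor_eval[OF hom_comp[OF Q cod_hom] mT mT PT.mMT c(1)])
 fix a b assume ab: "a:cT" "b:cT"
 note ll = lc ab hom_mem[OF Q]
 have "sw3 ?P (\<mu> a) (%u v w. tn TT T (tTT u v) (w ** b)) = srh ?P a (%u k. sga ?P k (%v w. tn TT T (tTT u v) (w ** b)))"
 by (rule sw_\<mu>[OF ab(1) _ PT.mMT]) (assumption | rule ll)+
 also have "... = srh ?P a (%u k. srh ?P b (%t l. ?G u t (k \<star> l)))"
 proof (rule rho_cong[OF ab(1) PT.mMT])
 fix u k assume u: "u:cT" "k:cH"
 note lu = ll u
 have "sga ?P k (%v w. tn TT T (tTT u v) (w ** b)) =
  sga ?P k (%v w. srh ?P w (%c g. srh ?P b (%t l. ?G u (v ** c ** t) (g \<star> l))))" (is "?lh = _")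
 proof (rule gamma_cong[OF u(2) PT.mMT])
  fix v w assume v: "v:cT" "w:cT"
  have "tn TT T (tTT u v) (w ** b) = sw ?P (\<rho> (w ** b)) (%c g. ?G u (v ** c) g)"
  by (rule gamma_expand[where F = "%x y. tens R TT T (tTT u x) y", OF v(1) m_closed[OF v(2) ab(2)] _ PT.mMT]) (assumption | rule lu v)+
  also have "... = srh ?P w (%c g. srh ?P b (%t l. ?G u (v ** (c ** t)) (g \<star> l)))"
  by (rule coact_mult[where F = "%c g. ?G u (v ** c) g", OF v(2) ab(2) _ PT.mMT]) (assumption | rule lu v)+
  also have "... = srh ?P w (%c g. srh ?P b (%t l. ?G u (v ** c ** t) (g \<star> l)))"
  by (rule rho_cong[OF v(2) PT.mMT], rule rho_cong[OF ab(2) PT.mMT], simp add: m_assoc v)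
   (assumption | rule lu v)+
  finally show "tn TT T (tTT u v) (w ** b) = ..." .
 qed (assumption | rule lu)+
 also have "... = srh ?P b (%t l. ?G u (eT ** t) (k \<star> l))"
  by (rule gamma_contract[where F = "%x g. srh ?P b (%t l. ?G u (x ** t) (g \<star> l))", OF u(2) _ PT.mMT]) (assumption | rule lu)+
 also have "... = srh ?P b (%t l. ?G u t (k \<star> l))"
  by (rule rho_cong[OF ab(2) PT.mMT], simp) (assumption | rule lu)+
 finally show "?lh = ..." .
 qed (assumption | rule ll)+
 also have "... = srh ?P a (%u k. srh ?P b (%t l. Q (tQ (tTT u t) (k \<star> l))))"
 by (rule rho_cong[OF ab(1) PT.mMT], rule rho_cong[OF ab(2) PT.mMT], rule Qt[symmetric]) (assumption | rule ll)+
 also have "... = srh ?P a (%u k. Q (srh TTH b (%t l. tQ (tTT u t) (k \<star> l))))"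
 by (rule rho_cong[OF ab(1) PT.mMT], rule sw_hom[OF Q \<rho>_closed[OF ab(2)] _ mT mH mTTH PT.mMT, symmetric]) (assumption | rule ll)+
 also have "... = Q (cod (tTT a b))"
 unfolding cod_t2[OF ab] by (rule sw_hom[OF Q \<rho>_closed[OF ab(1)] _ mT mH mTTH PT.mMT, symmetric]) (assumption | rule ll)+
 finally show "Q (cod (tTT a b)) = sw3 ?P (\<mu> a) (%u v w. tn TT T (tTT u v) (w ** b))" by (rule sym)
qed
moreover have "Q (tQ U eH) = tn TT T U eT"
proof (rule tens_heq[OF mT mT c(1) hom_comp[OF Q lin_tens1[OF lin_id H.one_closed mTT mH]] lin_tens1[OF lin_id one_closed mTT mT]])
 fix a b assume ab: "a:cT" "b:cT"
 have "Q (tQ (tTT a b) eH) = tn TT T (tTT a (b ** eT)) eT"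
 unfolding Qt[OF ab H.one_closed] gamma_one by (rule sw_tens[OF _ one_closed one_closed mT mT PT.mMT]) (assumption | rule lc ab)+
 then show "Q (tQ (tTT a b) eH) = tn TT T (tTT a b) eT" using ab by simp
qed
ultimately show ?thesis using c(2) by simp
qed

end

context hopf_galois
begin

text \<open>In the coaction of the product the \<open>H\<close> leg of the second factor stands
  between \<open>k\<close> and \<open>l\<close>, which is what \<open>W\<close> records. Since
  \<open>\<eta>\<close> is coinvariant, this leg is 1 and drops out even though \<open>H\<close> may
  be noncommutative.\<close>

lemma cod_mult:
assumes ab: "a:cT" "b:cT" and \<eta>: "\<eta>:PT.Cl"
shows "cod (tTT a b \<otimes>\<^bsub>PT.Q2\<^esub> \<eta>) = srh TTH a (%s k. srh TTH b (%t l. tQ (tTT s t \<otimes>\<^bsub>PT.Q2\<^esub> \<eta>) (k \<star> l)))"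
proof -
note qm = PT.Q2_m_lin alg_mult_hom(3)[OF PT.Q2_alg PT.same_Q2]
note ll = lc ab qm hom_comp[OF cod_hom] hom_mem[OF cod_hom]
have c: "\<eta>:car TT" "cod \<eta> = tQ \<eta> eH" using \<eta> by (simp_all add: Cl_eq)
define W where "W s k t l \<zeta> = sw TTH \<zeta> (%m g. tQ (tTT s t \<otimes>\<^bsub>PT.Q2\<^esub> m) (k \<star> g \<star> l))" for s k t l \<zeta>
have bW: "bilin R TT H TTH (%m g. tQ (tTT s t \<otimes>\<^bsub>PT.Q2\<^esub> m) (k \<star> g \<star> l))"
 if "s:cT" "t:cT" "k:cH" "l:cH" for s t k l
 by (assumption | rule ll that)+
have "cod (tTT a b \<otimes>\<^bsub>PT.Q2\<^esub> \<eta>) = srh TTH a (%s k. srh TTH b (%t l. W s k t l (cod \<eta>)))"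
proof (rule tens_heq[OF mT mT c(1) hom_comp[OF cod_hom PT.Q2_m_lin(2)[OF _ lin_id]]])
 show "tTT a b:car TT" by (rule ll)+
 show "(%\<eta>. srh TTH a (%s k. srh TTH b (%t l. W s k t l (cod \<eta>)))):Hom R TT TTH"
 unfolding W_def by (assumption | rule ll cod_hom)+
 fix c d assume cd: "c:cT" "d:cT"
 note lx = ll cd
 have "cod (tTT a b \<otimes>\<^bsub>PT.Q2\<^esub> tTT c d) = sw TTH (\<rho> (a ** c)) (%s k. sw TTH (\<rho> (d ** b)) (%t l. tQ (tTT s t) (k \<star> l)))" (is "?lh = _")
 unfolding PT.Q2_mult[OF ab cd] by (rule cod_t2) (rule lx)+
 also have "... = srh TTH a (%s k. srh TTH c (%s' k'. sw TTH (\<rho> (d ** b)) (%t l. tQ (tTT (s ** s') t) (k \<star> k' \<star> l))))"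
 by (rule coact_mult[OF ab(1) cd(1) _ mTTH]) (assumption | rule lx)+
 also have "... = srh TTH a (%s k. srh TTH c (%s' k'. srh TTH d (%t' l'. srh TTH b (%t l. tQ (tTT s t \<otimes>\<^bsub>PT.Q2\<^esub> tTT s' t') (k \<star> (k' \<star> l') \<star> l)))))"
 proof (rule rho_cong[OF ab(1) mTTH], rule rho_cong[OF cd(1) mTTH])
 fix s k s' k' assume s: "s:cT" "k:cH" "s':cT" "k':cH"
 have "sw TTH (\<rho> (d ** b)) (%t l. tQ (tTT (s ** s') t) (k \<star> k' \<star> l)) =
  srh TTH d (%t' l'. srh TTH b (%t l. tQ (tTT (s ** s') (t' ** t)) (k \<star> k' \<star> (l' \<star> l))))"
  by (rule coact_mult[OF cd(2) ab(2) _ mTTH]) (assumption | rule lx s)+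
 also have "... = srh TTH d (%t' l'. srh TTH b (%t l. tQ (tTT s t \<otimes>\<^bsub>PT.Q2\<^esub> tTT s' t') (k \<star> (k' \<star> l') \<star> l)))"
  by (rule rho_cong[OF cd(2) mTTH], rule rho_cong[OF ab(2) mTTH], simp add: PT.Q2_mult H.m_assoc s)
  (assumption | rule lx s)+
 finally show "sw TTH (\<rho> (d ** b)) (%t l. tQ (tTT (s ** s') t) (k \<star> k' \<star> l)) = ..." .
 qed (assumption | rule lx)+
 also have "... = srh TTH a (%s k. srh TTH c (%s' k'. srh TTH b (%t l. srh TTH d (%t' l'. tQ (tTT s t \<otimes>\<^bsub>PT.Q2\<^esub> tTT s' t') (k \<star> (k' \<star> l') \<star> l)))))"
 by (rule rho_cong[OF ab(1) mTTH], rule rho_cong[OF cd(1) mTTH],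
  rule sw_swap[OF \<rho>_closed[OF cd(2)] \<rho>_closed[OF ab(2)] mT mH mT mH mTTH]) (assumption | rule lx)+
 also have "... = srh TTH a (%s k. srh TTH b (%t l. srh TTH c (%s' k'. srh TTH d (%t' l'. tQ (tTT s t \<otimes>\<^bsub>PT.Q2\<^esub> tTT s' t') (k \<star> (k' \<star> l') \<star> l)))))"
 by (rule rho_cong[OF ab(1) mTTH], rule sw_swap[OF \<rho>_closed[OF cd(1)] \<rho>_closed[OF ab(2)] mT mH mT mH mTTH]) (assumption | rule lx)+
 also have "... = srh TTH a (%s k. srh TTH b (%t l. W s k t l (cod (tTT c d))))"
 proof (rule rho_cong[OF ab(1) mTTH], rule rho_cong[OF ab(2) mTTH])
 fix s k t l assume s: "s:cT" "k:cH" "t:cT" "l:cH"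
 note b = bW[OF s(1,3,2,4)] and w = sw_mhom[OF bW[OF s(1,3,2,4)] mTT mH mTTH]
 have "W s k t l (cod (tTT c d)) = srh TTH c (%s' k'. W s k t l (srh TTH d (%t' l'. tQ (tTT s' t') (k' \<star> l'))))"
  unfolding cod_t2[OF cd] W_def by (rule sw_hom[OF w \<rho>_closed[OF cd(1)] _ mT mH mTTH mTTH]) (assumption | rule lx s)+
 also have "... = srh TTH c (%s' k'. srh TTH d (%t' l'. W s k t l (tQ (tTT s' t') (k' \<star> l'))))"
  unfolding W_def by (rule rho_cong[OF cd(1) mTTH], rule sw_hom[OF w \<rho>_closed[OF cd(2)] _ mT mH mTTH mTTH]) (assumption | rule lx s)+
 also have "... = srh TTH c (%s' k'. srh TTH d (%t' l'. tQ (tTT s t \<otimes>\<^bsub>PT.Q2\<^esub> tTT s' t') (k \<star> (k' \<star> l') \<star> l)))"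
  unfolding W_def by (rule rho_cong[OF cd(1) mTTH], rule rho_cong[OF cd(2) mTTH],
  rule sw_tens[OF b _ _ mTT mH mTTH]) (assumption | rule lx s)+
 finally show "srh TTH c (%s' k'. srh TTH d (%t' l'. tQ (tTT s t \<otimes>\<^bsub>PT.Q2\<^esub> tTT s' t') (k \<star> (k' \<star> l') \<star> l))) = W s k t l (cod (tTT c d))"
  by (rule sym)
 qed (assumption | rule lx)+
 finally show "?lh = ..." .
qed
also have "... = srh TTH a (%s k. srh TTH b (%t l. tQ (tTT s t \<otimes>\<^bsub>PT.Q2\<^esub> \<eta>) (k \<star> l)))"
 unfolding c(2)
proof (rule rho_cong[OF ab(1) mTTH], rule rho_cong[OF ab(2) mTTH])
 fix s k t l assume s: "s:cT" "k:cH" "t:cT" "l:cH"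
 show "W s k t l (tQ \<eta> eH) = tQ (tTT s t \<otimes>\<^bsub>PT.Q2\<^esub> \<eta>) (k \<star> l)"
 unfolding W_def using sw_tens[OF bW[OF s(1,3,2,4)] c(1) H.one_closed mTT mH mTTH] s by simp
 show "W s k t l (tQ \<eta> eH):car TTH" unfolding W_def by (assumption | rule ll s c)+
next
 fix s k assume s: "s:cT" "k:cH"
 show "srh TTH b (%t l. W s k t l (tQ \<eta> eH)):car TTH" unfolding W_def by (assumption | rule ll s c)+
qed
finally show ?thesis .
qed

lemma Cl_mult:
assumes "U:PT.Cl" "\<eta>:PT.Cl"
shows "U \<otimes>\<^bsub>PT.Q2\<^esub> \<eta>:PT.Cl"
proof -
note qm = PT.Q2_m_lin alg_mult_hom(3)[OF PT.Q2_alg PT.same_Q2]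
note ll = lc qm
have c: "U:car TT" "cod U = tQ U eH" "\<eta>:car TT" using assms by (simp_all add: Cl_eq)
let ?h = "%\<zeta>. sw TTH \<zeta> (%m g. tQ (m \<otimes>\<^bsub>PT.Q2\<^esub> \<eta>) g)"
have b: "bilin R TT H TTH (%m g. tQ (m \<otimes>\<^bsub>PT.Q2\<^esub> \<eta>) g)" by (assumption | rule ll c)+
have h: "?h:Hom R TTH TTH" by (rule sw_mhom[OF b mTT mH mTTH])
have "cod (U \<otimes>\<^bsub>PT.Q2\<^esub> \<eta>) = ?h (cod U)"
proof (rule tens_heq[OF mT mT c(1) hom_comp[OF cod_hom PT.Q2_m_lin(1)[OF c(3) lin_id]] hom_comp[OF h cod_hom]])
 fix x y assume xy: "x:cT" "y:cT"
 note lx = ll xy c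
 have "?h (cod (tTT x y)) = srh TTH x (%s k. ?h (srh TTH y (%t l. tQ (tTT s t) (k \<star> l))))"
 unfolding cod_t2[OF xy] by (rule sw_hom[OF h \<rho>_closed[OF xy(1)] _ mT mH mTTH mTTH]) (assumption | rule lx)+
 also have "... = srh TTH x (%s k. srh TTH y (%t l. ?h (tQ (tTT s t) (k \<star> l))))"
 by (rule rho_cong[OF xy(1) mTTH], rule sw_hom[OF h \<rho>_closed[OF xy(2)] _ mT mH mTTH mTTH]) (assumption | rule lx)+
 also have "... = srh TTH x (%s k. srh TTH y (%t l. tQ (tTT s t \<otimes>\<^bsub>PT.Q2\<^esub> \<eta>) (k \<star> l)))"
 by (rule rho_cong[OF xy(1) mTTH], rule rho_cong[OF xy(2) mTTH], rule sw_tens[OF b _ _ mTT mH mTTH])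
  (assumption | rule lx)+
 finally show "cod (tTT x y \<otimes>\<^bsub>PT.Q2\<^esub> \<eta>) = ?h (cod (tTT x y))" unfolding cod_mult[OF xy assms(2)] by (rule sym)
qed
also have "... = tQ (U \<otimes>\<^bsub>PT.Q2\<^esub> \<eta>) eH"
 unfolding c(2) by (rule sw_tens[OF b c(1) H.one_closed mTT mH mTTH])
finally show ?thesis using qm(3)[OF c(1,3)] by (simp add: Cl_eq)
qed

text \<open>The codiagonal coaction on the first two legs of \<open>\<mu>(x)\<close> produces, by
  \<open>gamma_coact1\<close>, an \<open>H\<close> leg of the form l S(g) with neighbouring parts.
  The antipode relation makes it trivial, and \<open>flat_equalizer\<close> gives membership over
  \<open>Cl\<close>.\<close>

lemma \<nu>_left_in:
assumes x: "x:cT"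
shows "sw3 PT.MT (\<mu> x) (%u v w. tn TT T (tTT u v) w):tmp R TT T id id ` car (tp R (sub TT PT.Cl) T)"
proof -
let ?P = "tp R TTH T"
let ?\<nu> = "sw3 PT.MT (\<mu> x) (%u v w. tn TT T (tTT u v) w)"
let ?t = "tn TTH T"
have mP: "module R ?P" by (rule mod_tens[OF mTTH mT])
note ll = lc mP x hom_comp[OF cod_hom] hom_mem[OF cod_hom]
have h: "tmp R TTH T \<phi> id ?\<nu> = srh ?P x (%u k. sga ?P k (%v w. ?t (\<phi> (tTT u v)) w))" if \<phi>: "\<phi>:Hom R TT TTH" for \<phi>
proof -
 note t = tmap_hom[OF \<phi> id_hom mTT mT mTTH mT]
 note lp = hom_comp[OF \<phi>] hom_mem[OF \<phi>]
 have "tmp R TTH T \<phi> id ?\<nu> = sw3 ?P (\<mu> x) (%u v w. tmp R TTH T \<phi> id (tn TT T (tTT u v) w))"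
 by (rule T3.hom[OF t]) (assumption | rule ll)+
 also have "... = sw3 ?P (\<mu> x) (%u v w. ?t (\<phi> (tTT u v)) w)"
 by (rule T3.cong, (assumption | rule ll)+, simp add: tmap_tens[OF \<phi> id_hom mTT mT mTTH mT] tens_in[OF _ _ mT mT])
  (assumption | rule ll hom_mem[OF t])+
 also have "... = srh ?P x (%u k. sga ?P k (%v w. ?t (\<phi> (tTT u v)) w))"
 by (rule sw_\<mu>[OF x _ mP]) (assumption | rule ll lp)+
 finally show ?thesis .
qed
let ?N = "%s l t w. ?t (tQ (tTT s t) l) w"
have "tmp R TTH T cod id ?\<nu> = srh ?P x (%u k. sga ?P k (%v w. srh ?P u (%s l. srh ?P v (%t m. ?N s (l \<star> m) t w))))"
 unfolding h[OF cod_hom]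
proof (rule rho_cong[OF x mP], rule sw_cong[OF refl _ mT mT mP])
 fix u k v w assume u: "u:cT" "k:cH" "v:cT" "w:cT"
 note lu = ll u
 have "?t (cod (tTT u v)) w = srh ?P u (%s l. ?t (srh TTH v (%t m. tQ (tTT s t) (l \<star> m))) w)"
 unfolding cod_t2[OF u(1,3)] by (rule sw_hom[OF lin_tens1[OF lin_id u(4) mTTH mT] \<rho>_closed[OF u(1)] _ mT mH mTTH mP]) (assumption | rule lu)+
 also have "... = srh ?P u (%s l. srh ?P v (%t m. ?N s (l \<star> m) t w))"
 by (rule rho_cong[OF u(1) mP], rule sw_hom[OF lin_tens1[OF lin_id u(4) mTTH mT] \<rho>_closed[OF u(3)] _ mT mH mTTH mP]) (assumption | rule lu)+
 finally show "?t (cod (tTT u v)) w = ..." .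
qed (assumption | rule ll)+
also have "... = srh ?P x (%u k. srh ?P u (%s l. sga ?P k (%v w. srh ?P v (%t m. ?N s (l \<star> m) t w))))"
 by (rule rho_cong[OF x mP], rule sw_swap[OF _ _ mT mT mT mH mP]) (assumption | rule ll)+
also have "... = srh ?P x (%u k. srh ?P u (%s l. sde ?P k (%g k. sga ?P k (%t w. ?N s (l \<star> S g) t w))))"
 by (rule rho_cong[OF x mP], rule sw_cong[OF refl _ mT mH mP], (assumption | rule ll)+,
  rule gamma_coact1[where F = "%t m w. ?N s (l \<star> m) t w" for s l, OF _ _ mP]) (assumption | rule ll)+
also have "... = srh ?P x (%s h. sde ?P h (%l k. sde ?P k (%g k. sga ?P k (%t w. ?N s (l \<star> S g) t w))))"
 by (rule coact_coassoc[where F = "%s l k. sde ?P k (%g k. sga ?P k (%t w. ?N s (l \<star> S g) t w))", OF x _ mP]) (assumption | rule ll)+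
also have "... = srh ?P x (%s h. sga ?P h (%t w. ?N s eH t w))"
proof (rule rho_cong[OF x mP])
 fix s h assume s: "s:cT" "h:cH"
 note ls = ll s
 let ?Z = "%z k. sga ?P k (%t w. ?N s z t w)"
 have "sde ?P h (%l k. sde ?P k (%g k. ?Z (l \<star> S g) k)) = sde ?P h (%h k. sde ?P h (%l g. ?Z (l \<star> S g) k))" (is "?lh = _")
 by (rule comult_coassoc[where F = "%l g k. ?Z (l \<star> S g) k", OF s(2) _ mP, symmetric]) (assumption | rule ls)+
 also have "... = sde ?P h (%h k. \<e> h \<odot>\<^bsub>?P\<^esub> ?Z eH k)"
 proof (rule Delta_cong[OF s(2) mP])
 fix h k assume g: "h:cH" "k:cH"
 have z: "(%z. ?Z z k):Hom R H ?P" by (assumption | rule ls g)+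
 have "sde ?P h (%l g. ?Z (l \<star> S g) k) = ?Z (sde H h (%l g. l \<star> S g)) k"
  by (rule sw_hom[OF z \<D>_closed[OF g(1)] _ mH mH mH mP, symmetric]) (assumption | rule ls g)+
 then show "sde ?P h (%l g. ?Z (l \<star> S g) k) = \<e> h \<odot>\<^bsub>?P\<^esub> ?Z eH k"
  unfolding antipodeD(3)[OF antipode g(1)] hom_smult[OF z \<e>_closed[OF g(1)] H.one_closed] .
 qed (assumption | rule ls)+
 also have "... = ?Z eH h"
 by (rule comult_counit(1)[where g = "%k. ?Z eH k", OF s(2) _ mP]) (assumption | rule ls)+
 finally show "?lh = ..." .
qed (assumption | rule ll)+
also have "... = tmp R TTH T (%m. tQ m eH) id ?\<nu>"
 by (rule h[symmetric]) (rule lin_tens1[OF lin_id H.one_closed mTT mH])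
finally have e: "tmp R TTH T cod id ?\<nu> = ..." .
show ?thesis
 unfolding Cl_eq by (rule flat_equalizer[OF faithfully_flat_imp_flat[OF ff] mTT mTTH cod_hom lin_tens1[OF lin_id H.one_closed mTT mH] _ e]) (assumption | rule ll)+
qed

text \<open>By \<open>coinvariants_Cl\<close> the carriers coincide, and both comultiplications are
  corestrictions of maps that agree with \<open>Dl\<close> there. The identity is therefore the
  isomorphism.\<close>

lemma Hl_isomorphic: "hopf_isomorphic R (Hl R T \<mu> \<theta>) (L_hopf R H T \<rho>)"
proof -
let ?T' = "opp T"
let ?Q = "PT.Q2"
let ?QQ = "tp R ?Q ?Q"
let ?D1 = "%U. tassoc_inv R T ?T' ?Q (tassoc4 R T ?T' T ?T' (tmp R (tp R T (tp R ?T' T)) ?T' \<mu> id U))"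
let ?D2 = "tensor_lift ?QQ (%x y. tensor_lift ?QQ (%x0 x1. tensor_lift ?QQ
   (%a b. tn ?Q ?Q (tn T ?T' x0 a) (tn T ?T' b y)) (\<gamma> x1)) (\<rho> x))"
let ?H = "make_bialg (sub ?Q PT.Cl) (induced_comult R ?Q PT.Cl ?D1) (induced_counit R T)"
let ?L = "make_bialg (sub ?Q PT.Cl) (induced_comult R ?Q PT.Cl ?D2) (induced_counit R T)"
have H: "Hl R T \<mu> \<theta> = ?H" by (simp add: Hl_def Let_def PT.Hl_carrier_eq PT.Cl_def)
have L: "L_hopf R H T \<rho> = ?L" unfolding L_hopf_def Let_def coinvariants_Cl ..
have D1: "?D1 U = PT.Dl U" if "U:PT.Cl" for U by (rule PT.Dl_eq[OF PT.Cl_D(1)[OF that]])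
have D2: "?D2 U = PT.Dl U" if U: "U:PT.Cl" for U
proof -
 note c = PT.Cl_D(1)[OF U]
 have "?D2 U = sw PT.MM U (%x y. srh PT.MM x (%x0 x1. sga PT.MM x1 (%a b. PT.tt x0 a b y)))"
 unfolding same_tensor_lift[OF same_tensor[OF PT.same_Q2 PT.same_Q2]] same_tens[OF PT.same_Q2 PT.same_Q2] PT.tens_opp
 proof (rule tensor_lift_sw'[OF mT mT PT.mMM c], (assumption | rule lc)+, rule tensor_lift_sw'[OF mT mH PT.mMM])
 fix x y x0 x1 assume x: "x:cT" "y:cT" "x0:cT" "x1:cH"
 show "tensor_lift PT.MM (%a b. PT.tt x0 a b y) (\<gamma> x1) = sga PT.MM x1 (%a b. PT.tt x0 a b y)"
  by (rule tlift_sw[OF mT mT PT.mMM]) (assumption | rule lc x)+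
 qed (assumption | rule lc)+
 also have "... = PT.Dl U"
 unfolding PT.Dl_def by (rule sw_cong[OF refl c mT mT PT.mMM], rule sw_\<mu>[symmetric, OF _ _ PT.mMM]) (assumption | rule lc)+
 finally show ?thesis .
qed
have hH: "hopf_algebra R ?H" by (rule PT.left_hopf[OF Cl_one Cl_mult \<nu>_left_in Cl_expand D1])
have hL: "hopf_algebra R ?L" by (rule PT.left_hopf[OF Cl_one Cl_mult \<nu>_left_in Cl_expand D2])
have i: "id:alg_hom R ?H ?L" by (simp add: alg_hom_def mod_hom_def ring_hom_def)
have "comult ?L (id a) = tmp R ?L ?L id id (comult ?H a)" if a: "a:car ?H" for a
proof -
 have eq: "comult ?H a = comult ?L a"
 using D1[of a] D2[of a] a by (simp add: induced_comult_def)
 have m: "module R ?L" "comult ?L a:car (tp R ?L ?L)"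
 using hL a hom_mem[of "comult ?L" R ?L "tp R ?L ?L" a] unfolding hopf_algebra_def bialgebra_def coalgebra_def by auto
 show ?thesis unfolding eq using tensor_map_id[OF m(1,1,2), of id id] by simp
qed
then show ?thesis
 unfolding H L hopf_isomorphic_def using hH hL i by (intro conjI bexI[of _ id] ballI) simp_all
qed

end

theorem proposition3p4:
  fixes R :: "'k ring"
  assumes "cring R"
  shows
    "(\<forall>(H :: ('k, 'h) bialg) (T :: ('k, 't) module) \<rho>.
        hopf_algebra R H \<and> flat R H \<and>
        bij_betw (antipode R H) (carrier H) (carrier H) \<and>
        right_galois_object R H T \<rho> \<and> faithfully_flat R T \<longrightarrow>
        (let \<mu> = assoc_torsor_mu R H T \<rho>; \<theta> = assoc_torsor_theta R H T \<rho> in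
          hopf_isomorphic R (Hr R T \<mu> \<theta>) H \<and>
          hopf_isomorphic R (Hl R T \<mu> \<theta>) (L_hopf R H T \<rho>)))
     \<and>
     (\<forall>(T :: ('k, 't) module) \<mu> \<theta>.
        quantum_torsor R T \<mu> \<theta> \<longrightarrow>
        (let H = Hr R T \<mu> \<theta>; \<rho> = Hr_coaction R T \<mu> \<theta> in
          hopf_algebra R H \<and>
          bij_betw (antipode R H) (carrier H) (carrier H) \<and>
          right_galois_object R H T \<rho> \<and>
          (\<forall>x\<in>carrier T.
             assoc_torsor_mu R H T \<rho> x = \<mu> x \<and>
             assoc_torsor_theta R H T \<rho> x = \<theta> x)))"
proof (intro conjI allI impI)
fix H :: "('k, 'h) bialg" and T :: "('k, 't) module" and \<rho>
assume a: "hopf_algebra R H & flat R H & bij_betw (antipode R H) (car H) (car H) &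
  right_galois_object R H T \<rho> & faithfully_flat R T"
have "EX S. is_antipode R H S" using a by (simp add: hopf_algebra_def)
from someI_ex[OF this] have S: "is_antipode R H (antipode R H)" unfolding antipode_def .
have T: "k_algebra R T" using a by (simp add: right_galois_object_def right_comodule_algebra_def)
interpret hopf_galois R H T "antipode R H" \<rho>
 by (intro hopf_galois.intro hopf_galois_axioms.intro bialgebra_calculus.intro ff_algebra.intro ff_algebra_axioms.intro)
 (use a S T in \<open>simp_all add: hopf_algebra_def\<close>)
show "let \<mu> = assoc_torsor_mu R H T \<rho>; \<theta> = assoc_torsor_theta R H T \<rho> in
  hopf_isomorphic R (Hr R T \<mu> \<theta>) H & hopf_isomorphic R (Hl R T \<mu> \<theta>) (L_hopf R H T \<rho>)"
 using Hr_isomorphic Hl_isomorphic by (simp add: Let_def)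
next
fix T :: "('k, 't) module" and \<mu> \<theta>
assume "quantum_torsor R T \<mu> \<theta>"
from quantum_torsor_galois[OF this]
show "let H = Hr R T \<mu> \<theta>; \<rho> = Hr_coaction R T \<mu> \<theta> in
  hopf_algebra R H & bij_betw (antipode R H) (car H) (car H) & right_galois_object R H T \<rho> &
  (ALL x:car T. assoc_torsor_mu R H T \<rho> x = \<mu> x & assoc_torsor_theta R H T \<rho> x = \<theta> x)"
 by (simp add: Let_def)
qed

end
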